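(* Let $Z=\mathcal{A}_g(p,\rho_n)\subseteq\mathrm{Sing}(\mathcal{A}_g)$ be a positive-dimensional irreducible component of the singular locus of $\mathcal{A}_g$, with associated list of eigenspace dimensions $n_0,n_1,\ldots,n_{p-1}$. \begin{enumerate} \item If $p=2$, then $\pi(A)=1$ for a very general member $(A,\mathcal{L})$ of $Z$. \item If $p>2$, $\sum_{i=1}^{(p-1)/2}n_in_{p-i}>0$ and $n_i\neq 1$ for some $i\in\{1,\ldots,p-1\}$, then $\pi(A)=\mathfrak{u}(p)$ for a very general element $(A,\mathcal{L})\in Z$. \end{enumerate} Moreover, in either of the cases (1), (2), if $(A,\mathcal{L})\in Z$ is very general, then for every principal polarization $\mathcal{L}'$ on $A$, $(A,\mathcal{L}')\in Z$.
   Context: $\mathcal{A}_g$ is the (coarse) moduli space of complex principally polarized abelian varieties of dimension $g$, with $g\ge 3$; for $g\geq 3$ its singular locus $\mathrm{Sing}(\mathcal{A}_g)$ is the locus of principally polarized abelian varieties having an automorphism different from $\pm1$ that preserves the polarization. For a prime $p$, an integer $n\ge 3$ with $p\nmid n$, and $\rho_n\in\mathrm{GL}(2g,\mathbb{Z}/n\mathbb{Z})$, \[\mathcal{A}_g(p,\rho_n):=\{(A,\mathcal{L})\in\mathcal{A}_g:\exists\,\sigma\in\mathrm{Aut}(A,\mathcal{L}),\ |\sigma|=p,\ \sigma|_{A[n]}\sim\rho_n\},\] where $\sim$ denotes conjugation. It is known that every irreducible component of $\mathrm{Sing}(\mathcal{A}_g)$ is of this form for suitable $p,n,\rho_n$.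 The list $n_0,\ldots,n_{p-1}$ associated to $Z$: if $(A,\mathcal{L})\in Z$ is general with such an automorphism $\sigma$ of order $p$, then $n_i$ is the dimension of the eigenspace of $d\sigma$ on the tangent space $T_0(A)$ for the eigenvalue $\zeta_p^i$, where $\zeta_p$ is a primitive $p$th root of unity. $\pi(A)$ is the number of principal polarizations on $A$ modulo the action of $\mathrm{Aut}(A)$ by pullback. For an odd prime $p$, $U_p:=\mathbb{Z}[\zeta_p+\zeta_p^{-1}]^\times$, $U_p^+\leq U_p$ is the subgroup of totally positive units (those sent to a positive real number by every embedding of $\mathbb{Q}(\zeta_p+\zeta_p^{-1})$ in $\mathbb{C}$), $U_p^2$ is the group of squares of elements of $U_p$, and $\mathfrak{u}(p):=|U_p^+/U_p^2|$. A very general element of a subvariety $Z\subseteq\mathcal{A}_g$ means an element of the locus of principally polarized abelian varieties in $Z$ that have the same endomorphism ring (with its rational representation and Rosati involution), of lowest possible rank among elements of $Z$. *)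

theory Defs
  imports
    "HOL-Analysis.Analysis"
    "HOL-Computational_Algebra.Polynomial"
    "HOL-Algebra.Coset"
begin

section \<open>Complex tori and principal polarizations\<close>

text \<open>
  A complex torus of dimension \<open>g = CARD('g)\<close> is \<open>A = V/L\<close> with \<open>V = complex^'g\<close> and \<open>L\<close> a lattice
  in \<open>V\<close>; its homomorphisms are the complex linear maps respecting the lattices, and \<open>T\<^sub>0(A) = V\<close>
  with \<open>d\<sigma> = \<sigma>\<close>. A polarization is given by its first Chern class, viewed as a positive definite
  Hermitian form on \<open>V\<close>.
\<close>

type_synonym 'g hform = "complex^'g \<Rightarrow> complex^'g \<Rightarrow> complex"

type_synonym 'g pp = "(complex^'g) set \<times> 'g hform"

abbreviation clinear :: "(complex^'g \<Rightarrow> complex^'g) \<Rightarrow> bool"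
  where "clinear f \<equiv> Vector_Spaces.linear (*s) (*s) f"

definition is_lattice :: "(complex^'g::finite) set \<Rightarrow> bool"
  where "is_lattice L \<longleftrightarrow>
    (\<exists>B. independent B \<and> span B = UNIV \<and> L = range (\<lambda>c :: complex^'g \<Rightarrow> int. \<Sum>b\<in>B. of_int (c b) *\<^sub>R b))"

definition pos_def_hermitian :: "('g::finite) hform \<Rightarrow> bool"
  where "pos_def_hermitian H \<longleftrightarrow>
    (\<forall>y. Vector_Spaces.linear (*s) (*) (\<lambda>x. H x y)) \<and>
    (\<forall>x y. H y x = cnj (H x y)) \<and>
    (\<forall>x. x \<noteq> 0 \<longrightarrow> 0 < Re (H x x))"

text \<open>
  The kernel of the isogeny from \<open>V/L\<close> to its dual induced by \<open>H\<close> is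
  \<open>{x. Im (H x l) \<in> \<int> for all l \<in> L} / L\<close>, so the equation below says that \<open>Im H\<close> is integral
  on \<open>L\<close> and that this isogeny is an isomorphism.
\<close>

definition principal_polarization :: "(complex^'g::finite) set \<Rightarrow> 'g hform \<Rightarrow> bool"
  where "principal_polarization L H \<longleftrightarrow>
    pos_def_hermitian H \<and> {x. \<forall>l\<in>L. Im (H x l) \<in> \<int>} = L"

definition is_ppav :: "('g::finite) pp \<Rightarrow> bool"
  where "is_ppav X \<longleftrightarrow> is_lattice (fst X) \<and> principal_polarization (fst X) (snd X)"

definition pullback :: "(complex^'g \<Rightarrow> complex^'g) \<Rightarrow> 'g hform \<Rightarrow> 'g hform"
  where "pullback f H = (\<lambda>x y. H (f x) (f y))"

definition torus_End :: "(complex^'g::finite) set \<Rightarrow> (complex^'g \<Rightarrow> complex^'g) set"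
  where "torus_End L = {f. clinear f \<and> f ` L \<subseteq> L}"

definition torus_Aut :: "(complex^'g::finite) set \<Rightarrow> (complex^'g \<Rightarrow> complex^'g) set"
  where "torus_Aut L = {f. clinear f \<and> bij f \<and> f ` L = L}"

definition ppav_Aut :: "('g::finite) pp \<Rightarrow> (complex^'g \<Rightarrow> complex^'g) set"
  where "ppav_Aut X = {f \<in> torus_Aut (fst X). pullback f (snd X) = snd X}"

text \<open>The number \<open>\<pi>(A)\<close>.\<close>

definition num_polarizations :: "(complex^'g::finite) set \<Rightarrow> nat"
  where "num_polarizations L =
    card ({H. principal_polarization L H} //
      {(H, H'). principal_polarization L H \<and> principal_polarization L H' \<and>
        (\<exists>f \<in> torus_Aut L. H' = pullback f H)})"


section \<open>The moduli space as a complex analytic space\<close>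

definition ppav_iso :: "(('g::finite) pp \<times> 'g pp) set"
  where "ppav_iso = {(X, Y). is_ppav X \<and> is_ppav Y \<and>
    (\<exists>f. clinear f \<and> bij f \<and> f ` fst X = fst Y \<and> pullback f (snd Y) = snd X)}"

definition moduli_space :: "('g::finite) pp set set"
  where "moduli_space = {X. is_ppav X} // ppav_iso"

definition moduli_point :: "('g::finite) pp \<Rightarrow> 'g pp set"
  where "moduli_point X = ppav_iso `` {X}"

definition siegel_space :: "(complex^'g::finite^'g) set"
  where "siegel_space =
    {\<tau>. transpose \<tau> = \<tau> \<and> (\<forall>x :: real^'g. x \<noteq> 0 \<longrightarrow> 0 < x \<bullet> ((\<chi> i j. Im (\<tau> $ i $ j)) *v x))}"

text \<open>
  The principally polarized torus with period matrix \<open>(1, \<tau>)\<close>, i.e. lattice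
  \<open>\<int>\<^sup>g + \<tau> \<int>\<^sup>g\<close> and Hermitian form with matrix \<open>(Im \<tau>)\<close> inverse.
\<close>

definition siegel_ppav :: "complex^'g::finite^'g \<Rightarrow> 'g pp"
  where "siegel_ppav \<tau> =
    ({(\<chi> i. of_int (a $ i)) + \<tau> *v (\<chi> i. of_int (b $ i)) | a b :: int^'g. True},
     \<lambda>x y. \<Sum>i\<in>UNIV. \<Sum>j\<in>UNIV.
       x $ i * complex_of_real (matrix_inv (\<chi> k l. Im (\<tau> $ k $ l)) $ i $ j) * cnj (y $ j))"

text \<open>
  Siegel space is not open in the space of all matrices, only in that of the symmetric ones, hence
  the derivative within it (which is determined only on symmetric matrices).
\<close>

definition holomorphic_on_siegel ::
    "(complex^'g::finite^'g \<Rightarrow> complex) \<Rightarrow> (complex^'g^'g) set \<Rightarrow> bool"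
  where "holomorphic_on_siegel f W \<longleftrightarrow>
    (\<forall>\<tau> \<in> W \<inter> siegel_space. \<exists>D. (f has_derivative D) (at \<tau> within W \<inter> siegel_space) \<and>
      (\<forall>c M. D (\<chi> i j. c * M $ i $ j) = c * D M))"

text \<open>
  The moduli space is the quotient of Siegel space by the properly discontinuous action of the
  symplectic group, so a subset is closed analytic iff its preimage in Siegel space is.
\<close>

definition analytic_subset :: "('g::finite) pp set set \<Rightarrow> bool"
  where "analytic_subset C \<longleftrightarrow> C \<subseteq> moduli_space \<and>
    (\<forall>\<tau>\<^sub>0 \<in> siegel_space. \<exists>W F. open W \<and> \<tau>\<^sub>0 \<in> W \<and> finite F \<and>
      (\<forall>f\<in>F. holomorphic_on_siegel f W) \<and>
      (\<forall>\<tau> \<in> W \<inter> siegel_space. moduli_point (siegel_ppav \<tau>) \<in> C \<longleftrightarrow> (\<forall>f\<in>F. f \<tau> = 0)))"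

definition irreducible_subset :: "('g::finite) pp set set \<Rightarrow> bool"
  where "irreducible_subset C \<longleftrightarrow> analytic_subset C \<and> C \<noteq> {} \<and>
    (\<forall>C\<^sub>1 C\<^sub>2. analytic_subset C\<^sub>1 \<longrightarrow> analytic_subset C\<^sub>2 \<longrightarrow> C = C\<^sub>1 \<union> C\<^sub>2 \<longrightarrow> C = C\<^sub>1 \<or> C = C\<^sub>2)"

definition irreducible_component :: "('g::finite) pp set set \<Rightarrow> 'g pp set set \<Rightarrow> bool"
  where "irreducible_component S C \<longleftrightarrow> irreducible_subset C \<and> C \<subseteq> S \<and>
    (\<forall>C'. irreducible_subset C' \<longrightarrow> C' \<subseteq> S \<longrightarrow> C \<subseteq> C' \<longrightarrow> C' = C)"

definition analytic_dim :: "('g::finite) pp set set \<Rightarrow> enat"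
  where "analytic_dim Z = Sup {enat m | m. \<exists>c. (\<forall>i\<le>m. irreducible_subset (c i) \<and> c i \<subseteq> Z) \<and>
    (\<forall>i<m. c i \<subset> c (Suc i))}"

text \<open>The singular locus, in the description valid for \<open>g \<ge> 3\<close>.\<close>

definition singular_locus :: "('g::finite) pp set set"
  where "singular_locus = {moduli_point X | X. is_ppav X \<and>
    (\<exists>\<sigma> \<in> ppav_Aut X. \<sigma> \<noteq> id \<and> \<sigma> \<noteq> uminus)}"


section \<open>Automorphisms of prescribed type\<close>

text \<open>
  \<open>e\<close> represents a \<open>\<int>/n\<close>-basis of \<open>A[n] = {x \<in> V. n x \<in> L} / L\<close>.
\<close>

definition torsion_basis ::
    "nat \<Rightarrow> (complex^'g::finite) set \<Rightarrow> ('g + 'g \<Rightarrow> complex^'g) \<Rightarrow> bool"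
  where "torsion_basis n L e \<longleftrightarrow>
    (\<forall>x. real n *\<^sub>R x \<in> L \<longleftrightarrow> (\<exists>c :: 'g + 'g \<Rightarrow> int. x - (\<Sum>i\<in>UNIV. of_int (c i) *\<^sub>R e i) \<in> L)) \<and>
    (\<forall>c :: 'g + 'g \<Rightarrow> int. (\<Sum>i\<in>UNIV. of_int (c i) *\<^sub>R e i) \<in> L \<longleftrightarrow> (\<forall>i. int n dvd c i))"

text \<open>
  Matrices over \<open>\<int>/n\<close> are represented by integer matrices. That the action of \<open>\<sigma>\<close> on \<open>A[n]\<close> is
  conjugate to \<open>\<rho>\<close> means that \<open>\<rho>\<close> is its matrix in some basis.
\<close>

definition torsion_action_conj ::
    "nat \<Rightarrow> (complex^'g::finite) set \<Rightarrow> (complex^'g \<Rightarrow> complex^'g) \<Rightarrow> int^('g + 'g)^('g + 'g) \<Rightarrow> bool"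
  where "torsion_action_conj n L \<sigma> \<rho> \<longleftrightarrow>
    (\<exists>e. torsion_basis n L e \<and> (\<forall>j. \<sigma> (e j) - (\<Sum>i\<in>UNIV. of_int (\<rho> $ i $ j) *\<^sub>R e i) \<in> L))"

definition typed_automorphism ::
    "nat \<Rightarrow> nat \<Rightarrow> int^('g + 'g)^('g + 'g) \<Rightarrow> ('g::finite) pp \<Rightarrow> (complex^'g \<Rightarrow> complex^'g) \<Rightarrow> bool"
  where "typed_automorphism p n \<rho> X \<sigma> \<longleftrightarrow> \<sigma> \<in> ppav_Aut X \<and>
    (\<forall>k. \<sigma> ^^ k = id \<longleftrightarrow> p dvd k) \<and> torsion_action_conj n (fst X) \<sigma> \<rho>"

definition typed_locus :: "nat \<Rightarrow> nat \<Rightarrow> int^('g + 'g)^('g + 'g) \<Rightarrow> ('g::finite) pp set set"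
  where "typed_locus p n \<rho> = {moduli_point X | X. is_ppav X \<and> (\<exists>\<sigma>. typed_automorphism p n \<rho> X \<sigma>)}"

text \<open>
  \<open>d 0, \<dots>, d (p - 1)\<close> are the eigenspace dimensions, with respect to the primitive \<open>p\<close>-th root of
  unity \<open>\<zeta>\<close>, of an automorphism of the given type of a general member of \<open>Z\<close>. The list depends on
  the choice of the automorphism and of \<open>\<zeta>\<close>, so this is a predicate and not a function of \<open>Z\<close>.
\<close>

definition eigenspace_dims ::
    "nat \<Rightarrow> nat \<Rightarrow> int^('g + 'g)^('g + 'g) \<Rightarrow> complex \<Rightarrow> ('g::finite) pp set set \<Rightarrow> (nat \<Rightarrow> nat) \<Rightarrow> bool"
  where "eigenspace_dims p n \<rho> \<zeta> Z d \<longleftrightarrow>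
    (\<exists>C. analytic_subset C \<and> C \<subset> Z \<and>
      (\<forall>X. is_ppav X \<longrightarrow> moduli_point X \<in> Z - C \<longrightarrow>
        (\<exists>\<sigma>. typed_automorphism p n \<rho> X \<sigma> \<and> (\<forall>i<p. vec.dim {v. \<sigma> v = \<zeta> ^ i *s v} = d i))))"


section \<open>Very general members\<close>

definition End_rank :: "(complex^'g::finite) set \<Rightarrow> nat"
  where "End_rank L = Sup {card B | B. finite B \<and> B \<subseteq> torus_End L \<and>
    (\<forall>c :: (complex^'g \<Rightarrow> complex^'g) \<Rightarrow> int.
      (\<forall>x. (\<Sum>f\<in>B. of_int (c f) *\<^sub>R f x) = 0) \<longrightarrow> (\<forall>f\<in>B. c f = 0))}"

definition rosati :: "('g::finite) hform \<Rightarrow> (complex^'g \<Rightarrow> complex^'g) \<Rightarrow> (complex^'g \<Rightarrow> complex^'g)"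
  where "rosati H f = (THE f'. clinear f' \<and> (\<forall>x y. H (f x) y = H x (f' y)))"

text \<open>
  Equality of endomorphism rings together with their rational representations (on the lattices)
  and Rosati involutions; a group isomorphism of the lattices is the same as a real linear
  isomorphism of the ambient spaces carrying one lattice to the other.
\<close>

definition same_End :: "('g::finite) pp \<Rightarrow> 'g pp \<Rightarrow> bool"
  where "same_End X Y \<longleftrightarrow> (\<exists>\<alpha>. linear \<alpha> \<and> bij \<alpha> \<and> \<alpha> ` fst X = fst Y \<and>
    (\<lambda>f. \<alpha> \<circ> f \<circ> inv_into UNIV \<alpha>) ` torus_End (fst X) = torus_End (fst Y) \<and>
    (\<forall>f \<in> torus_End (fst X). rosati (snd Y) (\<alpha> \<circ> f \<circ> inv_into UNIV \<alpha>) = \<alpha> \<circ> rosati (snd X) f \<circ> inv_into UNIV \<alpha>))"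

definition very_general :: "('g::finite) pp set set \<Rightarrow> 'g pp \<Rightarrow> bool"
  where "very_general Z X \<longleftrightarrow> is_ppav X \<and> moduli_point X \<in> Z \<and>
    (\<exists>Y. is_ppav Y \<and> moduli_point Y \<in> Z \<and>
      (\<forall>W. is_ppav W \<longrightarrow> moduli_point W \<in> Z \<longrightarrow> End_rank (fst Y) \<le> End_rank (fst W)) \<and>
      same_End X Y)"


section \<open>Totally positive units\<close>

definition real_cyclotomic_generator :: "nat \<Rightarrow> complex"
  where "real_cyclotomic_generator p = cis (2 * pi / p) + inverse (cis (2 * pi / p))"

definition real_cyclotomic_ring :: "nat \<Rightarrow> complex set"
  where "real_cyclotomic_ring p =
    range (\<lambda>q :: int poly. poly (map_poly of_int q) (real_cyclotomic_generator p))"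

definition real_cyclotomic_field :: "nat \<Rightarrow> complex set"
  where "real_cyclotomic_field p =
    range (\<lambda>q :: rat poly. poly (map_poly of_rat q) (real_cyclotomic_generator p))"

definition field_embeddings :: "complex set \<Rightarrow> (complex \<Rightarrow> complex) set"
  where "field_embeddings K = {\<phi>. \<phi> 1 = 1 \<and>
    (\<forall>x\<in>K. \<forall>y\<in>K. \<phi> (x + y) = \<phi> x + \<phi> y \<and> \<phi> (x * y) = \<phi> x * \<phi> y)}"

definition cyc_units :: "nat \<Rightarrow> complex set"
  where "cyc_units p = {u \<in> real_cyclotomic_ring p. \<exists>v \<in> real_cyclotomic_ring p. u * v = 1}"

definition totpos_units :: "nat \<Rightarrow> complex set"
  where "totpos_units p = {u \<in> cyc_units p.
    \<forall>\<phi> \<in> field_embeddings (real_cyclotomic_field p). \<phi> u \<in> \<real> \<and> 0 < Re (\<phi> u)}"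

definition square_units :: "nat \<Rightarrow> complex set"
  where "square_units p = (\<lambda>u. u\<^sup>2) ` cyc_units p"

definition \<uu> :: "nat \<Rightarrow> nat"
  where "\<uu> p = card (carrier (\<lparr>carrier = totpos_units p, mult = (*), one = 1\<rparr> Mod square_units p))"

end

theory Submission
  imports "HOL-Number_Theory.Euler_Criterion" Defs
begin

text \<open>
  Let \<open>(A, H)\<close> be very general in \<open>Z\<close>, with automorphism \<open>\<sigma>\<close> of order \<open>p\<close>. The antilinear maps
  \<open>S\<close> commuting with \<open>\<sigma>\<close> and symmetric for \<open>H\<close> are tangent to the deformations of \<open>(A, H, \<sigma>)\<close>; an
  endomorphism that survives on a generic deformation commutes with all of them, and under the
  hypothesis on the \<open>n\<^sub>i\<close> this forces it into \<open>\<rat>[\<sigma>]\<close>. A Baire category argument produces such a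
  deformation, so minimality of the rank gives \<open>End(A) \<otimes> \<rat> = \<rat>[\<sigma>]\<close>.

  A principal polarization is then \<open>H(f x, y)\<close> for an automorphism \<open>f\<close> of \<open>A\<close> commuting with \<open>\<sigma>\<close>, so
  \<open>\<sigma>\<close> preserves it. As \<open>\<int>[\<zeta>]\<close> is integrally closed, \<open>f\<close> acts on the eigenspaces of \<open>\<sigma>\<close> with
  eigenvalues \<open>\<noteq> 1\<close> through a unit of \<open>\<int>[\<zeta>]\<close>, which is real and totally positive, and trivially on the
  fixed space of \<open>\<sigma>\<close>. For \<open>p = 2\<close> the unit is \<open>1\<close>. For odd \<open>p\<close> every class in \<open>U\<^sub>p\<^sup>+ / U\<^sub>p\<^sup>2\<close> is attained:
  a totally positive unit has norm \<open>1\<close>, hence is a square modulo the prime above \<open>p\<close>, and multiplying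
  by the square of a cyclotomic unit makes it \<open>\<equiv> 1\<close> there, so that it extends by the identity on the
  fixed space. Pulling back by an automorphism \<open>v\<close> multiplies the unit by \<open>v v\<^sup>*\<close>, which is a square in
  \<open>U\<^sub>p\<close> because \<open>v / v\<^sup>*\<close> is a root of unity of odd order; conversely, polarizations whose units
  differ by an element of \<open>U\<^sub>p\<^sup>2\<close> are related by an automorphism.
\<close>

section \<open>Integer polynomials at roots of unity of prime order\<close>

text \<open>An endomorphism of V / L need not commute with \<open>\<sigma>\<close>, so a priori no
  cyclotomic field acts that could conjugate eigenspaces. The substitute is a Galois principle for
  maps that are only real linear and preserve L: vanishing on the eigenspaces of one primitive root
  and its inverse implies vanishing on all eigenspaces with eigenvalue \<noteq> 1. It spreads
  information from a single pair to all of them. A pair that is nonzero on both sides is needed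
  because deformations couple the eigenspace of \<zeta>^i only with that of \<zeta>^(-i). If both
  members are lines, a surviving endomorphism could still mix them as in a quaternion algebra; an
  index with n_i \<noteq> 1 excludes this.

  The deformation starts from some member of Z, and its automorphism is tied to that of (A, H) only
  through the type on n-torsion; eigenspace dimensions of the two are never compared. What has to
  agree is the rank of Z[\<sigma>]. It is p or p - 1 according to whether \<sigma> has nonzero fixed
  vectors, and the action on A[n] decides this because p does not divide n.\<close>

definition ev :: "int poly \<Rightarrow> complex \<Rightarrow> complex"
  where "ev q z = poly (map_poly of_int q) z"

lemma ev_0 [simp]: "ev 0 z = 0"
  by (simp add: ev_def)

lemma ev_pCons [simp]: "ev (pCons a q) z = of_int a + z * ev q z"
  by (simp add: ev_def map_poly_pCons)

lemma ev_1 [simp]: "ev 1 z = 1"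
  by (simp add: one_pCons)

lemma ev_of_int [simp]: "ev (of_int a) z = of_int a"
  by (simp add: of_int_poly)

lemma ev_of_nat [simp]: "ev (of_nat a) z = of_nat a"
  using ev_of_int[of "int a"] by simp

lemma ev_add [simp]: "ev (q + r) z = ev q z + ev r z"
proof (induction q arbitrary: r)
  case (pCons a q)
  obtain b r' where "r = pCons b r'" by (rule pCons_cases)
  thus ?case by (simp add: pCons.IH algebra_simps)
qed simp

lemma ev_minus [simp]: "ev (- q) z = - ev q z"
  by (metis add.right_inverse ev_0 ev_add neg_eq_iff_add_eq_0)

lemma ev_diff [simp]: "ev (q - r) z = ev q z - ev r z"
  by (metis ev_add ev_minus diff_conv_add_uminus)

lemma ev_smult [simp]: "ev (smult a q) z = of_int a * ev q z"
  by (induction q) (simp_all add: algebra_simps)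

lemma ev_mult [simp]: "ev (q * r) z = ev q z * ev r z"
  by (induction q) (simp_all add: algebra_simps)

lemma ev_power [simp]: "ev (q ^ k) z = ev q z ^ k"
  by (induction k) simp_all

lemma ev_sum: "ev (sum f A) z = (\<Sum>i\<in>A. ev (f i) z)"
  by (induction A rule: infinite_finite_induct) simp_all

lemma ev_prod: "ev (prod f A) z = (\<Prod>i\<in>A. ev (f i) z)"
  by (induction A rule: infinite_finite_induct) simp_all

lemma ev_monom [simp]: "ev (monom a k) z = of_int a * z ^ k"
  by (simp add: ev_def map_poly_monom poly_monom)

lemma ev_pcompose [simp]: "ev (pcompose q r) z = ev q (ev r z)"
  by (induction q) (simp_all add: pcompose_pCons)

lemma ev_of_int_arg: "ev q (of_int a) = of_int (poly q a)"
  by (induction q) simp_all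

lemma ev_at_1: "ev q 1 = of_int (poly q 1)"
  using ev_of_int_arg[of q 1] by simp

lemma cnj_ev: "cnj (ev q z) = ev q (cnj z)"
  by (induction q) simp_all

section \<open>Frobenius congruences for integer polynomials\<close>

lemma poly_eq_of_int_mult_iff:
  fixes q :: "int poly"
  shows "(\<exists>r. q = of_int a * r) \<longleftrightarrow> (\<forall>k. a dvd coeff q k)"
proof -
  have "(\<exists>r. q = of_int a * r) \<longleftrightarrow> [:a:] dvd q"
    by (simp add: dvd_def of_int_poly)
  thus ?thesis
    by (simp add: const_poly_dvd_iff)
qed

text \<open>The error term is an explicit witness in an arbitrary commutative ring, so the
  congruences modulo l in Z and in Z[X] both come from this statement.\<close>

lemma binomial_prime_power:
  fixes a b :: "'a::comm_ring_1"
  assumes "prime l"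
  shows "\<exists>r. (a + b) ^ l = a ^ l + b ^ l + of_nat l * r"
proof -
  have "l > 0" using assms by (simp add: prime_gt_0_nat)
  have "(a + b) ^ l = (\<Sum>k\<le>l. of_nat (l choose k) * a ^ k * b ^ (l - k))"
    by (rule binomial_ring)
  also have "{..l} = insert 0 (insert l {1..<l})"
    using \<open>l > 0\<close> by auto
  also have "(\<Sum>k\<in>\<dots>. of_nat (l choose k) * a ^ k * b ^ (l - k)) =
      a ^ l + b ^ l + (\<Sum>k\<in>{1..<l}. of_nat (l choose k) * a ^ k * b ^ (l - k))"
    using \<open>l > 0\<close> by (simp add: algebra_simps)
  also have "(\<Sum>k\<in>{1..<l}. of_nat (l choose k) * a ^ k * b ^ (l - k)) =
      (\<Sum>k\<in>{1..<l}. of_nat l * (of_nat ((l choose k) div l) * a ^ k * b ^ (l - k)))"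
  proof (rule sum.cong)
    fix k assume "k \<in> {1..<l}"
    hence "l dvd (l choose k)"
      using assms by (intro dvd_choose_prime) auto
    hence "l choose k = l * ((l choose k) div l)" by simp
    hence "of_nat (l choose k) = (of_nat l * of_nat ((l choose k) div l) :: 'a)"
      by (metis of_nat_mult)
    thus "of_nat (l choose k) * a ^ k * b ^ (l - k) =
        of_nat l * (of_nat ((l choose k) div l) * a ^ k * b ^ (l - k))"
      by (simp add: mult.assoc)
  qed simp
  finally show ?thesis
    by (simp only: sum_distrib_left[symmetric]) (rule exI, rule refl)
qed

lemma int_power_prime:
  assumes "prime l"
  shows "\<exists>b. (a::int) ^ l = a + int l * b"
proof -
  have nonneg: "\<exists>b. (int k) ^ l = int k + int l * b" for k
  proof (induction k)
    case 0
    show ?case using assms prime_gt_0_nat by (intro exI[of _ 0]) auto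
  next
    case (Suc k)
    then obtain b where "(int k) ^ l = int k + int l * b" by blast
    moreover obtain r where "(int k + 1) ^ l = int k ^ l + 1 ^ l + int l * r"
      using binomial_prime_power[OF assms, of "int k" 1] by auto
    ultimately have "(int (Suc k)) ^ l = int (Suc k) + int l * (b + r)"
      by (simp add: algebra_simps)
    thus ?case by blast
  qed
  show ?thesis
  proof (cases "a \<ge> 0")
    case True
    thus ?thesis using nonneg[of "nat a"] by simp
  next
    case False
    then obtain b where b: "(- a) ^ l = - a + int l * b"
      using nonneg[of "nat (- a)"] by auto
    obtain r where "(a + - a) ^ l = a ^ l + (- a) ^ l + int l * r"
      using binomial_prime_power[OF assms, of a "- a"] by auto
    hence "a ^ l = a + int l * (- b - r)"
      using b assms prime_gt_0_nat[of l] by (simp add: algebra_simps power_0_left)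
    thus ?thesis by blast
  qed
qed

lemma poly_power_prime:
  fixes q :: "int poly"
  assumes "prime l"
  shows "\<exists>r. q ^ l = pcompose q (monom 1 l) + of_nat l * r"
proof (induction q)
  case 0
  show ?case using assms prime_gt_0_nat by (intro exI[of _ 0]) (auto simp: power_0_left)
next
  case (pCons a q)
  then obtain r where r: "q ^ l = pcompose q (monom 1 l) + of_nat l * r" by blast
  obtain b where b: "a ^ l = a + int l * b"
    using int_power_prime[OF assms] by blast
  obtain s where s: "([:a:] + [:0, 1:] * q) ^ l = [:a:] ^ l + ([:0, 1:] * q) ^ l + of_nat l * s"
    using binomial_prime_power[OF assms] by blast
  have X: "([:0, 1:] :: int poly) ^ l = monom 1 l"
    by (simp add: monom_altdef)
  have A: "[:a:] ^ l = [:a:] + of_nat l * [:b:]"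
    by (simp add: poly_const_pow b of_nat_poly)
  have "pCons a q ^ l = ([:a:] + [:0, 1:] * q) ^ l" by simp
  also have "\<dots> = pcompose (pCons a q) (monom 1 l) + of_nat l * ([:b:] + monom 1 l * r + s)"
    unfolding s power_mult_distrib X A r pcompose_pCons by (simp add: algebra_simps)
  finally show ?case by blast
qed

lemma pcompose_monom_monom:
  "pcompose (pcompose q (monom 1 m)) (monom 1 k) = pcompose (q :: int poly) (monom 1 (m * k))"
proof -
  have "pcompose (monom 1 m) (monom 1 k) = (monom 1 (m * k) :: int poly)"
    by (induction m) (simp_all add: monom_Suc pcompose_pCons mult_monom monom_0 one_pCons)
  thus ?thesis by (simp add: flip: pcompose_assoc)
qed

text \<open>Iterated Frobenius on Z[X] / l, so the error is a multiple of l only. The exponent f is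
  free because removing l from a denominator needs a power of l that is 1 modulo p and
  large.\<close>

lemma poly_power_prime_power:
  fixes q :: "int poly"
  assumes "prime l"
  shows "\<exists>r. q ^ (l ^ f) = pcompose q (monom 1 (l ^ f)) + of_nat l * r"
proof (induction f)
  case 0
  show ?case by (intro exI[of _ 0]) (simp add: monom_altdef)
next
  case (Suc f)
  then obtain r where r: "q ^ (l ^ f) = pcompose q (monom 1 (l ^ f)) + of_nat l * r" by blast
  obtain s where s: "(q ^ (l ^ f)) ^ l = pcompose q (monom 1 (l ^ f)) ^ l + (of_nat l * r) ^ l + of_nat l * s"
    using binomial_prime_power[OF assms] unfolding r by blast
  obtain t where t: "pcompose q (monom 1 (l ^ f)) ^ l =
      pcompose (pcompose q (monom 1 (l ^ f))) (monom 1 l) + of_nat l * t"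
    using poly_power_prime[OF assms] by blast
  obtain k where k: "l = Suc k" using assms prime_gt_0_nat gr0_implies_Suc by blast
  have "(of_nat l * r) ^ l = of_nat l * (r * (of_nat l * r) ^ k)"
    by (subst (2) k) simp
  hence "q ^ (l ^ Suc f) = pcompose q (monom 1 (l ^ Suc f)) + of_nat l * (t + r * (of_nat l * r) ^ k + s)"
    using s unfolding t pcompose_monom_monom by (simp add: power_mult algebra_simps flip: power_mult)
  thus ?case by blast
qed

text \<open>X^p - 1 is monic, so the remainder exists over Z. It is kept as an identity of
  polynomials because it is evaluated at all p-th roots of unity at once, and later at
  \<sigma>.\<close>

lemma poly_reduce:
  fixes q :: "int poly"
  assumes "p > 0"
  shows "\<exists>c r. q = (\<Sum>k<p. monom (c k) k) + (monom 1 p - 1) * r"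
proof (induction q)
  case 0
  show ?case by (intro exI[of _ "\<lambda>_. 0"] exI[of _ 0]) simp
next
  case (pCons a q)
  then obtain c r where q: "q = (\<Sum>k<p. monom (c k) k) + (monom 1 p - 1) * r" by blast
  obtain m where m: "p = Suc m" using assms gr0_implies_Suc by blast
  let ?c = "case_nat (c m + a) c"
  have sh: "[:0, 1:] * (\<Sum>k<m. monom (c k) k) = (\<Sum>k<m. monom (c k) (Suc k))"
    by (simp add: sum_distrib_left monom_Suc)
  have 1: "(\<Sum>k<p. monom (?c k) k) = monom (c m + a) 0 + (\<Sum>k<m. monom (c k) (Suc k))"
    unfolding m by (simp add: sum.lessThan_Suc_shift del: sum.lessThan_Suc)
  have 2: "[:0, 1:] * monom (c m) m = monom (c m) 0 + (monom 1 p - 1) * [:c m:]"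
    unfolding m by (simp add: monom_Suc smult_monom algebra_simps monom_0)
  have "pCons a q = [:a:] + [:0, 1:] * q" by simp
  also have "\<dots> = [:a:] + [:0, 1:] * (\<Sum>k<m. monom (c k) k) + [:0, 1:] * monom (c m) m + (monom 1 p - 1) * ([:0, 1:] * r)"
    unfolding q m by (simp add: algebra_simps)
  also have "\<dots> = (\<Sum>k<p. monom (?c k) k) + (monom 1 p - 1) * ([:c m:] + [:0, 1:] * r)"
    unfolding 1 2 sh by (simp add: algebra_simps monom_0)
  finally show ?case by blast
qed

text \<open>Nakayama's lemma for the module generated by the v k, carried out as Gaussian
  elimination: the pivot e = c t - p r t t stays prime to p. The multipliers c k, equal to 1 in the
  application, are general because elimination multiplies the equations by pivots.\<close>

lemma nakayama_int:
  fixes v :: "nat \<Rightarrow> complex" and c :: "nat \<Rightarrow> int" and r :: "nat \<Rightarrow> nat \<Rightarrow> int"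
  assumes "prime p"
    and "\<And>k. k < t \<Longrightarrow> \<not> int p dvd c k"
    and "\<And>k. k < t \<Longrightarrow> of_int (c k) * v k = of_nat p * (\<Sum>j<t. of_int (r k j) * v j)"
  shows "\<forall>k<t. v k = 0"
  using assms(2,3)
proof (induction t arbitrary: c r)
  case 0
  show ?case by simp
next
  case (Suc t)
  have pp: "prime (int p)" using assms(1) by simp
  define e where "e = c t - int p * r t t"
  have e: "\<not> int p dvd e"
    using Suc.prems(1)[of t] by (simp add: e_def dvd_diff_left_iff)
  have vt: "of_int e * v t = of_nat p * (\<Sum>j<t. of_int (r t j) * v j)"
    using Suc.prems(2)[of t] by (simp add: e_def algebra_simps)
  have IH: "\<forall>k<t. v k = 0"
  proof (rule Suc.IH)
    fix k assume "k < t"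
    show "\<not> int p dvd e * c k"
      using e Suc.prems(1)[of k] \<open>k < t\<close> pp by (simp add: prime_dvd_mult_iff)
    have "of_int (e * c k) * v k = of_int e * (of_int (c k) * v k)" by simp
    also have "\<dots> = of_nat p * (of_int e * (\<Sum>j<t. of_int (r k j) * v j) + of_int (r k t) * (of_int e * v t))"
      using Suc.prems(2)[of k] \<open>k < t\<close> by (simp add: algebra_simps)
    also have "\<dots> = of_nat p * (\<Sum>j<t. of_int (e * r k j + int p * r k t * r t j) * v j)"
      unfolding vt by (simp add: sum_distrib_left sum.distrib algebra_simps)
    finally show "of_int (e * c k) * v k = of_nat p * (\<Sum>j<t. of_int (e * r k j + int p * r k t * r t j) * v j)" .
  qed
  hence "of_int e * v t = 0" using vt by simp
  moreover have "e \<noteq> 0" using e by auto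
  ultimately show ?case using IH less_Suc_eq by auto
qed

section \<open>The ring Z[w] for a root of unity of prime order\<close>

locale prime_root =
  fixes p :: nat and w :: complex
  assumes prime_p: "prime p" and w_pow: "w ^ p = 1" and w_ne_1: "w \<noteq> 1"
begin

lemma p_gt_1: "p > 1"
  by (rule prime_gt_1_nat[OF prime_p])

lemma w_ne_0 [simp]: "w \<noteq> 0"
  using w_pow p_gt_1 by (auto simp: power_0_left)

lemma w_power_mod: "w ^ (k mod p) = w ^ k"
  by (metis mod_mult_div_eq mult.right_neutral power_add power_mult power_one w_pow)

lemma ev_reduce: "\<exists>c :: nat \<Rightarrow> int. \<forall>z. z ^ p = 1 \<longrightarrow> ev q z = (\<Sum>k<p. of_int (c k) * z ^ k)"
proof -
  obtain c r where "q = (\<Sum>k<p. monom (c k) k) + (monom 1 p - 1) * r"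
    using poly_reduce[of p q] p_gt_1 by auto
  thus ?thesis by (intro exI[of _ c]) (simp add: ev_sum)
qed

text \<open>In other words, w \<mapsto> 1 is a well-defined ring homomorphism from Z[w] to Z / p,
  the reduction modulo the prime above p. If p did not divide q(1), then q^p = q(X^p) + p r
  evaluated at w would make p invertible in Z[w], and Nakayama would kill the generators
  w^k.\<close>

lemma ev_root_imp_dvd:
  assumes "ev q w = 0"
  shows "int p dvd poly q 1"
proof (rule ccontr)
  assume "\<not> int p dvd poly q 1"
  hence "coprime (int p) (poly q 1)"
    using prime_p by (simp add: prime_imp_coprime)
  then obtain a b where ab: "a * int p + b * poly q 1 = 1"
    by (metis bezout_int coprime_imp_gcd_eq_1)
  obtain r where "q ^ p = pcompose q (monom 1 p) + of_nat p * r"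
    using poly_power_prime[OF prime_p] by blast
  hence "ev (q ^ p) w = ev (pcompose q (monom 1 p) + of_nat p * r) w" by simp
  hence r: "of_int (poly q 1) + of_nat p * ev r w = 0"
    using assms p_gt_1 ev_of_int[of "int p"] by (simp add: w_pow ev_at_1 power_0_left)
  define s where "s = of_int a - of_int b * r"
  have "of_nat p * ev s w = of_int a * of_nat p - of_int b * (of_nat p * ev r w)"
    by (simp add: s_def algebra_simps)
  hence "of_nat p * ev s w = of_int a * of_nat p - of_int b * (- of_int (poly q 1))"
    unfolding minus_unique[OF r] .
  moreover have "of_int a * of_nat p - of_int b * (- of_int (poly q 1)) = (of_int (a * int p + b * poly q 1) :: complex)"
    by simp
  ultimately have s: "of_nat p * ev s w = 1"
    unfolding ab by (simp only: of_int_1)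
  have "\<forall>k. \<exists>c :: nat \<Rightarrow> int. ev (s * monom 1 k) w = (\<Sum>j<p. of_int (c j) * w ^ j)"
    using ev_reduce w_pow by blast
  from choice[OF this] obtain C :: "nat \<Rightarrow> nat \<Rightarrow> int"
    where C: "\<And>k. ev (s * monom 1 k) w = (\<Sum>j<p. of_int (C k j) * w ^ j)"
    by blast
  have "\<forall>k<p. w ^ k = 0"
  proof (rule nakayama_int[where p = p and c = "\<lambda>_. 1" and r = C])
    fix k
    have "of_int 1 * w ^ k = (of_nat p * ev s w) * w ^ k"
      unfolding s by simp
    also have "\<dots> = of_nat p * ev (s * monom 1 k) w" by simp
    finally show "of_int 1 * w ^ k = of_nat p * (\<Sum>j<p. of_int (C k j) * w ^ j)"
      unfolding C .
  qed (use prime_p p_gt_1 in auto)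
  thus False using p_gt_1 by auto
qed

text \<open>The p-th cyclotomic polynomial. Applied to an automorphism of order p it becomes p times
  the projection to the fixed space.\<close>

definition Phi :: "int poly" where "Phi = (\<Sum>k<p. monom 1 k)"

lemma ev_Phi: "ev Phi z = (\<Sum>k<p. z ^ k)"
  by (simp add: Phi_def ev_sum)

lemma Phi_mult: "[:-1, 1:] * Phi = monom 1 p - 1"
proof -
  have X: "monom 1 k = ([:0, 1:] :: int poly) ^ k" for k
    by (simp add: monom_altdef)
  have "[:-1, 1:] = ([:0, 1:] :: int poly) - 1"
    by (simp add: one_pCons)
  thus ?thesis
    unfolding Phi_def X by (simp only: power_diff_1_eq)
qed

lemma ev_Phi_w [simp]: "ev Phi w = 0"
proof -
  have "ev ([:-1, 1:] * Phi) w = 0"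
    unfolding Phi_mult by (simp add: w_pow)
  thus ?thesis using w_ne_1 by simp
qed

lemma poly_Phi_1: "poly Phi 1 = int p"
  by (simp add: Phi_def poly_sum poly_monom)

text \<open>The Eisenstein shape of \<open>Phi\<close> at X = 1. At w it reads (w - 1)^(p - 1) = - p
  W(w), where W(w) has residue 1 modulo the prime above p.\<close>

lemma Phi_decomp: "\<exists>W. Phi = [:-1, 1:] ^ (p - 1) + of_nat p * W \<and> poly W 1 = 1"
proof -
  obtain r where r: "[:-1, 1:] ^ p = pcompose [:-1, 1:] (monom 1 p) + of_nat p * (r :: int poly)"
    using poly_power_prime[OF prime_p] by blast
  hence r': "[:-1, 1:] ^ p = [:-1, 1:] * Phi + of_nat p * r"
    unfolding Phi_mult by (simp add: pcompose_pCons one_pCons)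
  have "poly ([:-1, 1:] ^ p) 1 = (0::int)" using p_gt_1 by (simp add: power_0_left)
  hence "poly r 1 = 0"
    unfolding r' using p_gt_1 by simp
  then obtain s where s: "r = [:-1, 1:] * s"
    by (metis dvdE poly_eq_0_iff_dvd)
  have "[:-1, 1:] * ([:-1, 1:] ^ (p - 1)) = [:-1, 1:] * (Phi + of_nat p * s)"
    using r' p_gt_1 unfolding s power_Suc[symmetric] by (simp add: algebra_simps)
  hence 1: "[:-1, 1:] ^ (p - 1) = Phi + of_nat p * s"
    by (metis mult_cancel_left pCons_eq_0_iff zero_neq_one)
  have "poly ([:-1, 1:] ^ (p - 1)) 1 = (0::int)" using p_gt_1 by (simp add: power_0_left)
  hence "int p * (1 + poly s 1) = 0"
    unfolding 1 by (simp add: poly_Phi_1 algebra_simps)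
  hence "poly s 1 = -1" using p_gt_1 by simp
  hence "Phi = [:-1, 1:] ^ (p - 1) + of_nat p * (- s) \<and> poly (- s) 1 = 1"
    unfolding 1 by simp
  thus ?thesis by blast
qed

text \<open>Eisenstein's argument without factorisation: q is expanded in powers of X - 1 and the
  coefficients are treated in increasing order. Multiplying the relation at w by (w - 1)^(p - 1 - j)
  turns every term into a multiple of p; after cancelling p, the residue at 1 is the j-th
  coefficient up to sign.\<close>

lemma coeffs_dvd_of_root:
  assumes "ev q w = 0" and "degree q < p - 1"
  shows "\<exists>r. q = of_int (int p) * r"
proof -
  obtain W where W: "Phi = [:-1, 1:] ^ (p - 1) + of_nat p * W" "poly W 1 = 1"
    using Phi_decomp by blast
  have "ev ([:-1, 1:] ^ (p - 1) + of_int (int p) * W) w = 0"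
    using W(1) ev_Phi_w by simp
  hence lam: "(w - 1) ^ (p - 1) = - (of_nat p * ev W w)"
    by (simp add: eq_neg_iff_add_eq_0)
  define T where "T = pcompose q [:1, 1:]"
  have q: "q = pcompose T [:-1, 1:]"
    by (simp add: T_def pcompose_pCons one_pCons flip: pcompose_assoc)
  have degT: "degree T < p - 1"
    using assms(2) by (simp add: T_def degree_pcompose)
  have "int p dvd coeff T j" for j
  proof (induction j rule: less_induct)
    case (less j)
    show ?case
    proof (cases "j < p - 1")
      case False
      hence "coeff T j = 0" using degT by (intro coeff_eq_0) auto
      thus ?thesis by simp
    next
      case True
      let ?S = "poly_shift j T" and ?C = "\<Sum>i<j. monom (coeff T i) i"
      have TT: "T = ?C + monom 1 j * ?S"
        by (rule poly_eqI) (auto simp: coeff_sum coeff_monom_mult coeff_poly_shift)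
      have "\<forall>k. int p dvd coeff ?C k"
        using less by (auto simp: coeff_sum)
      then obtain C where C: "?C = of_int (int p) * C"
        using poly_eq_of_int_mult_iff by blast
      define A where "A = pcompose C [:-1, 1:]"
      define B where "B = pcompose ?S [:-1, 1:]"
      have "q = pcompose (of_int (int p) * C + monom 1 j * ?S) [:-1, 1:]"
        unfolding q by (subst TT) (simp only: C)
      hence "ev (pcompose (of_int (int p) * C + monom 1 j * ?S) [:-1, 1:]) w = 0"
        using assms(1) by simp
      hence "of_nat p * ev A w + (w - 1) ^ j * ev B w = 0"
        by (simp add: A_def B_def)
      hence "0 = (w - 1) ^ (p - 1 - j) * (of_nat p * ev A w + (w - 1) ^ j * ev B w)"
        by simp
      also have "\<dots> = of_nat p * ((w - 1) ^ (p - 1 - j) * ev A w) + ((w - 1) ^ (p - 1 - j) * (w - 1) ^ j) * ev B w"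
        by (simp add: algebra_simps)
      also have "(w - 1) ^ (p - 1 - j) * (w - 1) ^ j = (w - 1) ^ (p - 1)"
        using True by (simp flip: power_add)
      also have "of_nat p * ((w - 1) ^ (p - 1 - j) * ev A w) + (w - 1) ^ (p - 1) * ev B w =
          of_nat p * ev ([:-1, 1:] ^ (p - 1 - j) * A - W * B) w"
        unfolding lam by (simp add: algebra_simps)
      finally have "ev ([:-1, 1:] ^ (p - 1 - j) * A - W * B) w = 0"
        using p_gt_1 by simp
      hence "int p dvd poly ([:-1, 1:] ^ (p - 1 - j) * A - W * B) 1"
        by (rule ev_root_imp_dvd)
      also have "poly ([:-1, 1:] ^ (p - 1 - j) * A - W * B) 1 = - coeff T j"
        using True W(2) by (simp add: B_def poly_pcompose poly_0_coeff_0 coeff_poly_shift power_0_left)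
      finally show ?thesis by simp
    qed
  qed
  then obtain T' where T': "T = of_int (int p) * T'"
    using poly_eq_of_int_mult_iff by blast
  have "q = of_int (int p) * pcompose T' [:-1, 1:]"
    unfolding q T' by (simp add: pcompose_smult of_int_poly)
  thus ?thesis by blast
qed

text \<open>Infinite descent: after division by p the quotient is again such a root, so every power
  of p divides the coefficients. This is the irreducibility of \<open>Phi\<close> in the form used
  here, the independence of 1, w, ..., w^(p - 2) over Z.\<close>

lemma root_eq_0:
  assumes "ev q w = 0" and "degree q < p - 1"
  shows "q = 0"
proof -
  have dvd: "int p ^ n dvd coeff q j" if "ev q w = 0" "degree q < p - 1" for n j q
    using that
  proof (induction n arbitrary: q)
    case (Suc n)
    obtain r where r: "q = of_int (int p) * r"
      using coeffs_dvd_of_root Suc.prems by blast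
    have c: "coeff q k = int p * coeff r k" for k
      by (simp add: r of_int_poly)
    have "degree r = degree q"
      using p_gt_1 by (simp add: r of_int_poly)
    moreover have "ev r w = 0"
      using Suc.prems(1) p_gt_1 unfolding r by simp
    ultimately have "int p ^ n dvd coeff r j"
      using Suc.IH Suc.prems(2) by simp
    thus ?case unfolding c by (simp add: mult_dvd_mono)
  qed simp
  have "coeff q j = 0" for j
  proof (rule ccontr)
    assume "coeff q j \<noteq> 0"
    hence "int p ^ n \<le> \<bar>coeff q j\<bar>" for n
      using dvd[OF assms, of n j] by (intro zdvd_imp_le) auto
    from this[of "nat \<bar>coeff q j\<bar>"]
    have "int p ^ nat \<bar>coeff q j\<bar> \<le> int (nat \<bar>coeff q j\<bar>)" by simp
    moreover have "nat \<bar>coeff q j\<bar> < p ^ nat \<bar>coeff q j\<bar>"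
      using p_gt_1 by (intro power_gt_expt) auto
    hence "int (nat \<bar>coeff q j\<bar>) < int p ^ nat \<bar>coeff q j\<bar>"
      by (metis of_nat_less_iff of_nat_power)
    ultimately show False by simp
  qed
  thus ?thesis by (simp add: poly_eq_iff)
qed

lemma power_sum_eq_0_imp:
  fixes c :: "nat \<Rightarrow> int"
  assumes "(\<Sum>k<p. of_int (c k) * w ^ k) = 0" and "j < p"
  shows "c j = c (p - 1)"
proof -
  define q where "q = (\<Sum>k<p-1. monom (c k - c (p - 1)) k)"
  obtain m where m: "p = Suc m" using p_gt_1 gr0_implies_Suc by (metis gr_implies_not0 gr0I)
  have cq: "coeff q k = (if k < p - 1 then c k - c (p - 1) else 0)" for k
    by (simp add: q_def coeff_sum)
  have "ev q w = (\<Sum>k<p. of_int (c k - c (p - 1)) * w ^ k)"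
    by (simp add: q_def ev_sum m)
  also have "\<dots> = (\<Sum>k<p. of_int (c k) * w ^ k) - of_int (c (p - 1)) * ev Phi w"
    unfolding ev_Phi by (simp add: sum_distrib_left sum_subtractf left_diff_distrib)
  finally have "ev q w = 0" using assms(1) by simp
  moreover have "degree q < p - 1"
    using p_gt_1 by (intro degree_lessI) (auto simp: cq)
  ultimately have "q = 0" by (rule root_eq_0)
  hence "coeff q j = 0" by simp
  thus ?thesis
    using assms(2) by (cases "j = p - 1") (auto simp: cq split: if_splits)
qed

lemma sum_powers_eq_0:
  assumes "z ^ p = 1" "z \<noteq> 1"
  shows "(\<Sum>k<p. z ^ k) = (0::complex)"
  using power_diff_1_eq[of z p] assms by simp

text \<open>A relation between the p powers of w has constant coefficients, so it is a multiple of
  the sum of all powers, which vanishes at every other root too. This provides the Galois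
  conjugation w \<mapsto> w^t on Z[w].\<close>

lemma ev_root_conj:
  assumes "ev q w = 0" "z ^ p = 1" "z \<noteq> 1"
  shows "ev q z = 0"
proof -
  obtain c :: "nat \<Rightarrow> int" where c: "\<And>z. z ^ p = 1 \<Longrightarrow> ev q z = (\<Sum>k<p. of_int (c k) * z ^ k)"
    using ev_reduce by blast
  obtain m where m: "\<And>k. k < p \<Longrightarrow> c k = m"
  proof
    fix k assume "k < p"
    thus "c k = c (p - 1)"
      by (rule power_sum_eq_0_imp[rotated]) (use c[OF w_pow] assms(1) in simp)
  qed
  have "ev q z = of_int m * (\<Sum>k<p. z ^ k)"
    unfolding c[OF assms(2)] sum_distrib_left by (rule sum.cong) (simp_all add: m)
  thus ?thesis using sum_powers_eq_0[OF assms(2,3)] by simp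
qed

lemma w_power_eq_1_iff: "w ^ k = 1 \<longleftrightarrow> p dvd k"
proof
  assume "w ^ k = 1"
  show "p dvd k"
  proof (rule ccontr)
    assume "\<not> p dvd k"
    hence "coprime k p"
      using prime_p by (metis coprime_commute prime_imp_coprime)
    then obtain x where "[k * x = 1] (mod p)"
      using cong_solve_coprime_nat by auto
    hence "(k * x) mod p = 1"
      using p_gt_1 by (simp add: Cong.cong_def)
    hence "w = w ^ (k * x)" using w_power_mod[of "k * x"] by simp
    thus False using \<open>w ^ k = 1\<close> w_ne_1 by (simp add: power_mult)
  qed
qed (auto simp: power_mult w_pow)

lemma w_power_power: "(w ^ t) ^ p = 1"
  by (metis mult.commute power_mult power_one w_pow)

lemma prime_root_power: "\<not> p dvd t \<Longrightarrow> prime_root p (w ^ t)"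
  using prime_p w_power_power w_power_eq_1_iff by unfold_locales auto

lemma ev_conj_iff:
  assumes "\<not> p dvd t"
  shows "ev q (w ^ t) = 0 \<longleftrightarrow> ev q w = 0"
proof -
  interpret t: prime_root p "w ^ t" by (rule prime_root_power[OF assms])
  show ?thesis
    using ev_root_conj t.ev_root_conj w_pow w_ne_1 t.w_pow t.w_ne_1 by blast
qed

text \<open>Summing over the conjugates shows that (p - 1) q(w) is an integer; independence of the
  powers of w then removes the factor p - 1.\<close>

lemma ev_fixed_imp_int:
  assumes "\<And>t. t \<in> {1..<p} \<Longrightarrow> ev q (w ^ t) = ev q w"
  shows "\<exists>n. ev q w = of_int n"
proof -
  obtain c :: "nat \<Rightarrow> int" where c: "\<And>z. z ^ p = 1 \<Longrightarrow> ev q z = (\<Sum>k<p. of_int (c k) * z ^ k)"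
    using ev_reduce by blast
  note wt = w_power_power
  have split: "(\<Sum>k<p. f k) = f 0 + (\<Sum>k\<in>{1..<p}. f k)" for f :: "nat \<Rightarrow> complex"
  proof -
    have "{..<p} = insert 0 {1..<p}" using p_gt_1 by auto
    thus ?thesis by simp
  qed
  have sum1: "(\<Sum>t\<in>{1..<p}. (w ^ t) ^ k) = -1" if "k \<in> {1..<p}" for k
  proof -
    have "\<not> p dvd k" using that by (auto dest: dvd_imp_le)
    then interpret k: prime_root p "w ^ k" by (rule prime_root_power)
    have "(\<Sum>t<p. (w ^ k) ^ t) = 0" by (rule sum_powers_eq_0[OF k.w_pow k.w_ne_1])
    hence "1 + (\<Sum>t\<in>{1..<p}. (w ^ k) ^ t) = 0" unfolding split by simp
    thus ?thesis by (simp add: add_eq_0_iff power_mult[symmetric] mult.commute)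
  qed
  define N where "N = (int p - 1) * c 0 - (\<Sum>k\<in>{1..<p}. c k)"
  have "(of_nat p - 1) * ev q w = (\<Sum>t\<in>{1..<p}. ev q (w ^ t))"
    using assms p_gt_1 by (simp add: of_nat_diff)
  also have "\<dots> = (\<Sum>t\<in>{1..<p}. of_int (c 0) + (\<Sum>k\<in>{1..<p}. of_int (c k) * (w ^ t) ^ k))"
    by (simp add: c[OF wt] split)
  also have "\<dots> = (of_nat p - 1) * of_int (c 0) + (\<Sum>k\<in>{1..<p}. of_int (c k) * (\<Sum>t\<in>{1..<p}. (w ^ t) ^ k))"
    unfolding sum.distrib sum_distrib_left using p_gt_1 by (subst sum.swap) (simp add: of_nat_diff)
  also have "\<dots> = of_int N"
    using sum1 by (simp add: N_def sum_negf)
  finally have N: "(of_nat p - 1) * ev q w = of_int N" .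
  \<comment> \<open>The coefficients of the relation (p - 1) q(w) - N = 0.\<close>
  define e where "e k = (int p - 1) * c k - (if k = 0 then N else 0)" for k
  have "(\<Sum>k<p. of_int (e k) * w ^ k) = (of_nat p - 1) * ev q w - of_int N"
    unfolding c[OF w_pow] split e_def by (simp add: sum_distrib_left algebra_simps)
  hence "(\<Sum>k<p. of_int (e k) * w ^ k) = 0" using N by simp
  hence e: "e k = e (p - 1)" if "k < p" for k
    using power_sum_eq_0_imp that by blast
  have "c k = c (p - 1)" if "k \<in> {1..<p}" for k
    using e[of k] that p_gt_1 by (simp add: e_def split: if_splits)
  hence "ev q w = of_int (c 0) + of_int (c (p - 1)) * (\<Sum>k\<in>{1..<p}. w ^ k)"
    unfolding c[OF w_pow] split by (simp add: sum_distrib_left)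
  also have "(\<Sum>k\<in>{1..<p}. w ^ k) = -1"
    using sum1[of 1] p_gt_1 by simp
  finally show ?thesis by (intro exI[of _ "c 0 - c (p - 1)"]) simp
qed

lemma not_dvd_range: "j \<in> {1..<p} \<Longrightarrow> \<not> p dvd j"
  by (auto simp: nat_dvd_not_less)

lemma mult_mod_bij:
  assumes "\<not> p dvd t"
  shows "bij_betw (\<lambda>j. t * j mod p) {1..<p} {1..<p}"
proof -
  have cop: "coprime t p" using assms prime_p by (metis coprime_commute prime_imp_coprime)
  have inj: "inj_on (\<lambda>j. t * j mod p) {1..<p}"
  proof (rule inj_onI)
    fix i j assume ij: "i \<in> {1..<p}" "j \<in> {1..<p}" "t * i mod p = t * j mod p"
    hence "[t * i = t * j] (mod p)" by (simp add: Cong.cong_def)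
    hence "[i = j] (mod p)" using cop by (simp add: cong_mult_lcancel_nat)
    thus "i = j" using ij by (simp add: Cong.cong_def)
  qed
  have "(\<lambda>j. t * j mod p) ` {1..<p} \<subseteq> {1..<p}"
  proof safe
    fix j assume j: "j \<in> {1..<p}"
    have "\<not> p dvd t * j"
      using assms j prime_p by (auto simp: prime_dvd_mult_iff dest: dvd_imp_le)
    hence "t * j mod p \<noteq> 0" by (simp add: dvd_eq_mod_eq_0)
    moreover have "t * j mod p < p" using p_gt_1 by (intro mod_less_divisor) auto
    ultimately show "t * j mod p \<in> {1..<p}" by auto
  qed
  hence "(\<lambda>j. t * j mod p) ` {1..<p} = {1..<p}"
    using inj by (intro endo_inj_surj) auto
  thus ?thesis using inj by (simp add: bij_betw_def)
qed

lemma norm_int: "\<exists>n. (\<Prod>j\<in>{1..<p}. ev q (w ^ j)) = of_int n"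
proof -
  define Q where "Q = (\<Prod>j\<in>{1..<p}. pcompose q (monom 1 j))"
  have ev_Q: "ev Q z = (\<Prod>j\<in>{1..<p}. ev q (z ^ j))" for z
    by (simp add: Q_def ev_prod)
  have "ev Q (w ^ t) = ev Q w" if "t \<in> {1..<p}" for t
  proof -
    have "\<not> p dvd t" using that by (auto dest: dvd_imp_le)
    hence "(\<Prod>j\<in>{1..<p}. ev q (w ^ j)) = (\<Prod>j\<in>{1..<p}. ev q (w ^ (t * j mod p)))"
      by (rule prod.reindex_bij_betw[OF mult_mod_bij, symmetric])
    thus ?thesis by (simp add: ev_Q w_power_mod power_mult)
  qed
  thus ?thesis using ev_fixed_imp_int[of Q] by (simp add: ev_Q)
qed

text \<open>The product of the other conjugates is the cofactor, and the resulting norm is a nonzero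
  integer.\<close>

lemma ev_inverse:
  assumes "ev q w \<noteq> 0"
  shows "\<exists>r D. D \<noteq> 0 \<and> ev (r * q) w = of_int D"
proof -
  obtain n where n: "(\<Prod>j\<in>{1..<p}. ev q (w ^ j)) = of_int n"
    using norm_int by blast
  define r where "r = (\<Prod>j\<in>{1..<p}-{1}. pcompose q (monom 1 j))"
  have "(\<Prod>j\<in>{1..<p}. ev q (w ^ j)) = ev q (w ^ 1) * (\<Prod>j\<in>{1..<p}-{1}. ev q (w ^ j))"
    using p_gt_1 by (intro prod.remove) auto
  hence "ev (r * q) w = of_int n"
    using n by (simp add: r_def ev_prod mult.commute)
  moreover have "ev q (w ^ j) \<noteq> 0" if "j \<in> {1..<p}" for j
    using assms ev_conj_iff[OF not_dvd_range[OF that]] by simp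
  hence "(\<Prod>j\<in>{1..<p}. ev q (w ^ j)) \<noteq> 0" by simp
  hence "n \<noteq> 0" using n by auto
  ultimately show ?thesis by blast
qed

lemma norm_w [simp]: "norm w = 1"
proof (rule power_eq_imp_eq_base[of _ p])
  show "norm w ^ p = 1 ^ p" by (simp add: w_pow flip: norm_power)
qed (use p_gt_1 in auto)

lemma inverse_root: "z ^ p = (1::complex) \<Longrightarrow> inverse z = z ^ (p - 1)"
  by (rule inverse_unique) (use p_gt_1 in \<open>simp flip: power_Suc\<close>)

lemma cnj_w: "cnj w = inverse w"
  using complex_norm_square[of w] by (intro inverse_unique[symmetric]) simp

end

text \<open>Dickson polynomials, normalised so that D_k (z + 1/z) = z^k + 1/z^k. They rewrite
  expressions symmetric under z \<mapsto> 1/z as polynomials in z + 1/z.\<close>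

fun dickson :: "nat \<Rightarrow> int poly"
  where "dickson 0 = [:2:]"
  | "dickson (Suc 0) = [:0, 1:]"
  | "dickson (Suc (Suc k)) = [:0, 1:] * dickson (Suc k) - dickson k"

lemma ev_dickson:
  assumes "z \<noteq> 0"
  shows "ev (dickson k) (z + inverse z) = z ^ k + inverse z ^ k"
  by (induction k rule: dickson.induct) (use assms in \<open>simp_all add: field_simps\<close>)

section \<open>Real elements of Z[w], their residues and their positivity\<close>

context prime_root
begin

definition gam :: complex where "gam = w + inverse w"

text \<open>At p-th roots of unity X + X^(p - 1) is z + 1/z. The value at 1 is h(2), so
  \<open>poly h 2\<close> is the residue of the real element \<open>ev h gam\<close> modulo the
  prime above p.\<close>

definition trace_lift :: "int poly \<Rightarrow> int poly"
  where "trace_lift h = pcompose h (monom 1 1 + monom 1 (p - 1))"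

lemma ev_trace_lift: "z ^ p = 1 \<Longrightarrow> ev (trace_lift h) z = ev h (z + inverse z)"
  by (simp add: trace_lift_def inverse_root)

lemma ev_trace_lift_w: "ev (trace_lift h) w = ev h gam"
  by (simp add: ev_trace_lift w_pow gam_def)

lemma poly_trace_lift_1: "poly (trace_lift h) 1 = poly h 2"
  by (simp add: trace_lift_def poly_pcompose poly_monom)

text \<open>Conjugation exchanges the coefficients of w^k and w^(p - k), so reality makes them
  symmetric up to a constant, and the index 0 shows that the constant is 0. The resulting identity
  also holds at z = 1, which is what makes residues computable.\<close>

lemma ev_real_imp_trace:
  assumes "odd p" and "ev q w \<in> \<real>"
  shows "\<exists>h. \<forall>z. z ^ p = 1 \<longrightarrow> ev q z = ev h (z + inverse z)"
proof -
  obtain m where m: "p = 2 * m + 1" using assms(1) by (auto elim: oddE)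
  obtain c :: "nat \<Rightarrow> int" where c: "\<And>z. z ^ p = 1 \<Longrightarrow> ev q z = (\<Sum>k<p. of_int (c k) * z ^ k)"
    using ev_reduce by blast
  let ?r = "\<lambda>k. (p - k) mod p"
  have r: "?r k < p" "?r (?r k) = k" if "k < p" for k
  proof -
    show "?r k < p" using p_gt_1 by simp
    show "?r (?r k) = k" using that p_gt_1 by (cases "k = 0") auto
  qed
  have inv: "inverse w ^ k = w ^ ?r k" if "k < p" for k
  proof -
    have "w ^ k * w ^ (p - k) = 1"
      using that by (simp add: w_pow flip: power_add)
    hence "inverse (w ^ k) = w ^ (p - k)" by (rule inverse_unique)
    thus ?thesis by (simp add: w_power_mod power_inverse)
  qed
  have "inverse w ^ p = 1" using w_pow by (simp add: power_inverse)
  hence "cnj (ev q w) = (\<Sum>k<p. of_int (c k) * inverse w ^ k)"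
    unfolding cnj_ev cnj_w by (rule c)
  also have "\<dots> = (\<Sum>k<p. of_int (c k) * w ^ ?r k)"
    by (rule sum.cong) (simp_all only: lessThan_iff inv)
  also have "\<dots> = (\<Sum>k<p. of_int (c (?r k)) * w ^ k)"
    by (rule sum.reindex_bij_witness[of _ ?r ?r]) (simp_all add: r)
  finally have "(\<Sum>k<p. of_int (c k - c (?r k)) * w ^ k) = ev q w - cnj (ev q w)"
    unfolding c[OF w_pow] by (simp add: sum_subtractf left_diff_distrib)
  also have "\<dots> = 0" using assms(2) by (simp add: Reals_cnj_iff)
  finally have "(\<Sum>k<p. of_int (c k - c (?r k)) * w ^ k) = 0" .
  hence e: "c j - c (?r j) = c (p - 1) - c (?r (p - 1))" if "j < p" for j
    using power_sum_eq_0_imp[of "\<lambda>k. c k - c (?r k)"] that by blast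
  have "c (p - 1) - c (?r (p - 1)) = 0" using e[of 0] p_gt_1 by simp
  hence csym: "c k = c (p - k)" if "k \<in> {1..<p}" for k
    using e[of k] that by simp
  define h where "h = [:c 0:] + (\<Sum>k\<in>{1..m}. smult (c k) (dickson k))"
  have "ev q z = ev h (z + inverse z)" if z: "z ^ p = 1" for z
  proof -
    have "z \<noteq> 0" using z p_gt_1 by (auto simp: power_0_left)
    have zinv: "z ^ (p - k) = inverse z ^ k" if "k < p" for k
    proof -
      have "z ^ k * z ^ (p - k) = 1"
        using that z by (simp flip: power_add)
      hence "inverse (z ^ k) = z ^ (p - k)" by (rule inverse_unique)
      thus ?thesis by (simp add: power_inverse)
    qed
    have "{..<p} = insert 0 ({1..m} \<union> {m+1..2*m})"
      unfolding m by auto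
    hence "ev q z = of_int (c 0) + ((\<Sum>k\<in>{1..m}. of_int (c k) * z ^ k) + (\<Sum>k\<in>{m+1..2*m}. of_int (c k) * z ^ k))"
      unfolding c[OF z] by (simp add: sum.union_disjoint)
    also have "(\<Sum>k\<in>{m+1..2*m}. of_int (c k) * z ^ k) = (\<Sum>k\<in>{1..m}. of_int (c (p - k)) * z ^ (p - k))"
      by (rule sum.reindex_bij_witness[of _ "\<lambda>k. p - k" "\<lambda>k. p - k"]) (auto simp: m)
    also have "\<dots> = (\<Sum>k\<in>{1..m}. of_int (c k) * inverse z ^ k)"
    proof (rule sum.cong)
      fix k assume "k \<in> {1..m}"
      hence k: "k \<in> {1..<p}" by (simp add: m)
      hence "k < p" by simp
      thus "of_int (c (p - k)) * z ^ (p - k) = of_int (c k) * inverse z ^ k"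
        using csym[OF k] zinv by simp
    qed simp
    finally show ?thesis
      using ev_dickson[OF \<open>z \<noteq> 0\<close>] by (simp add: h_def ev_sum sum.distrib distrib_left)
  qed
  thus ?thesis by blast
qed

text \<open>The norm from Z[w] is the square of the product P over half of the conjugates, as w^j
  and w^(p - j) give the same real element. Positivity forces P = 1. All (p - 1) / 2 factors of P
  have residue h(2), so h(2)^((p - 1) / 2) = 1 modulo p and Euler's criterion applies.\<close>

lemma totally_positive_unit_residue:
  assumes "p > 2" and unit: "ev h gam * ev h' gam = 1"
    and pos: "\<And>j. j \<in> {1..<p} \<Longrightarrow> ev h (w ^ j + inverse (w ^ j)) \<in> \<real> \<and> 0 < Re (ev h (w ^ j + inverse (w ^ j)))"
  shows "QuadRes (int p) (poly h 2)"
proof -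
  have "odd p" using assms(1) prime_p prime_odd_nat by auto
  then obtain m where m: "p = 2 * m + 1" by (auto elim: oddE)
  define r where "r j = Re (ev h (w ^ j + inverse (w ^ j)))" for j
  have r: "ev h (w ^ j + inverse (w ^ j)) = of_real (r j)" "r j > 0" if "j \<in> {1..<p}" for j
    using pos[OF that] by (auto simp: r_def)
  obtain n where n: "(\<Prod>j\<in>{1..<p}. ev (trace_lift h) (w ^ j)) = of_int n"
    using norm_int by blast
  obtain n' where n': "(\<Prod>j\<in>{1..<p}. ev (trace_lift h') (w ^ j)) = of_int n'"
    using norm_int by blast
  have "ev (trace_lift h * trace_lift h' - 1) w = 0"
    using unit by (simp add: ev_trace_lift_w)
  hence "ev (trace_lift h) (w ^ j) * ev (trace_lift h') (w ^ j) = 1" if "j \<in> {1..<p}" for j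
    using ev_conj_iff[OF not_dvd_range[OF that], of "trace_lift h * trace_lift h' - 1"] by simp
  hence "(of_int n * of_int n' :: complex) = 1"
    unfolding n[symmetric] n'[symmetric] prod.distrib[symmetric] by simp
  hence "(of_int (n * n') :: complex) = of_int 1" by simp
  hence nn: "n * n' = 1" by (simp only: of_int_eq_iff)
  have nr: "of_int n = (of_real (\<Prod>j\<in>{1..<p}. r j) :: complex)"
    unfolding n[symmetric] of_real_prod
    by (rule prod.cong) (simp_all add: ev_trace_lift w_power_power r)
  hence "complex_of_real (of_int n) = of_real (\<Prod>j\<in>{1..<p}. r j)"
    unfolding of_real_of_int_eq .
  hence nr': "of_int n = (\<Prod>j\<in>{1..<p}. r j)"
    unfolding of_real_eq_iff .
  moreover have "(\<Prod>j\<in>{1..<p}. r j) > 0"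
    using r by (intro prod_pos) auto
  ultimately have "n > 0" by simp
  hence "n = 1" using nn pos_zmult_eq_1_iff by blast
  define P where "P = (\<Prod>j\<in>{1..m}. r j)"
  have "{1..<p} = {1..m} \<union> {m+1..2*m}" unfolding m by auto
  hence "(\<Prod>j\<in>{1..<p}. r j) = P * (\<Prod>j\<in>{m+1..2*m}. r j)"
    by (simp add: P_def prod.union_disjoint)
  also have "(\<Prod>j\<in>{m+1..2*m}. r j) = (\<Prod>j\<in>{1..m}. r (p - j))"
    by (rule prod.reindex_bij_witness[of _ "\<lambda>k. p - k" "\<lambda>k. p - k"]) (auto simp: m)
  also have "\<dots> = P"
    unfolding P_def
  proof (rule prod.cong)
    fix j assume "j \<in> {1..m}"
    hence "j + (p - j) = p" using m by simp
    hence "w ^ j * w ^ (p - j) = 1"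
      by (simp only: w_pow flip: power_add)
    hence "inverse (w ^ j) = w ^ (p - j)" by (rule inverse_unique)
    moreover from this have "inverse (w ^ (p - j)) = w ^ j"
      by (metis inverse_inverse_eq)
    ultimately
    show "r (p - j) = r j" by (simp add: r_def add.commute)
  qed simp
  finally have "P * P = 1"
    using nr' \<open>n = 1\<close> by simp
  moreover have "P > 0" using r by (auto simp: P_def m intro!: prod_pos)
  ultimately have "P = 1"
    using abs_square_eq_1[of P] by (simp add: power2_eq_square)
  define Q where "Q = (\<Prod>j\<in>{1..m}. pcompose (trace_lift h) (monom 1 j)) - 1"
  have "(\<Prod>j\<in>{1..m}. ev (trace_lift h) (w ^ j)) = (\<Prod>j\<in>{1..m}. of_real (r j))"
  proof (rule prod.cong)
    fix j assume "j \<in> {1..m}"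
    hence "j \<in> {1..<p}" using m by simp
    thus "ev (trace_lift h) (w ^ j) = of_real (r j)"
      by (simp only: ev_trace_lift[OF w_power_power] r(1))
  qed simp
  also have "\<dots> = of_real P" by (simp add: P_def)
  finally have "ev Q w = 0"
    using \<open>P = 1\<close> by (simp add: Q_def ev_prod)
  hence "int p dvd poly Q 1" by (rule ev_root_imp_dvd)
  also have "poly Q 1 = poly h 2 ^ m - 1"
    by (simp add: Q_def poly_prod poly_pcompose poly_monom poly_trace_lift_1)
  finally have 1: "[poly h 2 ^ m = 1] (mod int p)"
    by (simp add: cong_iff_dvd_diff)
  have "[Legendre (poly h 2) (int p) = poly h 2 ^ ((p - 1) div 2)] (mod int p)"
    using euler_criterion[of p "poly h 2"] prime_p assms(1) by simp
  also have "(p - 1) div 2 = m" using m by simp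
  finally have "[Legendre (poly h 2) (int p) = 1] (mod int p)"
    using 1 cong_trans by blast
  hence "int p dvd Legendre (poly h 2) (int p) - 1"
    by (simp add: cong_iff_dvd_diff)
  moreover have "\<not> int p dvd 0 - 1" "\<not> int p dvd -1 - 1"
    using assms(1) zdvd_imp_le[of "int p" 2] p_gt_1 by (auto simp: dvd_minus_iff)
  ultimately show ?thesis
    by (auto simp: Legendre_def split: if_splits)
qed

lemma w_ne_inverse: "odd p \<Longrightarrow> \<not> p dvd c \<Longrightarrow> w ^ c \<noteq> inverse w ^ c"
proof
  assume "odd p" "\<not> p dvd c" and a: "w ^ c = inverse w ^ c"
  have "w ^ c * inverse w ^ c = 1" by (simp add: power_inverse)
  hence "w ^ c * w ^ c = 1" unfolding a[symmetric] .
  hence "w ^ (2 * c) = 1" by (simp add: mult_2 power_add)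
  hence "p dvd 2 * c" by (simp add: w_power_eq_1_iff)
  moreover have "coprime p 2" using \<open>odd p\<close> by simp
  ultimately show False using \<open>\<not> p dvd c\<close> by (simp add: coprime_dvd_mult_right_iff)
qed

text \<open>The witness is the cyclotomic unit \<open>(w ^ c - w ^ - c) / (w - w ^ - 1)\<close>.\<close>

lemma cyclotomic_unit:
  assumes "odd p" and "\<not> p dvd c"
  shows "\<exists>k k'. ev k gam * ev k' gam = 1 \<and> poly k 2 = int c"
proof -
  have "c > 0" using assms(2) by (auto intro: Nat.gr0I)
  \<comment> \<open>The monomial is w^(-(c - 1)) at p-th roots of unity; times the geometric sum in
    w^2 it gives the quotient as a polynomial, with value c at 1.\<close>
  define q :: "nat \<Rightarrow> int poly" where "q c = monom 1 ((p - 1) * (c - 1)) * (\<Sum>i<c. monom 1 (2 * i))" for c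
  have q: "ev (q c) z * (z - inverse z) = z ^ c - inverse z ^ c" if "z ^ p = 1" "c > 0" for z c
  proof -
    have "z \<noteq> 0" using that p_gt_1 by (auto simp: power_0_left)
    obtain d where d: "c = Suc d" using \<open>c > 0\<close> gr0_implies_Suc by blast
    have "ev (q c) z = inverse z ^ d * (\<Sum>i<c. (z\<^sup>2) ^ i)"
      by (simp add: q_def ev_sum d power_mult inverse_root[OF that(1)] flip: power_mult)
    hence "ev (q c) z * (z - inverse z) = inverse z ^ c * ((z\<^sup>2 - 1) * (\<Sum>i<c. (z\<^sup>2) ^ i))"
      using \<open>z \<noteq> 0\<close> by (simp add: d field_simps power2_eq_square)
    also have "\<dots> = inverse z ^ c * ((z\<^sup>2) ^ c - 1)"
      by (simp only: power_diff_1_eq)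
    also have "\<dots> = z ^ c - inverse z ^ c"
      using \<open>z \<noteq> 0\<close> by (simp add: field_simps power2_eq_square power_mult_distrib flip: power_mult)
    finally show ?thesis .
  qed
  have wc: "w ^ c \<noteq> inverse w ^ c" "w \<noteq> inverse w"
    using w_ne_inverse[OF assms] w_ne_inverse[OF assms(1), of 1] p_gt_1 by auto
  have cq: "cnj (ev (q c) w) * (inverse w - w) = inverse w ^ c - w ^ c"
    using q[of "inverse w" c] w_pow \<open>c > 0\<close> by (simp add: cnj_ev cnj_w power_inverse)
  have "cnj (ev (q c) w) * (w - inverse w) = - (cnj (ev (q c) w) * (inverse w - w))"
    by (simp only: right_diff_distrib minus_diff_eq)
  also have "\<dots> = ev (q c) w * (w - inverse w)"
    unfolding cq q[OF w_pow \<open>c > 0\<close>] by (simp only: minus_diff_eq)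
  finally have "cnj (ev (q c) w) = ev (q c) w"
    using wc by simp
  hence real: "ev (q c) w \<in> \<real>" by (simp add: Reals_cnj_iff)
  \<comment> \<open>The inverse unit is the same kind of quotient taken at w^c with an exponent b
    such that c b = 1 modulo p: numerator and denominator are exchanged.\<close>
  have "coprime c p" using assms(2) prime_p by (metis coprime_commute prime_imp_coprime)
  then obtain b where "[c * b = 1] (mod p)"
    using cong_solve_coprime_nat by auto
  hence b1: "(c * b) mod p = 1"
    using p_gt_1 by (simp add: Cong.cong_def)
  hence b: "w ^ (c * b) = w" "b > 0" using w_power_mod[of "c * b"] by (auto intro: Nat.gr0I)
  have qb: "ev (q b) (w ^ c) * (w ^ c - inverse w ^ c) = w - inverse w"
    using q[OF w_power_power \<open>b > 0\<close>, of c] b by (simp add: power_inverse flip: power_mult)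
  have "ev (q c) w * ev (q b) (w ^ c) * (w ^ c - inverse w ^ c) = w ^ c - inverse w ^ c"
    unfolding mult.assoc qb by (rule q[OF w_pow \<open>c > 0\<close>])
  hence prod1: "ev (q c) w * ev (pcompose (q b) (monom 1 c)) w = 1"
    using wc by simp
  hence "ev (pcompose (q b) (monom 1 c)) w = inverse (ev (q c) w)"
    by (simp only: inverse_unique)
  hence real': "ev (pcompose (q b) (monom 1 c)) w \<in> \<real>"
    using real by simp
  obtain k where k: "\<forall>z. z ^ p = 1 \<longrightarrow> ev (q c) z = ev k (z + inverse z)"
    using ev_real_imp_trace[OF assms(1) real] by blast
  obtain k' where k': "\<forall>z. z ^ p = 1 \<longrightarrow> ev (pcompose (q b) (monom 1 c)) z = ev k' (z + inverse z)"
    using ev_real_imp_trace[OF assms(1) real'] by blast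
  have "ev k 2 = ev (q c) 1" using k[rule_format, of 1] by simp
  also have "\<dots> = of_int (int c)" by (simp add: q_def ev_sum)
  finally have "(of_int (poly k 2) :: complex) = of_int (int c)"
    using ev_of_int_arg[of k 2] by simp
  hence "poly k 2 = int c" unfolding of_int_eq_iff .
  moreover have "ev k gam * ev k' gam = 1"
    using prod1 k k' w_pow by (simp add: gam_def)
  ultimately show ?thesis by blast
qed

text \<open>If y^2 is the residue of the unit, a cyclotomic unit whose residue c is inverse to y
  does it: h(2) c^2 = (y c)^2 = 1 modulo p.\<close>

lemma totally_positive_unit_adjust:
  assumes "p > 2" and unit: "ev h gam * ev h' gam = 1"
    and pos: "\<And>j. j \<in> {1..<p} \<Longrightarrow> ev h (w ^ j + inverse (w ^ j)) \<in> \<real> \<and> 0 < Re (ev h (w ^ j + inverse (w ^ j)))"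
  shows "\<exists>k k'. ev k gam * ev k' gam = 1 \<and> int p dvd poly (h * k * k) 2 - 1"
proof -
  have "odd p" using assms(1) prime_p prime_odd_nat by auto
  obtain y where y: "[y\<^sup>2 = poly h 2] (mod int p)"
    using totally_positive_unit_residue[OF assms] by (auto simp: QuadRes_def)
  have "ev (trace_lift h * trace_lift h' - 1) w = 0"
    using unit by (simp add: ev_trace_lift_w)
  hence 1: "int p dvd poly h 2 * poly h' 2 - 1"
    using ev_root_imp_dvd[of "trace_lift h * trace_lift h' - 1"] by (simp add: poly_trace_lift_1)
  have ny: "\<not> int p dvd y"
  proof
    assume "int p dvd y"
    hence "int p dvd y\<^sup>2" by (simp add: power2_eq_square)
    hence "int p dvd poly h 2" using cong_dvd_iff[OF y] by simp
    hence "int p dvd poly h 2 * poly h' 2 - (poly h 2 * poly h' 2 - 1)"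
      using 1 by (rule dvd_diff[OF dvd_mult2])
    thus False using p_gt_1 by simp
  qed
  have "prime (int p)" using prime_p by simp
  from prime_imp_coprime[OF this ny] have "coprime y (int p)" by (simp add: coprime_commute)
  then obtain x where x: "[y * x = 1] (mod int p)"
    using cong_solve_coprime_int by blast
  define c where "c = nat (x mod int p)"
  have c: "int c = x mod int p" using p_gt_1 by (simp add: c_def)
  hence yc: "[y * int c = 1] (mod int p)"
    using x by (simp add: Cong.cong_def mod_mult_right_eq)
  have "\<not> p dvd c"
  proof
    assume "p dvd c"
    hence "int p dvd y * int c" by simp
    moreover have "int p dvd y * int c - 1" using yc by (simp add: cong_iff_dvd_diff)
    ultimately have "int p dvd y * int c - (y * int c - 1)" by (rule dvd_diff)
    thus False using p_gt_1 by simp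
  qed
  then obtain k k' where k: "ev k gam * ev k' gam = 1" "poly k 2 = int c"
    using cyclotomic_unit[OF \<open>odd p\<close>] by blast
  have c1: "[poly h 2 * int c * int c = y\<^sup>2 * int c * int c] (mod int p)"
    by (intro cong_mult cong_refl cong_sym[OF y])
  have eq: "(y * int c) * (y * int c) = y\<^sup>2 * int c * int c"
    by (simp add: power2_eq_square)
  have "[poly h 2 * int c * int c = 1 * 1] (mod int p)"
    by (rule cong_trans[OF c1 cong_mult[OF yc yc, unfolded eq]])
  hence "int p dvd poly (h * k * k) 2 - 1"
    by (simp add: k cong_iff_dvd_diff)
  thus ?thesis using k by blast
qed

end

section \<open>Lattices\<close>

lemma scaleR_eq_scale: "r *\<^sub>R (x :: complex^'n) = of_real r *s x"
  unfolding vec_eq_iff vector_scaleR_component vector_smult_component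
  by (simp add: scaleR_conv_of_real)

lemma clinear_iff: "clinear f \<longleftrightarrow> (\<forall>x y. f (x + y) = f x + f y) \<and> (\<forall>c x. f (c *s x) = c *s f x)"
  unfolding Vector_Spaces.linear_iff by (simp add: vec.vector_space_axioms)

lemma clinear_add: "clinear f \<Longrightarrow> f (x + y) = f x + f y"
  and clinear_scale: "clinear f \<Longrightarrow> f (c *s x) = c *s f x"
  by (simp_all add: clinear_iff)

lemma clinear_imp_linear: "clinear f \<Longrightarrow> linear f"
  by (rule linearI) (simp_all add: clinear_iff scaleR_eq_scale)

lemma clinear_compose: "clinear f \<Longrightarrow> clinear g \<Longrightarrow> clinear (\<lambda>x. f (g x))"
  by (simp add: clinear_iff)

lemma clinear_inv:
  assumes "clinear f" "bij f"
  shows "clinear (inv_into UNIV f)"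
proof -
  have 1: "f (inv_into UNIV f x) = x" and 2: "inv_into UNIV f (f x) = x" for x
    using assms(2) by (simp_all add: bij_is_surj surj_f_inv_f bij_is_inj inv_f_f)
  have "inv_into UNIV f (x + y) = inv_into UNIV f x + inv_into UNIV f y" for x y
    using 2[of "inv_into UNIV f x + inv_into UNIV f y"] by (simp add: clinear_add[OF assms(1)] 1)
  moreover have "inv_into UNIV f (c *s x) = c *s inv_into UNIV f x" for c x
    using 2[of "c *s inv_into UNIV f x"] by (simp add: clinear_scale[OF assms(1)] 1)
  ultimately show ?thesis unfolding clinear_iff by blast
qed

text \<open>Maps from the reals to the rationals, viewed inside the reals; additivity already makes
  them linear over Q. They turn a real relation between lattice vectors into a rational one.\<close>

definition qfunctional :: "(real \<Rightarrow> real) \<Rightarrow> bool"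
  where "qfunctional \<pi> \<longleftrightarrow> (\<forall>x y. \<pi> (x + y) = \<pi> x + \<pi> y) \<and> range \<pi> \<subseteq> \<rat>"

lemma qfunctional_0: "qfunctional \<pi> \<Longrightarrow> \<pi> 0 = 0"
  unfolding qfunctional_def by (metis add_cancel_right_left)

lemma qfunctional_minus: "qfunctional \<pi> \<Longrightarrow> \<pi> (- x) = - \<pi> x"
  using qfunctional_0 unfolding qfunctional_def by (metis add.right_inverse add_eq_0_iff)

lemma qfunctional_sum: "qfunctional \<pi> \<Longrightarrow> \<pi> (sum f A) = (\<Sum>i\<in>A. \<pi> (f i))"
  by (induction A rule: infinite_finite_induct) (simp_all add: qfunctional_0 qfunctional_def)

lemma qfunctional_of_int_mult: "qfunctional \<pi> \<Longrightarrow> \<pi> (x * of_int n) = \<pi> x * of_int n"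
proof (induction n rule: int_induct[where k = 0])
  case base
  thus ?case by (simp add: qfunctional_0)
next
  case (step1 i)
  thus ?case by (simp add: qfunctional_def algebra_simps)
next
  case (step2 i)
  hence "\<pi> (x * of_int i + - x) = \<pi> (x * of_int i) + - \<pi> x"
    using qfunctional_minus by (metis qfunctional_def)
  thus ?case using step2 by (simp add: algebra_simps)
qed

lemma qfunctional_exists:
  assumes "c \<noteq> 0"
  shows "\<exists>\<pi>. qfunctional \<pi> \<and> \<pi> c = 1"
proof -
  let ?s = "\<lambda>(q::rat) (x::real). of_rat q * x"
  interpret V: vector_space ?s
    by unfold_locales (simp_all add: of_rat_add of_rat_mult algebra_simps)
  interpret W: vector_space "(*) :: rat \<Rightarrow> rat \<Rightarrow> rat"
    by unfold_locales (simp_all add: algebra_simps)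
  interpret vector_space_pair ?s "(*) :: rat \<Rightarrow> rat \<Rightarrow> rat" ..
  have "V.independent {c}" using assms by simp
  then obtain g where g: "Vector_Spaces.linear ?s (*) g" "\<forall>x\<in>{c}. g x = 1"
    using linear_independent_extend[of "{c}" "\<lambda>_. 1"] by blast
  have "qfunctional (\<lambda>x. of_rat (g x))"
    using g(1) unfolding qfunctional_def Vector_Spaces.linear_iff by (auto simp: of_rat_add)
  moreover have "of_rat (g c) = (1 :: real)" using g(2) by simp
  ultimately show ?thesis by blast
qed

lemma lattice_basis:
  assumes "is_lattice L"
  obtains B where "independent B" "finite B" "span B = UNIV"
    "\<And>x. x \<in> L \<longleftrightarrow> (\<forall>b\<in>B. representation B x b \<in> \<int>)"
proof -
  obtain B where B: "independent B" "span B = UNIV"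
      "L = range (\<lambda>c :: complex^'a \<Rightarrow> int. \<Sum>b\<in>B. of_int (c b) *\<^sub>R b)"
    using assms unfolding is_lattice_def by blast
  have fin: "finite B" using B(1) by (rule finiteI_independent)
  have rep: "representation B (\<Sum>b\<in>B. r b *\<^sub>R b) b = r b" if "b \<in> B" for r b
  proof -
    have "representation B (\<Sum>b\<in>B. r b *\<^sub>R b) b = (\<Sum>b'\<in>B. r b' * representation B b' b)"
      using B by (simp add: representation_sum representation_scale)
    also have "\<dots> = (\<Sum>b'\<in>B. if b' = b then r b' else 0)"
      by (rule sum.cong) (auto simp: representation_basis[OF B(1)])
    also have "\<dots> = r b" using fin that by simp
    finally show ?thesis .
  qed
  have "x \<in> L \<longleftrightarrow> (\<forall>b\<in>B. representation B x b \<in> \<int>)" for x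
  proof
    assume "x \<in> L"
    then obtain c :: "complex^'a \<Rightarrow> int" where "x = (\<Sum>b\<in>B. of_int (c b) *\<^sub>R b)"
      using B(3) by blast
    thus "\<forall>b\<in>B. representation B x b \<in> \<int>" by (simp add: rep)
  next
    assume "\<forall>b\<in>B. representation B x b \<in> \<int>"
    hence fl: "representation B x b = of_int \<lfloor>representation B x b\<rfloor>" if "b \<in> B" for b
      using that by (auto elim!: Ints_cases)
    have "x = (\<Sum>b\<in>B. representation B x b *\<^sub>R b)"
      using B fin by (simp add: sum_representation_eq)
    also have "\<dots> = (\<Sum>b\<in>B. of_int \<lfloor>representation B x b\<rfloor> *\<^sub>R b)"
      by (rule sum.cong[OF refl], subst fl) auto
    finally have "x = (\<Sum>b\<in>B. of_int \<lfloor>representation B x b\<rfloor> *\<^sub>R b)" .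
    thus "x \<in> L" unfolding B(3) by (intro range_eqI[of _ _ "\<lambda>b. \<lfloor>representation B x b\<rfloor>"]) simp
  qed
  thus thesis using that B fin by blast
qed

context
  fixes L :: "(complex^'g::finite) set"
  assumes L: "is_lattice L"
begin

lemma lattice_add: "x \<in> L \<Longrightarrow> y \<in> L \<Longrightarrow> x + y \<in> L"
  and lattice_of_int: "x \<in> L \<Longrightarrow> of_int n *\<^sub>R x \<in> L"
  and lattice_0: "0 \<in> L"
proof -
  obtain B where B: "independent B" "finite B" "span B = UNIV"
    "\<And>x. x \<in> L \<longleftrightarrow> (\<forall>b\<in>B. representation B x b \<in> \<int>)"
    by (rule lattice_basis[OF L]) (rule that)
  show "x \<in> L \<Longrightarrow> y \<in> L \<Longrightarrow> x + y \<in> L"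
    using B by (simp add: representation_add)
  show "x \<in> L \<Longrightarrow> of_int n *\<^sub>R x \<in> L"
    using B by (simp add: representation_scale)
  show "0 \<in> L"
    using B by (simp add: representation_zero)
qed

lemma lattice_minus: "x \<in> L \<Longrightarrow> - x \<in> L"
  using lattice_of_int[of x "-1"] by simp

lemma lattice_diff: "x \<in> L \<Longrightarrow> y \<in> L \<Longrightarrow> x - y \<in> L"
  using lattice_add[of x "- y"] lattice_minus by simp

lemma lattice_sum: "(\<And>i. i \<in> A \<Longrightarrow> f i \<in> L) \<Longrightarrow> sum f A \<in> L"
  by (induction A rule: infinite_finite_induct) (auto intro: lattice_add lattice_0)

lemma lattice_span: "span L = UNIV"
proof -
  obtain B where B: "independent B" "finite B" "span B = UNIV"
    "\<And>x. x \<in> L \<longleftrightarrow> (\<forall>b\<in>B. representation B x b \<in> \<int>)"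
    by (rule lattice_basis[OF L]) (rule that)
  have "B \<subseteq> L"
    unfolding B(4) using representation_basis[OF B(1)] by (auto simp: B(4))
  thus ?thesis using span_mono[of B L] B(3) by auto
qed

lemma linear_eq_on_lattice:
  assumes "linear f" "linear g" "\<And>l. l \<in> L \<Longrightarrow> f l = g l"
  shows "f = g"
  using linear_eq_on_span[OF assms(1,2), of L] assms(3) lattice_span by auto

text \<open>The coordinates of the l i in a lattice basis are integers, and integers pass through
  the additive map \<pi>.\<close>

lemma lattice_qfunctional:
  fixes l :: "'i \<Rightarrow> complex^'g"
  assumes "qfunctional \<pi>" and "\<And>i. i \<in> I \<Longrightarrow> l i \<in> L" and "(\<Sum>i\<in>I. r i *\<^sub>R l i) = 0"
  shows "(\<Sum>i\<in>I. \<pi> (r i) *\<^sub>R l i) = 0"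
proof -
  obtain B where B: "independent B" "finite B" "span B = UNIV"
    "\<And>x. x \<in> L \<longleftrightarrow> (\<forall>b\<in>B. representation B x b \<in> \<int>)"
    by (rule lattice_basis[OF L]) (rule that)
  have rep: "representation B (\<Sum>i\<in>I. s i *\<^sub>R l i) b = (\<Sum>i\<in>I. s i * representation B (l i) b)" for s b
    using B by (simp add: representation_sum representation_scale)
  have "representation B (\<Sum>i\<in>I. \<pi> (r i) *\<^sub>R l i) b = 0" for b
  proof (cases "b \<in> B")
    case True
    have int: "\<exists>n. representation B (l i) b = of_int n" if "i \<in> I" for i
    proof -
      have "representation B (l i) b \<in> \<int>"
        using B(4)[of "l i"] assms(2)[OF that] True by blast
      thus ?thesis by (auto elim: Ints_cases)
    qed
    have "0 = \<pi> (\<Sum>i\<in>I. r i * representation B (l i) b)"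
      using rep[of r b] assms(3) qfunctional_0[OF assms(1)] by (simp add: representation_zero)
    also have "\<dots> = (\<Sum>i\<in>I. \<pi> (r i * representation B (l i) b))"
      by (rule qfunctional_sum[OF assms(1)])
    also have "\<dots> = (\<Sum>i\<in>I. \<pi> (r i) * representation B (l i) b)"
      using int qfunctional_of_int_mult[OF assms(1)] by (intro sum.cong) fastforce+
    finally show ?thesis unfolding rep by simp
  next
    case False
    thus ?thesis using representation_ne_zero by blast
  qed
  moreover have "(\<Sum>i\<in>I. \<pi> (r i) *\<^sub>R l i) = (\<Sum>b\<in>B. representation B (\<Sum>i\<in>I. \<pi> (r i) *\<^sub>R l i) b *\<^sub>R b)"
    using B by (simp add: sum_representation_eq)
  ultimately show ?thesis by simp
qed

lemma lattice_bounded_finite: "finite (L \<inter> cball 0 R)"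
proof -
  obtain B where B: "independent B" "finite B" "span B = UNIV"
    "\<And>x. x \<in> L \<longleftrightarrow> (\<forall>b\<in>B. representation B x b \<in> \<int>)"
    by (rule lattice_basis[OF L]) (rule that)
  have "linear (\<lambda>x. representation B x b)" for b
    using B by (intro linearI) (simp_all add: representation_add representation_scale)
  hence "\<exists>K>0. \<forall>x. norm (representation B x b) \<le> K * norm x" for b
    using linear_bounded_pos by blast
  then obtain K where K: "\<And>b. K b > 0" "\<And>b x. \<bar>representation B x b\<bar> \<le> K b * norm x"
    unfolding real_norm_def by metis
  let ?S = "\<lambda>b. {x \<in> \<int>. \<bar>x\<bar> \<le> K b * \<bar>R\<bar>}"
  have "inj_on (\<lambda>x. restrict (representation B x) B) UNIV"
  proof (rule inj_onI)
    fix x y assume eq: "restrict (representation B x) B = restrict (representation B y) B"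
    have "representation B x b = representation B y b" if "b \<in> B" for b
      using fun_cong[OF eq, of b] that by simp
    hence "(\<Sum>b\<in>B. representation B x b *\<^sub>R b) = (\<Sum>b\<in>B. representation B y b *\<^sub>R b)"
      by simp
    thus "x = y" using B by (simp add: sum_representation_eq)
  qed
  moreover have "(\<lambda>x. restrict (representation B x) B) ` (L \<inter> cball 0 R) \<subseteq> (\<Pi>\<^sub>E b\<in>B. ?S b)"
  proof -
    have "\<bar>representation B x b\<bar> \<le> K b * \<bar>R\<bar>" if "norm x \<le> R" for x b
      using K(2)[of x b] K(1)[of b] that by (smt (verit) mult_left_mono)
    thus ?thesis using B(4) by (auto simp: PiE_iff)
  qed
  moreover have "finite (?S b)" for b
    by (rule finite_abs_int_segment[of "K b * \<bar>R\<bar>", THEN rev_finite_subset]) auto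
  hence "finite (\<Pi>\<^sub>E b\<in>B. ?S b)" using B(2) by (intro finite_PiE)
  ultimately show ?thesis
    by (meson finite_imageD finite_subset inj_on_subset subset_UNIV)
qed

lemma lattice_discrete: "\<exists>e>0. \<forall>l\<in>L. norm l < e \<longrightarrow> l = 0"
proof -
  let ?F = "norm ` (L \<inter> cball 0 1 - {0})"
  have fin: "finite ?F" using lattice_bounded_finite by blast
  define e where "e = Min (insert 1 ?F)"
  have "e > 0" unfolding e_def using fin by (subst Min_gr_iff) auto
  moreover have "l = 0" if "l \<in> L" "norm l < e" for l
  proof (rule ccontr)
    assume "l \<noteq> 0"
    have "e \<le> 1" unfolding e_def using fin by (intro Min_le) auto
    hence "norm l \<in> ?F" using that \<open>l \<noteq> 0\<close> by auto
    hence "e \<le> norm l" unfolding e_def using fin by (intro Min_le) auto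
    thus False using that by simp
  qed
  ultimately show ?thesis by blast
qed

text \<open>By discreteness a sequence of lattice vectors that tends to 0 reaches 0.\<close>

lemma lattice_contract_eq_0:
  assumes "\<bar>c\<bar> < 1" and "\<And>k. (c ^ k) *\<^sub>R l \<in> L"
  shows "c = 0 \<or> l = 0"
proof (rule ccontr)
  assume "\<not> (c = 0 \<or> l = 0)"
  obtain e where e: "e > 0" "\<forall>l\<in>L. norm l < e \<longrightarrow> l = 0"
    using lattice_discrete by blast
  have "(\<lambda>k. c ^ k * norm l) \<longlonglongrightarrow> 0 * norm l"
    using assms(1) by (intro tendsto_mult tendsto_const LIMSEQ_power_zero) auto
  from tendstoD[OF this e(1)] have "\<forall>\<^sub>F k in sequentially. \<bar>c ^ k * norm l\<bar> < e"
    by simp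
  then obtain k where "\<bar>c ^ k * norm l\<bar> < e" by (auto simp: eventually_sequentially)
  hence "norm ((c ^ k) *\<^sub>R l) < e" by (simp add: abs_mult)
  hence "(c ^ k) *\<^sub>R l = 0" using e(2) assms(2) by blast
  thus False using \<open>\<not> (c = 0 \<or> l = 0)\<close> by simp
qed

lemma lattice_rational_scale:
  assumes "l \<in> L" "l \<noteq> 0" "s *\<^sub>R l \<in> L"
  shows "s \<in> \<rat>"
proof -
  obtain B where B: "independent B" "finite B" "span B = UNIV"
    "\<And>x. x \<in> L \<longleftrightarrow> (\<forall>b\<in>B. representation B x b \<in> \<int>)"
    by (rule lattice_basis[OF L]) (rule that)
  have "l = (\<Sum>b\<in>B. representation B l b *\<^sub>R b)"
    using B by (simp add: sum_representation_eq)
  then obtain b where b: "b \<in> B" "representation B l b \<noteq> 0"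
    using assms(2) by (metis (mono_tags, lifting) scaleR_eq_0_iff sum.neutral)
  have "representation B l b \<in> \<rat>" "s * representation B l b \<in> \<rat>"
    using B assms b(1) Ints_subset_Rats by (auto simp: representation_scale)
  hence "(s * representation B l b) / representation B l b \<in> \<rat>"
    by (rule Rats_divide[rotated])
  thus ?thesis using b(2) by simp
qed

text \<open>Needed for the Baire argument on deformations. A map preserving L is determined by the
  images of a basis, and these lie in the countable set L.\<close>

lemma countable_lattice_maps: "countable {f. linear f \<and> f ` L \<subseteq> L}"
proof -
  obtain B where B: "independent B" "finite B" "span B = UNIV"
    "\<And>x. x \<in> L \<longleftrightarrow> (\<forall>b\<in>B. representation B x b \<in> \<int>)"
    by (rule lattice_basis[OF L]) (rule that)
  have BL: "B \<subseteq> L"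
    using representation_basis[OF B(1)] by (auto simp: B(4))
  have "L = (\<Union>n::nat. L \<inter> cball 0 (of_nat n))"
    using real_arch_simple by fastforce
  moreover have "countable (\<Union>n::nat. L \<inter> cball 0 (of_nat n))"
    by (rule countable_UN) (simp_all add: countable_finite lattice_bounded_finite)
  ultimately have "countable L" by (rule ssubst)
  hence 1: "countable (\<Pi>\<^sub>E b\<in>B. L)" using B(2) by (intro countable_PiE) auto
  have 2: "(\<lambda>f. restrict f B) ` {f. linear f \<and> f ` L \<subseteq> L} \<subseteq> (\<Pi>\<^sub>E b\<in>B. L)"
    using BL by (auto simp: image_subset_iff subset_iff)
  have 3: "inj_on (\<lambda>f. restrict f B) {f. linear f \<and> f ` L \<subseteq> L}"
  proof (rule inj_onI)
    fix f g assume fg: "f \<in> {f. linear f \<and> f ` L \<subseteq> L}" "g \<in> {f. linear f \<and> f ` L \<subseteq> L}"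
      "restrict f B = restrict g B"
    have "f b = g b" if "b \<in> B" for b using fun_cong[OF fg(3), of b] that by simp
    thus "f = g" using linear_eq_on_span[of f g B] fg B(3) by auto
  qed
  show ?thesis by (rule countable_image_inj_on[OF countable_subset[OF 2 1] 3])
qed

end

lemma is_lattice_image:
  fixes f :: "complex^'g::finite \<Rightarrow> complex^'g"
  assumes "is_lattice L" "linear f" "bij f"
  shows "is_lattice (f ` L)"
proof -
  obtain B where B: "independent B" "span B = UNIV"
      "L = range (\<lambda>c :: complex^'g \<Rightarrow> int. \<Sum>b\<in>B. of_int (c b) *\<^sub>R b)"
    using assms(1) unfolding is_lattice_def by blast
  have inj: "inj f" using assms(3) by (rule bij_is_inj)
  have "independent (f ` B)"
    by (rule linear_independent_injective_image[OF assms(2) B(1) inj_on_subset[OF inj]]) simp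
  moreover have "span (f ` B) = UNIV"
    using linear_span_image[OF assms(2), of B] B(2) assms(3) by (simp add: bij_is_surj)
  moreover have "f ` L = range (\<lambda>c :: complex^'g \<Rightarrow> int. \<Sum>b\<in>f ` B. of_int (c b) *\<^sub>R b)"
  proof -
    have fsum: "f (\<Sum>b\<in>B. of_int (c b) *\<^sub>R b) = (\<Sum>b\<in>f ` B. of_int (c (inv_into UNIV f b)) *\<^sub>R b)" for c :: "complex^'g \<Rightarrow> int"
      using inj by (simp add: linear_sum[OF assms(2)] linear_scale[OF assms(2)] sum.reindex inj_on_subset)
    have "f ` L = range (\<lambda>c :: complex^'g \<Rightarrow> int. \<Sum>b\<in>f ` B. of_int ((c \<circ> inv_into UNIV f) b) *\<^sub>R b)"
      unfolding B(3) image_image fsum by simp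
    also have "\<dots> = (\<lambda>c. \<Sum>b\<in>f ` B. of_int (c b) *\<^sub>R b) ` range (\<lambda>c :: complex^'g \<Rightarrow> int. c \<circ> inv_into UNIV f)"
      by (simp only: image_image)
    also have "range (\<lambda>c :: complex^'g \<Rightarrow> int. c \<circ> inv_into UNIV f) = UNIV"
    proof (rule surjI)
      show "(c \<circ> f) \<circ> inv_into UNIV f = c" for c :: "complex^'g \<Rightarrow> int"
        using assms(3) by (simp add: fun_eq_iff bij_is_surj surj_f_inv_f)
    qed
    finally show ?thesis .
  qed
  ultimately show ?thesis unfolding is_lattice_def by blast
qed

section \<open>The rank of the endomorphism ring\<close>

lemma common_denominator:
  assumes "finite A" "\<And>a. a \<in> A \<Longrightarrow> q a \<in> \<rat>"
  shows "\<exists>D::int. D > 0 \<and> (\<forall>a\<in>A. of_int D * (q a :: real) \<in> \<int>)"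
  using assms
proof (induction A rule: finite_induct)
  case empty
  show ?case by (intro exI[of _ 1]) simp
next
  case (insert x A)
  then obtain D :: int where D: "D > 0" "\<forall>a\<in>A. of_int D * q a \<in> \<int>" by auto
  obtain m n where mn: "n > 0" "q x = of_int m / of_int n"
    using insert.prems[of x] by (auto elim!: Rats_cases')
  have 1: "of_int (D * n) * q x = of_int (D * m)"
    using mn by simp
  have 2: "of_int (D * n) * q a = of_int n * (of_int D * q a)" for a by simp
  have "of_int (D * n) * q a \<in> \<int>" if "a \<in> insert x A" for a
  proof (cases "a = x")
    case True
    show ?thesis unfolding True 1 by simp
  next
    case False
    show ?thesis unfolding 2 by (rule Ints_mult[OF Ints_of_int]) (use that D False in auto)
  qed
  thus ?case using D mn by (intro exI[of _ "D * n"]) simp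
qed

definition int_independent :: "(complex^'g \<Rightarrow> complex^'g) set \<Rightarrow> bool"
  where "int_independent B \<longleftrightarrow> (\<forall>c :: (complex^'g \<Rightarrow> complex^'g) \<Rightarrow> int.
    (\<forall>x. (\<Sum>f\<in>B. of_int (c f) *\<^sub>R f x) = 0) \<longrightarrow> (\<forall>f\<in>B. c f = 0))"

lemma End_rank_def': "End_rank L = Sup {card B | B. finite B \<and> B \<subseteq> torus_End L \<and> int_independent B}"
  by (simp add: End_rank_def int_independent_def)

text \<open>From a real relation with nonzero coefficient at f, a functional \<pi> with \<pi> (r f)
  = 1 and a common denominator produce an integer relation with nonzero coefficient at f. Hence the
  rank of the endomorphism ring can be bounded by real dimensions.\<close>

lemma int_independent_imp_real:
  fixes B :: "(complex^'g::finite \<Rightarrow> complex^'g) set"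
  assumes L: "is_lattice L" and B: "finite B" "B \<subseteq> torus_End L" "int_independent B"
    and rel: "\<And>x. (\<Sum>f\<in>B. r f *\<^sub>R f x) = 0" and f: "f \<in> B"
  shows "r f = 0"
proof (rule ccontr)
  assume "r f \<noteq> 0"
  then obtain \<pi> where \<pi>: "qfunctional \<pi>" "\<pi> (r f) = 1"
    using qfunctional_exists by blast
  have Q: "\<pi> (r f) \<in> \<rat>" for f using \<pi>(1) by (auto simp: qfunctional_def)
  have lin: "linear g" if "g \<in> B" for g
    using B(2) that clinear_imp_linear by (auto simp: torus_End_def)
  have rel': "(\<Sum>g\<in>B. \<pi> (r g) *\<^sub>R g l) = 0" if "l \<in> L" for l
    by (rule lattice_qfunctional[OF L \<pi>(1) _ rel]) (use that B(2) in \<open>auto simp: torus_End_def\<close>)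
  obtain D :: int where D: "D > 0" "\<forall>g\<in>B. of_int D * \<pi> (r g) \<in> \<int>"
    using common_denominator[of B "\<lambda>g. \<pi> (r g)"] B(1) Q by blast
  define c where "c g = \<lfloor>of_int D * \<pi> (r g)\<rfloor>" for g
  have c: "of_int (c g) = of_int D * \<pi> (r g)" if "g \<in> B" for g
    using D(2) that by (auto simp: c_def elim!: Ints_cases)
  have "(\<lambda>x. \<Sum>g\<in>B. of_int (c g) *\<^sub>R g x) = (\<lambda>x. 0)"
  proof (rule linear_eq_on_lattice[OF L])
    show "linear (\<lambda>x. \<Sum>g\<in>B. of_int (c g) *\<^sub>R g x)"
      using lin by (intro linear_compose_sum ballI linear_compose_scale_right)
    show "linear (\<lambda>x::complex^'g. 0 :: complex^'g)" by (rule linear_zero)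
    fix l assume "l \<in> L"
    have "(\<Sum>g\<in>B. of_int (c g) *\<^sub>R g l) = of_int D *\<^sub>R (\<Sum>g\<in>B. \<pi> (r g) *\<^sub>R g l)"
      by (simp add: c scaleR_sum_right)
    thus "(\<Sum>g\<in>B. of_int (c g) *\<^sub>R g l) = 0"
      using rel'[OF \<open>l \<in> L\<close>] by simp
  qed
  hence "c f = 0"
    using B(3) f unfolding int_independent_def by (simp add: fun_eq_iff)
  thus False using c[OF f] \<pi>(2) D(1) by simp
qed

lemma independent_matrix_image:
  fixes B :: "(complex^'g::finite \<Rightarrow> complex^'g) set"
  assumes L: "is_lattice L" and B: "finite B" "B \<subseteq> torus_End L" "int_independent B"
  shows "independent (matrix ` B)" and "card (matrix ` B) = card B"
proof -
  have works: "matrix f *v x = f x" if "f \<in> B" for f x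
    using B(2) that matrix_works by (auto simp: torus_End_def)
  have inj: "inj_on matrix B"
    by (rule inj_onI) (metis works ext)
  thus "card (matrix ` B) = card B" by (rule card_image)
  show "independent (matrix ` B)"
    unfolding dependent_finite[OF finite_imageI[OF B(1)]]
  proof (safe, goal_cases)
    case (1 u f)
    have "(\<Sum>g\<in>B. u (matrix g) *\<^sub>R g x) = 0" for x
    proof -
      have "0 = (\<Sum>v\<in>matrix ` B. u v *\<^sub>R v) *v x" using 1 by simp
      also have "\<dots> = (\<Sum>g\<in>B. u (matrix g) *\<^sub>R matrix g) *v x"
        using inj by (simp add: sum.reindex)
      also have "\<dots> = (\<Sum>g\<in>B. (u (matrix g) *\<^sub>R matrix g) *v x)"
        by (induction B rule: infinite_finite_induct) (simp_all add: matrix_vector_mult_add_rdistrib)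
      also have "\<dots> = (\<Sum>g\<in>B. u (matrix g) *\<^sub>R g x)"
        by (rule sum.cong) (simp_all add: works[symmetric] vec_eq_iff matrix_vector_mult_def scaleR_sum_right)
      finally show ?thesis by simp
    qed
    from int_independent_imp_real[OF L B this] 1 show False by blast
  qed
qed

lemma card_le_of_real_span:
  fixes B :: "(complex^'g::finite \<Rightarrow> complex^'g) set"
  assumes L: "is_lattice L" and B: "finite B" "B \<subseteq> torus_End L" "int_independent B"
    and g: "\<And>i. i < n \<Longrightarrow> clinear (g i)"
    and span: "\<And>f. f \<in> B \<Longrightarrow> \<exists>c :: nat \<Rightarrow> real. \<forall>x. f x = (\<Sum>i<n. c i *\<^sub>R g i x)"
  shows "card B \<le> n"
proof -
  have "matrix ` B \<subseteq> span ((\<lambda>i. matrix (g i)) ` {..<n})"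
  proof safe
    fix f assume f: "f \<in> B"
    then obtain c :: "nat \<Rightarrow> real" where c: "\<And>x. f x = (\<Sum>i<n. c i *\<^sub>R g i x)"
      using span by blast
    have "matrix f = (\<Sum>i<n. c i *\<^sub>R matrix (g i))"
      by (simp add: vec_eq_iff matrix_def c)
    also have "\<dots> \<in> span ((\<lambda>i. matrix (g i)) ` {..<n})"
      by (intro span_sum span_scale span_base) auto
    finally show "matrix f \<in> span ((\<lambda>i. matrix (g i)) ` {..<n})" .
  qed
  hence "card (matrix ` B) \<le> card ((\<lambda>i. matrix (g i)) ` {..<n})"
    using independent_span_bound[of "(\<lambda>i. matrix (g i)) ` {..<n}" "matrix ` B"]
      independent_matrix_image(1)[OF L B] by auto
  also have "\<dots> \<le> n"
    using card_image_le[of "{..<n}" "\<lambda>i. matrix (g i)"] by simp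
  finally show ?thesis
    unfolding independent_matrix_image(2)[OF L B] .
qed

text \<open>The content is boundedness: a supremum of naturals is informative only for bounded sets.
  The bound is the real dimension of the space of matrices.\<close>

lemma card_le_End_rank:
  fixes B :: "(complex^'g::finite \<Rightarrow> complex^'g) set"
  assumes L: "is_lattice L" and B: "finite B" "B \<subseteq> torus_End L" "int_independent B"
  shows "card B \<le> End_rank L"
  unfolding End_rank_def'
proof (rule cSup_upper)
  have "card C \<le> DIM(complex^'g^'g)" if C: "finite C" "C \<subseteq> torus_End L" "int_independent C" for C :: "(complex^'g \<Rightarrow> complex^'g) set"
    using independent_bound[OF independent_matrix_image(1)[OF L C]] independent_matrix_image(2)[OF L C] by simp
  thus "bdd_above {card B |B. finite B \<and> B \<subseteq> torus_End L \<and> int_independent B}"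
    unfolding bdd_above_def by blast
qed (use B in blast)

lemma End_rank_le:
  assumes "\<And>B. finite B \<Longrightarrow> B \<subseteq> torus_End L \<Longrightarrow> int_independent B \<Longrightarrow> card B \<le> n"
  shows "End_rank L \<le> n"
  unfolding End_rank_def'
proof (rule cSup_least)
  show "{card B |B. finite B \<and> B \<subseteq> torus_End L \<and> int_independent B} \<noteq> {}"
    by (auto intro!: exI[of _ "{}"] simp: int_independent_def)
qed (use assms in blast)

lemma same_End_rank_le:
  assumes "same_End X Y" and Y: "is_lattice (fst Y)"
  shows "End_rank (fst X) \<le> End_rank (fst Y)"
proof (rule End_rank_le)
  obtain \<alpha> where \<alpha>: "linear \<alpha>" "bij \<alpha>"
      "(\<lambda>f. \<alpha> \<circ> f \<circ> inv_into UNIV \<alpha>) ` torus_End (fst X) = torus_End (fst Y)"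
    using assms(1) unfolding same_End_def by blast
  define g where "g f = \<alpha> \<circ> f \<circ> inv_into UNIV \<alpha>" for f
  have inv: "inv_into UNIV \<alpha> (\<alpha> x) = x" "\<alpha> (inv_into UNIV \<alpha> x) = x" for x
    using \<alpha>(2) by (simp_all add: bij_is_inj inv_f_f bij_is_surj surj_f_inv_f)
  have "inj g"
  proof (rule injI, rule ext)
    fix f f' x assume "g f = g f'"
    from fun_cong[OF this, of "\<alpha> x"] have "\<alpha> (f x) = \<alpha> (f' x)" by (simp add: g_def inv)
    thus "f x = f' x" by (rule injD[OF bij_is_inj[OF \<alpha>(2)]])
  qed
  fix B assume B: "finite B" "B \<subseteq> torus_End (fst X)" "int_independent B"
  have "int_independent (g ` B)"
    unfolding int_independent_def
  proof (intro allI impI, safe)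
    fix c :: "(complex^'a \<Rightarrow> complex^'a) \<Rightarrow> int" and f
    assume c: "\<forall>x. (\<Sum>f\<in>g ` B. of_int (c f) *\<^sub>R f x) = 0" and "f \<in> B"
    have "(\<Sum>f\<in>B. of_int (c (g f)) *\<^sub>R f x) = 0" for x
    proof -
      have "\<alpha> (\<Sum>f\<in>B. of_int (c (g f)) *\<^sub>R f x) = (\<Sum>f\<in>B. of_int (c (g f)) *\<^sub>R g f (\<alpha> x))"
        by (simp add: linear_sum[OF \<alpha>(1)] linear_scale[OF \<alpha>(1)] g_def inv)
      also have "\<dots> = (\<Sum>f\<in>g ` B. of_int (c f) *\<^sub>R f (\<alpha> x))"
        using \<open>inj g\<close> by (simp add: sum.reindex inj_on_subset)
      also have "\<dots> = \<alpha> 0" using c linear_0[OF \<alpha>(1)] by simp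
      finally show ?thesis by (rule injD[OF bij_is_inj[OF \<alpha>(2)]])
    qed
    thus "c (g f) = 0"
      using B(3)[unfolded int_independent_def, rule_format, of "\<lambda>f. c (g f)"] \<open>f \<in> B\<close> by blast
  qed
  moreover have "g ` B \<subseteq> torus_End (fst Y)"
    using B(2) \<alpha>(3) unfolding g_def by blast
  ultimately have "card (g ` B) \<le> End_rank (fst Y)"
    using B(1) by (intro card_le_End_rank[OF Y]) auto
  moreover have "card (g ` B) = card B"
    by (rule card_image[OF inj_on_subset[OF \<open>inj g\<close>]]) simp
  ultimately show "card B \<le> End_rank (fst Y)" by simp
qed

section \<open>Polynomials in an automorphism\<close>

text \<open>The operator q(\<sigma>), by Horner's scheme; it makes V a module over Z[X] with X
  acting as \<sigma>.\<close>

definition pact :: "(complex^'g \<Rightarrow> complex^'g) \<Rightarrow> int poly \<Rightarrow> complex^'g \<Rightarrow> complex^'g"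
  where "pact \<sigma> q = fold_coeffs (\<lambda>a g v. of_int a *\<^sub>R v + \<sigma> (g v)) q (\<lambda>v. 0)"

context
  fixes \<sigma> :: "complex^'g::finite \<Rightarrow> complex^'g"
  assumes \<sigma>: "clinear \<sigma>"
begin

lemma pact_0 [simp]: "pact \<sigma> 0 v = 0"
  by (simp add: pact_def)

lemma pact_pCons: "pact \<sigma> (pCons a q) v = of_int a *\<^sub>R v + \<sigma> (pact \<sigma> q v)"
  using linear_0[OF clinear_imp_linear[OF \<sigma>]]
  by (cases "a = 0 \<and> q = 0") (auto simp: pact_def)

lemma pact_const: "pact \<sigma> [:a:] v = of_int a *\<^sub>R v"
  using linear_0[OF clinear_imp_linear[OF \<sigma>]] by (simp add: pact_pCons)

lemma pact_1 [simp]: "pact \<sigma> 1 v = v"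
  by (simp add: one_pCons pact_const)

lemma pact_of_int [simp]: "pact \<sigma> (of_int a) v = of_int a *\<^sub>R v"
  by (simp add: of_int_poly pact_const)

lemma pact_clinear: "clinear (pact \<sigma> q)"
proof (induction q)
  case (pCons a q)
  thus ?case
    unfolding clinear_iff
    by (simp add: pact_pCons clinear_add[OF \<sigma>] clinear_scale[OF \<sigma>] scaleR_eq_scale vec.scale_right_distrib
        vec.scale_scale mult.commute)
qed (simp add: clinear_iff)

lemmas pact_linear = clinear_imp_linear[OF pact_clinear]

lemma pact_add: "pact \<sigma> (q + r) v = pact \<sigma> q v + pact \<sigma> r v"
proof (induction q arbitrary: r)
  case (pCons a q)
  obtain b r' where "r = pCons b r'" by (rule pCons_cases)
  thus ?case
    by (simp add: pact_pCons pCons.IH clinear_add[OF \<sigma>] scaleR_left_distrib)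
qed simp

lemma pact_uminus: "pact \<sigma> (- q) v = - pact \<sigma> q v"
proof -
  have "pact \<sigma> (- q) v + pact \<sigma> q v = 0" by (simp flip: pact_add)
  thus ?thesis by (simp add: eq_neg_iff_add_eq_0)
qed

lemma pact_diff: "pact \<sigma> (q - r) v = pact \<sigma> q v - pact \<sigma> r v"
  using pact_add[of q "- r" v] by (simp add: pact_uminus)

lemma pact_sum: "pact \<sigma> (sum f A) v = (\<Sum>i\<in>A. pact \<sigma> (f i) v)"
  by (induction A rule: infinite_finite_induct) (simp_all add: pact_add)

lemma pact_commute:
  assumes "linear g" "\<And>v. g (\<sigma> v) = \<sigma> (g v)"
  shows "g (pact \<sigma> q v) = pact \<sigma> q (g v)"
  by (induction q) (simp_all add: pact_pCons linear_add[OF assms(1)] linear_scale[OF assms(1)]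
      linear_0[OF assms(1)] assms(2))

lemma pact_smult: "pact \<sigma> (smult a q) v = of_int a *\<^sub>R pact \<sigma> q v"
  by (induction q) (simp_all add: pact_pCons linear_scale[OF clinear_imp_linear[OF \<sigma>]] scaleR_right_distrib)

lemma pact_mult: "pact \<sigma> (q * r) v = pact \<sigma> q (pact \<sigma> r v)"
  by (induction q) (simp_all add: pact_pCons pact_add pact_smult)

lemma pact_monom: "pact \<sigma> (monom a k) v = of_int a *\<^sub>R (\<sigma> ^^ k) v"
  by (induction k) (simp_all add: monom_0 monom_Suc pact_pCons linear_scale[OF clinear_imp_linear[OF \<sigma>]]
      linear_0[OF clinear_imp_linear[OF \<sigma>]])

lemma pact_eigen: "\<sigma> v = z *s v \<Longrightarrow> pact \<sigma> q v = ev q z *s v"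
  by (induction q) (simp_all add: pact_pCons clinear_scale[OF \<sigma>] scaleR_eq_scale vec.scale_left_distrib mult.commute)

lemma pact_lattice: "is_lattice L \<Longrightarrow> \<sigma> ` L \<subseteq> L \<Longrightarrow> v \<in> L \<Longrightarrow> pact \<sigma> q v \<in> L"
  by (induction q) (auto simp: pact_pCons lattice_0 intro!: lattice_add lattice_of_int)

lemma funpow_clinear: "clinear (\<sigma> ^^ k)"
  by (induction k) (auto simp: clinear_iff clinear_add[OF \<sigma>] clinear_scale[OF \<sigma>])

end

section \<open>Automorphisms of prime order\<close>

context
  fixes H :: "('g::finite) hform"
  assumes H: "pos_def_hermitian H"
begin

lemma herm_add_left: "H (x + y) z = H x z + H y z"
  and herm_scale_left: "H (c *s x) z = c * H x z"
  and herm_cnj: "H y x = cnj (H x y)"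
  and herm_pos: "x \<noteq> 0 \<Longrightarrow> 0 < Re (H x x)"
  using H unfolding pos_def_hermitian_def Vector_Spaces.linear_iff by blast+

lemma herm_add_right: "H x (y + z) = H x y + H x z"
  using herm_cnj[of x "y + z"] herm_cnj[of x y] herm_cnj[of x z] by (simp add: herm_add_left)

lemma herm_scale_right: "H x (c *s y) = cnj c * H x y"
  using herm_cnj[of x "c *s y"] herm_cnj[of x y] by (simp add: herm_scale_left)

lemma herm_0_left [simp]: "H 0 z = 0"
  using herm_scale_left[of 0 0 z] by simp

lemma herm_0_right [simp]: "H z 0 = 0"
  using herm_scale_right[of z 0 0] by simp

lemma herm_minus_left: "H (- x) z = - H x z"
  using herm_add_left[of x "- x" z] by (simp add: eq_neg_iff_add_eq_0 add.commute)

lemma herm_diff_left: "H (x - y) z = H x z - H y z"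
  using herm_add_left[of x "- y" z] by (simp add: herm_minus_left)

lemma herm_scaleR_left: "H (r *\<^sub>R x) z = of_real r * H x z"
  by (simp add: scaleR_eq_scale herm_scale_left)

lemma herm_scaleR_right: "H x (r *\<^sub>R z) = of_real r * H x z"
  by (simp add: scaleR_eq_scale herm_scale_right)

lemma herm_sum_left: "H (sum f A) z = (\<Sum>i\<in>A. H (f i) z)"
  by (induction A rule: infinite_finite_induct) (simp_all add: herm_add_left)

lemma herm_sum_right: "H z (sum f A) = (\<Sum>i\<in>A. H z (f i))"
  by (induction A rule: infinite_finite_induct) (simp_all add: herm_add_right)

lemma herm_self_real: "H x x = of_real (Re (H x x))"
  using herm_cnj[of x x] by (simp add: complex_eq_iff)

lemma herm_self_eq_0: "H x x = 0 \<longleftrightarrow> x = 0"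
  using herm_pos[of x] by (cases "x = 0") auto

lemma herm_eqI: "(\<And>z. H x z = H y z) \<Longrightarrow> x = y"
  using herm_self_eq_0[of "x - y"] by (simp add: herm_diff_left)

end

lemma (in prime_root) w_power_inverse: "k \<le> p \<Longrightarrow> w ^ (p - k) = inverse w ^ k"
proof -
  assume "k \<le> p"
  hence "k + (p - k) = p" by simp
  hence "w ^ k * w ^ (p - k) = 1" by (simp only: w_pow flip: power_add)
  from inverse_unique[OF this] show ?thesis by (simp add: power_inverse)
qed

text \<open>Coordinatewise, 2 Re (w^k) = w^k + w^(-k) turns the real relation into an integer
  relation between powers of w with coefficients n_k + n_(p - k). These are all equal, and comparing
  the indices 0 and 1 gives the claim: on the cycle of length p, the second difference of l at 0
  vanishes.\<close>

lemma (in prime_root) lattice_cos_relation: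
  fixes l :: "nat \<Rightarrow> complex^'g::finite"
  assumes L: "is_lattice L" and l: "\<And>k. k < p \<Longrightarrow> l k \<in> L"
    and rel: "(\<Sum>k<p. (2 * Re (w ^ k)) *\<^sub>R l k) = 0"
  shows "l 1 + l (p - 1) = 2 *\<^sub>R l 0"
proof -
  obtain B where B: "independent B" "finite B" "span B = UNIV"
    "\<And>x. x \<in> L \<longleftrightarrow> (\<forall>b\<in>B. representation B x b \<in> \<int>)"
    by (rule lattice_basis[OF L]) (rule that)
  have "representation B (l 1 + l (p - 1)) b = representation B (2 *\<^sub>R l 0) b" if b: "b \<in> B" for b
  proof -
    have "\<exists>n. representation B (l k) b = of_int n" if "k < p" for k
    proof -
      have "representation B (l k) b \<in> \<int>" using B(4)[of "l k"] l[OF that] b by blast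
      thus ?thesis by (auto elim: Ints_cases)
    qed
    then obtain n where n: "\<And>k. k < p \<Longrightarrow> representation B (l k) b = of_int (n k)"
      by metis
    let ?r = "\<lambda>k. (p - k) mod p"
    have r: "?r k < p" "?r (?r k) = k" if "k < p" for k
    proof -
      show "?r k < p" using p_gt_1 by simp
      show "?r (?r k) = k" using that p_gt_1 by (cases "k = 0") auto
    qed
    have wr: "cnj (w ^ k) = w ^ ?r k" if "k < p" for k
      using that by (simp add: w_power_mod w_power_inverse cnj_w)
    have "(\<Sum>k<p. of_int (n k) * (2 * Re (w ^ k))) = representation B (\<Sum>k<p. (2 * Re (w ^ k)) *\<^sub>R l k) b"
      using B n by (simp add: representation_sum representation_scale mult.commute)
    also have "\<dots> = 0" unfolding rel by (simp add: representation_zero)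
    finally have "of_real (\<Sum>k<p. of_int (n k) * (2 * Re (w ^ k))) = (of_real 0 :: complex)"
      by (rule arg_cong)
    hence "0 = (\<Sum>k<p. of_int (n k) * (w ^ k + cnj (w ^ k)))"
      unfolding complex_add_cnj by simp
    also have "\<dots> = (\<Sum>k<p. of_int (n k) * w ^ k) + (\<Sum>k<p. of_int (n k) * cnj (w ^ k))"
      by (simp only: sum.distrib distrib_left)
    also have "(\<Sum>k<p. of_int (n k) * cnj (w ^ k)) = (\<Sum>k<p. of_int (n k) * w ^ ?r k)"
      by (rule sum.cong) (simp_all only: lessThan_iff wr)
    also have "\<dots> = (\<Sum>k<p. of_int (n (?r k)) * w ^ k)"
      by (rule sum.reindex_bij_witness[of _ ?r ?r]) (simp_all add: r)
    also have "(\<Sum>k<p. of_int (n k) * w ^ k) + (\<Sum>k<p. of_int (n (?r k)) * w ^ k) =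
        (\<Sum>k<p. of_int (n k + n (?r k)) * w ^ k)"
      by (simp add: sum.distrib distrib_right)
    finally have *: "(\<Sum>k<p. of_int (n k + n (?r k)) * w ^ k) = 0" by simp
    have "n 1 + n (?r 1) = n 0 + n (?r 0)"
      using power_sum_eq_0_imp[OF *, of 1] power_sum_eq_0_imp[OF *, of 0] p_gt_1 by simp
    hence "n 1 + n (p - 1) = 2 * n 0" using p_gt_1 by simp
    hence "real_of_int (n 1 + n (p - 1)) = of_int (2 * n 0)" by simp
    thus ?thesis using B p_gt_1 by (simp add: representation_add representation_scale n)
  qed
  hence "(\<Sum>b\<in>B. representation B (l 1 + l (p - 1)) b *\<^sub>R b) = (\<Sum>b\<in>B. representation B (2 *\<^sub>R l 0) b *\<^sub>R b)"
    by (intro sum.cong) auto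
  thus ?thesis using B by (simp add: sum_representation_eq)
qed

section \<open>Eigenspaces of the automorphism and Galois conjugation\<close>

locale ppav_aut = prime_root p w
  for p w +
  fixes L :: "(complex^'g::finite) set" and H :: "'g hform" and \<sigma> :: "complex^'g \<Rightarrow> complex^'g"
  assumes ppav: "is_ppav (L, H)" and aut: "\<sigma> \<in> ppav_Aut (L, H)"
    and ord: "\<And>k. \<sigma> ^^ k = id \<longleftrightarrow> p dvd k"
begin

lemma lat: "is_lattice L"
  and herm: "pos_def_hermitian H"
  and unimodular: "{x. \<forall>l\<in>L. Im (H x l) \<in> \<int>} = L"
  using ppav by (simp_all add: is_ppav_def principal_polarization_def)

lemma s_clinear: "clinear \<sigma>"
  and s_bij: "bij \<sigma>"
  and s_image: "\<sigma> ` L = L"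
  and s_iso: "H (\<sigma> x) (\<sigma> y) = H x y"
  using aut by (auto simp: ppav_Aut_def torus_Aut_def pullback_def fun_eq_iff)

lemmas s_linear = clinear_imp_linear[OF s_clinear]

lemma s_lattice: "\<sigma> ` L \<subseteq> L"
  using s_image by simp

lemma s_pow: "(\<sigma> ^^ p) v = v"
  using ord[of p] by simp

lemma s_ne_id: "\<sigma> \<noteq> id"
  using ord[of 1] p_gt_1 by auto

definition eig :: "nat \<Rightarrow> (complex^'g) set"
  where "eig j = {v. \<sigma> v = w ^ j *s v}"

lemma eigD: "v \<in> eig j \<Longrightarrow> \<sigma> v = w ^ j *s v"
  by (simp add: eig_def)

lemma eig_mod: "eig (j mod p) = eig j"
  by (simp add: eig_def w_power_mod)

lemma eig_scale: "v \<in> eig j \<Longrightarrow> c *s v \<in> eig j"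
  by (simp add: eig_def clinear_scale[OF s_clinear] mult.commute)

lemma eig_add: "v \<in> eig j \<Longrightarrow> u \<in> eig j \<Longrightarrow> v + u \<in> eig j"
  by (simp add: eig_def clinear_add[OF s_clinear] vec.scale_right_distrib)

lemma eig_0: "0 \<in> eig j"
  using eig_scale[of _ j 0] linear_0[OF s_linear] by (simp add: eig_def)

lemma pact_eig: "v \<in> eig j \<Longrightarrow> pact \<sigma> q v = ev q (w ^ j) *s v"
  by (rule pact_eigen[OF s_clinear eigD])

text \<open>The projection to \<open>eig j\<close>, up to the factor \<open>p\<close>.\<close>

definition epr :: "nat \<Rightarrow> complex^'g \<Rightarrow> complex^'g"
  where "epr j v = (\<Sum>k<p. inverse (w ^ j) ^ k *s (\<sigma> ^^ k) v)"

lemma epr_clinear: "clinear (epr j)"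
  unfolding clinear_iff epr_def
  by (simp add: clinear_add[OF funpow_clinear[OF s_clinear]] clinear_scale[OF funpow_clinear[OF s_clinear]]
      vec.scale_right_distrib sum.distrib vec.scale_sum_right vec.scale_left_commute mult.commute)

lemma epr_in_eig: "epr j v \<in> eig j"
proof -
  let ?z = "w ^ j"
  have "?z \<noteq> 0" by simp
  have zp: "inverse ?z ^ p = 1" using w_power_power[of j] by (simp add: power_inverse)
  obtain m where m: "p = Suc m" using p_gt_1 by (metis less_imp_Suc_add)
  have "\<sigma> (epr j v) = (\<Sum>k<p. inverse ?z ^ k *s (\<sigma> ^^ Suc k) v)"
    by (simp add: epr_def linear_sum[OF s_linear] clinear_scale[OF s_clinear])
  also have "\<dots> = (\<Sum>k<m. inverse ?z ^ k *s (\<sigma> ^^ Suc k) v) + inverse ?z ^ m *s v"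
    unfolding m sum.lessThan_Suc using s_pow[of v] by (simp add: m)
  finally have 1: "\<sigma> (epr j v) = (\<Sum>k<m. inverse ?z ^ k *s (\<sigma> ^^ Suc k) v) + inverse ?z ^ m *s v" .
  have "?z *s epr j v = ?z *s (v + (\<Sum>k<m. inverse ?z ^ Suc k *s (\<sigma> ^^ Suc k) v))"
    unfolding epr_def unfolding m sum.lessThan_Suc_shift by simp
  also have "\<dots> = ?z *s v + (\<Sum>k<m. inverse ?z ^ k *s (\<sigma> ^^ Suc k) v)"
    by (simp add: vec.scale_right_distrib vec.scale_sum_right mult.assoc[symmetric])
  finally have 2: "?z *s epr j v = ?z *s v + (\<Sum>k<m. inverse ?z ^ k *s (\<sigma> ^^ Suc k) v)" .
  have "inverse ?z * inverse ?z ^ m = 1" using zp unfolding m by simp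
  from inverse_unique[OF this] have zm: "inverse ?z ^ m = ?z" by simp
  show ?thesis unfolding eig_def mem_Collect_eq 1 2 zm by (rule add.commute)
qed

lemma sum_epr: "(\<Sum>j<p. epr j v) = of_nat p *s v"
proof -
  have "(\<Sum>j<p. epr j v) = (\<Sum>k<p. (\<Sum>j<p. inverse (w ^ j) ^ k) *s (\<sigma> ^^ k) v)"
    unfolding epr_def by (subst sum.swap) (simp add: vec.scale_sum_left)
  also have "\<dots> = (\<Sum>k<p. (if k = 0 then of_nat p *s v else 0))"
  proof (rule sum.cong)
    fix k assume k: "k \<in> {..<p}"
    show "(\<Sum>j<p. inverse (w ^ j) ^ k) *s (\<sigma> ^^ k) v = (if k = 0 then of_nat p *s v else 0)"
    proof (cases "k = 0")
      case False
      hence "\<not> p dvd k" using k by (auto dest: dvd_imp_le)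
      hence "inverse (w ^ k) \<noteq> 1" by (simp add: w_power_eq_1_iff)
      moreover have "inverse (w ^ k) ^ p = 1" using w_power_power[of k] by (simp add: power_inverse)
      ultimately have "(\<Sum>j<p. inverse (w ^ k) ^ j) = 0" by (intro sum_powers_eq_0)
      moreover have "inverse (w ^ k) ^ j = inverse (w ^ j) ^ k" for j
        by (simp add: power_inverse mult.commute flip: power_mult)
      ultimately show ?thesis using False by simp
    qed simp
  qed simp
  also have "\<dots> = of_nat p *s v" using p_gt_1 by simp
  finally show ?thesis .
qed

lemma eig_decomp: "\<exists>u. (\<forall>j<p. u j \<in> eig j) \<and> v = (\<Sum>j<p. u j)"
proof (intro exI conjI allI impI)
  show "inverse (of_nat p) *s epr j v \<in> eig j" for j
    by (rule eig_scale[OF epr_in_eig])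
  show "v = (\<Sum>j<p. inverse (of_nat p) *s epr j v)"
    using p_gt_1 by (simp add: vec.scale_sum_right[symmetric] sum_epr)
qed

lemma eig_eqI:
  assumes "linear f" "linear g" "\<And>j v. j < p \<Longrightarrow> v \<in> eig j \<Longrightarrow> f v = g v"
  shows "f v = g v"
proof -
  obtain u where "\<forall>j<p. u j \<in> eig j" "v = (\<Sum>j<p. u j)" using eig_decomp by blast
  thus ?thesis using assms by (simp add: linear_sum)
qed

lemma eig_orthogonal:
  assumes "v \<in> eig i" "u \<in> eig j" "w ^ i \<noteq> w ^ j"
  shows "H v u = 0"
proof -
  have eq: "H v u = w ^ i * cnj (w ^ j) * H v u"
    using s_iso[of v u] by (simp add: eigD[OF assms(1)] eigD[OF assms(2)] herm_scale_left[OF herm] herm_scale_right[OF herm] mult.commute)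
  moreover have "w ^ i * cnj (w ^ j) \<noteq> 1"
  proof
    assume "w ^ i * cnj (w ^ j) = 1"
    hence "w ^ i * inverse (w ^ j) = 1" by (simp add: cnj_w power_inverse)
    thus False using assms(3) by (simp add: field_simps)
  qed
  moreover have "(1 - w ^ i * cnj (w ^ j)) * H v u = 0"
    unfolding left_diff_distrib mult_1_left eq[symmetric] by (rule diff_self)
  ultimately show ?thesis by simp
qed

text \<open>The sum over a conjugate pair of eigenvalues has real coefficients, so it can be pushed
  through maps that are only real linear.\<close>

lemma cos_sum:
  assumes i: "i \<in> {1..<p}"
  shows "(\<Sum>k<p. (2 * Re ((w ^ i) ^ k)) *\<^sub>R (\<sigma> ^^ k) v) = epr i v + epr (p - i) v"
proof -
  have "w ^ (p - i) = inverse (w ^ i)"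
    using i by (simp add: w_power_inverse power_inverse)
  hence 1: "inverse (w ^ (p - i)) = w ^ i" by simp
  have 2: "cnj (w ^ i) = inverse (w ^ i)" by (simp add: cnj_w power_inverse)
  have "epr i v + epr (p - i) v = (\<Sum>k<p. (inverse (w ^ i) ^ k + (w ^ i) ^ k) *s (\<sigma> ^^ k) v)"
    unfolding epr_def 1 by (simp only: sum.distrib vec.scale_left_distrib)
  also have "\<dots> = (\<Sum>k<p. (2 * Re ((w ^ i) ^ k)) *\<^sub>R (\<sigma> ^^ k) v)"
    unfolding scaleR_eq_scale complex_add_cnj[symmetric] complex_cnj_power 2[symmetric]
    by (simp only: add.commute)
  finally show ?thesis by simp
qed

text \<open>c kills the image of the real operator \<open>epr i + epr (p - i)\<close>, so by the
  cosine relation the second differences of the sequence k \<mapsto> c (\<sigma>^k l) vanish. A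
  periodic sequence of this kind is constant.\<close>

lemma galois_fixed:
  assumes c: "linear c" "c ` L \<subseteq> L" and i: "i \<in> {1..<p}"
    and vanish: "\<And>v. v \<in> eig i \<Longrightarrow> c v = 0" "\<And>v. v \<in> eig (p - i) \<Longrightarrow> c v = 0"
  shows "c (\<sigma> v) = c v"
proof -
  interpret z: prime_root p "w ^ i" by (rule prime_root_power[OF not_dvd_range[OF i]])
  have pw: "(\<sigma> ^^ k) l \<in> L" if "l \<in> L" for k l
    using that s_lattice by (induction k) auto
  have step: "c (\<sigma> l) + c ((\<sigma> ^^ (p - 1)) l) = 2 *\<^sub>R c l" if l: "l \<in> L" for l
  proof -
    have "c (\<Sum>k<p. (2 * Re ((w ^ i) ^ k)) *\<^sub>R (\<sigma> ^^ k) l) = 0"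
      unfolding cos_sum[OF i] linear_add[OF c(1)] using vanish[OF epr_in_eig] by simp
    hence "(\<Sum>k<p. (2 * Re ((w ^ i) ^ k)) *\<^sub>R c ((\<sigma> ^^ k) l)) = 0"
      by (simp add: linear_sum[OF c(1)] linear_scale[OF c(1)])
    hence "c ((\<sigma> ^^ 1) l) + c ((\<sigma> ^^ (p - 1)) l) = 2 *\<^sub>R c ((\<sigma> ^^ 0) l)"
      by (intro z.lattice_cos_relation[OF lat, of "\<lambda>k. c ((\<sigma> ^^ k) l)"]) (use pw[OF l] c(2) in auto)
    thus ?thesis by simp
  qed
  \<comment> \<open>The first difference along the orbit of l: it is constant on the orbit, and its
    sum over one period telescopes to 0.\<close>
  define d where "d l = c (\<sigma> l) - c l" for l
  have d1: "d (\<sigma> l) = d l" if "l \<in> L" for l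
  proof -
    have "(\<sigma> ^^ (p - 1)) (\<sigma> l) = (\<sigma> ^^ Suc (p - 1)) l" by (simp add: funpow_swap1)
    hence "(\<sigma> ^^ (p - 1)) (\<sigma> l) = l" using p_gt_1 s_pow by simp
    thus ?thesis using step[of "\<sigma> l"] that s_lattice
      by (auto simp: d_def scaleR_2 algebra_simps)
  qed
  have dk: "d ((\<sigma> ^^ k) l) = d l" if "l \<in> L" for k l
    using d1 pw[OF that] by (induction k) auto
  have "c (\<sigma> l) = c l" if l: "l \<in> L" for l
  proof -
    have tele: "(\<Sum>k<n. d ((\<sigma> ^^ k) l)) = c ((\<sigma> ^^ n) l) - c l" for n
      by (induction n) (simp_all add: d_def)
    have "of_nat p *\<^sub>R d l = (\<Sum>k<p. d ((\<sigma> ^^ k) l))"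
      using dk[OF l] by (simp add: sum_constant_scaleR del: sum_constant)
    also have "\<dots> = 0" unfolding tele s_pow by simp
    finally show ?thesis using p_gt_1 by (simp add: d_def)
  qed
  hence "(\<lambda>v. c (\<sigma> v)) = c"
    by (intro linear_eq_on_lattice[OF lat] c linear_compose[OF s_linear c(1), unfolded o_def])
  thus ?thesis by (simp add: fun_eq_iff)
qed

text \<open>On an eigenspace with eigenvalue \<noteq> 1 every vector is \<sigma> u - u for some u,
  and c vanishes on such differences.\<close>

lemma galois_vanish:
  assumes c: "linear c" "c ` L \<subseteq> L" and i: "i \<in> {1..<p}"
    and vanish: "\<And>v. v \<in> eig i \<Longrightarrow> c v = 0" "\<And>v. v \<in> eig (p - i) \<Longrightarrow> c v = 0"
    and v: "v \<in> eig j" "\<not> p dvd j"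
  shows "c v = 0"
proof -
  have ne: "w ^ j - 1 \<noteq> 0" using v(2) by (simp add: w_power_eq_1_iff)
  define u where "u = inverse (w ^ j - 1) *s v"
  have u: "u \<in> eig j" using eig_scale[OF v(1)] by (simp add: u_def)
  have "c v = c ((w ^ j - 1) *s u)" using ne by (simp add: u_def)
  also have "(w ^ j - 1) *s u = \<sigma> u - u"
    by (simp add: eigD[OF u] vec.scale_left_diff_distrib)
  also have "c (\<sigma> u - u) = 0"
    using galois_fixed[OF c i vanish] by (simp add: linear_diff[OF c(1)])
  finally show ?thesis .
qed

lemma epr_eig: "v \<in> eig j \<Longrightarrow> epr j v = of_nat p *s v"
proof -
  assume v: "v \<in> eig j"
  have "(\<sigma> ^^ k) v = (w ^ j) ^ k *s v" for k
    by (induction k) (simp_all add: clinear_scale[OF s_clinear] eigD[OF v] mult.commute)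
  hence "epr j v = (\<Sum>k<p. 1 *s v)"
    unfolding epr_def by (simp add: power_inverse)
  also have "\<dots> = (\<Sum>k<p. 1) *s v" by (rule vec.scale_sum_left[symmetric])
  finally show ?thesis by simp
qed

text \<open>Put z = w^i. As z is not real, \<alpha> = x + y z with x, y real, and a - x - y \<sigma>
  vanishes on the pair. Evaluated on the two components of a lattice vector l this is a real
  relation between the lattice vectors \<sigma>^k (a l), \<sigma>^k l and \<sigma>^(k + 1) l; a
  rational functional turns it into u(\<sigma>) a l = v(\<sigma>) l with integer polynomials u, v.
  Then c = u(\<sigma>) a - v(\<sigma>) is a scalar on \<open>eig i\<close> and kills a nonzero
  component of l, so it vanishes on the pair and hence on all conjugate eigenspaces. It remains to
  invert u.\<close>

lemma scalar_on_pair_imp_pact: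
  assumes odd: "odd p" and a: "clinear a" "a ` L \<subseteq> L" and comm: "\<And>v. a (\<sigma> v) = \<sigma> (a v)"
    and i: "i \<in> {1..<p}" and ne: "eig i \<noteq> {0}"
    and al: "\<And>v. v \<in> eig i \<Longrightarrow> a v = \<alpha> *s v" "\<And>v. v \<in> eig (p - i) \<Longrightarrow> a v = cnj \<alpha> *s v"
  shows "\<exists>m q. m \<noteq> 0 \<and> (\<forall>j v. \<not> p dvd j \<longrightarrow> v \<in> eig j \<longrightarrow> of_int m *\<^sub>R a v = pact \<sigma> q v)"
proof -
  have ndvd: "\<not> p dvd i" by (rule not_dvd_range[OF i])
  define z where "z = w ^ i"
  interpret z: prime_root p z unfolding z_def by (rule prime_root_power[OF ndvd])
  have wpi: "w ^ (p - i) = cnj z"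
    using i by (simp add: z_def w_power_inverse power_inverse cnj_w)
  have "Im z \<noteq> 0"
  proof
    assume "Im z = 0"
    hence "cnj z = z" by (simp add: complex_eq_iff)
    hence "z ^ 1 = inverse z ^ 1" by (simp add: z.cnj_w)
    thus False using z.w_ne_inverse[OF odd, of 1] p_gt_1 by simp
  qed
  define y where "y = Im \<alpha> / Im z"
  define x where "x = Re \<alpha> - y * Re z"
  have \<alpha>: "\<alpha> = of_real x + of_real y * z"
    using \<open>Im z \<noteq> 0\<close> by (simp add: complex_eq_iff x_def y_def)
  have "\<exists>l\<in>L. epr i l \<noteq> 0"
  proof (rule ccontr)
    assume "\<not> ?thesis"
    hence "epr i = (\<lambda>v. 0)"
      by (intro linear_eq_on_lattice[OF lat] clinear_imp_linear[OF epr_clinear] linear_zero) auto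
    moreover obtain v where "v \<in> eig i" "v \<noteq> 0" using ne eig_0 by blast
    ultimately show False using epr_eig[of v i] p_gt_1 by simp
  qed
  then obtain l where l: "l \<in> L" "epr i l \<noteq> 0" by blast
  have al_lin: "linear a" by (rule clinear_imp_linear[OF a(1)])
  have comm_k: "a ((\<sigma> ^^ k) v) = (\<sigma> ^^ k) (a v)" for k v
    by (induction k) (simp_all add: comm)
  have pw: "(\<sigma> ^^ k) v \<in> L" if "v \<in> L" for k v
    using that s_lattice by (induction k) auto
  define r where "r k = 2 * Re (z ^ k)" for k
  define b where "b v = a v - x *\<^sub>R v - y *\<^sub>R \<sigma> v" for v
  have b_lin: "linear b"
    unfolding b_def using al_lin s_linear by (intro linear_compose_sub linear_compose_scale_right linear_ident)
  have b1: "b v = 0" if "v \<in> eig i" for v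
    using al(1)[OF that] eigD[OF that]
    by (simp add: b_def \<alpha> scaleR_eq_scale z_def[symmetric] vec.scale_left_distrib)
  have b2: "b v = 0" if "v \<in> eig (p - i)" for v
    using al(2)[OF that] eigD[OF that]
    by (simp add: b_def \<alpha> scaleR_eq_scale wpi vec.scale_left_distrib)
  have "0 = b (epr i l + epr (p - i) l)"
    by (simp add: linear_add[OF b_lin] b1[OF epr_in_eig] b2[OF epr_in_eig])
  also have "\<dots> = (\<Sum>k<p. r k *\<^sub>R b ((\<sigma> ^^ k) l))"
    unfolding cos_sum[OF i, symmetric] by (simp add: linear_sum[OF b_lin] linear_scale[OF b_lin] r_def z_def)
  also have "\<dots> = (\<Sum>k<p. (r k *\<^sub>R (\<sigma> ^^ k) (a l) + (- (r k * x)) *\<^sub>R (\<sigma> ^^ k) l) + (- (r k * y)) *\<^sub>R (\<sigma> ^^ Suc k) l)"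
    by (simp add: b_def comm_k scaleR_diff_right)
  finally have rel0: "0 = (\<Sum>k<p. (r k *\<^sub>R (\<sigma> ^^ k) (a l) + (- (r k * x)) *\<^sub>R (\<sigma> ^^ k) l) + (- (r k * y)) *\<^sub>R (\<sigma> ^^ Suc k) l)" .
  \<comment> \<open>The pairs (k, t) index the three families in the relation: t = 0 for \<sigma>^k
    (a l), t = 1 for \<sigma>^k l, t = 2 for \<sigma>^(k + 1) l.\<close>
  define \<rho> where "\<rho> kt = (if snd kt = 0 then r (fst kt) else if snd kt = 1 then - (r (fst kt) * x) else - (r (fst kt) * y))"
    for kt :: "nat \<times> nat"
  define m where "m kt = (if snd kt = 0 then (\<sigma> ^^ fst kt) (a l) else if snd kt = 1 then (\<sigma> ^^ fst kt) l else (\<sigma> ^^ Suc (fst kt)) l)"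
    for kt :: "nat \<times> nat"
  have sum3: "(\<Sum>kt\<in>{..<p} \<times> {0,1,2}. f kt *\<^sub>R m kt) =
      (\<Sum>k<p. (f (k, 0) *\<^sub>R (\<sigma> ^^ k) (a l) + f (k, 1) *\<^sub>R (\<sigma> ^^ k) l) + f (k, 2) *\<^sub>R (\<sigma> ^^ Suc k) l)" for f
    unfolding sum.cartesian_product' by (simp add: m_def add.assoc)
  have rel: "(\<Sum>kt\<in>{..<p} \<times> {0,1,2}. \<rho> kt *\<^sub>R m kt) = 0"
    unfolding sum3 using rel0 by (simp add: \<rho>_def)
  obtain \<pi> where \<pi>: "qfunctional \<pi>" "\<pi> 1 = 1" using qfunctional_exists[of 1] by auto
  have mL: "m kt \<in> L" for kt
    using l(1) a(2) pw pw[of l "Suc _"] by (auto simp: m_def simp del: funpow.simps)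
  have rel\<pi>: "(\<Sum>kt\<in>{..<p} \<times> {0,1,2}. \<pi> (\<rho> kt) *\<^sub>R m kt) = 0"
    by (rule lattice_qfunctional[OF lat \<pi>(1) mL rel])
  have "\<exists>D::int. D > 0 \<and> (\<forall>kt\<in>{..<p} \<times> {0,1,2}. of_int D * \<pi> (\<rho> kt) \<in> \<int>)"
    by (rule common_denominator) (use \<pi>(1) in \<open>auto simp: qfunctional_def\<close>)
  then obtain D :: int where D: "D > 0" "\<forall>kt\<in>{..<p} \<times> {0,1,2}. of_int D * \<pi> (\<rho> kt) \<in> \<int>"
    by blast
  define N where "N kt = \<lfloor>of_int D * \<pi> (\<rho> kt)\<rfloor>" for kt
  have N: "of_int (N kt) = of_int D * \<pi> (\<rho> kt)" if "kt \<in> {..<p} \<times> {0,1,2}" for kt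
    using D(2) that by (auto simp: N_def elim!: Ints_cases)
  have relN: "(\<Sum>kt\<in>{..<p} \<times> {0,1,2}. of_int (N kt) *\<^sub>R m kt) = 0"
  proof -
    have "(\<Sum>kt\<in>{..<p} \<times> {0,1,2}. of_int (N kt) *\<^sub>R m kt) =
        of_int D *\<^sub>R (\<Sum>kt\<in>{..<p} \<times> {0,1,2}. \<pi> (\<rho> kt) *\<^sub>R m kt)"
      unfolding scaleR_sum_right by (rule sum.cong) (simp_all only: N scaleR_scaleR)
    thus ?thesis by (simp only: rel\<pi> scaleR_zero_right)
  qed
  define u where "u = (\<Sum>k<p. monom (N (k, 0)) k)"
  define v where "v = - ((\<Sum>k<p. monom (N (k, 1)) k) + (\<Sum>k<p. monom (N (k, 2)) (Suc k)))"
  have pu: "pact \<sigma> u (a l) = (\<Sum>k<p. of_int (N (k, 0)) *\<^sub>R (\<sigma> ^^ k) (a l))"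
    by (simp only: u_def pact_sum[OF s_clinear] pact_monom[OF s_clinear])
  have pv: "pact \<sigma> v l = - ((\<Sum>k<p. of_int (N (k, 1)) *\<^sub>R (\<sigma> ^^ k) l) + (\<Sum>k<p. of_int (N (k, 2)) *\<^sub>R (\<sigma> ^^ Suc k) l))"
    by (simp only: v_def pact_sum[OF s_clinear] pact_monom[OF s_clinear] pact_uminus[OF s_clinear] pact_add[OF s_clinear])
  have uv: "pact \<sigma> u (a l) = pact \<sigma> v l"
    using relN unfolding sum3 pu pv eq_neg_iff_add_eq_0 by (simp only: sum.distrib add.assoc)
  \<comment> \<open>If u(z) = 0, all coefficients of u equal the one at k = 0, which is 2 D because
    r 0 = 2 and \<pi> 1 = 1. But the r k add up to 0, and then so do the coefficients.\<close>
  have ev_u: "ev u z \<noteq> 0"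
  proof
    assume "ev u z = 0"
    hence "(\<Sum>k<p. of_int (N (k, 0)) * z ^ k) = 0" by (simp add: u_def ev_sum)
    hence eqN: "N (k, 0) = N (p - 1, 0)" if "k < p" for k
      using z.power_sum_eq_0_imp[of "\<lambda>k. N (k, 0)"] that by blast
    have "\<pi> (r 0) = 2"
      using qfunctional_of_int_mult[OF \<pi>(1), of 1 2] \<pi>(2) by (simp add: r_def)
    hence "real_of_int (N (0, 0)) = of_int (2 * D)" using N[of "(0, 0)"] p_gt_1 by (simp add: \<rho>_def)
    hence "N (p - 1, 0) = 2 * D" using eqN[of 0] p_gt_1 by linarith
    hence N2: "N (k, 0) = 2 * D" if "k < p" for k using eqN[OF that] by simp
    have "(\<Sum>k<p. r k) = 2 * Re (\<Sum>k<p. z ^ k)"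
      by (simp add: r_def sum_distrib_left)
    also have "\<dots> = 0" by (simp add: z.sum_powers_eq_0[OF z.w_pow z.w_ne_1])
    finally have "\<pi> (\<Sum>k<p. r k) = 0" by (simp add: qfunctional_0[OF \<pi>(1)])
    hence "of_int D * (\<Sum>k<p. \<pi> (r k)) = 0" by (simp add: qfunctional_sum[OF \<pi>(1)])
    hence "(\<Sum>k<p. of_int D * \<pi> (\<rho> (k, 0))) = 0" by (simp add: \<rho>_def sum_distrib_left)
    moreover have "(\<Sum>k<p. of_int D * \<pi> (\<rho> (k, 0))) = (\<Sum>k<p. real_of_int (2 * D))"
      by (rule sum.cong[OF refl], subst N[symmetric]) (simp_all add: N2)
    ultimately show False using D(1) p_gt_1 by simp
  qed
  define c where "c t = pact \<sigma> u (a t) - pact \<sigma> v t" for t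
  have c_clin: "clinear c"
    unfolding clinear_iff c_def
    by (simp add: clinear_add[OF a(1)] clinear_scale[OF a(1)] clinear_add[OF pact_clinear[OF s_clinear]]
        clinear_scale[OF pact_clinear[OF s_clinear]] vec.scale_right_diff_distrib)
  have c_lin: "linear c" by (rule clinear_imp_linear[OF c_clin])
  have cL: "c ` L \<subseteq> L"
    using a(2) by (auto simp: c_def intro!: lattice_diff[OF lat] pact_lattice[OF s_clinear lat s_lattice])
  have c_comm: "c (\<sigma> t) = \<sigma> (c t)" for t
    by (simp add: c_def comm pact_commute[OF s_clinear s_linear, symmetric] linear_diff[OF s_linear])
  have c_comm_k: "c ((\<sigma> ^^ k) t) = (\<sigma> ^^ k) (c t)" for k t
    by (induction k) (simp_all add: c_comm)
  define \<gamma> where "\<gamma> = ev u z * \<alpha> - ev v z"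
  have c1: "c t = \<gamma> *s t" if t: "t \<in> eig i" for t
    by (simp add: c_def al(1)[OF t] clinear_scale[OF pact_clinear[OF s_clinear]] pact_eig[OF t] \<gamma>_def
        vec.scale_left_diff_distrib mult.commute flip: z_def)
  have c2: "c t = cnj \<gamma> *s t" if t: "t \<in> eig (p - i)" for t
    by (simp add: c_def al(2)[OF t] clinear_scale[OF pact_clinear[OF s_clinear]] pact_eig[OF t] \<gamma>_def wpi
        vec.scale_left_diff_distrib mult.commute cnj_ev)
  have "c (epr i l) = epr i (c l)"
    by (simp add: epr_def linear_sum[OF c_lin] clinear_scale[OF c_clin] c_comm_k)
  also have "c l = 0" using uv by (simp add: c_def)
  finally have "c (epr i l) = 0" using linear_0[OF clinear_imp_linear[OF epr_clinear]] by simp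
  hence "\<gamma> = 0" using c1[OF epr_in_eig] l(2) by simp
  have c0: "c t = 0" if "\<not> p dvd j" "t \<in> eig j" for j t
    by (rule galois_vanish[OF c_lin cL i _ _ that(2,1)]) (use c1 c2 \<open>\<gamma> = 0\<close> in auto)
  have "ev u w \<noteq> 0" using ev_u ev_conj_iff[OF ndvd] by (simp add: z_def)
  from ev_inverse[OF this] obtain u' E where E: "E \<noteq> 0" "ev (u' * u) w = of_int E" by blast
  have "of_int E *\<^sub>R a t = pact \<sigma> (u' * v) t" if j: "\<not> p dvd j" "t \<in> eig j" for j t
  proof -
    have "ev (u' * u - of_int E) w = 0" unfolding ev_diff E(2) ev_of_int by simp
    hence "ev (u' * u - of_int E) (w ^ j) = 0" unfolding ev_conj_iff[OF j(1)] .
    moreover have at: "a t \<in> eig j"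
      using comm[of t] by (simp add: eig_def eigD[OF j(2)] clinear_scale[OF a(1)])
    ultimately have "pact \<sigma> (u' * u) (a t) = of_int E *s a t"
      by (simp add: pact_eig[OF at])
    moreover have "pact \<sigma> u (a t) = pact \<sigma> v t"
      using c0[OF j] by (simp add: c_def)
    ultimately show ?thesis
      by (simp add: pact_mult[OF s_clinear] scaleR_eq_scale)
  qed
  thus ?thesis using E(1) by blast
qed

end

section \<open>Infinitesimal deformations and the endomorphisms commuting with them\<close>

definition antilinear :: "(complex^'g \<Rightarrow> complex^'g) \<Rightarrow> bool"
  where "antilinear S \<longleftrightarrow> (\<forall>x y. S (x + y) = S x + S y) \<and> (\<forall>c x. S (c *s x) = cnj c *s S x)"

text \<open>The tangent directions at \<open>(L, H)\<close> of the deformations that preserve \<open>\<sigma>\<close>.\<close>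

definition deformation :: "'g::finite hform \<Rightarrow> (complex^'g \<Rightarrow> complex^'g) \<Rightarrow> (complex^'g \<Rightarrow> complex^'g) \<Rightarrow> bool"
  where "deformation H \<sigma> S \<longleftrightarrow> antilinear S \<and> (\<forall>v. S (\<sigma> v) = \<sigma> (S v)) \<and> (\<forall>x y. H (S x) y = H (S y) x)"

text \<open>The endomorphisms of \<open>V / L\<close> that remain complex linear along all these directions.\<close>

definition generic_End :: "(complex^'g::finite) set \<Rightarrow> 'g hform \<Rightarrow> (complex^'g \<Rightarrow> complex^'g) \<Rightarrow> (complex^'g \<Rightarrow> complex^'g) set"
  where "generic_End L H \<sigma> = {a \<in> torus_End L. \<forall>S. deformation H \<sigma> S \<longrightarrow> (\<forall>v. a (S v) = S (a v))}"

context ppav_aut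
begin

text \<open>The symmetric product of v and v'; it commutes with \<sigma> because the two eigenvalues
  are inverse to each other. Generic endomorphisms are computed below from these directions
  alone.\<close>

lemma pair_deformation:
  assumes v: "v \<in> eig i" and v': "v' \<in> eig j" and ij: "w ^ i * w ^ j = 1"
  shows "deformation H \<sigma> (\<lambda>u. H v u *s v' + H v' u *s v)"
proof -
  have 1: "H v (\<sigma> u) = w ^ j * H v u" for u
  proof -
    have "H v u = w ^ i * H v (\<sigma> u)"
      using s_iso[of v u] by (simp add: eigD[OF v] herm_scale_left[OF herm])
    hence "w ^ j * H v u = (w ^ i * w ^ j) * H v (\<sigma> u)" by simp
    thus ?thesis unfolding ij by simp
  qed
  have 2: "H v' (\<sigma> u) = w ^ i * H v' u" for u
  proof -
    have "H v' u = w ^ j * H v' (\<sigma> u)"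
      using s_iso[of v' u] by (simp add: eigD[OF v'] herm_scale_left[OF herm])
    hence "w ^ i * H v' u = (w ^ i * w ^ j) * H v' (\<sigma> u)" by simp
    thus ?thesis unfolding ij by simp
  qed
  show ?thesis
    unfolding deformation_def antilinear_def
    by (simp add: herm_add_right[OF herm] herm_scale_right[OF herm] herm_add_left[OF herm] herm_scale_left[OF herm]
        clinear_add[OF s_clinear] clinear_scale[OF s_clinear] eigD[OF v] eigD[OF v'] 1 2
        vec.scale_left_distrib vec.scale_right_distrib mult.commute add.commute)
qed

lemma generic_EndD:
  assumes "a \<in> generic_End L H \<sigma>"
  shows "clinear a" "a ` L \<subseteq> L" "linear a"
  using assms clinear_imp_linear by (auto simp: generic_End_def torus_End_def)

lemma generic_End_pair:
  assumes a: "a \<in> generic_End L H \<sigma>" and v: "v \<in> eig i" and v': "v' \<in> eig j" and ij: "w ^ i * w ^ j = 1"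
  shows "H v u *s a v' + H v' u *s a v = H v (a u) *s v' + H v' (a u) *s v"
proof -
  have "a (H v u *s v' + H v' u *s v) = H v (a u) *s v' + H v' (a u) *s v"
    using a pair_deformation[OF v v' ij] unfolding generic_End_def by blast
  thus ?thesis by (simp add: clinear_add[OF generic_EndD(1)[OF a]] clinear_scale[OF generic_EndD(1)[OF a]])
qed

text \<open>The eigenvalue is its own inverse, so v = v' is allowed. That direction has the line of
  v0 as its image, so v0 is an eigenvector of a; the scalar is real because a commutes with an
  antilinear map preserving the line. Pairing v0 with other vectors shows that the scalar is common
  to all.\<close>

lemma generic_End_real_eig:
  assumes a: "a \<in> generic_End L H \<sigma>" and j: "w ^ j * w ^ j = 1"
  shows "\<exists>s. \<forall>v\<in>eig j. a v = of_real s *s v"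
proof (cases "eig j = {0}")
  case True
  thus ?thesis using linear_0[OF generic_EndD(3)[OF a]] by auto
next
  case False
  then obtain v0 where v0: "v0 \<in> eig j" "v0 \<noteq> 0" using eig_0 by blast
  have h0: "H v0 v0 \<noteq> 0" using v0 herm_self_eq_0[OF herm] by blast
  define t where "t = H v0 (a v0) / H v0 v0"
  have "(2 * H v0 v0) *s a v0 = (2 * H v0 (a v0)) *s v0"
    unfolding mult_2 vec.scale_left_distrib by (rule generic_End_pair[OF a v0(1) v0(1) j])
  hence "(inverse (2 * H v0 v0)) *s ((2 * H v0 v0) *s a v0) = inverse (2 * H v0 v0) *s ((2 * H v0 (a v0)) *s v0)"
    by simp
  hence av0: "a v0 = t *s v0"
    using h0 by (simp add: t_def field_simps)
  have "H v0 (a v0) = cnj t * H v0 v0"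
    unfolding av0 by (rule herm_scale_right[OF herm])
  hence "H v0 (a v0) / H v0 v0 = cnj t" using h0 by simp
  hence tc: "cnj t = t" unfolding t_def[symmetric] by (rule sym)
  hence t: "t = of_real (Re t)" by (simp add: complex_eq_iff)
  have "a v = t *s v" if v: "v \<in> eig j" for v
  proof -
    have "H v0 v0 *s a v + H v v0 *s (t *s v0) = (cnj t * H v0 v0) *s v + (cnj t * H v v0) *s v0"
      using generic_End_pair[OF a v0(1) v j, of v0] by (simp add: av0 herm_scale_right[OF herm])
    hence "H v0 v0 *s a v = (t * H v0 v0) *s v"
      by (simp add: tc mult.commute[of t])
    hence "inverse (H v0 v0) *s (H v0 v0 *s a v) = inverse (H v0 v0) *s ((t * H v0 v0) *s v)" by simp
    thus ?thesis using h0 by (simp add: field_simps)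
  qed
  thus ?thesis using t by metis
qed

text \<open>For an integral eigenvalue the operator \<open>epr j\<close> has integer coefficients in
  \<sigma>, so the eigenspace contains nonzero lattice vectors.\<close>

lemma real_eig_scalar_rational:
  assumes a: "a ` L \<subseteq> L" and j: "w ^ j = of_int e" "e * e = 1"
    and s: "\<And>v. v \<in> eig j \<Longrightarrow> a v = of_real s *s v" and ne: "eig j \<noteq> {0}"
  shows "s \<in> \<rat>"
proof -
  have "of_int e * of_int e = (1 :: complex)" using j(2) by (metis of_int_1 of_int_mult)
  hence einv: "inverse (w ^ j) = of_int e" unfolding j(1) by (rule inverse_unique)
  have "\<exists>l\<in>L. epr j l \<noteq> 0"
  proof (rule ccontr)
    assume "\<not> ?thesis"
    hence "epr j = (\<lambda>v. 0)"
      by (intro linear_eq_on_lattice[OF lat] clinear_imp_linear[OF epr_clinear] linear_zero) auto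
    moreover obtain v where "v \<in> eig j" "v \<noteq> 0" using ne eig_0 by blast
    ultimately show False using epr_eig[of v j] p_gt_1 by simp
  qed
  then obtain l where l: "l \<in> L" "epr j l \<noteq> 0" by blast
  have "epr j l = (\<Sum>k<p. of_int (e ^ k) *\<^sub>R (\<sigma> ^^ k) l)"
    unfolding epr_def einv by (simp add: scaleR_eq_scale)
  also have "\<dots> = pact \<sigma> (\<Sum>k<p. monom (e ^ k) k) l"
    by (simp add: pact_sum[OF s_clinear] pact_monom[OF s_clinear])
  finally have eL: "epr j l \<in> L"
    using pact_lattice[OF s_clinear lat s_lattice l(1)] by simp
  hence "s *\<^sub>R epr j l \<in> L"
    using s[OF epr_in_eig] a by (auto simp: scaleR_eq_scale image_subset_iff)
  thus ?thesis by (rule lattice_rational_scale[OF lat eL l(2)])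
qed

text \<open>False for the zero eigenspace too, so that the negation matches the condition n_i
  \<noteq> 1.\<close>

definition one_dim :: "nat \<Rightarrow> bool"
  where "one_dim j \<longleftrightarrow> (\<exists>v\<in>eig j. v \<noteq> 0 \<and> (\<forall>u\<in>eig j. \<exists>c. u = c *s v))"

lemma w_pair:
  assumes "i \<in> {1..<p}"
  shows "w ^ i * w ^ (p - i) = 1" "w ^ (p - i) * w ^ i = 1"
proof -
  have "i + (p - i) = p" using assms by simp
  thus "w ^ i * w ^ (p - i) = 1" by (simp only: w_pow flip: power_add)
  thus "w ^ (p - i) * w ^ i = 1" by (simp only: mult.commute)
qed

lemma w_pair_ne:
  assumes "odd p" "i \<in> {1..<p}"
  shows "w ^ i \<noteq> w ^ (p - i)"
  using w_ne_inverse[OF assms(1) not_dvd_range[OF assms(2)]] assms(2) by (simp add: w_power_inverse)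

text \<open>Pairing v with v' writes a v' as a multiple of v' plus a multiple of v. The second term
  vanishes: v may be replaced by an independent vector of the same eigenspace, and the two
  eigenspaces are orthogonal.\<close>

lemma generic_End_big_pair:
  assumes odd: "odd p" and a: "a \<in> generic_End L H \<sigma>" and i: "i \<in> {1..<p}"
    and ne: "eig i \<noteq> {0}" "eig (p - i) \<noteq> {0}" and big: "\<not> one_dim i"
  shows "\<exists>\<kappa>. (\<forall>v\<in>eig (p - i). a v = \<kappa> *s v) \<and> (\<forall>v\<in>eig i. a v = cnj \<kappa> *s v)"
proof -
  have orth: "H v v' = 0" "H v' v = 0" if "v \<in> eig i" "v' \<in> eig (p - i)" for v v'
    using eig_orthogonal[OF that w_pair_ne[OF odd i]] eig_orthogonal[OF that(2,1) w_pair_ne[OF odd i, symmetric]] by auto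
  have h: "H v v \<noteq> 0" if "v \<noteq> 0" for v using that herm_self_eq_0[OF herm] by blast
  have key: "a v' = (H v (a v) / H v v) *s v' + (H v' (a v) / H v v) *s v"
    if "v \<in> eig i" "v' \<in> eig (p - i)" "v \<noteq> 0" for v v'
  proof -
    have "H v v *s a v' = H v (a v) *s v' + H v' (a v) *s v"
      using generic_End_pair[OF a that(1,2) w_pair(1)[OF i], of v] orth[OF that(1,2)] by simp
    hence "inverse (H v v) *s (H v v *s a v') = inverse (H v v) *s (H v (a v) *s v' + H v' (a v) *s v)" by simp
    thus ?thesis using h[OF that(3)] by (simp add: vec.scale_right_distrib field_simps)
  qed
  have vanish: "H v' (a v) = 0" if v: "v \<in> eig i" and v': "v' \<in> eig (p - i)" for v v'
  proof (cases "v = 0")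
    case True
    thus ?thesis using linear_0[OF generic_EndD(3)[OF a]] herm_0_right[OF herm] by simp
  next
    case False
    then obtain v2 where v2: "v2 \<in> eig i" "\<nexists>c. v2 = c *s v"
      using big v unfolding one_dim_def by blast
    have "v2 \<noteq> 0" using v2(2) by (metis vec.scale_zero_left)
    define A B A2 B2 where "A = H v (a v) / H v v" and "B = H v' (a v) / H v v"
      and "A2 = H v2 (a v2) / H v2 v2" and "B2 = H v' (a v2) / H v2 v2"
    have "A *s v' + B *s v = A2 *s v' + B2 *s v2"
      using key[OF v v' False] key[OF v2(1) v' \<open>v2 \<noteq> 0\<close>] by (simp add: A_def B_def A2_def B2_def)
    hence eq: "B *s v - B2 *s v2 = (A2 - A) *s v'"
      by (simp add: vec.scale_left_diff_distrib algebra_simps)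
    have "B *s v - B2 *s v2 \<in> eig i"
      using eig_add[OF eig_scale[OF v, of B] eig_scale[OF v2(1), of "- B2"]] by simp
    moreover have "B *s v - B2 *s v2 \<in> eig (p - i)" unfolding eq by (rule eig_scale[OF v'])
    ultimately have "H (B *s v - B2 *s v2) (B *s v - B2 *s v2) = 0" by (rule orth(1))
    hence "B *s v - B2 *s v2 = 0" unfolding herm_self_eq_0[OF herm] .
    hence Bv: "B2 *s v2 = B *s v" by simp
    have "B2 = 0"
    proof (rule ccontr)
      assume "B2 \<noteq> 0"
      have "inverse B2 *s (B2 *s v2) = inverse B2 *s (B *s v)" using Bv by simp
      hence "v2 = (inverse B2 * B) *s v" using \<open>B2 \<noteq> 0\<close> by simp
      thus False using v2(2) by blast
    qed
    hence "B *s v = 0" using Bv by simp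
    thus ?thesis using False h[OF False] by (simp add: B_def)
  qed
  obtain v0 where v0: "v0 \<in> eig i" "v0 \<noteq> 0" using ne(1) eig_0 by blast
  obtain v0' where v0': "v0' \<in> eig (p - i)" "v0' \<noteq> 0" using ne(2) eig_0 by blast
  define \<kappa> where "\<kappa> = H v0 (a v0) / H v0 v0"
  have 1: "a v' = \<kappa> *s v'" if "v' \<in> eig (p - i)" for v'
    using key[OF v0(1) that v0(2)] vanish[OF v0(1) that] by (simp add: \<kappa>_def)
  have "a v = cnj \<kappa> *s v" if v: "v \<in> eig i" for v
  proof -
    have "H v0' v0' *s a v = (cnj \<kappa> * H v0' v0') *s v"
      using generic_End_pair[OF a v0'(1) v w_pair(2)[OF i], of v0'] orth[OF v v0'(1)]
      by (simp add: 1[OF v0'(1)] herm_scale_right[OF herm])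
    hence "inverse (H v0' v0') *s (H v0' v0' *s a v) = inverse (H v0' v0') *s ((cnj \<kappa> * H v0' v0') *s v)" by simp
    thus ?thesis using h[OF v0'(2)] by (simp add: field_simps)
  qed
  thus ?thesis using 1 by blast
qed

text \<open>The commutator with \<sigma> preserves L and vanishes on the pair, so it vanishes on all
  conjugate eigenspaces; on \<open>eig 0\<close> the map a is a scalar.\<close>

lemma commutes_with_eig_scalars:
  assumes a: "a \<in> generic_End L H \<sigma>" and i: "i \<in> {1..<p}"
    and al: "\<And>v. v \<in> eig i \<Longrightarrow> a v = \<alpha> *s v" "\<And>v. v \<in> eig (p - i) \<Longrightarrow> a v = \<beta> *s v"
  shows "a (\<sigma> v) = \<sigma> (a v)"
proof (rule eig_eqI[where f = "\<lambda>v. a (\<sigma> v)" and g = "\<lambda>v. \<sigma> (a v)"])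
  note a' = generic_EndD[OF a]
  show 1: "linear (\<lambda>v. a (\<sigma> v))" and 2: "linear (\<lambda>v. \<sigma> (a v))"
    using linear_compose[OF s_linear a'(3)] linear_compose[OF a'(3) s_linear] by (simp_all add: o_def)
  fix j v assume "j < p" and v: "v \<in> eig j"
  show "a (\<sigma> v) = \<sigma> (a v)"
  proof (cases "j = 0")
    case True
    obtain s where "\<forall>v\<in>eig 0. a v = of_real s *s v"
      using generic_End_real_eig[OF a, of 0] by auto
    thus ?thesis using v eigD[OF v] True by (simp add: clinear_scale[OF s_clinear])
  next
    case False
    hence j: "\<not> p dvd j" using \<open>j < p\<close> by (auto dest: dvd_imp_le)
    have "a (\<sigma> v) - \<sigma> (a v) = 0"
    proof (rule galois_vanish[OF _ _ i _ _ v j])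
      show "linear (\<lambda>v. a (\<sigma> v) - \<sigma> (a v))" by (rule linear_compose_sub[OF 1 2])
      show "(\<lambda>v. a (\<sigma> v) - \<sigma> (a v)) ` L \<subseteq> L"
        using a'(2) s_lattice by (auto intro!: lattice_diff[OF lat])
    qed (simp_all add: al eigD clinear_scale[OF a'(1)] clinear_scale[OF s_clinear] mult.commute)
    thus ?thesis by simp
  qed
qed

text \<open>On two lines a may have off-diagonal entries B and B'. Suppose B \<noteq> 0. Then the
  commutator c of a and \<sigma> exchanges the lines and c^2 is a nonzero real scalar on them, as in
  a quaternion algebra. By conjugation c carries every moved \<open>eig j\<close> to
  \<open>eig (p - j)\<close>, and a multiple of c^2 is a polynomial in \<sigma> there, nonzero at w
  and so at all its conjugates; thus c is injective on each. Nonzero eigenspaces then come in pairs,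
  so \<open>eig k\<close>, not being a line, is 0 together with its partner; conjugation would make
  the identity vanish on v.\<close>

lemma generic_End_small_pair:
  assumes odd: "odd p" and a: "a \<in> generic_End L H \<sigma>" and i: "i \<in> {1..<p}"
    and one: "one_dim i" "one_dim (p - i)"
    and small: "\<And>j. j \<in> {1..<p} \<Longrightarrow> eig j \<noteq> {0} \<Longrightarrow> eig (p - j) \<noteq> {0} \<Longrightarrow> one_dim j"
    and k: "k \<in> {1..<p}" "\<not> one_dim k"
  shows "\<exists>\<kappa>. (\<forall>v\<in>eig (p - i). a v = \<kappa> *s v) \<and> (\<forall>v\<in>eig i. a v = cnj \<kappa> *s v)"
proof -
  note a' = generic_EndD[OF a]
  obtain v where v: "v \<in> eig i" "v \<noteq> 0" "\<forall>u\<in>eig i. \<exists>c. u = c *s v" using one(1) unfolding one_dim_def by blast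
  obtain v' where v': "v' \<in> eig (p - i)" "v' \<noteq> 0" "\<forall>u\<in>eig (p - i). \<exists>c. u = c *s v'"
    using one(2) unfolding one_dim_def by blast
  have orth: "H v v' = 0" "H v' v = 0"
    using eig_orthogonal[OF v(1) v'(1) w_pair_ne[OF odd i]] eig_orthogonal[OF v'(1) v(1) w_pair_ne[OF odd i, symmetric]] by auto
  have h: "H v v \<noteq> 0" "H v' v' \<noteq> 0" using v v' herm_self_eq_0[OF herm] by blast+
  have hr: "cnj (H v v) = H v v" "cnj (H v' v') = H v' v'"
    using herm_cnj[OF herm, of v v] herm_cnj[OF herm, of v' v'] by auto
  define A B B' where "A = H v (a v) / H v v" and "B = H v' (a v) / H v v" and "B' = H v (a v') / H v' v'"
  have av': "a v' = A *s v' + B *s v"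
  proof -
    have "H v v *s a v' = H v (a v) *s v' + H v' (a v) *s v"
      using generic_End_pair[OF a v(1) v'(1) w_pair(1)[OF i], of v] orth by simp
    hence "inverse (H v v) *s (H v v *s a v') = inverse (H v v) *s (H v (a v) *s v' + H v' (a v) *s v)" by simp
    thus ?thesis using h by (simp add: A_def B_def vec.scale_right_distrib field_simps)
  qed
  have av: "a v = cnj A *s v + B' *s v'"
  proof -
    have "H v' v' *s a v = (cnj A * H v' v') *s v + H v (a v') *s v'"
      using generic_End_pair[OF a v'(1) v(1) w_pair(2)[OF i], of v'] orth
      by (simp add: av' herm_add_right[OF herm] herm_scale_right[OF herm])
    hence "inverse (H v' v') *s (H v' v' *s a v) = inverse (H v' v') *s ((cnj A * H v' v') *s v + H v (a v') *s v')" by simp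
    thus ?thesis using h by (simp add: B'_def vec.scale_right_distrib field_simps)
  qed
  have B': "B' * H v' v' = cnj B * H v v"
    using h by (simp add: B'_def av' herm_add_right[OF herm] herm_scale_right[OF herm] orth)
  have "B = 0"
  proof (rule ccontr)
    assume "B \<noteq> 0"
    define z where "z = w ^ i"
    have z1: "w ^ (p - i) = cnj z"
      using i by (simp add: z_def w_power_inverse power_inverse cnj_w)
    have "z \<noteq> cnj z" using w_pair_ne[OF odd i] unfolding z1 unfolding z_def[symmetric] .
    define c where "c u = a (\<sigma> u) - \<sigma> (a u)" for u
    have c_clin: "clinear c"
      unfolding clinear_iff c_def
      by (simp add: clinear_add[OF a'(1)] clinear_add[OF s_clinear] clinear_scale[OF a'(1)] clinear_scale[OF s_clinear]
          vec.scale_right_diff_distrib)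
    note c_lin = clinear_imp_linear[OF c_clin]
    have cL: "c ` L \<subseteq> L"
      using a'(2) s_lattice by (auto simp: c_def intro!: lattice_diff[OF lat])
    have sv: "\<sigma> v = z *s v" "\<sigma> v' = cnj z *s v'"
      using eigD[OF v(1)] eigD[OF v'(1)] by (simp_all add: z1 z_def)
    have cv: "c v = (B' * (z - cnj z)) *s v'"
      by (simp add: c_def sv av clinear_add[OF s_clinear] clinear_scale[OF a'(1)] clinear_scale[OF s_clinear]
          vec.scale_right_distrib vec.scale_left_diff_distrib right_diff_distrib mult.commute)
    have cv': "c v' = (B * (cnj z - z)) *s v"
      by (simp add: c_def sv av' clinear_add[OF s_clinear] clinear_scale[OF a'(1)] clinear_scale[OF s_clinear]
          vec.scale_right_distrib vec.scale_left_diff_distrib right_diff_distrib mult.commute)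
    define \<gamma> where "\<gamma> = B' * B * ((z - cnj z) * (cnj z - z))"
    have ccv: "c (c v) = \<gamma> *s v" and ccv': "c (c v') = \<gamma> *s v'"
      by (simp_all add: cv cv' clinear_scale[OF c_clin] \<gamma>_def mult_ac)
    have "B' \<noteq> 0" using B' \<open>B \<noteq> 0\<close> h by auto
    hence "\<gamma> \<noteq> 0" using \<open>B \<noteq> 0\<close> \<open>z \<noteq> cnj z\<close> by (simp add: \<gamma>_def)
    have "B' * B * H v' v' = (B * cnj B) * H v v" using B' by (simp add: mult_ac)
    hence BB: "B' * B = (B * cnj B) * (H v v / H v' v')" using h(2) by (simp add: eq_divide_eq)
    have "cnj (B' * B) = B' * B" unfolding BB by (simp add: hr mult_ac)
    moreover have "cnj ((z - cnj z) * (cnj z - z)) = (z - cnj z) * (cnj z - z)" by (simp add: mult.commute)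
    ultimately have "cnj \<gamma> = \<gamma>" unfolding \<gamma>_def complex_cnj_mult[of "B' * B"] by (simp only:)
    have cc1: "c (c u) = \<gamma> *s u" if u: "u \<in> eig i" for u
    proof -
      obtain t where "u = t *s v" by (rule exE[OF bspec[OF v(3) u]])
      thus ?thesis by (simp add: clinear_scale[OF c_clin] ccv mult.commute)
    qed
    have cc2: "c (c u) = cnj \<gamma> *s u" if u: "u \<in> eig (p - i)" for u
    proof -
      obtain t where "u = t *s v'" by (rule exE[OF bspec[OF v'(3) u]])
      thus ?thesis by (simp add: clinear_scale[OF c_clin] ccv' \<open>cnj \<gamma> = \<gamma>\<close> mult.commute)
    qed
    have c_eig0: "c u = 0" if "u \<in> eig 0" for u
    proof -
      obtain s where "\<forall>v\<in>eig 0. a v = of_real s *s v"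
        using generic_End_real_eig[OF a, of 0] by auto
      thus ?thesis using that eigD[OF that] by (simp add: c_def clinear_scale[OF s_clinear])
    qed
    \<comment> \<open>The identity \<sigma> c \<sigma> = c holds on the two lines and compares maps
      preserving L, so it spreads to all conjugate eigenspaces.\<close>
    have swap: "\<sigma> (c u) = inverse (w ^ j) *s c u" if j: "\<not> p dvd j" and u: "u \<in> eig j" for j u
    proof -
      let ?d = "\<lambda>u. \<sigma> (c (\<sigma> u)) - c u"
      have "?d u = 0"
      proof (rule galois_vanish[OF _ _ i _ _ u j])
        show "linear ?d"
          using linear_compose_sub[OF linear_compose[OF linear_compose[OF s_linear c_lin] s_linear] c_lin]
          by (simp add: o_def)
        show "?d ` L \<subseteq> L" using cL s_lattice by (auto intro!: lattice_diff[OF lat])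
        have zz: "z * cnj z = 1" using w_pair(1)[OF i] by (simp add: z1 z_def[symmetric])
        have dv: "?d v = 0" "?d v' = 0"
          using zz by (simp_all add: sv cv cv' clinear_scale[OF c_clin] clinear_scale[OF s_clinear] mult_ac)
        show "?d u = 0" if u: "u \<in> eig i" for u
        proof -
          obtain t where "u = t *s v" by (rule exE[OF bspec[OF v(3) u]])
          thus ?thesis using dv(1) by (simp add: clinear_scale[OF c_clin] clinear_scale[OF s_clinear]
              flip: vec.scale_right_diff_distrib)
        qed
        show "?d u = 0" if u: "u \<in> eig (p - i)" for u
        proof -
          obtain t where "u = t *s v'" by (rule exE[OF bspec[OF v'(3) u]])
          thus ?thesis using dv(2) by (simp add: clinear_scale[OF c_clin] clinear_scale[OF s_clinear]
              flip: vec.scale_right_diff_distrib)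
        qed
      qed
      hence "w ^ j *s \<sigma> (c u) = c u"
        by (simp add: eigD[OF u] clinear_scale[OF c_clin] clinear_scale[OF s_clinear])
      hence "inverse (w ^ j) *s (w ^ j *s \<sigma> (c u)) = inverse (w ^ j) *s c u" by simp
      thus ?thesis by simp
    qed
    have swap': "c u \<in> eig (p - j)" if j: "j \<in> {1..<p}" and u: "u \<in> eig j" for j u
      using swap[OF not_dvd_range[OF j] u] j by (simp add: eig_def w_power_inverse power_inverse)
    have cc_comm: "c (c (\<sigma> u)) = \<sigma> (c (c u))" for u
    proof (rule eig_eqI[where f = "\<lambda>u. c (c (\<sigma> u))" and g = "\<lambda>u. \<sigma> (c (c u))"])
      show "linear (\<lambda>u. c (c (\<sigma> u)))" "linear (\<lambda>u. \<sigma> (c (c u)))"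
        using linear_compose[OF s_linear linear_compose[OF c_lin c_lin]]
          linear_compose[OF linear_compose[OF c_lin c_lin] s_linear] by (simp_all add: o_def)
      fix j u assume "j < p" and u: "u \<in> eig j"
      show "c (c (\<sigma> u)) = \<sigma> (c (c u))"
      proof (cases "j = 0")
        case True
        hence u0: "u \<in> eig 0" using u by simp
        show ?thesis using eigD[OF u0] by (simp add: c_eig0[OF u0] linear_0[OF c_lin] linear_0[OF s_linear])
      next
        case False
        hence j: "j \<in> {1..<p}" using \<open>j < p\<close> by simp
        hence j': "p - j \<in> {1..<p}" by auto
        have "p - (p - j) = j" using j by simp
        hence "c (c u) \<in> eig j" using swap'[OF j' swap'[OF j u]] by simp
        thus ?thesis by (simp add: eigD eigD[OF u] clinear_scale[OF c_clin])
      qed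
    qed
    have "\<exists>m q. m \<noteq> 0 \<and> (\<forall>j u. \<not> p dvd j \<longrightarrow> u \<in> eig j \<longrightarrow> of_int m *\<^sub>R c (c u) = pact \<sigma> q u)"
    proof (rule scalar_on_pair_imp_pact[OF odd _ _ cc_comm i _ cc1 cc2])
      show "clinear (\<lambda>u. c (c u))" by (rule clinear_compose[OF c_clin c_clin])
      show "(\<lambda>u. c (c u)) ` L \<subseteq> L" using cL by auto
      show "eig i \<noteq> {0}" using v(1,2) by blast
    qed
    then obtain m q where mq: "m \<noteq> 0" "\<forall>j u. \<not> p dvd j \<longrightarrow> u \<in> eig j \<longrightarrow> of_int m *\<^sub>R c (c u) = pact \<sigma> q u"
      by (elim exE conjE)
    have "of_int m *s (\<gamma> *s v) = ev q z *s v"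
      using mq(2)[rule_format, OF not_dvd_range[OF i] v(1)] by (simp add: ccv pact_eig[OF v(1)] scaleR_eq_scale z_def)
    hence "(of_int m * \<gamma> - ev q z) *s v = 0" by (simp add: vec.scale_left_diff_distrib)
    hence "ev q z \<noteq> 0" using v(2) mq(1) \<open>\<gamma> \<noteq> 0\<close> by auto
    hence evq: "ev q (w ^ j) \<noteq> 0" if "j \<in> {1..<p}" for j
      using ev_conj_iff[OF not_dvd_range[OF i], of q] ev_conj_iff[OF not_dvd_range[OF that], of q] by (simp add: z_def)
    have inj: "u = 0" if j: "j \<in> {1..<p}" and u: "u \<in> eig j" "c u = 0" for j u
    proof -
      have "ev q (w ^ j) *s u = 0"
        using mq(2)[rule_format, OF not_dvd_range[OF j] u(1)] by (simp add: u(2) linear_0[OF c_lin] pact_eig[OF u(1)])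
      thus ?thesis using evq[OF j] by simp
    qed
    have ne: "eig (p - j) \<noteq> {0}" if j: "j \<in> {1..<p}" "eig j \<noteq> {0}" for j
    proof -
      obtain u where u: "u \<in> eig j" "u \<noteq> 0" using j(2) eig_0 by blast
      hence "c u \<noteq> 0" using inj[OF j(1)] by blast
      thus ?thesis using swap'[OF j(1) u(1)] by blast
    qed
    have k': "p - k \<in> {1..<p}" "p - (p - k) = k" using k(1) by auto
    have ek: "eig k = {0}"
      using small[OF k(1)] ne[OF k(1)] k(2) by blast
    hence ek': "eig (p - k) = {0}"
      using ne[OF k'(1)] unfolding k'(2) by blast
    have "id v = 0"
      by (rule galois_vanish[OF linear_id _ k(1) _ _ v(1) not_dvd_range[OF i]]) (use ek ek' in auto)
    thus False using v(2) by simp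
  qed
  hence "B' = 0" using B' h by simp
  have "\<forall>u\<in>eig (p - i). a u = A *s u"
  proof
    fix u assume "u \<in> eig (p - i)"
    from bspec[OF v'(3) this] obtain t where "u = t *s v'" by (rule exE)
    thus "a u = A *s u" using av' \<open>B = 0\<close> by (simp add: clinear_scale[OF a'(1)] mult.commute)
  qed
  moreover have "\<forall>u\<in>eig i. a u = cnj A *s u"
  proof
    fix u assume "u \<in> eig i"
    from bspec[OF v(3) this] obtain t where "u = t *s v" by (rule exE)
    thus "a u = cnj A *s u" using av \<open>B' = 0\<close> by (simp add: clinear_scale[OF a'(1)] mult.commute)
  qed
  ultimately show ?thesis by blast
qed

text \<open>Phi(\<sigma>) is p on \<open>eig 0\<close> and 0 on the moved eigenspaces, so
  \<open>Phi\<close> and p - \<open>Phi\<close> act as p times the two projections. They glue the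
  rational scalar on \<open>eig 0\<close> to q1 elsewhere.\<close>

lemma pact_combine:
  assumes a: "clinear a" "a ` L \<subseteq> L"
    and s: "\<And>v. v \<in> eig 0 \<Longrightarrow> a v = of_real s *s v"
    and m1: "m1 \<noteq> 0" and q1: "\<And>j v. \<not> p dvd j \<Longrightarrow> v \<in> eig j \<Longrightarrow> of_int m1 *\<^sub>R a v = pact \<sigma> q1 v"
  shows "\<exists>m q. m \<noteq> 0 \<and> (\<forall>v. of_int m *\<^sub>R a v = pact \<sigma> q v)"
proof -
  have "\<exists>s'\<in>\<rat>. \<forall>v\<in>eig 0. a v = of_real s' *s v"
  proof (cases "eig 0 = {0}")
    case True
    thus ?thesis using linear_0[OF clinear_imp_linear[OF a(1)]] by (intro bexI[of _ 0]) auto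
  next
    case False
    have "s \<in> \<rat>"
      by (rule real_eig_scalar_rational[OF a(2), of 0 1]) (use s False in auto)
    thus ?thesis using s by blast
  qed
  then obtain s' where s': "s' \<in> \<rat>" "\<And>v. v \<in> eig 0 \<Longrightarrow> a v = of_real s' *s v" by blast
  from s'(1) obtain r t :: int where rt: "t > 0" "s' = of_int r / of_int t" by (rule Rats_cases')
  define q where "q = of_int t * ((of_nat p - Phi) * q1) + of_int (r * m1) * Phi"
  define m where "m = int p * t * m1"
  have lin: "linear (\<lambda>v. of_int m *\<^sub>R a v)"
    by (intro linear_compose_scale_right clinear_imp_linear[OF a(1)])
  have "of_int m *\<^sub>R a v = pact \<sigma> q v" for v
  proof (rule eig_eqI[where f = "\<lambda>v. of_int m *\<^sub>R a v", OF lin pact_linear[OF s_clinear]])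
    fix j v assume j: "j < p" and v: "v \<in> eig j"
    show "of_int m *\<^sub>R a v = pact \<sigma> q v"
    proof (cases "j = 0")
      case True
      have "ev q (w ^ j) = of_int (r * m1) * of_nat p"
        using True by (simp add: q_def ev_at_1 poly_Phi_1)
      moreover have "of_int m *\<^sub>R a v = (of_int m * of_real s') *s v"
        using s'(2)[of v] v True by (simp add: scaleR_eq_scale)
      moreover have "of_int m * of_real s' = (of_int (r * m1) * of_nat p :: complex)"
      proof -
        have "complex_of_real s' = of_int r / of_int t" using rt(2) by simp
        thus ?thesis using rt(1) by (simp add: m_def)
      qed
      ultimately show ?thesis by (simp add: pact_eig[OF v])
    next
      case False
      hence j': "\<not> p dvd j" using j by (auto dest: dvd_imp_le)
      have "ev Phi (w ^ j) = 0" using ev_Phi_w ev_conj_iff[OF j'] by blast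
      hence "ev q (w ^ j) = of_int (int p * t) * ev q1 (w ^ j)"
        by (simp add: q_def)
      moreover have "of_int m *\<^sub>R a v = of_int (int p * t) *\<^sub>R (of_int m1 *\<^sub>R a v)"
        by (simp add: m_def)
      ultimately show ?thesis
        unfolding q1[OF j' v] pact_eig[OF v] by (simp add: scaleR_eq_scale)
    qed
  qed
  moreover have "m \<noteq> 0" using rt(1) m1 p_gt_1 by (simp add: m_def)
  ultimately show ?thesis by blast
qed

lemma generic_End_pact_2:
  assumes "p = 2" and a: "a \<in> generic_End L H \<sigma>"
  shows "\<exists>m q. m \<noteq> 0 \<and> (\<forall>v. of_int m *\<^sub>R a v = pact \<sigma> q v)"
proof -
  note a' = generic_EndD[OF a]
  have "w\<^sup>2 = 1" using w_pow assms(1) by simp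
  hence w: "w = -1" using w_ne_1 by (simp add: power2_eq_1_iff)
  obtain s where s: "\<forall>v\<in>eig 0. a v = of_real s *s v"
    using generic_End_real_eig[OF a, of 0] by auto
  obtain t where t: "\<forall>v\<in>eig 1. a v = of_real t *s v"
    using generic_End_real_eig[OF a, of 1] w by auto
  have "\<exists>t'\<in>\<rat>. \<forall>v\<in>eig 1. a v = of_real t' *s v"
  proof (cases "eig 1 = {0}")
    case True
    thus ?thesis using linear_0[OF a'(3)] by (intro bexI[of _ 0]) auto
  next
    case False
    have "t \<in> \<rat>"
      by (rule real_eig_scalar_rational[OF a'(2), of 1 "-1"]) (use t False w in auto)
    thus ?thesis using t by blast
  qed
  then obtain t' where t': "t' \<in> \<rat>" "\<And>v. v \<in> eig 1 \<Longrightarrow> a v = of_real t' *s v" by blast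
  from t'(1) obtain k m :: int where km: "m > 0" "t' = of_int k / of_int m" by (rule Rats_cases')
  show ?thesis
  proof (rule pact_combine[OF a'(1,2), of s m "[:k:]"])
    fix j v assume j: "\<not> p dvd j" and v: "v \<in> eig j"
    have "j mod p = 1" using j assms(1) by presburger
    hence v1: "v \<in> eig 1" using v eig_mod[of j] by simp
    show "of_int m *\<^sub>R a v = pact \<sigma> [:k:] v"
    proof -
      have "complex_of_real t' = of_int k / of_int m" using km(2) by simp
      thus ?thesis using km(1) by (simp add: t'(2)[OF v1] pact_const[OF s_clinear] scaleR_eq_scale)
    qed
  qed (use s km in auto)
qed

text \<open>Either some pair of nonzero eigenspaces has a member that is not a line, and a is scalar
  on that pair, or the given pair consists of lines and the index k is used.\<close>

lemma generic_End_pact_odd: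
  assumes odd: "odd p" and a: "a \<in> generic_End L H \<sigma>"
    and i: "i \<in> {1..<p}" "eig i \<noteq> {0}" "eig (p - i) \<noteq> {0}"
    and k: "k \<in> {1..<p}" "\<not> one_dim k"
  shows "\<exists>m q. m \<noteq> 0 \<and> (\<forall>v. of_int m *\<^sub>R a v = pact \<sigma> q v)"
proof -
  note a' = generic_EndD[OF a]
  have "\<exists>i \<kappa>. i \<in> {1..<p} \<and> eig i \<noteq> {0} \<and> (\<forall>v\<in>eig (p - i). a v = \<kappa> *s v) \<and> (\<forall>v\<in>eig i. a v = cnj \<kappa> *s v)"
  proof (cases "\<exists>j\<in>{1..<p}. eig j \<noteq> {0} \<and> eig (p - j) \<noteq> {0} \<and> \<not> one_dim j")
    case True
    then obtain j where "j \<in> {1..<p}" "eig j \<noteq> {0}" "eig (p - j) \<noteq> {0}" "\<not> one_dim j" by blast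
    thus ?thesis using generic_End_big_pair[OF odd a] by blast
  next
    case False
    have i': "p - i \<in> {1..<p}" "p - (p - i) = i" using i(1) by auto
    have "one_dim i" "one_dim (p - i)"
      using False i i' by metis+
    from generic_End_small_pair[OF odd a i(1) this _ k] False show ?thesis
      using i(1,2) by blast
  qed
  then obtain i \<kappa> where i: "i \<in> {1..<p}" "eig i \<noteq> {0}"
      and \<kappa>: "\<forall>v\<in>eig (p - i). a v = \<kappa> *s v" "\<forall>v\<in>eig i. a v = cnj \<kappa> *s v"
    by (elim exE conjE)
  have comm: "a (\<sigma> v) = \<sigma> (a v)" for v
    by (rule commutes_with_eig_scalars[OF a i(1)]) (use \<kappa> in auto)
  have "\<exists>m q. m \<noteq> 0 \<and> (\<forall>j v. \<not> p dvd j \<longrightarrow> v \<in> eig j \<longrightarrow> of_int m *\<^sub>R a v = pact \<sigma> q v)"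
    by (rule scalar_on_pair_imp_pact[OF odd a'(1,2) comm i, of "cnj \<kappa>"]) (use \<kappa> in auto)
  then obtain m1 q1 where m1: "m1 \<noteq> 0" and q1: "\<forall>j v. \<not> p dvd j \<longrightarrow> v \<in> eig j \<longrightarrow> of_int m1 *\<^sub>R a v = pact \<sigma> q1 v"
    by (elim exE conjE)
  obtain s where s: "\<forall>v\<in>eig 0. a v = of_real s *s v"
    using generic_End_real_eig[OF a, of 0] by auto
  show ?thesis
    by (rule pact_combine[OF a'(1,2) _ m1]) (use s q1 in auto)
qed

section \<open>The rank of Z[\<sigma>] and its comparison with End(A)\<close>

lemma pact_reduce: "\<exists>c :: nat \<Rightarrow> int. \<forall>v. pact \<sigma> q v = (\<Sum>k<p. of_int (c k) *\<^sub>R (\<sigma> ^^ k) v)"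
proof -
  obtain c r where q: "q = (\<Sum>k<p. monom (c k) k) + (monom 1 p - 1) * r"
    using poly_reduce[of p q] p_gt_1 by auto
  have "pact \<sigma> ((monom 1 p - 1) * r) v = 0" for v
    by (simp add: pact_mult[OF s_clinear] pact_diff[OF s_clinear] pact_monom[OF s_clinear] s_pow pact_1[OF s_clinear])
  hence "pact \<sigma> q v = (\<Sum>k<p. of_int (c k) *\<^sub>R (\<sigma> ^^ k) v)" for v
    unfolding q by (simp add: pact_add[OF s_clinear] pact_sum[OF s_clinear] pact_monom[OF s_clinear])
  thus ?thesis by blast
qed

text \<open>The rank of Z[\<sigma>]: the relation Phi(\<sigma>) = 0 holds exactly when \<sigma> has
  no nonzero fixed vector.\<close>

definition pact_rank :: nat
  where "pact_rank = (if \<forall>v. pact \<sigma> Phi v = 0 then p - 1 else p)"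

lemma pact_Phi: "pact \<sigma> Phi v = (\<Sum>k<p. (\<sigma> ^^ k) v)"
  by (simp add: Phi_def pact_sum[OF s_clinear] pact_monom[OF s_clinear])

lemma pact_multiple_span:
  assumes "m \<noteq> 0" "\<And>v. of_int m *\<^sub>R f v = pact \<sigma> q v"
  shows "\<exists>c :: nat \<Rightarrow> real. \<forall>v. f v = (\<Sum>k<pact_rank. c k *\<^sub>R (\<sigma> ^^ k) v)"
proof -
  obtain c :: "nat \<Rightarrow> int" where c: "\<And>v. pact \<sigma> q v = (\<Sum>k<p. of_int (c k) *\<^sub>R (\<sigma> ^^ k) v)"
    using pact_reduce by blast
  have f: "f v = (\<Sum>k<p. (of_int (c k) / of_int m) *\<^sub>R (\<sigma> ^^ k) v)" for v
  proof -
    have "f v = (1 / of_int m) *\<^sub>R (of_int m *\<^sub>R f v)" using assms(1) by simp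
    thus ?thesis unfolding assms(2) c by (simp add: scaleR_sum_right)
  qed
  show ?thesis
  proof (cases "\<forall>v. pact \<sigma> Phi v = 0")
    case False
    hence "pact_rank = p" unfolding pact_rank_def by (rule if_not_P)
    thus ?thesis using f by (intro exI[of _ "\<lambda>k. of_int (c k) / of_int m"]) simp
  next
    case True
    define n where "n = p - 1"
    have n: "p = Suc n" using p_gt_1 by (simp add: n_def)
    have pn: "pact_rank = n" using True unfolding pact_rank_def n_def by (rule if_P)
    have last: "(\<sigma> ^^ n) v = - (\<Sum>k<n. (\<sigma> ^^ k) v)" for v
    proof -
      have "(\<Sum>k<p. (\<sigma> ^^ k) v) = 0"
        using True[rule_format, of v] unfolding pact_Phi .
      hence "(\<Sum>k<n. (\<sigma> ^^ k) v) + (\<sigma> ^^ n) v = 0"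
        unfolding n sum.lessThan_Suc .
      thus ?thesis by (simp add: eq_neg_iff_add_eq_0 add.commute)
    qed
    have "f v = (\<Sum>k<n. (of_int (c k) / of_int m - of_int (c n) / of_int m) *\<^sub>R (\<sigma> ^^ k) v)" for v
    proof -
      have "f v = (\<Sum>k<n. (of_int (c k) / of_int m) *\<^sub>R (\<sigma> ^^ k) v) + (of_int (c n) / of_int m) *\<^sub>R (\<sigma> ^^ n) v"
        unfolding f by (simp only: n sum.lessThan_Suc)
      also have "\<dots> = (\<Sum>k<n. (of_int (c k) / of_int m - of_int (c n) / of_int m) *\<^sub>R (\<sigma> ^^ k) v)"
        unfolding last by (simp add: scaleR_diff_left sum_subtractf scaleR_sum_right)
      finally show ?thesis .
    qed
    thus ?thesis unfolding pn
      by (intro exI[of _ "\<lambda>k. of_int (c k) / of_int m - of_int (c n) / of_int m"] allI)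
  qed
qed

lemma End_rank_le_pact_rank:
  assumes L': "is_lattice L'" and pact: "\<And>f. f \<in> torus_End L' \<Longrightarrow> \<exists>m q. m \<noteq> 0 \<and> (\<forall>v. of_int m *\<^sub>R f v = pact \<sigma> q v)"
  shows "End_rank L' \<le> pact_rank"
proof (rule End_rank_le)
  fix B assume B: "finite B" "B \<subseteq> torus_End L'" "int_independent B"
  show "card B \<le> pact_rank"
  proof (rule card_le_of_real_span[OF L' B, of _ "\<lambda>k. \<sigma> ^^ k"])
    show "clinear (\<sigma> ^^ k)" for k by (rule funpow_clinear[OF s_clinear])
    fix f assume "f \<in> B"
    hence "f \<in> torus_End L'" using B(2) by blast
    from pact[OF this] obtain m q where "m \<noteq> 0" "\<forall>v. of_int m *\<^sub>R f v = pact \<sigma> q v"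
      by (elim exE conjE)
    thus "\<exists>c :: nat \<Rightarrow> real. \<forall>v. f v = (\<Sum>k<pact_rank. c k *\<^sub>R (\<sigma> ^^ k) v)"
      by (intro pact_multiple_span) auto
  qed
qed

lemma ex_eig_ne_0: "\<exists>j. j \<in> {1..<p} \<and> eig j \<noteq> {0}"
proof (rule ccontr)
  assume *: "\<not> ?thesis"
  have "\<sigma> v = v" for v
  proof (rule eig_eqI[OF s_linear linear_ident])
    fix j v assume j: "j < p" and v: "v \<in> eig j"
    show "\<sigma> v = v"
    proof (cases "j = 0")
      case True
      thus ?thesis using eigD[OF v] by simp
    next
      case False
      hence "eig j = {0}" using * j by auto
      thus ?thesis using v linear_0[OF s_linear] by simp
    qed
  qed
  thus False using s_ne_id by (simp add: fun_eq_iff)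
qed

lemma pact_eq_0_imp_root:
  assumes "\<And>v. pact \<sigma> q v = 0"
  shows "ev q w = 0"
proof -
  obtain j where j: "j \<in> {1..<p}" "eig j \<noteq> {0}" using ex_eig_ne_0 by blast
  then obtain v where v: "v \<in> eig j" "v \<noteq> 0" using eig_0 by blast
  have "ev q (w ^ j) = 0" using assms[of v] v(2) by (simp add: pact_eig[OF v(1)])
  thus ?thesis using ev_conj_iff[OF not_dvd_range[OF j(1)]] by blast
qed

lemma power_relation_trivial:
  fixes c :: "nat \<Rightarrow> int"
  assumes "\<And>v. (\<Sum>k<pact_rank. of_int (c k) *\<^sub>R (\<sigma> ^^ k) v) = 0" and "k < pact_rank"
  shows "c k = 0"
proof -
  \<comment> \<open>Padding by 0 up to p: for rank p - 1 the last coefficient is 0, so the equality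
    of all coefficients already finishes the proof.\<close>
  define e where "e k = (if k < pact_rank then c k else 0)" for k
  define q where "q = (\<Sum>k<p. monom (e k) k)"
  have le: "pact_rank \<le> p" by (simp add: pact_rank_def)
  have "pact \<sigma> q v = (\<Sum>k<p. of_int (e k) *\<^sub>R (\<sigma> ^^ k) v)" for v
    by (simp add: q_def pact_sum[OF s_clinear] pact_monom[OF s_clinear])
  also have "\<dots> v = (\<Sum>k<pact_rank. of_int (c k) *\<^sub>R (\<sigma> ^^ k) v)" for v
    using le by (intro sum.mono_neutral_cong_right) (auto simp: e_def)
  finally have q0: "pact \<sigma> q v = 0" for v using assms(1) by simp
  have "(\<Sum>k<p. of_int (e k) * w ^ k) = 0"
    using pact_eq_0_imp_root[OF q0] by (simp add: q_def ev_sum)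
  hence eq: "e j = e (p - 1)" if "j < p" for j
    by (rule power_sum_eq_0_imp[OF _ that])
  have "e (p - 1) = 0"
  proof (cases "\<forall>v. pact \<sigma> Phi v = 0")
    case True
    thus ?thesis by (simp add: e_def pact_rank_def)
  next
    case False
    then obtain v where v: "pact \<sigma> Phi v \<noteq> 0" by blast
    have "pact \<sigma> q v = (\<Sum>k<p. of_int (e k) *\<^sub>R (\<sigma> ^^ k) v)"
      by (simp add: q_def pact_sum[OF s_clinear] pact_monom[OF s_clinear])
    also have "\<dots> = (\<Sum>k<p. of_int (e (p - 1)) *\<^sub>R (\<sigma> ^^ k) v)"
      by (rule sum.cong[OF refl], subst eq) simp_all
    also have "\<dots> = of_int (e (p - 1)) *\<^sub>R pact \<sigma> Phi v"
      by (simp only: pact_Phi scaleR_sum_right)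
    finally show ?thesis using q0[of v] v by simp
  qed
  thus ?thesis using eq[of k] assms(2) le by (simp add: e_def)
qed

text \<open>The powers of \<sigma> already fill the rank, so f depends on them; its own coefficient
  is nonzero because the powers are independent.\<close>

lemma End_multiple_pact:
  assumes rank: "End_rank L \<le> pact_rank" and f: "f \<in> torus_End L"
  shows "\<exists>m q. m \<noteq> 0 \<and> (\<forall>v. of_int m *\<^sub>R f v = pact \<sigma> q v)"
proof -
  let ?B = "(\<lambda>k. \<sigma> ^^ k) ` {..<pact_rank}"
  have le: "pact_rank \<le> p" by (simp add: pact_rank_def)
  have inj: "inj_on (\<lambda>k. \<sigma> ^^ k) {..<p}"
  proof (rule linorder_inj_onI)
    fix i j assume ij: "i < j" "i \<in> {..<p}" "j \<in> {..<p}"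
    have bi: "bij (\<sigma> ^^ i)" using s_bij by (rule bij_fn)
    show "\<sigma> ^^ i \<noteq> \<sigma> ^^ j"
    proof
      assume eq: "\<sigma> ^^ i = \<sigma> ^^ j"
      have "(\<sigma> ^^ i) ((\<sigma> ^^ (j - i)) v) = (\<sigma> ^^ i) v" for v
        using ij(1) eq by (metis comp_apply funpow_add le_add_diff_inverse less_imp_le_nat)
      hence "(\<sigma> ^^ (j - i)) v = v" for v
        using bij_is_inj[OF bi] by (simp add: inj_eq)
      hence "\<sigma> ^^ (j - i) = id" by (simp add: fun_eq_iff)
      hence "p dvd j - i" using ord by blast
      thus False using ij by (auto dest: dvd_imp_le)
    qed
  qed auto
  have injr: "inj_on (\<lambda>k. \<sigma> ^^ k) {..<pact_rank}" by (rule inj_on_subset[OF inj]) (use le in auto)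
  show ?thesis
  proof (cases "f \<in> ?B")
    case True
    then obtain k where "f = \<sigma> ^^ k" by blast
    hence "of_int 1 *\<^sub>R f v = pact \<sigma> (monom 1 k) v" for v
      by (simp add: pact_monom[OF s_clinear])
    thus ?thesis by (intro exI[of _ 1] exI[of _ "monom 1 k"]) simp
  next
    case False
    have pwL: "(\<sigma> ^^ k) ` L \<subseteq> L" for k
      using s_lattice by (induction k) auto
    have sub: "insert f ?B \<subseteq> torus_End L"
      using f pwL funpow_clinear[OF s_clinear] by (auto simp: torus_End_def)
    have card: "card (insert f ?B) = Suc pact_rank"
      using False card_image[OF injr] by simp
    have "\<not> int_independent (insert f ?B)"
    proof
      assume ii: "int_independent (insert f ?B)"
      have "card (insert f ?B) \<le> End_rank L"
        by (rule card_le_End_rank[OF lat _ sub ii]) simp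
      thus False using rank card by linarith
    qed
    then obtain c :: "(complex^'g \<Rightarrow> complex^'g) \<Rightarrow> int" and h
      where c: "\<forall>v. (\<Sum>g\<in>insert f ?B. of_int (c g) *\<^sub>R g v) = 0" and h: "h \<in> insert f ?B" "c h \<noteq> 0"
      unfolding int_independent_def not_all not_imp by (elim exE conjE) (unfold not_all ball_simps, blast)
    have rel: "of_int (c f) *\<^sub>R f v + (\<Sum>k<pact_rank. of_int (c (\<sigma> ^^ k)) *\<^sub>R (\<sigma> ^^ k) v) = 0" for v
      using c[rule_format, of v] False by (simp add: sum.reindex[OF injr])
    have "c f \<noteq> 0"
    proof
      assume "c f = 0"
      hence "c (\<sigma> ^^ k) = 0" if "k < pact_rank" for k
        using power_relation_trivial[of "\<lambda>k. c (\<sigma> ^^ k)" k] rel that by simp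
      thus False using h \<open>c f = 0\<close> by auto
    qed
    define q where "q = - (\<Sum>k<pact_rank. monom (c (\<sigma> ^^ k)) k)"
    have "of_int (c f) *\<^sub>R f v = pact \<sigma> q v" for v
      using rel[of v] by (simp add: q_def pact_uminus[OF s_clinear] pact_sum[OF s_clinear]
        pact_monom[OF s_clinear] eq_neg_iff_add_eq_0)
    with \<open>c f \<noteq> 0\<close> show ?thesis by (intro exI conjI allI)
  qed
qed

end

section \<open>Generic deformations\<close>

definition vcnj :: "complex^'n \<Rightarrow> complex^'n"
  where "vcnj v = (\<chi> i. cnj (v $ i))"

lemma vcnj_add: "vcnj (x + y) = vcnj x + vcnj y"
  and vcnj_scale: "vcnj (c *s x) = cnj c *s vcnj x"
  and vcnj_vcnj [simp]: "vcnj (vcnj x) = x"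
  by (simp_all add: vcnj_def vec_eq_iff)

text \<open>Antilinear maps are parametrised by matrices to have a finite-dimensional normed space
  in which the Baire argument can take place.\<close>

definition amap :: "complex^'g^'g::finite \<Rightarrow> complex^'g \<Rightarrow> complex^'g"
  where "amap A v = A *v vcnj v"

lemma amap_antilinear: "antilinear (amap A)"
  by (simp add: antilinear_def amap_def vcnj_add vcnj_scale matrix_vector_right_distrib vector_scalar_commute)

lemma antilinear_eq_amap: "antilinear S \<Longrightarrow> S = amap (matrix (\<lambda>v. S (vcnj v)))"
proof -
  assume S: "antilinear S"
  have "clinear (\<lambda>v. S (vcnj v))"
    using S by (simp add: clinear_iff antilinear_def vcnj_add vcnj_scale)
  from matrix_works[OF this] show ?thesis by (simp add: amap_def fun_eq_iff)
qed

lemma antilinear_add: "antilinear S \<Longrightarrow> S (x + y) = S x + S y"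
  and antilinear_scale: "antilinear S \<Longrightarrow> S (c *s x) = cnj c *s S x"
  by (simp_all add: antilinear_def)

lemma antilinear_imp_linear: "antilinear S \<Longrightarrow> linear S"
  by (rule linearI) (simp_all add: antilinear_def scaleR_eq_scale)

lemma amap_add_left: "amap (A + B) v = amap A v + amap B v"
  by (simp add: amap_def matrix_vector_mult_add_rdistrib)

lemma amap_scaleR_left: "amap (r *\<^sub>R A) v = r *\<^sub>R amap A v"
  by (simp add: amap_def vec_eq_iff matrix_vector_mult_def scaleR_sum_right)

lemma amap_0_left [simp]: "amap 0 v = 0"
  by (simp add: amap_def)

lemma bounded_bilinear_amap: "bounded_bilinear (amap :: complex^'g^'g::finite \<Rightarrow> complex^'g \<Rightarrow> complex^'g)"
proof -
  have "linear (\<lambda>A. amap A v)" for v :: "complex^'g"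
    by (rule linearI) (simp_all add: amap_add_left amap_scaleR_left)
  hence "bilinear (amap :: complex^'g^'g::finite \<Rightarrow> complex^'g \<Rightarrow> complex^'g)"
    using antilinear_imp_linear[OF amap_antilinear] unfolding bilinear_def by (intro conjI allI)
  thus ?thesis by (simp add: bilinear_conv_bounded_bilinear)
qed

lemma bounded_bilinear_herm:
  fixes H :: "('g::finite) hform"
  assumes H: "pos_def_hermitian H"
  shows "bounded_bilinear H"
proof -
  have "bilinear H"
    unfolding bilinear_def
    by (intro conjI allI linearI)
      (simp_all add: herm_add_left[OF H] herm_add_right[OF H] herm_scaleR_left[OF H] herm_scaleR_right[OF H] scaleR_conv_of_real[where 'a = complex])
  thus ?thesis by (simp add: bilinear_conv_bounded_bilinear)
qed

lemma herm_norm_lower: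
  fixes H :: "('g::finite) hform"
  assumes H: "pos_def_hermitian H"
  shows "\<exists>c>0. \<forall>x. c * (norm x)\<^sup>2 \<le> Re (H x x)"
proof -
  have cont: "continuous_on (sphere 0 1) (\<lambda>x. Re (H x x))"
    by (intro continuous_intros bounded_bilinear.continuous_on[OF bounded_bilinear_herm[OF H]])
  obtain x :: "complex^'g" where "norm x = 1" using vector_choose_size[of 1] by auto
  hence "x \<in> sphere 0 1" by simp
  hence ne: "(sphere 0 1 :: (complex^'g) set) \<noteq> {}" by blast
  from continuous_attains_inf[OF compact_sphere ne cont]
  obtain x0 where x0: "x0 \<in> sphere 0 1" "\<And>x. x \<in> sphere 0 1 \<Longrightarrow> Re (H x0 x0) \<le> Re (H x x)"
    by blast
  have "x0 \<noteq> 0" using x0(1) by auto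
  have "Re (H x0 x0) * (norm x)\<^sup>2 \<le> Re (H x x)" for x
  proof (cases "x = 0")
    case False
    let ?y = "(1 / norm x) *\<^sub>R x"
    have "?y \<in> sphere 0 1" using False by simp
    hence "Re (H x0 x0) \<le> Re (H ?y ?y)" by (rule x0(2))
    also have "Re (H ?y ?y) = Re (H x x) / (norm x)\<^sup>2"
      by (simp add: herm_scaleR_left[OF H] herm_scaleR_right[OF H] power2_eq_square flip: of_real_mult)
    finally show ?thesis using False by (simp add: pos_le_divide_eq)
  qed (simp add: herm_0_left[OF H])
  thus ?thesis using herm_pos[OF H \<open>x0 \<noteq> 0\<close>] by blast
qed

text \<open>Contraction in the norm of H keeps the deformed form positive definite and makes 1 + S,
  1 - S and 1 - S^2 invertible for S = \<open>amap A\<close>.\<close>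

lemma amap_contracting:
  fixes H :: "('g::finite) hform"
  assumes H: "pos_def_hermitian H"
  shows "\<exists>e>0. \<forall>A. norm A < e \<longrightarrow> (\<forall>x. x \<noteq> 0 \<longrightarrow> Re (H (amap A x) (amap A x)) < Re (H x x))"
proof -
  obtain c where c: "c > 0" "\<forall>x. c * (norm x)\<^sup>2 \<le> Re (H x x)" using herm_norm_lower[OF H] by (elim exE conjE)
  obtain C where C: "C > 0" "\<forall>x y. norm (H x y) \<le> norm x * norm y * C"
    using bounded_bilinear.pos_bounded[OF bounded_bilinear_herm[OF H]] by (elim exE conjE)
  obtain K where K: "K > 0" "\<forall>A x. norm (amap A x :: complex^'g) \<le> norm A * norm x * K"
    using bounded_bilinear.pos_bounded[OF bounded_bilinear_amap] by (elim exE conjE)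
  \<comment> \<open>C bounds H, K bounds \<open>amap\<close>, and c comes from compactness of the
    unit sphere. The cap at 1 allows the square of the norm of A to be replaced by the norm.\<close>
  define e where "e = min 1 (c / (C * K\<^sup>2))"
  have e: "e > 0" using c C K by (simp add: e_def)
  have "Re (H (amap A x) (amap A x)) < Re (H x x)" if A: "norm A < e" and x: "x \<noteq> 0" for A x
  proof -
    have "Re (H (amap A x) (amap A x)) \<le> norm (amap A x) * norm (amap A x) * C"
      by (rule order_trans[OF complex_Re_le_cmod C(2)[rule_format]])
    also have "\<dots> \<le> (norm A * norm x * K) * (norm A * norm x * K) * C"
      using K C(1) by (intro mult_right_mono mult_mono) auto
    also have "\<dots> = (norm A * norm A) * ((norm x)\<^sup>2 * K\<^sup>2 * C)" by (simp add: power2_eq_square mult_ac)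
    also have "\<dots> \<le> norm A * ((norm x)\<^sup>2 * K\<^sup>2 * C)"
    proof (rule mult_right_mono)
      have "norm A \<le> 1" using A by (simp add: e_def)
      thus "norm A * norm A \<le> norm A" by (simp add: mult_left_le)
    qed (use C in simp)
    also have "\<dots> < (c / (C * K\<^sup>2)) * ((norm x)\<^sup>2 * K\<^sup>2 * C)"
      using A x K C by (intro mult_strict_right_mono) (auto simp: e_def)
    also have "\<dots> = c * (norm x)\<^sup>2" using K C by (simp add: field_simps)
    also have "\<dots> \<le> Re (H x x)" by (rule c(2)[rule_format])
    finally show ?thesis .
  qed
  thus ?thesis using e by blast
qed

section \<open>The obstruction to remaining complex linear\<close>

definition lin_part :: "(complex^'g \<Rightarrow> complex^'g) \<Rightarrow> complex^'g \<Rightarrow> complex^'g"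
  where "lin_part \<phi> v = (1/2) *s (\<phi> v - \<i> *s \<phi> (\<i> *s v))"

definition anti_part :: "(complex^'g \<Rightarrow> complex^'g) \<Rightarrow> complex^'g \<Rightarrow> complex^'g"
  where "anti_part \<phi> v = (1/2) *s (\<phi> v + \<i> *s \<phi> (\<i> *s v))"

lemma lin_anti_part: "\<phi> v = lin_part \<phi> v + anti_part \<phi> v"
  by (simp add: lin_part_def anti_part_def vec_eq_iff)

lemma complex_scale_split:
  fixes \<phi> :: "complex^'g::finite \<Rightarrow> complex^'g"
  assumes "linear \<phi>"
  shows "\<phi> (c *s v) = of_real (Re c) *s \<phi> v + of_real (Im c) *s \<phi> (\<i> *s v)"
proof -
  have "c *s v = Re c *\<^sub>R v + Im c *\<^sub>R (\<i> *s v)"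
    by (simp add: vec_eq_iff complex_eq_iff)
  hence "\<phi> (c *s v) = Re c *\<^sub>R \<phi> v + Im c *\<^sub>R \<phi> (\<i> *s v)"
    by (simp only: linear_add[OF assms] linear_scale[OF assms])
  thus ?thesis by (simp only: scaleR_eq_scale)
qed

lemma lin_part_clinear:
  fixes \<phi> :: "complex^'g::finite \<Rightarrow> complex^'g"
  assumes \<phi>: "linear \<phi>"
  shows "clinear (lin_part \<phi>)"
proof -
  have 1: "\<phi> (\<i> *s (\<i> *s v)) = - \<phi> v" for v
    using linear_neg[OF \<phi>, of v] by simp
  have "lin_part \<phi> (c *s v) = c *s lin_part \<phi> v" for c v
  proof -
    have "\<phi> (\<i> *s (c *s v)) = \<phi> (c *s (\<i> *s v))" by (simp add: mult.commute)
    hence F: "\<phi> (\<i> *s (c *s v)) = of_real (Re c) *s \<phi> (\<i> *s v) - of_real (Im c) *s \<phi> v"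
      unfolding complex_scale_split[OF \<phi>, of c "\<i> *s v"] 1 by simp
    show ?thesis
      unfolding lin_part_def F complex_scale_split[OF \<phi>, of c v]
      by (simp add: vec_eq_iff complex_eq_iff field_simps)
  qed
  thus ?thesis
    unfolding clinear_iff
    by (simp add: lin_part_def linear_add[OF \<phi>] vec.scale_right_distrib vec.scale_right_diff_distrib)
qed

lemma anti_part_antilinear:
  fixes \<phi> :: "complex^'g::finite \<Rightarrow> complex^'g"
  assumes \<phi>: "linear \<phi>"
  shows "antilinear (anti_part \<phi>)"
proof -
  have 1: "\<phi> (\<i> *s (\<i> *s v)) = - \<phi> v" for v
    using linear_neg[OF \<phi>, of v] by simp
  have "anti_part \<phi> (c *s v) = cnj c *s anti_part \<phi> v" for c v
  proof -
    have "\<phi> (\<i> *s (c *s v)) = \<phi> (c *s (\<i> *s v))" by (simp add: mult.commute)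
    hence F: "\<phi> (\<i> *s (c *s v)) = of_real (Re c) *s \<phi> (\<i> *s v) - of_real (Im c) *s \<phi> v"
      unfolding complex_scale_split[OF \<phi>, of c "\<i> *s v"] 1 by simp
    show ?thesis
      unfolding anti_part_def F complex_scale_split[OF \<phi>, of c v]
      by (simp add: vec_eq_iff complex_eq_iff field_simps)
  qed
  thus ?thesis
    unfolding antilinear_def
    by (simp add: anti_part_def linear_add[OF \<phi>] vec.scale_right_distrib)
qed

text \<open>With \<open>S = amap A\<close>, vanishing of \<open>obstruction \<phi> A\<close> means that \<open>(1 + S) \<circ> \<phi> \<circ> (1 + S)\<^sup>-\<^sup>1\<close> is complex linear.\<close>

definition obstruction :: "(complex^'g \<Rightarrow> complex^'g) \<Rightarrow> complex^'g^'g::finite \<Rightarrow> complex^'g \<Rightarrow> complex^'g"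
  where "obstruction \<phi> A v = anti_part \<phi> v + amap A (lin_part \<phi> v) - lin_part \<phi> (amap A v) - amap A (anti_part \<phi> (amap A v))"

lemma obstruction_continuous:
  assumes \<phi>: "linear \<phi>"
  shows "continuous_on UNIV (\<lambda>A. obstruction \<phi> A v)"
proof -
  have c1: "continuous_on UNIV (\<lambda>A. amap A (g A))" if "continuous_on UNIV g" for g :: "complex^'a^'a \<Rightarrow> complex^'a"
    by (rule bounded_bilinear.continuous_on[OF bounded_bilinear_amap continuous_on_id that])
  have lin: "linear (lin_part \<phi>)" "linear (anti_part \<phi>)"
    using clinear_imp_linear[OF lin_part_clinear[OF \<phi>]] antilinear_imp_linear[OF anti_part_antilinear[OF \<phi>]] by auto
  have c2: "continuous_on UNIV (\<lambda>A. f (amap A v))" if "linear f" for f :: "complex^'a \<Rightarrow> complex^'a"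
    using continuous_on_compose2[OF linear_continuous_on[OF linear_conv_bounded_linear[THEN iffD1, OF that], of UNIV] c1[OF continuous_on_const]] by simp
  show ?thesis
    unfolding obstruction_def
    by (intro continuous_on_add continuous_on_diff continuous_on_const c1 c2 lin)
qed

lemma obstruction_line:
  assumes \<phi>: "linear \<phi>"
  shows "\<exists>c1 c2. \<forall>t. obstruction \<phi> (A + t *\<^sub>R D) v = obstruction \<phi> A v + t *\<^sub>R c1 + (t * t) *\<^sub>R c2"
proof (intro exI allI)
  fix t
  have lin: "linear (lin_part \<phi>)" "linear (anti_part \<phi>)" "linear (amap A)" "linear (amap D)"
    using clinear_imp_linear[OF lin_part_clinear[OF \<phi>]] antilinear_imp_linear[OF anti_part_antilinear[OF \<phi>]]
      antilinear_imp_linear[OF amap_antilinear] by auto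
  show "obstruction \<phi> (A + t *\<^sub>R D) v = obstruction \<phi> A v +
      t *\<^sub>R (amap D (lin_part \<phi> v) - lin_part \<phi> (amap D v) - amap A (anti_part \<phi> (amap D v)) - amap D (anti_part \<phi> (amap A v))) +
      (t * t) *\<^sub>R (- amap D (anti_part \<phi> (amap D v)))"
    unfolding obstruction_def
    by (simp add: amap_add_left amap_scaleR_left linear_add[OF lin(1)] linear_add[OF lin(2)] linear_add[OF lin(3)]
      linear_add[OF lin(4)] linear_scale[OF lin(1)] linear_scale[OF lin(2)] linear_scale[OF lin(3)]
      linear_scale[OF lin(4)] scaleR_right_distrib scaleR_right_diff_distrib)
qed

context ppav_aut
begin

definition dspace :: "(complex^'g^'g) set"
  where "dspace = {A. deformation H \<sigma> (amap A)}"

lemma dspace_subspace: "subspace dspace"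
proof (rule subspaceI)
  show "0 \<in> dspace"
    by (simp add: dspace_def deformation_def amap_antilinear linear_0[OF s_linear] herm_0_left[OF herm])
  show "A + B \<in> dspace" if "A \<in> dspace" "B \<in> dspace" for A B
    using that by (simp add: dspace_def deformation_def amap_antilinear amap_add_left linear_add[OF s_linear] herm_add_left[OF herm])
  show "c *\<^sub>R A \<in> dspace" if "A \<in> dspace" for c A
    using that by (simp add: dspace_def deformation_def amap_antilinear amap_scaleR_left linear_scale[OF s_linear] herm_scaleR_left[OF herm])
qed

text \<open>On the line from A to B the obstruction is a quadratic polynomial in the parameter. If
  it vanished near 0, its values at 0, t and -t would force all coefficients to be 0, so it would
  vanish at B as well.\<close>

lemma obstruction_dense:
  assumes \<phi>: "linear \<phi>" and B: "B \<in> dspace" "obstruction \<phi> B v \<noteq> 0"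
  shows "dspace \<subseteq> closure {A \<in> dspace. obstruction \<phi> A v \<noteq> 0}"
proof
  fix A assume A: "A \<in> dspace"
  show "A \<in> closure {A \<in> dspace. obstruction \<phi> A v \<noteq> 0}"
  proof (rule ccontr)
    assume "\<not> ?thesis"
    then obtain e where e: "e > 0" "\<And>A'. A' \<in> dspace \<Longrightarrow> obstruction \<phi> A' v \<noteq> 0 \<Longrightarrow> \<not> dist A' A < e"
      unfolding closure_approachable by blast
    define D where "D = B - A"
    have line: "A + t *\<^sub>R D \<in> dspace" for t
      unfolding D_def by (intro subspace_add[OF dspace_subspace] subspace_scale[OF dspace_subspace] subspace_diff[OF dspace_subspace] A B)
    obtain c1 c2 where c: "\<And>t. obstruction \<phi> (A + t *\<^sub>R D) v = obstruction \<phi> A v + t *\<^sub>R c1 + (t * t) *\<^sub>R c2"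
      using obstruction_line[OF \<phi>] by blast
    define t where "t = e / (2 * (norm D + 1))"
    have tpos: "t > 0" using e(1) norm_ge_zero[of D] by (simp add: t_def add_nonneg_pos)
    have "t * norm D < e"
    proof -
      have "t * norm D \<le> t * (norm D + 1)" using tpos by simp
      also have "\<dots> = e / 2" using norm_ge_zero[of D] by (simp add: t_def field_simps add_nonneg_eq_0_iff)
      finally show ?thesis using e(1) by simp
    qed
    hence small: "obstruction \<phi> (A + s *\<^sub>R D) v = 0" if "\<bar>s\<bar> \<le> t" for s
      using e(2)[OF line[of s]] that mult_right_mono[OF that norm_ge_zero[of D]] by (auto simp: dist_norm)
    have c0: "obstruction \<phi> A v = 0" using small[of 0] tpos by simp
    have p: "t *\<^sub>R c1 + (t * t) *\<^sub>R c2 = 0" using c[of t] small[of t] tpos c0 by simp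
    have m: "- (t *\<^sub>R c1) + (t * t) *\<^sub>R c2 = 0" using c[of "- t"] small[of "- t"] tpos c0 by simp
    have gen: "Y + Y = (X + Y) + (- X + Y)" for X Y :: "complex^'g" by simp
    have "2 *\<^sub>R ((t * t) *\<^sub>R c2) = (t *\<^sub>R c1 + (t * t) *\<^sub>R c2) + (- (t *\<^sub>R c1) + (t * t) *\<^sub>R c2)"
      unfolding scaleR_2 by (rule gen)
    also have "\<dots> = 0" unfolding p m by simp
    finally have "c2 = 0" using tpos by (metis scaleR_eq_0_iff mult_eq_0_iff less_numeral_extra(3) zero_neq_numeral)
    hence "c1 = 0" using p tpos by simp
    hence "obstruction \<phi> (A + 1 *\<^sub>R D) v = 0" using c[of 1] c0 \<open>c2 = 0\<close> by simp
    thus False using B(2) by (simp add: D_def)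
  qed
qed

text \<open>Baire category: only countably many real linear maps preserve L, and each that is
  obstructed in some direction is obstructed on an open dense set of directions.\<close>

lemma generic_dspace:
  assumes "e > 0"
  shows "\<exists>A\<in>dspace. norm A < e \<and>
    (\<forall>\<phi>. linear \<phi> \<longrightarrow> \<phi> ` L \<subseteq> L \<longrightarrow> (\<forall>v. obstruction \<phi> A v = 0) \<longrightarrow> (\<forall>B\<in>dspace. \<forall>v. obstruction \<phi> B v = 0))"
proof -
  define \<Phi> where "\<Phi> = {\<phi>. linear \<phi> \<and> \<phi> ` L \<subseteq> L \<and> (\<exists>B\<in>dspace. \<exists>v. obstruction \<phi> B v \<noteq> 0)}"
  define U where "U \<phi> = {A \<in> dspace. \<exists>v. obstruction \<phi> A v \<noteq> 0}" for \<phi>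
  have "countable \<Phi>"
    by (rule countable_subset[OF _ countable_lattice_maps[OF lat]]) (auto simp: \<Phi>_def)
  \<comment> \<open>\<open>dspace\<close> itself joins the family, so that points of the
    intersection lie in it even when there is no condition.\<close>
  hence count: "countable (insert dspace (U ` \<Phi>))" by simp
  have open_dense: "openin (top_of_set dspace) T \<and> dspace \<subseteq> closure T" if T: "T \<in> insert dspace (U ` \<Phi>)" for T
  proof (cases "T = dspace")
    case True
    thus ?thesis using closure_subset by simp
  next
    case False
    then obtain \<phi> where \<phi>: "\<phi> \<in> \<Phi>" "T = U \<phi>" using T by blast
    have lin: "linear \<phi>" using \<phi>(1) by (simp add: \<Phi>_def)
    obtain B v where Bv: "B \<in> dspace" "obstruction \<phi> B v \<noteq> 0" using \<phi>(1) by (auto simp: \<Phi>_def)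
    have "open {A. obstruction \<phi> A v \<noteq> 0}" for v
    proof -
      have "open ((\<lambda>A. obstruction \<phi> A v) -` (- {0}))"
        by (rule open_vimage[OF _ obstruction_continuous[OF lin]]) auto
      thus ?thesis by (simp add: vimage_def)
    qed
    hence "open (\<Union>v. {A. obstruction \<phi> A v \<noteq> 0})" by blast
    moreover have "T = dspace \<inter> (\<Union>v. {A. obstruction \<phi> A v \<noteq> 0})"
      unfolding \<phi>(2) U_def by blast
    ultimately have "openin (top_of_set dspace) T" by (auto simp: openin_open)
    moreover have "dspace \<subseteq> closure T"
      using obstruction_dense[OF lin Bv] closure_mono[of "{A \<in> dspace. obstruction \<phi> A v \<noteq> 0}" T]
      unfolding \<phi>(2) U_def by blast
    ultimately show ?thesis by blast
  qed
  have "dspace \<subseteq> closure (\<Inter> (insert dspace (U ` \<Phi>)))"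
    by (rule Baire[OF closed_subspace[OF dspace_subspace] count open_dense])
  hence "0 \<in> closure (\<Inter> (insert dspace (U ` \<Phi>)))"
    using subspace_0[OF dspace_subspace] by blast
  then obtain A where A: "A \<in> \<Inter> (insert dspace (U ` \<Phi>))" "dist A 0 < e"
    unfolding closure_approachable using assms by blast
  have "obstruction \<phi> B v = 0"
    if "linear \<phi>" "\<phi> ` L \<subseteq> L" "\<forall>v. obstruction \<phi> A v = 0" "B \<in> dspace" for \<phi> B v
  proof (rule ccontr)
    assume "obstruction \<phi> B v \<noteq> 0"
    hence "\<phi> \<in> \<Phi>" using that by (auto simp: \<Phi>_def)
    hence "A \<in> U \<phi>" using A(1) by blast
    thus False using that(3) by (simp add: U_def)
  qed
  thus ?thesis using A by (intro bexI[of _ A]) auto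
qed

end

lemma torsion_basis_mem_iff:
  "torsion_basis n L e \<Longrightarrow> (\<Sum>i\<in>UNIV. of_int (c i) *\<^sub>R e i) \<in> L \<longleftrightarrow> (\<forall>i. int n dvd c i)"
  unfolding torsion_basis_def by (elim conjE) (erule spec)

lemma torsion_basis_expand:
  "torsion_basis n L e \<Longrightarrow> real n *\<^sub>R x \<in> L \<Longrightarrow> \<exists>c :: 'g::finite + 'g \<Rightarrow> int. x - (\<Sum>i\<in>UNIV. of_int (c i) *\<^sub>R e i) \<in> L"
  unfolding torsion_basis_def by (elim conjE, drule spec[of _ x]) (drule iffD1)

lemma torsion_action_conj_image:
  fixes f :: "complex^'g::finite \<Rightarrow> complex^'g"
  assumes f: "linear f" "bij f" and comm: "\<And>v. f (\<sigma> v) = \<sigma>' (f v)" and tac: "torsion_action_conj n L \<sigma> \<rho>"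
  shows "torsion_action_conj n (f ` L) \<sigma>' \<rho>"
proof -
  obtain e where e: "torsion_basis n L e" "\<And>j. \<sigma> (e j) - (\<Sum>i\<in>UNIV. of_int (\<rho> $ i $ j) *\<^sub>R e i) \<in> L"
    using tac unfolding torsion_action_conj_def by blast
  have mem: "f x \<in> f ` L \<longleftrightarrow> x \<in> L" for x
    using bij_is_inj[OF f(2)] by (simp add: inj_image_mem_iff)
  have sum: "(\<Sum>i\<in>UNIV. of_int (c i) *\<^sub>R f (e i)) = f (\<Sum>i\<in>UNIV. of_int (c i) *\<^sub>R e i)" for c :: "'g + 'g \<Rightarrow> int"
    by (simp add: linear_sum[OF f(1)] linear_scale[OF f(1)])
  have "torsion_basis n (f ` L) (\<lambda>i. f (e i))"
    unfolding torsion_basis_def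
  proof (intro conjI allI)
    fix x
    obtain y where x: "x = f y" using bij_is_surj[OF f(2)] by (metis surj_def)
    have "x - (\<Sum>i\<in>UNIV. of_int (c i) *\<^sub>R f (e i)) = f (y - (\<Sum>i\<in>UNIV. of_int (c i) *\<^sub>R e i))" for c :: "'g + 'g \<Rightarrow> int"
      unfolding x sum by (simp add: linear_diff[OF f(1)])
    moreover have "real n *\<^sub>R x = f (real n *\<^sub>R y)" by (simp add: x linear_scale[OF f(1)])
    ultimately show "real n *\<^sub>R x \<in> f ` L \<longleftrightarrow> (\<exists>c :: 'g + 'g \<Rightarrow> int. x - (\<Sum>i\<in>UNIV. of_int (c i) *\<^sub>R f (e i)) \<in> f ` L)"
      using e(1) unfolding torsion_basis_def by (simp only: mem)
  next
    fix c :: "'g + 'g \<Rightarrow> int"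
    show "(\<Sum>i\<in>UNIV. of_int (c i) *\<^sub>R f (e i)) \<in> f ` L \<longleftrightarrow> (\<forall>i. int n dvd c i)"
      using e(1) unfolding torsion_basis_def sum mem by blast
  qed
  moreover have "\<sigma>' (f (e j)) - (\<Sum>i\<in>UNIV. of_int (\<rho> $ i $ j) *\<^sub>R f (e i)) \<in> f ` L" for j
    unfolding sum[of "\<lambda>i. \<rho> $ i $ j"] comm[symmetric] linear_diff[OF f(1), symmetric] mem by (rule e(2))
  ultimately show ?thesis unfolding torsion_action_conj_def by blast
qed

lemma pos_def_hermitianI:
  assumes "\<And>x y z. H (x + y) z = H x z + H y z" "\<And>c x z. H (c *s x) z = c * H x z"
    and "\<And>x y. H y x = cnj (H x y)" "\<And>x. x \<noteq> 0 \<Longrightarrow> 0 < Re (H x x)"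
  shows "pos_def_hermitian (H :: ('g::finite) hform)"
proof -
  have "vector_space ((*) :: complex \<Rightarrow> complex \<Rightarrow> complex)"
    by unfold_locales (simp_all add: algebra_simps)
  thus ?thesis
    unfolding pos_def_hermitian_def Vector_Spaces.linear_iff
    by (intro conjI allI impI) (rule vec.vector_space_axioms assms | assumption)+
qed

context ppav_aut
begin

text \<open>Instead of the complex structure on V the lattice is moved: L' = (1 + S) L for a small
  antilinear S, with H' x y = H ((1 - S^2)^(-1) x) y. On images under 1 + S the imaginary part is
  unchanged, so H' is again principal; contraction gives positivity. An endomorphism f of V / L'
  corresponds to a real linear \<phi> preserving L whose obstruction at S vanishes. By genericity it
  vanishes in all directions: the direction 0 makes \<phi> complex linear, hence equal to f, and the
  others make f commute with them.\<close>

lemma generic_deformation: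
  "\<exists>L' H'. is_ppav (L', H') \<and> \<sigma> \<in> ppav_Aut (L', H') \<and>
    (\<forall>n \<rho>. torsion_action_conj n L \<sigma> \<rho> \<longrightarrow> torsion_action_conj n L' \<sigma> \<rho>) \<and>
    torus_End L' \<subseteq> generic_End L H \<sigma>"
proof -
  obtain \<epsilon> where \<epsilon>: "\<epsilon> > 0" "\<forall>A. norm A < \<epsilon> \<longrightarrow> (\<forall>x. x \<noteq> 0 \<longrightarrow> Re (H (amap A x) (amap A x)) < Re (H x x))"
    using amap_contracting[OF herm] by (elim exE conjE)
  obtain A where A: "A \<in> dspace" "norm A < \<epsilon>"
    and generic: "\<forall>\<phi>. linear \<phi> \<longrightarrow> \<phi> ` L \<subseteq> L \<longrightarrow> (\<forall>v. obstruction \<phi> A v = 0) \<longrightarrow> (\<forall>B\<in>dspace. \<forall>v. obstruction \<phi> B v = 0)"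
    using generic_dspace[OF \<epsilon>(1)] by (elim bexE conjE)
  define S where "S = amap A"
  have anti: "antilinear S" and S_comm: "\<And>v. S (\<sigma> v) = \<sigma> (S v)" and S_sym: "\<And>x y. H (S x) y = H (S y) x"
    using A(1) by (simp_all add: S_def dspace_def deformation_def)
  have S_lin: "linear S" by (rule antilinear_imp_linear[OF anti])
  have contr: "Re (H (S x) (S x)) < Re (H x x)" if "x \<noteq> 0" for x
    using \<epsilon>(2) A(2) that by (simp add: S_def)
  have bijI: "bij f" if "linear f" "\<And>x. f x = 0 \<Longrightarrow> x = 0" for f :: "complex^'g \<Rightarrow> complex^'g"
  proof -
    have "inj f" using that linear_injective_0 by blast
    thus ?thesis using linear_injective_imp_surjective[OF that(1)] by (simp add: bij_def)
  qed
  define g where "g v = v + S v" for v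
  define k where "k v = v - S v" for v
  define h where "h v = v - S (S v)" for v
  have Sne: "S v \<noteq> v" "S v \<noteq> - v" "S (S v) \<noteq> v" if "v \<noteq> 0" for v
  proof -
    show "S v \<noteq> v" using contr[OF that] by auto
    show "S v \<noteq> - v"
    proof
      assume "S v = - v"
      hence "H (S v) (S v) = H v v"
        using herm_scale_left[OF herm, of "-1" v] herm_scale_right[OF herm, of _ "-1" v] by simp
      thus False using contr[OF that] by simp
    qed
    show "S (S v) \<noteq> v"
    proof
      assume eq: "S (S v) = v"
      have "S v \<noteq> 0" using eq that linear_0[OF S_lin] by auto
      from contr[OF this] contr[OF that] show False unfolding eq by simp
    qed
  qed
  have g_lin: "linear g" and k_lin: "linear k" and h_lin: "linear h"
    unfolding g_def k_def h_def
    using linear_compose[OF S_lin S_lin] by (auto intro!: linear_compose_add linear_compose_sub linear_ident S_lin simp: o_def)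
  have g_bij: "bij g" by (rule bijI[OF g_lin]) (metis Sne(2) add_eq_0_iff g_def)
  have k_bij: "bij k" by (rule bijI[OF k_lin]) (metis Sne(1) eq_iff_diff_eq_0 k_def)
  have h_bij: "bij h" by (rule bijI[OF h_lin]) (metis Sne(3) eq_iff_diff_eq_0 h_def)
  have h_clin: "clinear h"
    unfolding clinear_iff h_def
    by (simp add: antilinear_add[OF anti] antilinear_scale[OF anti] vec.scale_right_diff_distrib)
  have gk: "g (k v) = h v" for v
    by (simp add: g_def k_def h_def linear_diff[OF S_lin])
  define T where "T = inv_into UNIV h"
  have T_clin: "clinear T" unfolding T_def by (rule clinear_inv[OF h_clin h_bij])
  have Th: "T (h v) = v" and hT: "h (T v) = v" for v
    using h_bij by (simp_all add: T_def bij_is_inj inv_f_f bij_is_surj surj_f_inv_f)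
  define H' where "H' x y = H (T x) y" for x y
  have H'h: "H' (h u) (h u') = H u u' - H (S u') (S u)" for u u'
  proof -
    have "H u (S (S u')) = cnj (H (S (S u')) u)" by (rule herm_cnj[OF herm])
    also have "H (S (S u')) u = H (S u) (S u')" by (rule S_sym)
    also have "cnj (H (S u) (S u')) = H (S u') (S u)" by (rule herm_cnj[OF herm, symmetric])
    finally have 1: "H u (S (S u')) = H (S u') (S u)" .
    have "H u (h u') + H u (S (S u')) = H u u'"
      by (simp add: h_def flip: herm_add_right[OF herm])
    thus ?thesis by (simp add: H'_def Th 1[symmetric] eq_diff_eq)
  qed
  have surj_h: "\<exists>u. x = h u" for x using hT[of x] by metis
  have herm': "pos_def_hermitian H'"
  proof (rule pos_def_hermitianI)
    show "H' (x + y) z = H' x z + H' y z" for x y z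
      by (simp add: H'_def clinear_add[OF T_clin] herm_add_left[OF herm])
    show "H' (c *s x) z = c * H' x z" for c x z
      by (simp add: H'_def clinear_scale[OF T_clin] herm_scale_left[OF herm])
    show "H' y x = cnj (H' x y)" for x y
    proof -
      obtain u u' where uu: "x = h u" "y = h u'" using surj_h by metis
      have 1: "H u' u = cnj (H u u')" "H (S u) (S u') = cnj (H (S u') (S u))"
        by (rule herm_cnj[OF herm])+
      show ?thesis unfolding uu H'h complex_cnj_diff 1 ..
    qed
    show "0 < Re (H' x x)" if "x \<noteq> 0" for x
    proof -
      obtain u where u: "x = h u" using surj_h by metis
      hence "u \<noteq> 0" using that linear_0[OF h_lin] by auto
      from contr[OF this] show ?thesis by (simp add: u H'h)
    qed
  qed
  have ImH': "Im (H' (g u) (g v)) = Im (H u v)" for u v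
  proof -
    obtain u' where u': "u = k u'" using bij_is_surj[OF k_bij] by (metis surj_def)
    have "T (g u) = u'" by (simp only: u' gk Th)
    hence "H' (g u) (g v) = H u' v + H u' (S v)"
      by (simp only: H'_def) (simp only: g_def herm_add_right[OF herm])
    moreover have "H u v = H u' v - H (S u') v" by (simp add: u' k_def herm_diff_left[OF herm])
    moreover have "H (S u') v = cnj (H u' (S v))"
      using S_sym[of u' v] herm_cnj[OF herm, of u' "S v"] by simp
    ultimately show ?thesis by simp
  qed
  define L' where "L' = g ` L"
  have lat': "is_lattice L'" unfolding L'_def by (rule is_lattice_image[OF lat g_lin g_bij])
  have mem_L: "(\<forall>l\<in>L. Im (H u l) \<in> \<int>) \<longleftrightarrow> u \<in> L" for u
  proof -
    have "u \<in> {x. \<forall>l\<in>L. Im (H x l) \<in> \<int>} \<longleftrightarrow> u \<in> L" by (simp only: unimodular)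
    thus ?thesis by (simp only: mem_Collect_eq)
  qed
  have "x \<in> {x. \<forall>l\<in>L'. Im (H' x l) \<in> \<int>} \<longleftrightarrow> x \<in> L'" for x
  proof -
    obtain u where u: "x = g u" using surjE[OF bij_is_surj[OF g_bij]] by blast
    have "x \<in> L' \<longleftrightarrow> u \<in> L"
      by (simp only: L'_def u inj_image_mem_iff[OF bij_is_inj[OF g_bij]])
    moreover have "(\<forall>l\<in>L'. Im (H' x l) \<in> \<int>) \<longleftrightarrow> u \<in> L"
      by (simp only: L'_def u ball_simps(9) ImH' mem_L)
    ultimately show ?thesis by (simp only: mem_Collect_eq)
  qed
  hence "{x. \<forall>l\<in>L'. Im (H' x l) \<in> \<int>} = L'" unfolding set_eq_iff by (rule allI)
  hence ppav': "is_ppav (L', H')"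
    using lat' herm' by (simp add: is_ppav_def principal_polarization_def)
  have g_comm: "g (\<sigma> v) = \<sigma> (g v)" for v
    by (simp add: g_def S_comm clinear_add[OF s_clinear])
  have h_comm: "h (\<sigma> v) = \<sigma> (h v)" for v
    by (simp add: h_def S_comm linear_diff[OF s_linear])
  have T_comm: "T (\<sigma> v) = \<sigma> (T v)" for v
    using h_comm[of "T v"] Th[of "\<sigma> (T v)"] by (simp add: hT)
  have "\<sigma> ` L' = g ` (\<sigma> ` L)"
    unfolding L'_def image_image g_comm ..
  hence sL': "\<sigma> ` L' = L'" by (simp add: L'_def s_image)
  have aut': "\<sigma> \<in> ppav_Aut (L', H')"
    using s_clinear s_bij sL'
    by (simp add: ppav_Aut_def torus_Aut_def pullback_def fun_eq_iff H'_def T_comm s_iso)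
  have tors: "torsion_action_conj n L' \<sigma> \<rho>" if "torsion_action_conj n L \<sigma> \<rho>" for n \<rho>
    unfolding L'_def by (rule torsion_action_conj_image[OF g_lin g_bij g_comm that])
  have "f \<in> generic_End L H \<sigma>" if f: "f \<in> torus_End L'" for f
  proof -
    have f_clin: "clinear f" and fL': "f ` L' \<subseteq> L'" using f by (simp_all add: torus_End_def)
    define \<phi> where "\<phi> v = inv_into UNIV g (f (g v))" for v
    have ginv: "g (inv_into UNIV g v) = v" "inv_into UNIV g (g v) = v" for v
      using g_bij by (simp_all add: bij_is_inj inv_f_f bij_is_surj surj_f_inv_f)
    have g\<phi>: "g (\<phi> v) = f (g v)" for v by (simp add: \<phi>_def ginv)
    have ginv_lin: "linear (inv_into UNIV g)"
    proof (rule linearI)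
      show "inv_into UNIV g (x + y) = inv_into UNIV g x + inv_into UNIV g y" for x y
        using ginv(2)[of "inv_into UNIV g x + inv_into UNIV g y"] by (simp add: linear_add[OF g_lin] ginv(1))
      show "inv_into UNIV g (c *\<^sub>R x) = c *\<^sub>R inv_into UNIV g x" for c x
        using ginv(2)[of "c *\<^sub>R inv_into UNIV g x"] by (simp add: linear_scale[OF g_lin] ginv(1))
    qed
    have \<phi>_lin: "linear \<phi>"
      unfolding \<phi>_def
      using linear_compose[OF linear_compose[OF g_lin clinear_imp_linear[OF f_clin]] ginv_lin] by (simp add: o_def)
    have \<phi>L: "\<phi> ` L \<subseteq> L"
    proof safe
      fix l assume "l \<in> L"
      hence "f (g l) \<in> g ` L" using fL' by (auto simp: L'_def)
      thus "\<phi> l \<in> L" by (auto simp: \<phi>_def ginv)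
    qed
    let ?a = "lin_part \<phi>" and ?b = "anti_part \<phi>"
    have a: "clinear ?a" and b: "antilinear ?b"
      by (rule lin_part_clinear[OF \<phi>_lin], rule anti_part_antilinear[OF \<phi>_lin])
    \<comment> \<open>E1 is g \<circ> \<phi> = f \<circ> g at v, and E2 is the same equation at \<i>
      v divided by \<i>. Half their sum and difference, F1 and F2, separate the linear from the
      antilinear part.\<close>
    have E1: "?a v + ?b v + S (?a v) + S (?b v) = f v + f (S v)" for v
      using g\<phi>[of v] unfolding g_def lin_anti_part[of \<phi> v] linear_add[OF S_lin] clinear_add[OF f_clin]
      by (simp add: add.assoc)
    have E2: "?a v - ?b v - S (?a v) + S (?b v) = f v - f (S v)" for v
    proof -
      have "\<i> *s ?a v + - \<i> *s ?b v + - \<i> *s S (?a v) + \<i> *s S (?b v) = \<i> *s f v + - \<i> *s f (S v)"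
        using E1[of "\<i> *s v"]
        by (simp add: clinear_scale[OF a] antilinear_scale[OF b] antilinear_scale[OF anti] clinear_scale[OF f_clin]
            linear_neg[OF S_lin] linear_neg[OF clinear_imp_linear[OF f_clin]])
      hence "- \<i> *s (\<i> *s ?a v + - \<i> *s ?b v + - \<i> *s S (?a v) + \<i> *s S (?b v)) = - \<i> *s (\<i> *s f v + - \<i> *s f (S v))"
        by simp
      thus ?thesis by (simp add: vec.scale_right_distrib)
    qed
    have half: "x = y" if "x + x = y + y" for x y :: "complex^'g"
    proof -
      have "2 *\<^sub>R x = 2 *\<^sub>R y" unfolding scaleR_2 by (rule that)
      thus ?thesis by (simp only: scaleR_cancel_left) simp
    qed
    have F1: "f v = ?a v + S (?b v)" for v
    proof (rule half)
      have "f v + f v = (f v + f (S v)) + (f v - f (S v))" by simp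
      also have "\<dots> = (?a v + S (?b v)) + (?a v + S (?b v))"
        unfolding E1[symmetric] E2[symmetric] by simp
      finally show "f v + f v = (?a v + S (?b v)) + (?a v + S (?b v))" .
    qed
    have F2: "f (S v) = ?b v + S (?a v)" for v
    proof (rule half)
      have "f (S v) + f (S v) = (f v + f (S v)) - (f v - f (S v))" by simp
      also have "\<dots> = (?b v + S (?a v)) + (?b v + S (?a v))"
        unfolding E1[symmetric] E2[symmetric] by simp
      finally show "f (S v) + f (S v) = (?b v + S (?a v)) + (?b v + S (?a v))" .
    qed
    \<comment> \<open>f (S v) is evaluated in two ways, by F2 at v and by F1 at S v.\<close>
    have obsA: "obstruction \<phi> A v = 0" for v
    proof -
      have eq: "?b v + S (?a v) = ?a (S v) + S (?b (S v))"
        unfolding F2[symmetric] by (rule F1)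
      show ?thesis unfolding obstruction_def S_def[symmetric] eq by simp
    qed
    have obs: "obstruction \<phi> B v = 0" if "B \<in> dspace" for B v
      by (rule generic[rule_format, OF \<phi>_lin \<phi>L obsA that])
    have b0: "?b v = 0" for v
      using obs[OF subspace_0[OF dspace_subspace], of v] linear_0[OF clinear_imp_linear[OF a]]
      by (simp add: obstruction_def)
    have f\<phi>: "f v = ?a v" "\<phi> v = ?a v" for v
      using F1[of v] lin_anti_part[of \<phi> v] linear_0[OF S_lin] by (simp_all add: b0)
    have "f ` L \<subseteq> L" using \<phi>L f\<phi> by auto
    moreover have "f (S' v) = S' (f v)" if S': "deformation H \<sigma> S'" for S' v
    proof -
      define B where "B = matrix (\<lambda>v. S' (vcnj v))"
      have "antilinear S'" using S' by (simp add: deformation_def)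
      hence B: "S' = amap B" unfolding B_def by (rule antilinear_eq_amap)
      have "B \<in> dspace" using S' unfolding dspace_def B by simp
      from obs[OF this, of v] show ?thesis
        using antilinear_imp_linear[OF amap_antilinear[of B], THEN linear_0]
        by (simp add: obstruction_def b0 f\<phi>(1) B)
    qed
    ultimately show ?thesis
      using f_clin by (simp add: generic_End_def torus_End_def)
  qed
  thus ?thesis using ppav' aut' tors by blast
qed

section \<open>Fixed vectors and the action on torsion points\<close>

lemma s_pact_Phi: "\<sigma> (pact \<sigma> Phi v) = pact \<sigma> Phi v"
proof -
  have "pact \<sigma> ([:-1, 1:] * Phi) v = 0"
    unfolding Phi_mult by (simp add: pact_diff[OF s_clinear] pact_monom[OF s_clinear] s_pow pact_1[OF s_clinear])
  thus ?thesis
    unfolding pact_mult[OF s_clinear]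
    by (simp add: pact_pCons[OF s_clinear] pact_0[OF s_clinear] linear_0[OF s_linear])
qed

text \<open>M is multiplication by \<rho> on coefficient vectors, so the sum of its powers is the
  matrix of Phi(\<sigma>) on the n-torsion.\<close>

lemma torsion_power:
  fixes e :: "'g + 'g \<Rightarrow> complex^'g" and \<rho> :: "int^('g + 'g)^('g + 'g)" and c :: "'g + 'g \<Rightarrow> int"
  assumes e: "\<And>j. \<sigma> (e j) - (\<Sum>i\<in>UNIV. of_int (\<rho> $ i $ j) *\<^sub>R e i) \<in> L"
  defines "M \<equiv> \<lambda>c i. \<Sum>j\<in>UNIV. \<rho> $ i $ j * c j"
  shows "pact \<sigma> Phi (\<Sum>i\<in>UNIV. of_int (c i) *\<^sub>R e i) - (\<Sum>i\<in>UNIV. of_int (\<Sum>k<p. (M ^^ k) c i) *\<^sub>R e i) \<in> L"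
proof -
  let ?e = "\<lambda>c :: 'g + 'g \<Rightarrow> int. \<Sum>i\<in>UNIV. of_int (c i) *\<^sub>R e i"
  have step: "\<sigma> (?e c) - ?e (M c) \<in> L" for c
  proof -
    have "?e (M c) = (\<Sum>i\<in>UNIV. \<Sum>j\<in>UNIV. of_int (c j) *\<^sub>R (of_int (\<rho> $ i $ j) *\<^sub>R e i))"
      by (simp add: M_def scaleR_sum_left mult.commute)
    also have "\<dots> = (\<Sum>j\<in>UNIV. of_int (c j) *\<^sub>R (\<Sum>i\<in>UNIV. of_int (\<rho> $ i $ j) *\<^sub>R e i))"
      unfolding scaleR_sum_right by (rule sum.swap)
    finally have "\<sigma> (?e c) - ?e (M c) = (\<Sum>j\<in>UNIV. of_int (c j) *\<^sub>R (\<sigma> (e j) - (\<Sum>i\<in>UNIV. of_int (\<rho> $ i $ j) *\<^sub>R e i)))"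
      by (simp add: linear_sum[OF s_linear] linear_scale[OF s_linear] scaleR_diff_right sum_subtractf)
    also have "\<dots> \<in> L" by (intro lattice_sum[OF lat] lattice_of_int[OF lat] e)
    finally show ?thesis .
  qed
  have pow: "(\<sigma> ^^ k) (?e c) - ?e ((M ^^ k) c) \<in> L" for k
  proof (induction k)
    case 0
    show ?case by (simp add: lattice_0[OF lat])
  next
    case (Suc k)
    have "\<sigma> ((\<sigma> ^^ k) (?e c) - ?e ((M ^^ k) c)) + (\<sigma> (?e ((M ^^ k) c)) - ?e (M ((M ^^ k) c))) \<in> L"
      using Suc s_lattice by (intro lattice_add[OF lat] step) auto
    thus ?case by (simp add: linear_diff[OF s_linear])
  qed
  have "pact \<sigma> Phi (?e c) - ?e (\<lambda>i. \<Sum>k<p. (M ^^ k) c i) = (\<Sum>k<p. (\<sigma> ^^ k) (?e c) - ?e ((M ^^ k) c))"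
  proof -
    have "?e (\<lambda>i. \<Sum>k<p. (M ^^ k) c i) = (\<Sum>k<p. ?e ((M ^^ k) c))"
      unfolding of_int_sum scaleR_sum_left by (rule sum.swap)
    thus ?thesis by (simp add: pact_Phi sum_subtractf)
  qed
  thus ?thesis using lattice_sum[OF lat pow] by simp
qed

end

text \<open>Whether there are nonzero fixed vectors can be read off from \<rho>. If Phi(\<sigma>) =
  0, the sum of the powers of \<rho> is 0 modulo n, so Phi(\<sigma>') maps L' into n L'. Its values
  are fixed vectors, and on fixed vectors Phi(\<sigma>') is p, which is invertible modulo n; hence
  these values can be divided by n within L' again and again, and are 0.\<close>

lemma pact_Phi_eq_0_transfer:
  assumes X: "ppav_aut p w L H \<sigma>" and X': "ppav_aut p w' L' H' \<sigma>'"
    and n: "n \<ge> 2" "coprime p n"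
    and tac: "torsion_action_conj n L \<sigma> \<rho>" "torsion_action_conj n L' \<sigma>' \<rho>"
    and zero: "\<And>v. pact \<sigma> (prime_root.Phi p) v = 0"
  shows "pact \<sigma>' (prime_root.Phi p) v = 0"
proof -
  interpret X: ppav_aut p w L H \<sigma> by fact
  interpret X': ppav_aut p w' L' H' \<sigma>' by fact
  obtain e where e: "torsion_basis n L e" "\<And>j. \<sigma> (e j) - (\<Sum>i\<in>UNIV. of_int (\<rho> $ i $ j) *\<^sub>R e i) \<in> L"
    using tac(1) unfolding torsion_action_conj_def by blast
  obtain e' where e': "torsion_basis n L' e'" "\<And>j. \<sigma>' (e' j) - (\<Sum>i\<in>UNIV. of_int (\<rho> $ i $ j) *\<^sub>R e' i) \<in> L'"
    using tac(2) unfolding torsion_action_conj_def by blast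
  define M where "M = (\<lambda>c i. \<Sum>j\<in>UNIV. \<rho> $ i $ j * c j)"
  have div: "int n dvd (\<Sum>k<p. (M ^^ k) c i)" for c i
  proof -
    have "- (\<Sum>i\<in>UNIV. of_int (\<Sum>k<p. (M ^^ k) c i) *\<^sub>R e i) \<in> L"
      using X.torsion_power[OF e(2), of c] zero unfolding M_def by simp
    from lattice_minus[OF X.lat this] have "(\<Sum>i\<in>UNIV. of_int (\<Sum>k<p. (M ^^ k) c i) *\<^sub>R e i) \<in> L" by simp
    thus ?thesis unfolding torsion_basis_mem_iff[OF e(1)] by (rule spec)
  qed
  have inL: "pact \<sigma>' X'.Phi (\<Sum>i\<in>UNIV. of_int (c i) *\<^sub>R e' i) \<in> L'" for c
  proof -
    have "(\<Sum>i\<in>UNIV. of_int (\<Sum>k<p. (M ^^ k) c i) *\<^sub>R e' i) \<in> L'"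
      unfolding torsion_basis_mem_iff[OF e'(1)] using div by blast
    from lattice_add[OF X'.lat X'.torsion_power[OF e'(2), of c, folded M_def] this] show ?thesis by simp
  qed
  have frac: "(1 / of_nat n) *\<^sub>R pact \<sigma>' X'.Phi x \<in> L'" if x: "x \<in> L'" for x
  proof -
    let ?y = "(1 / of_nat n) *\<^sub>R x"
    have "real n *\<^sub>R ?y \<in> L'" using x n(1) by simp
    from torsion_basis_expand[OF e'(1) this]
    obtain c :: "'a + 'a \<Rightarrow> int" where c: "?y - (\<Sum>i\<in>UNIV. of_int (c i) *\<^sub>R e' i) \<in> L'"
      by (rule exE)
    have "pact \<sigma>' X'.Phi (?y - (\<Sum>i\<in>UNIV. of_int (c i) *\<^sub>R e' i)) + pact \<sigma>' X'.Phi (\<Sum>i\<in>UNIV. of_int (c i) *\<^sub>R e' i) \<in> L'"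
      by (intro lattice_add[OF X'.lat] inL pact_lattice[OF X'.s_clinear X'.lat X'.s_lattice c])
    thus ?thesis
      by (simp add: linear_diff[OF pact_linear[OF X'.s_clinear]] linear_scale[OF pact_linear[OF X'.s_clinear]])
  qed
  have fixed_div: "(1 / of_nat n) *\<^sub>R m \<in> L'" if m: "m \<in> L'" "\<sigma>' m = m" for m
  proof -
    have "m \<in> X'.eig 0" using m(2) by (simp add: X'.eig_def)
    hence "pact \<sigma>' X'.Phi m = of_nat p *\<^sub>R m"
      by (simp add: X'.pact_eig ev_at_1 X'.poly_Phi_1 scaleR_eq_scale)
    hence pm: "(of_nat p / of_nat n) *\<^sub>R m \<in> L'"
      using frac[OF m(1)] by simp
    have "coprime (int p) (int n)" using n(2) by simp
    hence "gcd (int p) (int n) = 1" by (rule coprime_imp_gcd_eq_1)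
    then obtain a b where ab: "a * int p + b * int n = 1"
      using bezout_int[of "int p" "int n"] by auto
    have "of_int a *\<^sub>R ((of_nat p / of_nat n) *\<^sub>R m) + of_int b *\<^sub>R m \<in> L'"
      by (intro lattice_add[OF X'.lat] lattice_of_int[OF X'.lat] pm m(1))
    moreover have "of_int a * (of_nat p / of_nat n) + of_int b = (1 / of_nat n :: real)"
    proof -
      have "of_int (a * int p + b * int n) = (1 :: real)" unfolding ab by simp
      thus ?thesis using n(1) by (simp add: field_simps)
    qed
    ultimately show ?thesis by (simp flip: scaleR_add_left)
  qed
  have zeroL: "pact \<sigma>' X'.Phi x = 0" if x: "x \<in> L'" for x
  proof -
    let ?m = "pact \<sigma>' X'.Phi x"
    have "((1 / of_nat n) ^ k) *\<^sub>R ?m \<in> L' \<and> \<sigma>' (((1 / of_nat n) ^ k) *\<^sub>R ?m) = ((1 / of_nat n) ^ k) *\<^sub>R ?m" for k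
    proof (induction k)
      case 0
      show ?case using x by (simp add: pact_lattice[OF X'.s_clinear X'.lat X'.s_lattice] X'.s_pact_Phi)
    next
      case (Suc k)
      have "(1 / of_nat n) *\<^sub>R (((1 / of_nat n) ^ k) *\<^sub>R ?m) \<in> L'" using Suc by (intro fixed_div) auto
      thus ?case by (simp add: linear_scale[OF X'.s_linear] X'.s_pact_Phi)
    qed
    moreover have "\<bar>1 / of_nat n :: real\<bar> < 1" using n(1) by simp
    ultimately have "1 / of_nat n = (0::real) \<or> ?m = 0"
      using lattice_contract_eq_0[OF X'.lat] by blast
    thus ?thesis using n(1) by simp
  qed
  have "pact \<sigma>' X'.Phi = (\<lambda>v. 0)"
    by (intro linear_eq_on_lattice[OF X'.lat] pact_linear[OF X'.s_clinear] linear_zero zeroL)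
  thus ?thesis by simp
qed

lemma typed_automorphism_iso:
  assumes typed: "typed_automorphism p n \<rho> X' \<sigma>'" and iso: "(X', X) \<in> ppav_iso"
  shows "\<exists>\<sigma>. typed_automorphism p n \<rho> X \<sigma>"
proof -
  obtain f where f: "clinear f" "bij f" "f ` fst X' = fst X" "pullback f (snd X) = snd X'"
    using iso unfolding ppav_iso_def by blast
  let ?i = "inv_into UNIV f"
  have inv: "f (?i v) = v" "?i (f v) = v" for v
    using f(2) by (simp_all add: bij_is_inj inv_f_f bij_is_surj surj_f_inv_f)
  have i: "clinear ?i" "bij ?i" by (rule clinear_inv[OF f(1,2)], rule bij_betw_inv_into[OF f(2)])
  define \<sigma> where "\<sigma> v = f (\<sigma>' (?i v))" for v
  have s': "clinear \<sigma>'" "bij \<sigma>'" "\<sigma>' ` fst X' = fst X'" "pullback \<sigma>' (snd X') = snd X'"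
    using typed by (simp_all add: typed_automorphism_def ppav_Aut_def torus_Aut_def)
  have iX: "?i ` fst X = fst X'"
    unfolding f(3)[symmetric] image_image inv by simp
  have "\<sigma> ` fst X = f ` (\<sigma>' ` (?i ` fst X))" by (simp add: \<sigma>_def image_image)
  hence 1: "\<sigma> ` fst X = fst X" unfolding iX s'(3) f(3) .
  have H: "snd X (f x) (f y) = snd X' x y" for x y
    using f(4) by (auto simp: pullback_def fun_eq_iff)
  have "snd X (\<sigma> x) (\<sigma> y) = snd X x y" for x y
  proof -
    have "snd X (\<sigma> x) (\<sigma> y) = snd X' (\<sigma>' (?i x)) (\<sigma>' (?i y))" by (simp add: \<sigma>_def H)
    also have "\<dots> = snd X' (?i x) (?i y)" using s'(4) by (simp add: pullback_def fun_eq_iff)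
    also have "\<dots> = snd X x y" by (simp add: inv flip: H)
    finally show ?thesis .
  qed
  hence 2: "pullback \<sigma> (snd X) = snd X" by (simp add: pullback_def)
  have 3: "clinear \<sigma>" 
    by (simp add: clinear_iff \<sigma>_def clinear_add[OF f(1)] clinear_add[OF i(1)] clinear_add[OF s'(1)]
      clinear_scale[OF f(1)] clinear_scale[OF i(1)] clinear_scale[OF s'(1)])
  have "bij (f \<circ> (\<sigma>' \<circ> ?i))" by (rule bij_comp[OF bij_comp[OF i(2) s'(2)] f(2)])
  moreover have "\<sigma> = f \<circ> (\<sigma>' \<circ> ?i)" by (simp add: fun_eq_iff \<sigma>_def)
  ultimately have 4: "bij \<sigma>" by (simp only:)
  have pow: "(\<sigma> ^^ k) v = f ((\<sigma>' ^^ k) (?i v))" for k v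
    by (induction k) (simp_all add: \<sigma>_def inv)
  have "\<sigma> ^^ k = id \<longleftrightarrow> \<sigma>' ^^ k = id" for k
  proof
    assume *: "\<sigma> ^^ k = id"
    have "f ((\<sigma>' ^^ k) v) = f v" for v
      using pow[of k "f v"] by (simp add: * inv)
    hence "(\<sigma>' ^^ k) v = v" for v
      using bij_is_inj[OF f(2)] by (simp add: inj_eq)
    thus "\<sigma>' ^^ k = id" by (simp add: fun_eq_iff)
  qed (simp add: fun_eq_iff pow inv)
  hence 5: "\<forall>k. \<sigma> ^^ k = id \<longleftrightarrow> p dvd k"
    using typed by (simp add: typed_automorphism_def)
  have tac: "torsion_action_conj n (fst X') \<sigma>' \<rho>"
    using typed by (simp add: typed_automorphism_def)
  have 6: "torsion_action_conj n (fst X) \<sigma> \<rho>"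
    unfolding f(3)[symmetric]
    by (rule torsion_action_conj_image[OF clinear_imp_linear[OF f(1)] f(2) _ tac]) (simp add: \<sigma>_def inv)
  have "\<sigma> \<in> ppav_Aut X"
    unfolding ppav_Aut_def torus_Aut_def using 1 2 3 4 by simp
  hence typedX: "typed_automorphism p n \<rho> X \<sigma>"
    unfolding typed_automorphism_def using 5 6 by (intro conjI)
  show ?thesis by (rule exI[of _ \<sigma>]) (rule typedX)
qed

text \<open>The locus consists of isomorphism classes; conjugating by an isomorphism carries an
  automorphism of the given type to any other representative.\<close>

lemma moduli_point_typed_locus_iff:
  assumes X: "is_ppav X"
  shows "moduli_point X \<in> typed_locus p n \<rho> \<longleftrightarrow> (\<exists>\<sigma>. typed_automorphism p n \<rho> X \<sigma>)"
proof
  assume "moduli_point X \<in> typed_locus p n \<rho>"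
  then obtain X' \<sigma>' where X': "moduli_point X = moduli_point X'" "typed_automorphism p n \<rho> X' \<sigma>'"
    unfolding typed_locus_def mem_Collect_eq by (elim exE conjE)
  have "(X, X) \<in> ppav_iso"
    unfolding ppav_iso_def mem_Collect_eq case_prod_conv
    by (intro conjI X exI[of _ id]) (simp_all add: clinear_iff pullback_def)
  hence "X \<in> moduli_point X" by (simp add: moduli_point_def)
  hence "X \<in> moduli_point X'" unfolding X'(1) .
  hence "(X', X) \<in> ppav_iso" by (simp add: moduli_point_def)
  thus "\<exists>\<sigma>. typed_automorphism p n \<rho> X \<sigma>" by (rule typed_automorphism_iso[OF X'(2)])
next
  assume "\<exists>\<sigma>. typed_automorphism p n \<rho> X \<sigma>"
  thus "moduli_point X \<in> typed_locus p n \<rho>"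
    unfolding typed_locus_def mem_Collect_eq by (intro exI[of _ X] conjI refl X)
qed

section \<open>Integral closedness and totally positive units\<close>

context prime_root
begin

text \<open>Complex conjugation on Z[w], as w^(p - 1) is the conjugate of w.\<close>

definition conj_poly :: "int poly \<Rightarrow> int poly"
  where "conj_poly q = pcompose q (monom 1 (p - 1))"

lemma ev_conj_poly: "ev (conj_poly q) (w ^ j) = cnj (ev q (w ^ j))"
proof -
  have "(w ^ j) ^ (p - 1) = cnj (w ^ j)"
    using inverse_root[OF w_power_power, of j] by (simp add: cnj_w power_inverse)
  thus ?thesis by (simp add: conj_poly_def cnj_ev)
qed

lemma ev_conj_poly_w: "ev (conj_poly q) w = cnj (ev q w)"
  using ev_conj_poly[of q 1] by simp

lemma poly_conj_poly_1: "poly (conj_poly q) 1 = poly q 1"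
  by (simp add: conj_poly_def poly_pcompose poly_monom)

text \<open>\<open>\<int>[w]\<close> is integrally closed: this is the step that removes one prime from a denominator.
  For \<open>l \<noteq> p\<close> it uses that the \<open>l\<close>-power Frobenius is invertible on \<open>\<int>[w] / l\<close>, for \<open>l = p\<close> that
  \<open>w - 1\<close> generates the only prime above \<open>p\<close>.\<close>

lemma prime_denominator_ne:
  assumes l: "prime l" "l \<noteq> p" and d: "d \<noteq> 0"
    and bounded: "\<And>s. \<exists>r. of_int d * ev q w ^ s = of_nat l ^ s * ev r w"
  shows "\<exists>q'. ev q w = of_nat l * ev q' w"
proof -
  define e where "e = multiplicity (int l) d"
  obtain d' where d': "d = int l ^ e * d'" "\<not> int l dvd d'"
    unfolding e_def by (rule multiplicity_decompose'[of d "int l"]) (use d l(1) prime_gt_1_nat[of l] in \<open>simp_all add: mult_ac\<close>)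
  have l1: "l > 1" by (rule prime_gt_1_nat[OF l(1)])
  \<comment> \<open>A power of l that is 1 modulo p by Fermat, so that Frobenius fixes w and q(w)^s
    = q(w) modulo l, and that exceeds e + 1, so that a factor l is left after cancelling the l-part
    of d.\<close>
  define s where "s = l ^ ((p - 1) * Suc e)"
  have "\<not> p dvd l" using l prime_p by (metis primes_dvd_imp_eq)
  hence "[l ^ (p - 1) = 1] (mod p)" using fermat_theorem[of p l] prime_p by simp
  hence "[(l ^ (p - 1)) ^ Suc e = 1 ^ Suc e] (mod p)" by (rule cong_pow)
  hence "[s = 1] (mod p)" unfolding s_def power_mult[symmetric] by (simp only: power_one)
  hence "s mod p = 1" using p_gt_1 by (simp add: Cong.cong_def)
  hence ws: "w ^ s = w" using w_power_mod[of s] by simp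
  have "Suc e < l ^ Suc e" using power_gt_expt[of l "Suc e"] l1 by simp
  moreover have "1 * Suc e \<le> (p - 1) * Suc e" using p_gt_1 by (intro mult_right_mono) auto
  hence "l ^ Suc e \<le> l ^ ((p - 1) * Suc e)" using l1 by (intro power_increasing) auto
  ultimately have es: "Suc e < s" unfolding s_def by (rule less_le_trans)
  obtain h where h: "q ^ s = pcompose q (monom 1 s) + of_nat l * h"
    using poly_power_prime_power[OF l(1)] unfolding s_def by blast
  have "ev (q ^ s) w = ev (pcompose q (monom 1 s) + of_nat l * h) w" by (simp only: h)
  hence xs: "ev q w ^ s = ev q w + of_nat l * ev h w" by (simp add: ws)
  obtain r where "of_int d * ev q w ^ s = of_nat l ^ s * ev r w" using bounded by blast
  hence "of_nat l ^ e * (of_int d' * (ev q w + of_nat l * ev h w)) = of_nat l ^ (e + (s - e)) * ev r w"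
    using es unfolding xs d'(1) by (simp add: mult.assoc)
  hence "of_int d' * (ev q w + of_nat l * ev h w) = of_nat l ^ (s - e) * ev r w"
    using l1 by (simp add: power_add)
  also have "of_nat l ^ (s - e) = (of_nat l * of_nat l ^ (s - e - 1) :: complex)"
    unfolding power_Suc[symmetric] using es by (simp add: Suc_diff_Suc)
  finally have key: "of_int d' * ev q w = of_nat l * (of_nat l ^ (s - e - 1) * ev r w - of_int d' * ev h w)"
    by (simp add: algebra_simps)
  have "coprime (int l) d'" using l(1) d'(2) by (simp add: prime_imp_coprime)
  hence "gcd (int l) d' = 1" by (rule coprime_imp_gcd_eq_1)
  then obtain a b where ab: "a * int l + b * d' = 1" using bezout_int[of "int l" d'] by auto
  have "of_int a * of_nat l + of_int b * of_int d' = (of_int (a * int l + b * d') :: complex)" by simp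
  hence ab': "of_int a * of_nat l + of_int b * of_int d' = (1 :: complex)" unfolding ab by simp
  have "ev q w = (of_int a * of_nat l + of_int b * of_int d') * ev q w" unfolding ab' by simp
  also have "\<dots> = of_int a * of_nat l * ev q w + of_int b * (of_int d' * ev q w)" by (simp add: algebra_simps)
  also have "\<dots> = of_nat l * ev (of_int a * q + of_int b * (of_nat l ^ (s - e - 1) * r - of_int d' * h)) w"
    unfolding key by (simp add: algebra_simps)
  finally show ?thesis by blast
qed

lemma p_eq_lambda_mult: "\<exists>q. of_nat p = (w - 1) * ev q w"
proof -
  have "poly (Phi - of_nat p) 1 = 0" by (simp add: poly_Phi_1)
  hence "[:-1, 1:] dvd Phi - of_nat p" by (simp only: poly_eq_0_iff_dvd)
  then obtain u where u: "Phi - of_nat p = [:-1, 1:] * u" by (elim dvdE)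
  have "ev (Phi - of_nat p) w = ev ([:-1, 1:] * u) w" by (simp only: u)
  hence "of_nat p = (w - 1) * ev (- u) w" by (simp add: algebra_simps)
  thus ?thesis by blast
qed

text \<open>For the valuation v with v (w - 1) = 1 and v (p) = p - 1 the hypothesis gives s v (q(w))
  \<ge> (p - 1) (s - e). The induction extracts factors w - 1 one by one; another one is available
  as long as fewer than p - 1 have been found.\<close>

lemma prime_denominator_p:
  assumes d: "d \<noteq> 0" and bounded: "\<And>s. \<exists>r. of_int d * ev q w ^ s = of_nat p ^ s * ev r w"
  shows "\<exists>q'. ev q w = of_nat p * ev q' w"
proof -
  define e where "e = multiplicity (int p) d"
  obtain d' where d': "d = int p ^ e * d'" "\<not> int p dvd d'"
    unfolding e_def by (rule multiplicity_decompose'[of d "int p"]) (use d p_gt_1 in \<open>simp_all add: mult_ac\<close>)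
  obtain W where W: "Phi = [:-1, 1:] ^ (p - 1) + of_nat p * W" "poly W 1 = 1"
    using Phi_decomp by blast
  have lam: "(w - 1) ^ (p - 1) = of_nat p * ev (- W) w"
    using ev_Phi_w unfolding W(1) by (simp add: eq_neg_iff_add_eq_0)
  obtain P where P: "of_nat p = (w - 1) * ev P w" using p_eq_lambda_mult by blast
  have "\<exists>r. ev q w = (w - 1) ^ j * ev r w" if "j \<le> p - 1" for j
    using that
  proof (induction j)
    case 0
    show ?case by (intro exI[of _ q]) simp
  next
    case (Suc j)
    have "j \<le> p - 1" using Suc.prems by simp
    from Suc.IH[OF this] obtain r where r: "ev q w = (w - 1) ^ j * ev r w" by (elim exE)
    \<comment> \<open>The least s with j s < (p - 1) (s - e) for all j \<le> p - 2, that is, with s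
      > (p - 1) e.\<close>
    define s where "s = (p - 1) * e + 1"
    have "1 * e \<le> (p - 1) * e" using p_gt_1 by (intro mult_right_mono) auto
    hence "e \<le> s" unfolding s_def by linarith
    have "s * 1 \<le> s * (p - 1 - j)" using Suc.prems by (intro mult_left_mono) auto
    hence "(p - 1) * e < s * (p - 1 - j)" by (simp add: s_def)
    hence "j * s < (p - 1) * (s - e)"
    proof -
      have "s * j + s * (p - 1 - j) = s * (p - 1)"
        unfolding add_mult_distrib2[symmetric] using Suc.prems by simp
      hence "j * s + s * (p - 1 - j) = s * (p - 1)" by (simp only: mult.commute[of j])
      moreover have "(p - 1) * e + (p - 1) * (s - e) = s * (p - 1)"
        unfolding add_mult_distrib2[symmetric] using \<open>e \<le> s\<close> by simp
      ultimately show ?thesis using \<open>(p - 1) * e < s * (p - 1 - j)\<close> by linarith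
    qed
    from less_imp_Suc_add[OF this] obtain N where "(p - 1) * (s - e) = Suc (j * s + N)" by (elim exE)
    hence N: "(p - 1) * (s - e) = j * s + Suc N" by simp
    obtain t where "of_int d * ev q w ^ s = of_nat p ^ s * ev t w" using bounded by blast
    hence "of_nat p ^ e * (of_int d' * ev q w ^ s) = of_nat p ^ (e + (s - e)) * ev t w"
      using \<open>e \<le> s\<close> unfolding d'(1) by (simp add: mult.assoc)
    hence "of_int d' * ev q w ^ s = of_nat p ^ (s - e) * ev t w"
      using p_gt_1 by (simp add: power_add)
    hence "of_int d' * ev q w ^ s * ev (- W) w ^ (s - e) = (of_nat p * ev (- W) w) ^ (s - e) * ev t w"
      unfolding power_mult_distrib by (simp only: mult_ac)
    also have "\<dots> = (w - 1) ^ (j * s) * ((w - 1) ^ Suc N * ev t w)"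
      unfolding lam[symmetric] power_mult[symmetric] N power_add by (simp only: mult.assoc)
    also have "of_int d' * ev q w ^ s * ev (- W) w ^ (s - e) =
        (w - 1) ^ (j * s) * (of_int d' * ev r w ^ s * ev (- W) w ^ (s - e))"
      unfolding r by (simp add: power_mult_distrib power_mult mult_ac)
    finally have "of_int d' * ev r w ^ s * ev (- W) w ^ (s - e) = (w - 1) ^ Suc N * ev t w"
      using w_ne_1 by simp
    hence "ev (of_int d' * r ^ s * (- W) ^ (s - e) - [:-1, 1:] ^ Suc N * t) w = 0"
      by (simp del: power_Suc)
    hence "int p dvd poly (of_int d' * r ^ s * (- W) ^ (s - e) - [:-1, 1:] ^ Suc N * t) 1"
      by (rule ev_root_imp_dvd)
    hence "int p dvd d' * poly r 1 ^ s * (- 1) ^ (s - e)" by (simp add: W(2))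
    moreover have "prime (int p)" using prime_p by simp
    moreover have "\<not> int p dvd (- 1) ^ (s - e)"
      using p_gt_1 by (cases "even (s - e)") auto
    ultimately have "int p dvd poly r 1"
      using d'(2) by (metis prime_dvd_mult_iff prime_dvd_power)
    then obtain c where c: "poly r 1 = int p * c" by (elim dvdE)
    have "poly (r - of_int (int p * c)) 1 = 0" by (simp add: c)
    hence "[:-1, 1:] dvd r - of_int (int p * c)" by (simp only: poly_eq_0_iff_dvd)
    then obtain u where u: "r - of_int (int p * c) = [:-1, 1:] * u" by (elim dvdE)
    have "ev (r - of_int (int p * c)) w = ev ([:-1, 1:] * u) w" by (simp only: u)
    hence "ev r w = of_nat p * of_int c + (w - 1) * ev u w" by (simp add: algebra_simps)
    also have "\<dots> = (w - 1) * ev (of_int c * P + u) w" unfolding P by (simp add: algebra_simps)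
    finally have "ev q w = (w - 1) ^ Suc j * ev (of_int c * P + u) w" unfolding r by (simp add: mult_ac)
    thus ?case by blast
  qed
  then obtain r where "ev q w = (w - 1) ^ (p - 1) * ev r w" by blast
  hence "ev q w = of_nat p * ev (- W * r) w" unfolding lam by (simp add: mult.assoc)
  thus ?thesis by blast
qed

lemma prime_denominator:
  assumes "prime l" "d \<noteq> 0" "\<And>s. \<exists>r. of_int d * ev q w ^ s = of_nat l ^ s * ev r w"
  shows "\<exists>q'. ev q w = of_nat l * ev q' w"
  using prime_denominator_ne[of l d q] prime_denominator_p[of d q] assms by blast

text \<open>The root of unity \<eta> = v / cnj v has residue 1 at the prime above p, because
  conjugation does not change residues. So -1 is not a power of \<eta>, the order n = 2 m + 1 is
  odd, and x = v \<eta>^m is real with x^2 = v^2 / \<eta> = v cnj v.\<close>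

lemma unit_norm_square:
  assumes p: "p > 2" and unit: "ev z w * ev z' w = 1"
    and root: "(ev z w * cnj (ev z' w)) ^ t = 1" "t > 0"
  shows "\<exists>k k'. ev k gam * ev k' gam = 1 \<and> ev z w * cnj (ev z w) = (ev k gam)\<^sup>2"
proof -
  have odd: "odd p" using p prime_p prime_odd_nat by auto
  define v v' \<eta> where "v = ev z w" and "v' = ev z' w" and "\<eta> = v * cnj v'"
  have vv: "v * v' = 1" using unit by (simp add: v_def v'_def)
  have cvv: "cnj v * cnj v' = 1" using vv by (metis complex_cnj_mult complex_cnj_one)
  define n where "n = (LEAST n. n > 0 \<and> \<eta> ^ n = 1)"
  have n: "n > 0 \<and> \<eta> ^ n = 1"
    unfolding n_def by (rule LeastI[of _ t]) (use root in \<open>simp add: \<eta>_def v_def v'_def\<close>)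
  define E where "E = z * conj_poly z'"
  have evE: "ev E w = \<eta>" by (simp add: E_def \<eta>_def v_def v'_def ev_conj_poly_w)
  have "ev (z * z' - 1) w = 0" using unit by simp
  from ev_root_imp_dvd[OF this] have E1: "[poly E 1 = 1] (mod int p)"
    by (simp add: E_def poly_conj_poly_1 cong_iff_dvd_diff)
  have "odd n"
  proof
    assume "even n"
    then obtain m where m: "n = 2 * m" by blast
    have "(\<eta> ^ m)\<^sup>2 = 1" using n by (simp add: m mult.commute flip: power_mult)
    moreover have "\<eta> ^ m \<noteq> 1"
      using not_less_Least[of m "\<lambda>n. n > 0 \<and> \<eta> ^ n = 1"] n m by (auto simp: n_def[symmetric])
    ultimately have "\<eta> ^ m = -1" by (simp add: power2_eq_1_iff)
    hence "ev (E ^ m + 1) w = 0" by (simp add: evE)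
    from ev_root_imp_dvd[OF this] have "int p dvd poly E 1 ^ m + 1" by simp
    moreover have "int p dvd poly E 1 ^ m - 1 ^ m"
      using cong_pow[OF E1, of m] by (simp add: cong_iff_dvd_diff)
    ultimately have "int p dvd (poly E 1 ^ m + 1) - (poly E 1 ^ m - 1 ^ m)" by (rule dvd_diff)
    hence "int p dvd 2" by simp
    thus False using p zdvd_imp_le[of "int p" 2] by simp
  qed
  then obtain m where m: "n = 2 * m + 1" by (auto elim: oddE)
  have ne: "v \<noteq> 0" "v' \<noteq> 0" "\<eta> \<noteq> 0" using vv by (auto simp: \<eta>_def)
  have cv: "cnj v = v * inverse \<eta>"
  proof -
    have "cnj v * \<eta> = v" using cvv by (simp add: \<eta>_def mult_ac)
    thus ?thesis using ne by (simp add: field_simps)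
  qed
  have "cnj \<eta> * \<eta> = 1" using vv cvv by (simp add: \<eta>_def) (metis mult.assoc mult.commute mult_1)
  hence c\<eta>: "cnj \<eta> = inverse \<eta>" using ne by (simp add: field_simps)
  have \<eta>n: "\<eta> ^ m * \<eta> ^ m * \<eta> = 1" using n by (simp add: m power_add mult_2 mult.left_commute mult.assoc mult.commute[of \<eta>])
  define x where "x = v * \<eta> ^ m"
  define x' where "x' = v' * \<eta> ^ Suc m"
  have "cnj x = v * (inverse \<eta> * inverse \<eta> ^ m)" by (simp add: x_def cv c\<eta> mult.assoc)
  also have "inverse \<eta> * inverse \<eta> ^ m = \<eta> ^ m"
  proof -
    have "(\<eta> * \<eta> ^ m) * \<eta> ^ m = 1" using \<eta>n by (simp add: mult_ac)
    from inverse_unique[OF this] show ?thesis by (simp add: power_inverse)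
  qed
  finally have "cnj x = x" by (simp add: x_def)
  have xx: "x * x' = 1"
  proof -
    have "x * x' = (v * v') * (\<eta> ^ m * \<eta> ^ m * \<eta>)" by (simp add: x_def x'_def mult_ac)
    thus ?thesis by (simp add: vv \<eta>n)
  qed
  have sq: "v * cnj v = x\<^sup>2"
  proof -
    have "x\<^sup>2 = v * v * (\<eta> ^ m * \<eta> ^ m)" by (simp add: x_def power2_eq_square mult_ac)
    also have "\<eta> ^ m * \<eta> ^ m = inverse \<eta>" using \<eta>n ne by (simp add: field_simps)
    finally show ?thesis by (simp add: cv mult_ac)
  qed
  have ex: "ev (z * E ^ m) w = x" by (simp add: x_def evE v_def)
  have ex': "ev (z' * E ^ Suc m) w = x'" by (simp add: x'_def evE v'_def)
  have real: "x \<in> \<real>" using \<open>cnj x = x\<close> by (simp add: Reals_cnj_iff)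
  have "x' = inverse x" using inverse_unique[OF xx] by simp
  hence real': "x' \<in> \<real>" using real by simp
  obtain k where k: "\<forall>y. y ^ p = 1 \<longrightarrow> ev (z * E ^ m) y = ev k (y + inverse y)"
    using ev_real_imp_trace[OF odd, of "z * E ^ m"] real unfolding ex by blast
  obtain k' where k': "\<forall>y. y ^ p = 1 \<longrightarrow> ev (z' * E ^ Suc m) y = ev k' (y + inverse y)"
    using ev_real_imp_trace[OF odd, of "z' * E ^ Suc m"] real' unfolding ex' by blast
  have "ev k gam = x" "ev k' gam = x'"
    using k[rule_format, OF w_pow] k'[rule_format, OF w_pow] unfolding ex ex' by (simp_all add: gam_def)
  thus ?thesis using xx sq by (intro exI[of _ k] exI[of _ k']) (simp add: v_def)
qed

end

section \<open>Embeddings of the real cyclotomic field\<close>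

lemma prime_root_cis:
  assumes "prime p"
  shows "prime_root p (cis (2 * pi / real p))"
proof
  have p: "p > 1" by (rule prime_gt_1_nat[OF assms])
  show "prime p" by (rule assms)
  show "cis (2 * pi / real p) ^ p = 1" using p by (simp add: Complex.DeMoivre)
  have "inj_on (\<lambda>k. cis (2 * pi * real k / real p)) {..<p}"
    using Complex.bij_betw_roots_unity[of p] p by (auto simp: bij_betw_def)
  from inj_onD[OF this, of 1 0] show "cis (2 * pi / real p) \<noteq> 1" using p by auto
qed

lemma rat_poly_clear_denominators:
  fixes q :: "rat poly"
  shows "\<exists>D Q. D \<noteq> 0 \<and> (\<forall>z. of_int D * poly (map_poly of_rat q) z = ev Q z)"
proof (induction q)
  case 0
  show ?case by (intro exI[of _ 1] exI[of _ 0]) simp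
next
  case (pCons a q)
  then obtain D Q where D: "D \<noteq> 0" and Q': "\<forall>z. of_int D * poly (map_poly of_rat q) z = ev Q z"
    by (elim exE conjE)
  note Q = Q'[rule_format]
  obtain n m where nm: "quotient_of a = (n, m)" by (rule prod.exhaust)
  have a: "a = of_int n / of_int m" using nm by (rule quotient_of_div)
  have m: "m \<noteq> 0" using quotient_of_denom_pos[OF nm] by simp
  have "(of_rat a :: complex) = of_int n / of_int m" by (simp add: a of_rat_divide)
  hence am: "of_int m * (of_rat a :: complex) = of_int n" using m by simp
  have "of_int (m * D) * poly (map_poly of_rat (pCons a q)) z = ev (pCons (n * D) (smult m Q)) z" for z
  proof -
    have "of_int (m * D) * poly (map_poly of_rat (pCons a q)) z =
        of_int m * of_rat a * of_int D + z * (of_int m * (of_int D * poly (map_poly of_rat q) z))"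
      by (simp add: map_poly_pCons algebra_simps)
    thus ?thesis unfolding am Q by simp
  qed
  moreover have "m * D \<noteq> 0" using m D by simp
  ultimately show ?case by (intro exI[of _ "m * D"] exI[of _ "pCons (n * D) (smult m Q)"] conjI allI)
qed

lemma ev_mem_real_cyclotomic_field: "ev q (real_cyclotomic_generator p) \<in> real_cyclotomic_field p"
proof -
  have "map_poly of_rat (map_poly of_int q :: rat poly) = (map_poly of_int q :: complex poly)"
    by (intro poly_eqI) (simp add: coeff_map_poly)
  hence "ev q (real_cyclotomic_generator p) =
      poly (map_poly of_rat (map_poly of_int q)) (real_cyclotomic_generator p)" by (simp add: ev_def)
  thus ?thesis unfolding real_cyclotomic_field_def by (rule range_eqI)
qed

lemma field_embedding_of_int:
  assumes emb: "\<phi> \<in> field_embeddings (real_cyclotomic_field p)"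
  shows "\<phi> (of_int a) = of_int a"
proof -
  have mem: "of_int b \<in> real_cyclotomic_field p" for b
    using ev_mem_real_cyclotomic_field[of "of_int b" p] by simp
  have add: "\<phi> (of_int b + of_int c) = \<phi> (of_int b) + \<phi> (of_int c)" for b c
    using emb mem unfolding field_embeddings_def by blast
  have one: "\<phi> 1 = 1" using emb by (simp add: field_embeddings_def)
  have zero: "\<phi> 0 = 0" using add[of 0 0] by simp
  show ?thesis
  proof (induction a rule: int_induct[where k = 0])
    case base
    show ?case using zero by simp
  next
    case (step1 i)
    thus ?case using add[of i 1] one by simp
  next
    case (step2 i)
    have "\<phi> (of_int i) = \<phi> (of_int (i - 1)) + 1" using add[of "i - 1" 1] one by simp
    thus ?case unfolding step2.IH by (simp add: algebra_simps)
  qed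
qed

lemma field_embedding_ev:
  assumes emb: "\<phi> \<in> field_embeddings (real_cyclotomic_field p)"
  shows "\<phi> (ev q (real_cyclotomic_generator p)) = ev q (\<phi> (real_cyclotomic_generator p))"
proof (induction q)
  case 0
  show ?case using field_embedding_of_int[OF emb, of 0] by simp
next
  case (pCons a q)
  let ?g = "real_cyclotomic_generator p"
  note mem = ev_mem_real_cyclotomic_field[of _ p]
  have K: "of_int a \<in> real_cyclotomic_field p" "?g \<in> real_cyclotomic_field p"
    "?g * ev q ?g \<in> real_cyclotomic_field p"
    using mem[of "of_int a"] mem[of "[:0, 1:]"] mem[of "[:0, 1:] * q"] by simp_all
  have "\<phi> (of_int a + ?g * ev q ?g) = \<phi> (of_int a) + \<phi> (?g * ev q ?g)"
    using emb K(1,3) unfolding field_embeddings_def by blast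
  also have "\<phi> (?g * ev q ?g) = \<phi> ?g * \<phi> (ev q ?g)"
    using emb K(2) mem[of q] unfolding field_embeddings_def by blast
  finally show ?case by (simp add: pCons.IH field_embedding_of_int[OF emb])
qed

lemma ex_add_inverse_eq: "\<exists>z. z \<noteq> 0 \<and> z + inverse z = (t :: complex)"
proof -
  define z where "z = (t + csqrt (t\<^sup>2 - 4)) / 2"
  have "4 * (z * (t - z)) = (t + csqrt (t\<^sup>2 - 4)) * (t - csqrt (t\<^sup>2 - 4))"
    by (simp add: z_def field_simps)
  also have "\<dots> = 4" by (simp add: algebra_simps flip: power2_eq_square)
  finally have zt: "z * (t - z) = 1" by simp
  hence "inverse z = t - z" by (rule inverse_unique)
  moreover have "z \<noteq> 0" using zt by auto
  ultimately show ?thesis by (intro exI[of _ z]) simp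
qed

context prime_root
begin

lemma gam_eq_generator: "w = cis (2 * pi / p) \<Longrightarrow> gam = real_cyclotomic_generator p"
  unfolding real_cyclotomic_generator_def by (drule sym) (simp only: gam_def)

lemma cyc_units_iff:
  assumes "w = cis (2 * pi / p)"
  shows "u \<in> cyc_units p \<longleftrightarrow> (\<exists>h h'. u = ev h gam \<and> ev h gam * ev h' gam = 1)"
  unfolding cyc_units_def real_cyclotomic_ring_def gam_eq_generator[OF assms] ev_def by auto

lemma root_of_unity_power:
  assumes "w = cis (2 * pi / p)" "z ^ p = 1" "z \<noteq> 1"
  shows "\<exists>j\<in>{1..<p}. z = w ^ j"
proof -
  have "z \<in> (\<lambda>k. cis (2 * pi * real k / real p)) ` {..<p}"
    using Complex.bij_betw_roots_unity[of p] p_gt_1 assms(2) by (simp add: bij_betw_def)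
  then obtain k where k: "k < p" "z = cis (2 * pi * real k / real p)" by auto
  have "w ^ k = cis (real k * (2 * pi / real p))" unfolding assms(1) by (rule Complex.DeMoivre)
  also have "\<dots> = z" unfolding k(2) by (simp add: mult_ac)
  finally have "z = w ^ k" by (rule sym)
  moreover have "k \<noteq> 0" using calculation assms(3) by (intro notI) simp
  ultimately show ?thesis using k(1) by (intro bexI[of _ k]) simp_all
qed

text \<open>Write the image of gam as z + 1/z. The Dickson polynomial of index p is 2 at gam, hence
  at the image, and this forces z^p = 1; \<open>Phi\<close> rewritten as a polynomial in z + 1/z
  excludes z = 1.\<close>

lemma field_embedding_gam:
  assumes w: "w = cis (2 * pi / p)" and odd: "odd p"
    and emb: "\<phi> \<in> field_embeddings (real_cyclotomic_field p)"
  shows "\<exists>j\<in>{1..<p}. \<phi> gam = w ^ j + inverse (w ^ j)"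
proof -
  note phi = field_embedding_ev[OF emb, folded gam_eq_generator[OF w]]
  obtain z where z: "z \<noteq> 0" "z + inverse z = \<phi> gam" using ex_add_inverse_eq[of "\<phi> gam"] by (elim exE conjE)
  have "ev (dickson p) gam = of_int 2"
    unfolding gam_def ev_dickson[OF w_ne_0] by (simp add: w_pow power_inverse)
  hence "ev (dickson p) (\<phi> gam) = 2"
    using phi[of "dickson p"] field_embedding_of_int[OF emb, of 2] by simp
  hence "z ^ p + inverse (z ^ p) = 2"
    unfolding z(2)[symmetric] ev_dickson[OF z(1)] by (simp add: power_inverse)
  hence "(z ^ p - 1)\<^sup>2 = 0" using z(1) by (simp add: field_simps power2_eq_square)
  hence zp: "z ^ p = 1" by simp
  have "ev Phi w \<in> \<real>" by simp
  from ev_real_imp_trace[OF odd this]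
  obtain h where h': "\<forall>y. y ^ p = 1 \<longrightarrow> ev Phi y = ev h (y + inverse y)" by (elim exE)
  note h = h'[rule_format]
  have "ev h gam = of_int 0" using h[OF w_pow] by (simp add: gam_def)
  hence "ev h (\<phi> gam) = 0" using phi[of h] field_embedding_of_int[OF emb, of 0] by simp
  hence "ev Phi z = 0" using h[OF zp] z(2) by simp
  moreover have "ev Phi 1 \<noteq> 0" using p_gt_1 by (simp add: ev_Phi)
  ultimately have "z \<noteq> 1" by auto
  from root_of_unity_power[OF w zp this] obtain j where "j \<in> {1..<p}" "z = w ^ j" by (elim bexE)
  thus ?thesis using z(2) by (intro bexI[of _ j]) simp_all
qed

text \<open>Q(gam) / D has to go to Q(g) / D. The relation R collects these pairs; it is
  single-valued because a polynomial relation at gam also holds at its conjugate g.\<close>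

lemma ex_field_embedding:
  assumes w: "w = cis (2 * pi / p)" and j: "\<not> p dvd j"
  shows "\<exists>\<phi> \<in> field_embeddings (real_cyclotomic_field p). \<phi> gam = w ^ j + inverse (w ^ j)"
proof -
  define g where "g = w ^ j + inverse (w ^ j)"
  define R where "R x y \<longleftrightarrow> (\<exists>Q D. D \<noteq> 0 \<and> of_int D * x = ev Q gam \<and> of_int D * y = ev Q g)" for x y
  have unique: "y = y'" if xy: "R x y" "R x y'" for x y y'
  proof -
    obtain Q D where 1: "D \<noteq> 0" "of_int D * x = ev Q gam" "of_int D * y = ev Q g"
      using xy(1) unfolding R_def by (elim exE conjE)
    obtain Q' D' where 2: "D' \<noteq> 0" "of_int D' * x = ev Q' gam" "of_int D' * y' = ev Q' g"
      using xy(2) unfolding R_def by (elim exE conjE)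
    let ?P = "smult D' Q - smult D Q'"
    have "ev ?P gam = 0" by (simp add: 1(2)[symmetric] 2(2)[symmetric])
    hence "ev (trace_lift ?P) (w ^ j) = 0"
      unfolding ev_conj_iff[OF j] ev_trace_lift_w .
    hence "ev ?P g = 0" by (simp add: ev_trace_lift w_power_power g_def)
    hence "of_int D' * (of_int D * y) = of_int D * (of_int D' * y')" by (simp add: 1(3) 2(3))
    thus ?thesis using 1(1) 2(1) by simp
  qed
  have total: "\<exists>y. R x y" if x: "x \<in> real_cyclotomic_field p" for x
  proof -
    obtain q where q: "x = poly (map_poly of_rat q) gam"
      using x unfolding real_cyclotomic_field_def gam_eq_generator[OF w] by (elim rangeE)
    obtain D Q where D: "D \<noteq> 0" and Q': "\<forall>z. of_int D * poly (map_poly of_rat q) z = ev Q z"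
      using rat_poly_clear_denominators[of q] by (elim exE conjE)
    note Q = Q'[rule_format]
    show ?thesis unfolding R_def q using D Q
      by (intro exI[of _ "poly (map_poly of_rat q) g"] exI[of _ Q] exI[of _ D] conjI)
  qed
  have add: "R (x + x') (y + y')" and mult: "R (x * x') (y * y')" if xy: "R x y" "R x' y'" for x x' y y'
  proof -
    obtain Q D where 1: "D \<noteq> 0" "of_int D * x = ev Q gam" "of_int D * y = ev Q g"
      using xy(1) unfolding R_def by (elim exE conjE)
    obtain Q' D' where 2: "D' \<noteq> 0" "of_int D' * x' = ev Q' gam" "of_int D' * y' = ev Q' g"
      using xy(2) unfolding R_def by (elim exE conjE)
    show "R (x + x') (y + y')" unfolding R_def
      by (intro exI[of _ "smult D' Q + smult D Q'"] exI[of _ "D * D'"])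
        (simp add: 1(1) 2(1) 1(2,3)[symmetric] 2(2,3)[symmetric] algebra_simps)
    show "R (x * x') (y * y')" unfolding R_def
      by (intro exI[of _ "Q * Q'"] exI[of _ "D * D'"])
        (simp add: 1(1) 2(1) 1(2,3)[symmetric] 2(2,3)[symmetric] mult_ac)
  qed
  have R1: "R 1 1" unfolding R_def by (intro exI[of _ 1]) simp
  have Rg: "R gam g" unfolding R_def by (intro exI[of _ "[:0, 1:]"] exI[of _ 1]) simp
  define \<phi> where "\<phi> x = (SOME y. R x y)" for x
  have phi: "\<phi> x = y" if xy: "R x y" for x y
    unfolding \<phi>_def by (intro some_equality) (rule xy, erule unique[OF _ xy])
  have "\<phi> \<in> field_embeddings (real_cyclotomic_field p)"
    unfolding field_embeddings_def mem_Collect_eq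
  proof (intro conjI ballI)
    show "\<phi> 1 = 1" by (rule phi[OF R1])
    fix x x' assume "x \<in> real_cyclotomic_field p" "x' \<in> real_cyclotomic_field p"
    then obtain y y' where y: "R x y" "R x' y'" using total by (metis (no_types))
    show "\<phi> (x + x') = \<phi> x + \<phi> x'" using phi[OF add[OF y]] phi y by simp
    show "\<phi> (x * x') = \<phi> x * \<phi> x'" using phi[OF mult[OF y]] phi y by simp
  qed
  moreover have "\<phi> gam = w ^ j + inverse (w ^ j)" using phi[OF Rg] by (simp add: g_def)
  ultimately show ?thesis by (intro bexI[of _ \<phi>])
qed

lemma totpos_units_iff:
  assumes w: "w = cis (2 * pi / p)" and odd: "odd p"
  shows "u \<in> totpos_units p \<longleftrightarrow> (\<exists>h h'. u = ev h gam \<and> ev h gam * ev h' gam = 1 \<and>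
    (\<forall>j\<in>{1..<p}. ev h (w ^ j + inverse (w ^ j)) \<in> \<real> \<and> 0 < Re (ev h (w ^ j + inverse (w ^ j)))))"
  (is "_ \<longleftrightarrow> ?rhs")
proof
  assume u: "u \<in> totpos_units p"
  hence "u \<in> cyc_units p" by (simp add: totpos_units_def)
  then obtain h h' where h: "u = ev h gam" "ev h gam * ev h' gam = 1"
    unfolding cyc_units_iff[OF w] by (elim exE conjE)
  have "ev h (w ^ j + inverse (w ^ j)) \<in> \<real> \<and> 0 < Re (ev h (w ^ j + inverse (w ^ j)))" if j: "j \<in> {1..<p}" for j
  proof -
    obtain \<phi> where \<phi>: "\<phi> \<in> field_embeddings (real_cyclotomic_field p)" "\<phi> gam = w ^ j + inverse (w ^ j)"
      using ex_field_embedding[OF w not_dvd_range[OF j]] by (elim bexE)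
    have "\<phi> u = ev h (w ^ j + inverse (w ^ j))"
      using field_embedding_ev[OF \<phi>(1), folded gam_eq_generator[OF w]] by (simp only: h(1) \<phi>(2))
    moreover have "\<phi> u \<in> \<real> \<and> 0 < Re (\<phi> u)" using u \<phi>(1) by (simp add: totpos_units_def)
    ultimately show ?thesis by simp
  qed
  thus ?rhs using h by blast
next
  assume ?rhs
  then obtain h h' where h: "u = ev h gam" "ev h gam * ev h' gam = 1"
    and pos: "\<forall>j\<in>{1..<p}. ev h (w ^ j + inverse (w ^ j)) \<in> \<real> \<and> 0 < Re (ev h (w ^ j + inverse (w ^ j)))"
    by (elim exE conjE)
  have "u \<in> cyc_units p" unfolding cyc_units_iff[OF w] using h by blast
  moreover have "\<phi> u \<in> \<real> \<and> 0 < Re (\<phi> u)" if emb: "\<phi> \<in> field_embeddings (real_cyclotomic_field p)" for \<phi>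
  proof -
    obtain j where j: "j \<in> {1..<p}" "\<phi> gam = w ^ j + inverse (w ^ j)"
      using field_embedding_gam[OF w odd emb] by (elim bexE)
    have "\<phi> u = ev h (w ^ j + inverse (w ^ j))"
      using field_embedding_ev[OF emb, folded gam_eq_generator[OF w]] by (simp only: h(1) j(2))
    thus ?thesis using pos j(1) by simp
  qed
  ultimately show "u \<in> totpos_units p" by (simp add: totpos_units_def)
qed

end

text \<open>The prime factors of n are removed one at a time; the common denominator d serves at
  every stage.\<close>

lemma (in prime_root) denominator:
  assumes "n > 0" "d \<noteq> 0" and "\<And>s. \<exists>r. of_int d * ev q w ^ s = of_nat n ^ s * ev r w"
  shows "\<exists>z. ev q w = of_nat n * ev z w"
  using assms(1,3)
proof (induction n arbitrary: q rule: less_induct)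
  case (less n)
  show ?case
  proof (cases "n = 1")
    case True
    thus ?thesis by (intro exI[of _ q]) simp
  next
    case False
    from prime_factor_nat[OF this] obtain l where l: "prime l" "l dvd n" by (elim exE conjE)
    then obtain n' where n': "n = l * n'" by (elim dvdE)
    have l1: "l > 1" by (rule prime_gt_1_nat[OF l(1)])
    have n'0: "n' > 0" "n' < n" using less.prems(1) l1 by (auto simp: n')
    have "\<exists>r. of_int d * ev q w ^ s = of_nat l ^ s * ev r w" for s
    proof -
      obtain r where "of_int d * ev q w ^ s = of_nat n ^ s * ev r w" using less.prems(2) by (rule exE)
      hence "of_int d * ev q w ^ s = of_nat l ^ s * ev (of_nat n' ^ s * r) w"
        by (simp add: n' power_mult_distrib)
      thus ?thesis by (rule exI)
    qed
    from prime_denominator[OF l(1) assms(2) this]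
    obtain q' where q': "ev q w = of_nat l * ev q' w" by (elim exE)
    have "\<exists>r. of_int d * ev q' w ^ s = of_nat n' ^ s * ev r w" for s
    proof -
      obtain r where "of_int d * ev q w ^ s = of_nat n ^ s * ev r w" using less.prems(2) by (rule exE)
      hence "of_nat l ^ s * (of_int d * ev q' w ^ s) = of_nat l ^ s * (of_nat n' ^ s * ev r w)"
        unfolding q' n' by (simp add: power_mult_distrib mult_ac)
      hence "of_int d * ev q' w ^ s = of_nat n' ^ s * ev r w" using l1 by simp
      thus ?thesis by (rule exI)
    qed
    from less.IH[OF n'0(2,1) this] obtain z where "ev q' w = of_nat n' * ev z w" by (elim exE)
    hence "ev q w = of_nat n * ev z w" unfolding q' n' by simp
    thus ?thesis by (rule exI)
  qed
qed

lemma (in prime_root) w_power_inj: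
  assumes "i < p" "j < p" "w ^ i = w ^ j"
  shows "i = j"
proof (rule ccontr)
  assume "i \<noteq> j"
  define a b where "a = min i j" and "b = max i j"
  have ab: "a < b" "b < p" "w ^ a = w ^ b"
    using assms \<open>i \<noteq> j\<close> unfolding a_def b_def by (cases "i \<le> j"; simp)+
  have "w ^ a * w ^ (b - a) = w ^ b" using ab(1) by (simp flip: power_add)
  hence "w ^ a * w ^ (b - a) = w ^ a * 1" by (simp only: ab(3) mult_1_right)
  hence "w ^ (b - a) = 1" by simp
  hence "p dvd b - a" unfolding w_power_eq_1_iff .
  thus False using ab(1,2) by (auto dest: dvd_imp_le)
qed

section \<open>Endomorphisms generated by the automorphism\<close>

lemma torus_AutD:
  assumes "f \<in> torus_Aut L"
  shows "clinear f" "bij f" "f ` L = L" "f \<in> torus_End L" "x \<in> L \<Longrightarrow> f x \<in> L"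
  using assms by (auto simp: torus_Aut_def torus_End_def)

lemma torus_Aut_inv:
  assumes f: "f \<in> torus_Aut L"
  shows "inv_into UNIV f \<in> torus_Aut L"
proof -
  note f' = torus_AutD[OF f]
  have "inv_into UNIV f ` L = inv_into UNIV f ` (f ` L)" by (simp only: f'(3))
  also have "\<dots> = L" by (rule image_inv_f_f[OF bij_is_inj[OF f'(2)]])
  finally show ?thesis
    using clinear_inv[OF f'(1,2)] bij_imp_bij_inv[OF f'(2)] by (simp add: torus_Aut_def)
qed

lemma torus_End_funpow:
  assumes "f \<in> torus_End L"
  shows "f ^^ k \<in> torus_End L"
proof -
  have f: "clinear f" "f ` L \<subseteq> L" using assms by (simp_all add: torus_End_def)
  have "(f ^^ k) ` L \<subseteq> L" by (induction k) (use f(2) in auto)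
  thus ?thesis using funpow_clinear[OF f(1)] by (simp add: torus_End_def)
qed

lemma torus_AutI:
  assumes f: "f \<in> torus_End L" "f' \<in> torus_End L" and inv: "\<And>v. f (f' v) = v" "\<And>v. f' (f v) = v"
  shows "f \<in> torus_Aut L"
proof -
  have "bij f" by (rule bijI'[of f]) (metis inv(2), metis inv(1))
  moreover have "L \<subseteq> f ` L"
  proof
    fix x assume "x \<in> L"
    hence "f' x \<in> L" using f(2) by (auto simp: torus_End_def)
    thus "x \<in> f ` L" using inv(1)[of x] by (rule_tac image_eqI[of _ _ "f' x"]) simp_all
  qed
  ultimately show ?thesis using f(1) by (auto simp: torus_Aut_def torus_End_def)
qed

text \<open>If |r| < 1, the powers of f would map l to arbitrarily small nonzero lattice vectors;
  the inverse automorphism excludes |r| > 1.\<close>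

lemma torus_Aut_scalar:
  assumes L: "is_lattice L" and f: "f \<in> torus_Aut L" and l: "l \<in> L" "l \<noteq> 0" "f l = r *\<^sub>R l"
  shows "\<bar>r\<bar> = 1"
proof -
  have ge1: "1 \<le> \<bar>s\<bar>" if g: "g \<in> torus_Aut L" "g l = s *\<^sub>R l" for g s
  proof (rule ccontr)
    assume less: "\<not> 1 \<le> \<bar>s\<bar>"
    note glin = clinear_imp_linear[OF torus_AutD(1)[OF g(1)]]
    have gk: "(g ^^ k) l = (s ^ k) *\<^sub>R l" for k
      by (induction k) (simp_all add: g(2) linear_scale[OF glin])
    have "(s ^ k) *\<^sub>R l \<in> L" for k
      using torus_End_funpow[OF torus_AutD(4)[OF g(1)], of k] l(1) unfolding gk[symmetric]
      by (auto simp: torus_End_def)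
    hence "s = 0" using lattice_contract_eq_0[OF L, of s l] less l(2) by auto
    hence "g l = g 0" using g(2) linear_0[OF glin] by simp
    thus False using bij_is_inj[OF torus_AutD(2)[OF g(1)]] l(2) by (simp add: inj_eq)
  qed
  have "1 \<le> \<bar>r\<bar>" by (rule ge1[OF f l(3)])
  moreover have "inv_into UNIV f l = inverse r *\<^sub>R l"
  proof -
    have "r \<noteq> 0" using \<open>1 \<le> \<bar>r\<bar>\<close> by auto
    hence "f (inverse r *\<^sub>R l) = l"
      using l(3) linear_scale[OF clinear_imp_linear[OF torus_AutD(1)[OF f]]] by simp
    thus ?thesis by (metis bij_is_inj inv_f_f torus_AutD(2)[OF f])
  qed
  hence "1 \<le> \<bar>inverse r\<bar>" by (rule ge1[OF torus_Aut_inv[OF f]])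
  ultimately show ?thesis by (simp add: one_le_inverse_iff)
qed

context ppav_aut
begin

lemma pact_End: "pact \<sigma> q \<in> torus_End L"
  using pact_clinear[OF s_clinear] pact_lattice[OF s_clinear lat s_lattice] by (auto simp: torus_End_def)

lemma herm_eig_sum:
  assumes u: "\<And>j. j < p \<Longrightarrow> u j \<in> eig j" and v: "\<And>j. j < p \<Longrightarrow> v j \<in> eig j"
  shows "H (\<Sum>j<p. u j) (\<Sum>j<p. v j) = (\<Sum>j<p. H (u j) (v j))"
proof -
  have "H (\<Sum>j<p. u j) (\<Sum>j<p. v j) = (\<Sum>i<p. \<Sum>j<p. H (u i) (v j))"
    unfolding herm_sum_left[OF herm] unfolding herm_sum_right[OF herm] by (rule refl)
  also have "\<dots> = (\<Sum>i<p. \<Sum>j<p. if j = i then H (u i) (v i) else 0)"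
  proof (intro sum.cong refl)
    fix i j assume ij: "i \<in> {..<p}" "j \<in> {..<p}"
    show "H (u i) (v j) = (if j = i then H (u i) (v i) else 0)"
    proof (cases "j = i")
      case False
      hence "w ^ i \<noteq> w ^ j" using w_power_inj[of i j] ij by auto
      thus ?thesis using False eig_orthogonal[OF u v, of i j] ij by simp
    qed simp
  qed
  also have "\<dots> = (\<Sum>i<p. H (u i) (v i))" by (intro sum.cong refl) simp
  finally show ?thesis .
qed

lemma ex_fixed_lattice_point:
  assumes "eig 0 \<noteq> {0}"
  shows "\<exists>l\<in>L. l \<in> eig 0 \<and> l \<noteq> 0"
proof (rule ccontr)
  assume none: "\<not> ?thesis"
  have "pact \<sigma> Phi l = 0" if "l \<in> L" for l
  proof -
    have "pact \<sigma> Phi l \<in> L" by (rule pact_lattice[OF s_clinear lat s_lattice that])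
    moreover have "pact \<sigma> Phi l \<in> eig 0" by (simp add: eig_def s_pact_Phi)
    ultimately show ?thesis using none by blast
  qed
  hence z: "pact \<sigma> Phi = (\<lambda>_. 0)"
    using linear_eq_on_lattice[OF lat pact_linear[OF s_clinear] linear_zero] by blast
  obtain v where v: "v \<in> eig 0" "v \<noteq> 0" using assms eig_0[of 0] by blast
  have "pact \<sigma> Phi v = of_nat p *s v" using pact_eig[OF v(1), of Phi] by (simp add: ev_Phi)
  hence "of_nat p *s v = 0" unfolding z by simp
  thus False using v(2) p_gt_1 by simp
qed

lemma ex_moved_lattice_point: "\<exists>l\<in>L. \<sigma> l \<noteq> l"
proof (rule ccontr)
  assume "\<not> ?thesis"
  hence "\<sigma> = (\<lambda>x. x)" by (intro linear_eq_on_lattice[OF lat s_linear linear_id[unfolded id_def]]) blast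
  thus False using s_ne_id by (simp add: id_def)
qed

lemma pact_moved_eq_0:
  assumes Q: "\<And>j v. \<not> p dvd j \<Longrightarrow> v \<in> eig j \<Longrightarrow> pact \<sigma> Q v = 0"
  shows "pact \<sigma> Q (v - \<sigma> v) = 0"
proof -
  have lin: "linear (\<lambda>v. pact \<sigma> Q (v - \<sigma> v))"
    using linear_compose[OF linear_compose_sub[OF linear_id s_linear] pact_linear[OF s_clinear]]
    by (simp add: o_def)
  have "pact \<sigma> Q (v - \<sigma> v) = (\<lambda>_. 0) v"
  proof (rule eig_eqI[OF lin linear_zero])
    fix j v assume "j < p" and v: "v \<in> eig j"
    show "pact \<sigma> Q (v - \<sigma> v) = 0"
    proof (cases "j = 0")
      case True
      hence "\<sigma> v = v" using eigD[OF v] by simp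
      thus ?thesis using linear_0[OF pact_linear[OF s_clinear]] by simp
    next
      case False
      hence j: "\<not> p dvd j" using \<open>j < p\<close> by (auto dest: dvd_imp_le)
      have "\<sigma> v \<in> eig j" unfolding eigD[OF v] by (rule eig_scale[OF v])
      thus ?thesis using Q[OF j] v by (simp add: linear_diff[OF pact_linear[OF s_clinear]])
    qed
  qed
  thus ?thesis by simp
qed

text \<open>v - \<sigma> v has no component in \<open>eig 0\<close>. If Q(w) \<noteq> 0, then Q is
  invertible up to a nonzero integer on the moved eigenspaces, so Q(\<sigma>) could not kill this
  nonzero vector.\<close>

lemma pact_moved_root:
  assumes Q: "pact \<sigma> Q (v - \<sigma> v) = 0" and v: "\<sigma> v \<noteq> v"
  shows "ev Q w = 0"
proof (rule ccontr)
  assume "ev Q w \<noteq> 0"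
  from ev_inverse[OF this] obtain r D where D: "D \<noteq> 0" "ev (r * Q) w = of_int D" by (elim exE conjE)
  have "pact \<sigma> (r * Q - of_int D) u = 0" if j: "\<not> p dvd j" and u: "u \<in> eig j" for j u
  proof -
    have "ev (r * Q - of_int D) (w ^ j) = 0" unfolding ev_conj_iff[OF j] using D(2) by simp
    thus ?thesis unfolding pact_eig[OF u] by simp
  qed
  hence "pact \<sigma> (r * Q - of_int D) (v - \<sigma> v) = 0" by (rule pact_moved_eq_0)
  hence "pact \<sigma> r (pact \<sigma> Q (v - \<sigma> v)) = of_int D *\<^sub>R (v - \<sigma> v)"
    by (simp add: pact_diff[OF s_clinear] pact_mult[OF s_clinear] pact_of_int[OF s_clinear])
  hence "of_int D *\<^sub>R (v - \<sigma> v) = 0"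
    unfolding Q by (simp add: linear_0[OF pact_linear[OF s_clinear]])
  thus False using D(1) v by simp
qed

text \<open>Modulo Z[\<sigma>] m0 such an x can be moved into a fixed ball by rounding its rational
  coefficients, and the ball contains finitely many lattice points. The product of their
  denominators serves for all x.\<close>

lemma bounded_multiples:
  assumes m0: "m0 \<in> L"
  shows "\<exists>d. d \<noteq> 0 \<and> (\<forall>x m q. x \<in> L \<longrightarrow> m \<noteq> 0 \<longrightarrow> of_int m *\<^sub>R x = pact \<sigma> q m0 \<longrightarrow>
    (\<exists>r. of_int d *\<^sub>R x = pact \<sigma> r m0))"
proof -
  define R where "R = (\<Sum>k<p. norm ((\<sigma> ^^ k) m0))"
  define F where "F = L \<inter> cball 0 R"
  have finF: "finite F" unfolding F_def by (rule lattice_bounded_finite[OF lat])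
  define P where "P y D \<longleftrightarrow> D \<noteq> 0 \<and> (\<exists>q. of_int D *\<^sub>R y = pact \<sigma> q m0)" for y and D :: int
  \<comment> \<open>The default 1 covers lattice points without a multiple in Z[\<sigma>] m0 and
    keeps the product nonzero.\<close>
  define D where "D y = (if \<exists>D. P y D then SOME D. P y D else 1)" for y
  have DP: "P y (D y)" if "P y D'" for y D'
    unfolding D_def using that someI_ex[of "P y"] by auto
  have D0: "D y \<noteq> 0" for y
    by (cases "\<exists>D. P y D") (use DP[of y] in \<open>auto simp: P_def D_def\<close>)
  define d where "d = prod D F"
  have d0: "d \<noteq> 0" unfolding d_def using D0 finF by simp
  have "\<exists>r. of_int d *\<^sub>R x = pact \<sigma> r m0" if x: "x \<in> L" and m: "m \<noteq> 0" and q: "of_int m *\<^sub>R x = pact \<sigma> q m0" for x m q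
  proof -
    obtain c :: "nat \<Rightarrow> int" where "\<forall>v. pact \<sigma> q v = (\<Sum>k<p. of_int (c k) *\<^sub>R (\<sigma> ^^ k) v)"
      using pact_reduce[of q] by (elim exE)
    hence mx: "of_int m *\<^sub>R x = (\<Sum>k<p. of_int (c k) *\<^sub>R (\<sigma> ^^ k) m0)" unfolding q by blast
    define a where "a = (\<Sum>k<p. monom (c k div m) k)"
    define y where "y = x - pact \<sigma> a m0"
    have am: "pact \<sigma> a m0 = (\<Sum>k<p. of_int (c k div m) *\<^sub>R (\<sigma> ^^ k) m0)"
      by (simp add: a_def pact_sum[OF s_clinear] pact_monom[OF s_clinear])
    have my: "of_int m *\<^sub>R y = (\<Sum>k<p. of_int (c k mod m) *\<^sub>R (\<sigma> ^^ k) m0)"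
    proof -
      have "of_int m *\<^sub>R y = (\<Sum>k<p. of_int (c k) *\<^sub>R (\<sigma> ^^ k) m0 - of_int (m * (c k div m)) *\<^sub>R (\<sigma> ^^ k) m0)"
        unfolding y_def am by (simp add: scaleR_diff_right mx sum_subtractf scaleR_sum_right)
      also have "\<dots> = (\<Sum>k<p. of_int (c k mod m) *\<^sub>R (\<sigma> ^^ k) m0)"
        unfolding scaleR_diff_left[symmetric] of_int_diff[symmetric] minus_mult_div_eq_mod ..
      finally show ?thesis .
    qed
    have "y \<in> L" unfolding y_def
      by (rule lattice_diff[OF lat x pact_lattice[OF s_clinear lat s_lattice m0]])
    moreover have "norm y \<le> R"
    proof -
      have "\<bar>of_int m\<bar> * norm y = norm (\<Sum>k<p. of_int (c k mod m) *\<^sub>R (\<sigma> ^^ k) m0)"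
        by (simp flip: my)
      also have "\<dots> \<le> (\<Sum>k<p. norm (of_int (c k mod m) *\<^sub>R (\<sigma> ^^ k) m0))" by (rule norm_sum)
      also have "\<dots> \<le> (\<Sum>k<p. \<bar>of_int m\<bar> * norm ((\<sigma> ^^ k) m0))"
      proof (rule sum_mono)
        fix k
        have "\<bar>c k mod m\<bar> \<le> \<bar>m\<bar>" using abs_mod_less[of m "c k"] m by simp
        hence "(of_int \<bar>c k mod m\<bar> :: real) \<le> of_int \<bar>m\<bar>" by (simp only: of_int_le_iff)
        thus "norm (of_int (c k mod m) *\<^sub>R (\<sigma> ^^ k) m0) \<le> \<bar>of_int m\<bar> * norm ((\<sigma> ^^ k) m0)"
          by (simp add: mult_right_mono)
      qed
      also have "\<dots> = \<bar>of_int m\<bar> * R" by (simp add: R_def sum_distrib_left)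
      finally show ?thesis using m by simp
    qed
    ultimately have yF: "y \<in> F" by (simp add: F_def)
    have "of_int m *\<^sub>R y = pact \<sigma> (\<Sum>k<p. monom (c k mod m) k) m0"
      unfolding my by (simp add: pact_sum[OF s_clinear] pact_monom[OF s_clinear])
    hence "P y m" unfolding P_def using m by blast
    hence "P y (D y)" by (rule DP)
    then obtain b where b: "of_int (D y) *\<^sub>R y = pact \<sigma> b m0" unfolding P_def by (elim exE conjE)
    have "D y dvd d" unfolding d_def using finF yF by (rule dvd_prodI)
    then obtain e where e: "d = D y * e" by (elim dvdE)
    have "of_int d *\<^sub>R x = of_int e *\<^sub>R (of_int (D y) *\<^sub>R y) + of_int d *\<^sub>R pact \<sigma> a m0"
      by (simp add: y_def e scaleR_diff_right mult.commute)
    also have "\<dots> = pact \<sigma> (smult e b + smult d a) m0"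
      unfolding b by (simp add: pact_add[OF s_clinear] pact_smult[OF s_clinear])
    finally show ?thesis by (rule exI)
  qed
  thus ?thesis using d0 by blast
qed

text \<open>Kronecker's theorem on algebraic integers whose conjugates have absolute value 1, with L
  in place of integral minimal polynomials: off \<open>eig 0\<close> the operator E(\<sigma>) is an
  isometry of H, so the orbit of a lattice vector under its powers is bounded, hence finite.\<close>

lemma unit_modulus_finite_order:
  assumes mod1: "\<And>j. \<not> p dvd j \<Longrightarrow> norm (ev E (w ^ j)) = 1"
  shows "\<exists>t>0. ev E w ^ t = 1"
proof -
  obtain l where l: "l \<in> L" "\<sigma> l \<noteq> l" using ex_moved_lattice_point by (elim bexE)
  define m0 where "m0 = l - \<sigma> l"
  have m0: "m0 \<in> L" unfolding m0_def using l(1) s_lattice by (intro lattice_diff[OF lat]) auto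
  have iso: "H (pact \<sigma> E v) (pact \<sigma> E v) = H v v" if v: "pact \<sigma> Phi v = 0" for v
  proof -
    obtain u where u: "\<forall>j<p. u j \<in> eig j" "v = (\<Sum>j<p. u j)" using eig_decomp[of v] by (elim exE conjE)
    have u0: "u 0 = 0"
    proof -
      have "pact \<sigma> Phi v = (\<Sum>j<p. if j = 0 then of_nat p *s u 0 else 0)"
        unfolding u(2) linear_sum[OF pact_linear[OF s_clinear]]
      proof (rule sum.cong)
        fix j assume "j \<in> {..<p}"
        hence j: "j < p" by simp
        show "pact \<sigma> Phi (u j) = (if j = 0 then of_nat p *s u 0 else 0)"
        proof (cases "j = 0")
          case True
          thus ?thesis using pact_eig[OF u(1)[rule_format, OF j], of Phi] by (simp add: ev_Phi)
        next
          case False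
          hence "\<not> p dvd j" using j by (auto dest: dvd_imp_le)
          hence "ev Phi (w ^ j) = 0" by (simp add: ev_conj_iff)
          thus ?thesis using False pact_eig[OF u(1)[rule_format, OF j], of Phi] by simp
        qed
      qed simp
      also have "\<dots> = of_nat p *s u 0" using p_gt_1 by simp
      finally show ?thesis using v p_gt_1 by simp
    qed
    have ue: "u j \<in> eig j" "ev E (w ^ j) *s u j \<in> eig j" if "j < p" for j
      using u(1) that by (simp_all add: eig_scale)
    have "pact \<sigma> E v = (\<Sum>j<p. ev E (w ^ j) *s u j)"
      unfolding u(2) linear_sum[OF pact_linear[OF s_clinear]] using pact_eig u(1) by (intro sum.cong) simp_all
    hence "H (pact \<sigma> E v) (pact \<sigma> E v) = (\<Sum>j<p. H (ev E (w ^ j) *s u j) (ev E (w ^ j) *s u j))"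
      using herm_eig_sum[OF ue(2) ue(2)] by simp
    also have "\<dots> = (\<Sum>j<p. H (u j) (u j))"
    proof (intro sum.cong refl)
      fix j assume j: "j \<in> {..<p}"
      show "H (ev E (w ^ j) *s u j) (ev E (w ^ j) *s u j) = H (u j) (u j)"
      proof (cases "j = 0")
        case True
        thus ?thesis using u0 by simp
      next
        case False
        hence "\<not> p dvd j" using j by (auto dest: dvd_imp_le)
        hence "cnj (ev E (w ^ j)) * ev E (w ^ j) = 1"
          using mod1[of j] by (simp add: mult.commute[of "cnj _"] complex_norm_square[symmetric])
        thus ?thesis by (simp add: herm_scale_left[OF herm] herm_scale_right[OF herm] flip: mult.assoc)
      qed
    qed
    also have "\<dots> = H v v" unfolding u(2) using herm_eig_sum[OF ue(1) ue(1)] by simp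
    finally show ?thesis .
  qed
  have phi0: "pact \<sigma> Phi m0 = 0"
    unfolding m0_def by (rule pact_moved_eq_0) (simp add: pact_eig ev_conj_iff)
  have fix1: "pact \<sigma> Phi (pact \<sigma> (E ^ s) m0) = 0" for s
  proof -
    have "pact \<sigma> Phi (pact \<sigma> (E ^ s) m0) = pact \<sigma> (E ^ s) (pact \<sigma> Phi m0)"
      unfolding pact_mult[OF s_clinear, symmetric] by (simp only: mult.commute)
    thus ?thesis by (simp add: phi0 linear_0[OF pact_linear[OF s_clinear]])
  qed
  have isos: "H (pact \<sigma> (E ^ s) m0) (pact \<sigma> (E ^ s) m0) = H m0 m0" for s
  proof (induction s)
    case (Suc s)
    have "pact \<sigma> (E ^ Suc s) m0 = pact \<sigma> E (pact \<sigma> (E ^ s) m0)"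
      unfolding power_Suc pact_mult[OF s_clinear] ..
    thus ?case using iso[OF fix1[of s]] Suc.IH by simp
  qed (simp add: pact_1[OF s_clinear])
  obtain c where c: "c > 0" "\<And>x. c * (norm x)\<^sup>2 \<le> Re (H x x)" using herm_norm_lower[OF herm] by blast
  define R where "R = sqrt (Re (H m0 m0) / c)"
  have "pact \<sigma> (E ^ s) m0 \<in> L \<inter> cball 0 R" for s
  proof -
    have "(norm (pact \<sigma> (E ^ s) m0))\<^sup>2 \<le> Re (H m0 m0) / c"
      using c(2)[of "pact \<sigma> (E ^ s) m0"] c(1) by (simp add: isos field_simps)
    hence "norm (pact \<sigma> (E ^ s) m0) \<le> R" unfolding R_def by (rule real_le_rsqrt)
    thus ?thesis using pact_lattice[OF s_clinear lat s_lattice m0] by simp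
  qed
  hence "range (\<lambda>s. pact \<sigma> (E ^ s) m0) \<subseteq> L \<inter> cball 0 R" by blast
  hence fin: "finite (range (\<lambda>s. pact \<sigma> (E ^ s) m0))"
    by (rule finite_subset) (rule lattice_bounded_finite[OF lat])
  have "\<exists>a b. a < b \<and> pact \<sigma> (E ^ a) m0 = pact \<sigma> (E ^ b) m0"
  proof (rule ccontr)
    assume none: "\<not> ?thesis"
    have "inj (\<lambda>s. pact \<sigma> (E ^ s) m0)"
    proof (rule linorder_injI, rule notI)
      fix a b :: nat
      assume "a < b" "pact \<sigma> (E ^ a) m0 = pact \<sigma> (E ^ b) m0"
      hence "\<exists>a b. a < b \<and> pact \<sigma> (E ^ a) m0 = pact \<sigma> (E ^ b) m0" by (intro exI conjI)
      from none this show False by (rule notE)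
    qed
    hence "infinite (range (\<lambda>s. pact \<sigma> (E ^ s) m0))" by (rule range_inj_infinite)
    from this fin show False by (rule notE)
  qed
  then obtain a b where ab: "a < b" "pact \<sigma> (E ^ a) m0 = pact \<sigma> (E ^ b) m0" by (elim exE conjE)
  have "pact \<sigma> (E ^ a - E ^ b) m0 = 0" by (simp add: pact_diff[OF s_clinear] ab(2))
  hence "ev (E ^ a - E ^ b) w = 0" unfolding m0_def by (rule pact_moved_root[OF _ l(2)])
  hence e: "ev E w ^ b = ev E w ^ a" by simp
  have "ev E w ^ a * ev E w ^ (b - a) = ev E w ^ b" using ab(1) by (simp flip: power_add)
  hence "ev E w ^ a * ev E w ^ (b - a) = ev E w ^ a" by (simp only: e)
  moreover have "ev E w \<noteq> 0" using mod1[of 1] p_gt_1 by auto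
  ultimately have "ev E w ^ (b - a) = 1" by simp
  thus ?thesis using ab(1) by (intro exI[of _ "b - a"]) simp
qed

end

section \<open>Comparing two principal polarizations\<close>

lemma herm_represent:
  fixes H H' :: "('g::finite) hform"
  assumes H: "pos_def_hermitian H" and H': "pos_def_hermitian H'"
  shows "\<exists>f. clinear f \<and> (\<forall>x y. H' x y = H (f x) y)"
proof -
  define T where "T K x = (\<chi> j. K x (axis j 1))" for K :: "'g hform" and x :: "complex^'g"
  have lin: "clinear (T K)" if "pos_def_hermitian K" for K :: "'g hform"
    unfolding clinear_iff T_def
    by (simp add: vec_eq_iff herm_add_left[OF that] herm_scale_left[OF that])
  have expand: "K x y = (\<Sum>j\<in>UNIV. cnj (y $ j) * T K x $ j)" if K: "pos_def_hermitian K" for K :: "'g hform" and x y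
  proof -
    have "K x y = K x (\<Sum>j\<in>UNIV. (y $ j) *s axis j 1)" by (simp only: basis_expansion)
    also have "\<dots> = (\<Sum>j\<in>UNIV. cnj (y $ j) * T K x $ j)"
      unfolding herm_sum_right[OF K] herm_scale_right[OF K] by (simp add: T_def)
    finally show ?thesis .
  qed
  have "inj (T H)"
  proof (rule injI)
    fix x y assume eq: "T H x = T H y"
    show "x = y"
    proof (rule herm_eqI[OF H])
      fix z show "H x z = H y z"
        using expand[OF H, of x z] expand[OF H, of y z] by (simp only: eq)
    qed
  qed
  moreover from this have "surj (T H)" by (rule vec.linear_injective_imp_surjective[OF lin[OF H] _ refl])
  ultimately have bij: "bij (T H)" by (rule bijI)
  define f where "f x = inv_into UNIV (T H) (T H' x)" for x
  have "clinear f" unfolding f_def by (rule clinear_compose[OF clinear_inv[OF lin[OF H] bij] lin[OF H']])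
  moreover have "T H (f x) = T H' x" for x
    unfolding f_def by (rule surj_f_inv_f[OF bij_is_surj[OF bij]])
  hence "H' x y = H (f x) y" for x y
    using expand[OF H, of "f x" y] expand[OF H', of x y] by (simp only:)
  ultimately show ?thesis by (intro exI[of _ f] conjI allI)
qed

text \<open>For x in L the numbers Im H (f x) l = Im H' x l are integers, and L is its own dual
  under Im H, so f x is in L.\<close>

lemma polarization_End:
  fixes H H' :: "('g::finite) hform"
  assumes H: "principal_polarization L H" and H': "principal_polarization L H'"
  shows "\<exists>f\<in>torus_End L. \<forall>x y. H' x y = H (f x) y"
proof -
  have h: "pos_def_hermitian H" "{x. \<forall>l\<in>L. Im (H x l) \<in> \<int>} = L"
    and h': "pos_def_hermitian H'" "{x. \<forall>l\<in>L. Im (H' x l) \<in> \<int>} = L"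
    using H H' by (simp_all add: principal_polarization_def)
  obtain f where f: "clinear f" "\<forall>x y. H' x y = H (f x) y"
    using herm_represent[OF h(1) h'(1)] by (elim exE conjE)
  have "f x \<in> L" if x: "x \<in> L" for x
  proof -
    have "x \<in> {x. \<forall>l\<in>L. Im (H' x l) \<in> \<int>}" unfolding h'(2) by (rule x)
    hence "f x \<in> {x. \<forall>l\<in>L. Im (H x l) \<in> \<int>}" unfolding f(2)[rule_format] by simp
    thus ?thesis unfolding h(2) .
  qed
  thus ?thesis using f by (intro bexI[of _ f]) (auto simp: torus_End_def)
qed

lemma polarization_Aut:
  fixes H H' :: "('g::finite) hform"
  assumes H: "principal_polarization L H" and H': "principal_polarization L H'"
  shows "\<exists>f\<in>torus_Aut L. \<forall>x y. H' x y = H (f x) y"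
proof -
  obtain f where f: "f \<in> torus_End L" "\<forall>x y. H' x y = H (f x) y"
    using polarization_End[OF H H'] by (elim bexE)
  obtain g where g: "g \<in> torus_End L" "\<forall>x y. H x y = H' (g x) y"
    using polarization_End[OF H' H] by (elim bexE)
  have h: "pos_def_hermitian H" "pos_def_hermitian H'" using H H' by (simp_all add: principal_polarization_def)
  have "f (g v) = v" for v
  proof (rule herm_eqI[OF h(1)])
    fix z show "H (f (g v)) z = H v z" using f(2)[rule_format, of "g v" z] g(2)[rule_format, of v z] by simp
  qed
  moreover have "g (f v) = v" for v
  proof (rule herm_eqI[OF h(2)])
    fix z show "H' (g (f v)) z = H' v z" using g(2)[rule_format, of "f v" z] f(2)[rule_format, of v z] by simp
  qed
  ultimately have "f \<in> torus_Aut L" by (rule torus_AutI[OF f(1) g(1)])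
  from f(2) this show ?thesis by (rule bexI)
qed

context ppav_aut
begin

text \<open>The fixed space is left out because Z[\<sigma>] acts there through Z and not through
  Z[w]; it is always treated separately.\<close>

definition acts_as :: "(complex^'g \<Rightarrow> complex^'g) \<Rightarrow> int poly \<Rightarrow> bool"
  where "acts_as f z \<longleftrightarrow> (\<forall>j v. \<not> p dvd j \<longrightarrow> v \<in> eig j \<longrightarrow> f v = ev z (w ^ j) *s v)"

lemma acts_asD: "acts_as f z \<Longrightarrow> \<not> p dvd j \<Longrightarrow> v \<in> eig j \<Longrightarrow> f v = ev z (w ^ j) *s v"
  by (simp add: acts_as_def)

lemma ev_conj_eq: "\<not> p dvd j \<Longrightarrow> ev a (w ^ j) = ev b (w ^ j) \<longleftrightarrow> ev a w = ev b w"
  using ev_conj_iff[of j "a - b"] by simp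

lemma ex_eig_vector: "\<exists>j v. j \<in> {1..<p} \<and> \<not> p dvd j \<and> v \<in> eig j \<and> v \<noteq> 0"
proof -
  obtain j where j: "j \<in> {1..<p}" "eig j \<noteq> {0}" using ex_eig_ne_0 by (elim exE conjE)
  then obtain v where "v \<in> eig j" "v \<noteq> 0" using eig_0[of j] by blast
  thus ?thesis using j(1) not_dvd_range[OF j(1)] by (intro exI conjI)
qed

lemma acts_as_unique:
  assumes "acts_as f y" "acts_as f z"
  shows "ev y w = ev z w"
proof -
  obtain j v where j: "\<not> p dvd j" "v \<in> eig j" "v \<noteq> 0" using ex_eig_vector by (elim exE conjE)
  have "ev y (w ^ j) *s v = ev z (w ^ j) *s v"
    unfolding acts_asD[OF assms(1) j(1,2), symmetric] acts_asD[OF assms(2) j(1,2), symmetric] by (rule refl)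
  hence "ev y (w ^ j) = ev z (w ^ j)" using j(3) by simp
  thus ?thesis unfolding ev_conj_eq[OF j(1)] .
qed

lemma eig_eq_if_acts_as:
  assumes lin: "linear f" "linear g" and fix0: "\<And>v. v \<in> eig 0 \<Longrightarrow> f v = g v"
    and acts: "acts_as f y" "acts_as g z" "ev y w = ev z w"
  shows "f v = g v"
proof (rule eig_eqI[OF lin])
  fix j v assume j: "j < p" and v: "v \<in> eig j"
  show "f v = g v"
  proof (cases "j = 0")
    case True
    thus ?thesis using fix0 v by simp
  next
    case False
    hence j': "\<not> p dvd j" using j by (auto dest: dvd_imp_le)
    show ?thesis
      using acts_asD[OF acts(1) j' v] acts_asD[OF acts(2) j' v] acts(3) ev_conj_eq[OF j'] by simp
  qed
qed

lemma acts_as_pact: "acts_as (pact \<sigma> q) q"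
  by (simp add: acts_as_def pact_eig)

end

text \<open>The situation of a very general member: \<open>End(A) \<otimes> \<rat>\<close> is generated by \<open>\<sigma>\<close>.\<close>

locale ppav_generic = ppav_aut +
  assumes generic: "f \<in> torus_End L \<Longrightarrow> \<exists>m q. m \<noteq> 0 \<and> (\<forall>v. of_int m *\<^sub>R f v = pact \<sigma> q v)"
begin

lemma pp: "principal_polarization L H"
  using ppav by (simp add: is_ppav_def)

lemma End_commute:
  assumes f: "f \<in> torus_End L"
  shows "f (\<sigma> v) = \<sigma> (f v)"
proof -
  obtain m q where m: "m \<noteq> 0" and q: "\<forall>v. of_int m *\<^sub>R f v = pact \<sigma> q v"
    using generic[OF f] by (elim exE conjE)
  have "of_int m *\<^sub>R f (\<sigma> v) = pact \<sigma> q (\<sigma> v)" using q by blast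
  also have "\<dots> = \<sigma> (pact \<sigma> q v)" by (rule pact_commute[OF s_clinear s_linear, symmetric]) (rule refl)
  also have "\<dots> = \<sigma> (of_int m *\<^sub>R f v)" using q by simp
  also have "\<dots> = of_int m *\<^sub>R \<sigma> (f v)" by (rule linear_scale[OF s_linear])
  finally show ?thesis using m by simp
qed

lemma End_scalar:
  assumes f: "f \<in> torus_End L"
  shows "\<exists>m q. m \<noteq> 0 \<and> (\<forall>j v. v \<in> eig j \<longrightarrow> f v = (ev q (w ^ j) / of_int m) *s v)"
proof -
  obtain m q where m: "m \<noteq> 0" and q: "\<forall>v. of_int m *\<^sub>R f v = pact \<sigma> q v"
    using generic[OF f] by (elim exE conjE)
  have "f v = (ev q (w ^ j) / of_int m) *s v" if v: "v \<in> eig j" for j v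
  proof -
    have "of_int m *s f v = ev q (w ^ j) *s v"
      using q[rule_format, of v] pact_eig[OF v, of q] by (simp add: scaleR_eq_scale)
    hence "inverse (of_int m) *s (of_int m *s f v) = inverse (of_int m) *s (ev q (w ^ j) *s v)" by simp
    thus ?thesis using m by (simp add: divide_inverse mult.commute)
  qed
  thus ?thesis using m by blast
qed

text \<open>\<open>\<int>[\<zeta>]\<close> is the maximal order: the multiples \<open>d f^s\<close> lie in \<open>\<int>[\<sigma>]\<close> for a fixed \<open>d\<close>.\<close>

lemma End_acts_as:
  assumes f: "f \<in> torus_End L"
  shows "\<exists>z. acts_as f z"
proof -
  obtain l where l: "l \<in> L" "\<sigma> l \<noteq> l" using ex_moved_lattice_point by (elim bexE)
  define m0 where "m0 = l - \<sigma> l"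
  have m0: "m0 \<in> L" unfolding m0_def using l(1) s_lattice by (intro lattice_diff[OF lat]) auto
  obtain d where d: "d \<noteq> 0" and bounded: "\<forall>x m q. x \<in> L \<longrightarrow> m \<noteq> 0 \<longrightarrow> of_int m *\<^sub>R x = pact \<sigma> q m0 \<longrightarrow>
    (\<exists>r. of_int d *\<^sub>R x = pact \<sigma> r m0)"
    using bounded_multiples[OF m0] by (elim exE conjE)
  obtain m q0 where m: "m \<noteq> 0" and q0: "\<forall>v. of_int m *\<^sub>R f v = pact \<sigma> q0 v"
    using generic[OF f] by (elim exE conjE)
  define n where "n = nat \<bar>m\<bar>"
  define q where "q = smult (sgn m) q0"
  have n0: "n > 0" using m by (simp add: n_def)
  have q: "of_nat n *\<^sub>R f v = pact \<sigma> q v" for v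
  proof -
    have "int n = sgn m * m" unfolding n_def using abs_sgn[of m] by (simp add: mult.commute)
    hence "real_of_int (int n) = of_int (sgn m * m)" by (rule arg_cong)
    hence "of_nat n *\<^sub>R f v = of_int (sgn m) *\<^sub>R (of_int m *\<^sub>R f v)" by simp
    thus ?thesis using q0 by (simp add: q_def pact_smult[OF s_clinear])
  qed
  have flin: "linear f" using f by (auto simp: torus_End_def intro: clinear_imp_linear)
  have qs: "of_nat (n ^ s) *\<^sub>R (f ^^ s) m0 = pact \<sigma> (q ^ s) m0" for s
  proof (induction s)
    case (Suc s)
    have "of_nat (n ^ Suc s) *\<^sub>R (f ^^ Suc s) m0 = of_nat n *\<^sub>R f (of_nat (n ^ s) *\<^sub>R (f ^^ s) m0)"
      by (simp add: linear_scale[OF flin] mult.commute)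
    also have "\<dots> = pact \<sigma> (q ^ Suc s) m0"
      unfolding Suc.IH q power_Suc pact_mult[OF s_clinear] ..
    finally show ?case .
  qed (simp add: pact_1[OF s_clinear])
  have "\<exists>r. of_int d * ev q w ^ s = of_nat n ^ s * ev r w" for s
  proof -
    have "(f ^^ s) m0 \<in> L" using torus_End_funpow[OF f, of s] m0 by (auto simp: torus_End_def)
    moreover have "int (n ^ s) \<noteq> 0" using n0 by simp
    moreover have "of_int (int (n ^ s)) *\<^sub>R (f ^^ s) m0 = pact \<sigma> (q ^ s) m0"
      using qs[of s] by simp
    ultimately have "\<exists>r. of_int d *\<^sub>R (f ^^ s) m0 = pact \<sigma> r m0" using bounded by blast
    then obtain r where r: "of_int d *\<^sub>R (f ^^ s) m0 = pact \<sigma> r m0" by (elim exE)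
    have "pact \<sigma> (smult d (q ^ s) - smult (int (n ^ s)) r) m0 = 0"
      by (simp add: pact_diff[OF s_clinear] pact_smult[OF s_clinear] qs[symmetric] r[symmetric])
    hence "ev (smult d (q ^ s) - smult (int (n ^ s)) r) w = 0"
      unfolding m0_def by (rule pact_moved_root[OF _ l(2)])
    hence "of_int d * ev q w ^ s = of_nat n ^ s * ev r w" by simp
    thus ?thesis by (rule exI)
  qed
  from denominator[OF n0 d this] obtain z where z: "ev q w = ev (of_nat n * z) w" by auto
  have "acts_as f z"
    unfolding acts_as_def
  proof (intro allI impI)
    fix j v assume j: "\<not> p dvd j" and v: "v \<in> eig j"
    have "of_nat n *\<^sub>R f v = of_nat n *\<^sub>R (ev z (w ^ j) *s v)"
      unfolding q pact_eig[OF v] using z[folded ev_conj_eq[OF j]] by (simp add: scaleR_eq_scale)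
    thus "f v = ev z (w ^ j) *s v" using n0 by simp
  qed
  thus ?thesis by (rule exI)
qed

lemma Aut_on_fixed:
  assumes f: "f \<in> torus_Aut L"
  shows "\<exists>r. \<bar>r\<bar> = 1 \<and> (\<forall>v\<in>eig 0. f v = r *\<^sub>R v)"
proof (cases "eig 0 = {0}")
  case True
  thus ?thesis
    using linear_0[OF clinear_imp_linear[OF torus_AutD(1)[OF f]]] by (intro exI[of _ 1]) simp
next
  case False
  from ex_fixed_lattice_point[OF this] obtain l where l: "l \<in> L" "l \<in> eig 0" "l \<noteq> 0" by (elim bexE conjE)
  obtain m q where mq: "\<forall>j v. v \<in> eig j \<longrightarrow> f v = (ev q (w ^ j) / of_int m) *s v"
    using End_scalar[OF torus_AutD(4)[OF f]] by (elim exE conjE)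
  define r where "r = of_int (poly q 1) / real_of_int m"
  have r: "f v = r *\<^sub>R v" if "v \<in> eig 0" for v
    using mq[rule_format, OF that] by (simp add: r_def ev_at_1 scaleR_eq_scale)
  have "\<bar>r\<bar> = 1" by (rule torus_Aut_scalar[OF lat f l(1,3) r[OF l(2)]])
  thus ?thesis using r by blast
qed

lemma Aut_acts_as:
  assumes f: "f \<in> torus_Aut L"
  shows "\<exists>z z'. acts_as f z \<and> ev z w * ev z' w = 1"
proof -
  obtain z where z: "acts_as f z" using End_acts_as[OF torus_AutD(4)[OF f]] by (elim exE)
  obtain z' where z': "acts_as (inv_into UNIV f) z'"
    using End_acts_as[OF torus_AutD(4)[OF torus_Aut_inv[OF f]]] by (elim exE)
  have unit: "ev z w * ev z' w = 1"
  proof -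
    obtain j v where j: "\<not> p dvd j" "v \<in> eig j" "v \<noteq> 0" using ex_eig_vector by (elim exE conjE)
    have "v = inv_into UNIV f (f v)" using bij_is_inj[OF torus_AutD(2)[OF f]] by simp
    also have "\<dots> = ev (z * z') (w ^ j) *s v"
      unfolding acts_asD[OF z j(1,2)] using acts_asD[OF z' j(1) eig_scale[OF j(2)]] by (simp add: mult.commute)
    finally have "1 *s v = ev (z * z') (w ^ j) *s v" by simp
    hence "ev (z * z') (w ^ j) = ev 1 (w ^ j)" using j(3) by (simp only: vec.scale_cancel_right) simp
    hence "ev (z * z') w = ev 1 w" unfolding ev_conj_eq[OF j(1)] .
    thus ?thesis by simp
  qed
  from z unit show ?thesis by (intro exI conjI)
qed

lemma polarization_scalar_positive:
  assumes H': "principal_polarization L H'" and f: "\<forall>x y. H' x y = H (f x) y"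
    and v: "f v = c *s v" "v \<noteq> 0"
  shows "c \<in> \<real> \<and> 0 < Re c"
proof -
  have h': "pos_def_hermitian H'" using H' by (simp add: principal_polarization_def)
  have "of_real (Re (H' v v)) = c * of_real (Re (H v v))"
    unfolding herm_self_real[OF h', symmetric] herm_self_real[OF herm, symmetric]
    using f[rule_format, of v v] by (simp add: v(1) herm_scale_left[OF herm])
  hence "c = of_real (Re (H' v v) / Re (H v v))"
    using herm_pos[OF herm v(2)] by (simp add: field_simps)
  thus ?thesis using herm_pos[OF herm v(2)] herm_pos[OF h' v(2)] by simp
qed

text \<open>On \<open>eig 0\<close> the scalar of f has absolute value 1, f being an automorphism,
  and is positive, hence 1. Positivity on a moved eigenspace is asserted only if it is nonzero,
  since H and H' can be compared only there.\<close>

lemma polarization_unit: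
  assumes H': "principal_polarization L H'"
  shows "\<exists>f z z'. f \<in> torus_Aut L \<and> (\<forall>x y. H' x y = H (f x) y) \<and> (\<forall>v\<in>eig 0. f v = v) \<and>
    acts_as f z \<and> ev z w * ev z' w = 1 \<and>
    (\<forall>j. \<not> p dvd j \<longrightarrow> eig j \<noteq> {0} \<longrightarrow> ev z (w ^ j) \<in> \<real> \<and> 0 < Re (ev z (w ^ j)))"
proof -
  obtain f where f: "f \<in> torus_Aut L" "\<forall>x y. H' x y = H (f x) y"
    using polarization_Aut[OF pp H'] by (elim bexE)
  note pos = polarization_scalar_positive[OF H' f(2)]
  obtain r where r: "\<bar>r\<bar> = 1" "\<forall>v\<in>eig 0. f v = r *\<^sub>R v" using Aut_on_fixed[OF f(1)] by (elim exE conjE)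
  have fix0: "f v = v" if v: "v \<in> eig 0" for v
  proof (cases "v = 0")
    case True
    thus ?thesis using linear_0[OF clinear_imp_linear[OF torus_AutD(1)[OF f(1)]]] by simp
  next
    case False
    have fv: "f v = of_real r *s v" using r(2) v by (simp add: scaleR_eq_scale)
    have "r > 0" using pos[OF fv False] by simp
    hence "r = 1" using r(1) by simp
    thus ?thesis using fv by simp
  qed
  obtain z z' where z: "acts_as f z" and unit: "ev z w * ev z' w = 1"
    using Aut_acts_as[OF f(1)] by (elim exE conjE)
  have positive: "\<forall>j. \<not> p dvd j \<longrightarrow> eig j \<noteq> {0} \<longrightarrow> ev z (w ^ j) \<in> \<real> \<and> 0 < Re (ev z (w ^ j))"
  proof (intro allI impI)
    fix j assume j: "\<not> p dvd j" "eig j \<noteq> {0}"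
    obtain v where v: "v \<in> eig j" "v \<noteq> 0" using j(2) eig_0[of j] by blast
    from acts_asD[OF z j(1) v(1)] v(2) show "ev z (w ^ j) \<in> \<real> \<and> 0 < Re (ev z (w ^ j))" by (rule pos)
  qed
  have fix0': "\<forall>v\<in>eig 0. f v = v" using fix0 by (rule ballI)
  show ?thesis
    by (rule exI[of _ f], rule exI[of _ z], rule exI[of _ z'], intro conjI) (rule f fix0' z unit positive)+
qed

lemma polarization_Aut_mem:
  assumes H': "principal_polarization L H'"
  shows "\<sigma> \<in> ppav_Aut (L, H')"
proof -
  obtain f where f: "f \<in> torus_Aut L" "\<forall>x y. H' x y = H (f x) y"
    using polarization_Aut[OF pp H'] by (elim bexE)
  have "H' (\<sigma> x) (\<sigma> y) = H' x y" for x y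
    using f(2) End_commute[OF torus_AutD(4)[OF f(1)]] s_iso by simp
  hence "pullback \<sigma> H' = H'" unfolding pullback_def by (intro ext)
  thus ?thesis using aut by (simp add: ppav_Aut_def)
qed

text \<open>Here w = -1 is rational, so f is a real scalar on \<open>eig 1\<close> as well; it is
  positive, and of absolute value 1 because \<open>eig 1\<close> contains the lattice vector l -
  \<sigma> l.\<close>

lemma num_polarizations_2:
  assumes "p = 2"
  shows "num_polarizations L = 1"
proof -
  have "w * w = 1" using w_pow assms by (simp add: power2_eq_square)
  hence w: "w = -1" using w_ne_1 by (simp add: square_eq_1_iff)
  have unique: "H' = H" if H': "principal_polarization L H'" for H'
  proof -
    obtain f where f: "f \<in> torus_Aut L" "\<forall>x y. H' x y = H (f x) y" "\<forall>v\<in>eig 0. f v = v"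
      using polarization_unit[OF H'] by (elim exE conjE)
    obtain m q where mq: "\<forall>j v. v \<in> eig j \<longrightarrow> f v = (ev q (w ^ j) / of_int m) *s v"
      using End_scalar[OF torus_AutD(4)[OF f(1)]] by (elim exE conjE)
    define r where "r = of_int (poly q (-1)) / real_of_int m"
    have r: "f v = r *\<^sub>R v" if "v \<in> eig 1" for v
      using mq[rule_format, OF that] ev_of_int_arg[of q "-1"] by (simp add: r_def w scaleR_eq_scale)
    obtain l where l: "l \<in> L" "\<sigma> l \<noteq> l" using ex_moved_lattice_point by (elim bexE)
    define m0 where "m0 = l - \<sigma> l"
    have m0: "m0 \<in> L" unfolding m0_def using l(1) s_lattice by (intro lattice_diff[OF lat]) auto
    have "\<sigma> (\<sigma> l) = l" using s_pow[of l] unfolding assms by (simp add: numeral_2_eq_2)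
    hence "\<sigma> m0 = w ^ 1 *s m0" unfolding m0_def linear_diff[OF s_linear] by (simp add: w)
    hence "m0 \<in> eig 1" unfolding eig_def mem_Collect_eq .
    moreover have "m0 \<noteq> 0" using l(2) by (simp add: m0_def)
    ultimately have m1: "f m0 = r *\<^sub>R m0" "m0 \<noteq> 0" using r by simp_all
    have "\<bar>r\<bar> = 1" by (rule torus_Aut_scalar[OF lat f(1) m0 m1(2,1)])
    moreover have "r > 0" using polarization_scalar_positive[OF H' f(2), of m0 "of_real r"] m1 by (simp add: scaleR_eq_scale)
    ultimately have r1: "r = 1" by simp
    have "f v = v" for v
    proof (rule eig_eqI[OF clinear_imp_linear[OF torus_AutD(1)[OF f(1)]] linear_id[unfolded id_def]])
      fix j v assume "j < p" "v \<in> eig j"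
      moreover from this have "j = 0 \<or> j = 1" using assms by auto
      ultimately show "f v = v" using f(3) r r1 by auto
    qed
    thus ?thesis using f(2) by (intro ext) simp
  qed
  hence "{H. principal_polarization L H} = {H}" using pp by blast
  thus ?thesis unfolding num_polarizations_def by (simp add: quotient_def)
qed

end

section \<open>Polarizations and totally positive units\<close>

context ppav_aut
begin

text \<open>Otherwise conjugation would make the identity vanish on all moved eigenspaces. Thus
  every real conjugate of a unit is seen by some nonzero eigenspace, which turns positivity there
  into total positivity.\<close>

lemma eig_pair_ne_0:
  assumes i: "i \<in> {1..<p}"
  shows "eig i \<noteq> {0} \<or> eig (p - i) \<noteq> {0}"
proof (rule ccontr)
  assume "\<not> ?thesis"
  hence z: "eig i = {0}" "eig (p - i) = {0}" by simp_all
  obtain j v where j: "\<not> p dvd j" "v \<in> eig j" "v \<noteq> 0" using ex_eig_vector by (elim exE conjE)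
  have "(\<lambda>x. x) v = 0"
    by (rule galois_vanish[OF linear_id[unfolded id_def] _ i _ _ j(2,1)]) (use z in simp_all)
  thus False using j(3) by simp
qed

lemma acts_as_pact_on: "ev q w = ev r w \<Longrightarrow> acts_as (pact \<sigma> q) r"
  by (simp add: acts_as_def pact_eig ev_conj_eq)

lemma pact_on_fixed: "v \<in> eig 0 \<Longrightarrow> pact \<sigma> q v = of_int (poly q 1) *\<^sub>R v"
  by (simp add: pact_eig ev_at_1 scaleR_eq_scale)

text \<open>Subtracting a multiple of \<open>Phi\<close> changes the value at 1 by a multiple of p
  and leaves the value at w alone, so y can be corrected to be exactly \<epsilon> on the fixed
  space. The same works for y', whose residue is \<epsilon> too because \<epsilon>^2 = 1.\<close>

lemma Aut_of_unit:
  assumes unit: "ev y w * ev y' w = 1" and res: "int p dvd poly y 1 - \<epsilon>" and \<epsilon>: "\<epsilon> * \<epsilon> = 1"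
  shows "\<exists>g\<in>torus_Aut L. acts_as g y \<and> (\<forall>v\<in>eig 0. g v = of_int \<epsilon> *\<^sub>R v)"
proof -
  have "ev (y * y' - 1) w = 0" using unit by simp
  from ev_root_imp_dvd[OF this] have 1: "int p dvd poly y 1 * poly y' 1 - 1" by simp
  have "poly y' 1 - \<epsilon> = \<epsilon> * (poly y 1 * poly y' 1 - 1) - \<epsilon> * poly y' 1 * (poly y 1 - \<epsilon>)"
  proof -
    have "\<epsilon> * (poly y 1 * poly y' 1 - 1) - \<epsilon> * poly y' 1 * (poly y 1 - \<epsilon>) = (\<epsilon> * \<epsilon>) * poly y' 1 - \<epsilon>"
      by (simp add: algebra_simps)
    thus ?thesis unfolding \<epsilon> by simp
  qed
  hence res': "int p dvd poly y' 1 - \<epsilon>" using 1 res by simp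
  obtain c where c: "poly y 1 - \<epsilon> = int p * c" using res by (elim dvdE)
  obtain c' where c': "poly y' 1 - \<epsilon> = int p * c'" using res' by (elim dvdE)
  define Y Y' where "Y = y - smult c Phi" and "Y' = y' - smult c' Phi"
  have Y1: "poly Y 1 = \<epsilon>" "poly Y' 1 = \<epsilon>" using c c' by (simp_all add: Y_def Y'_def poly_Phi_1 mult.commute)
  have Yw: "ev Y w = ev y w" "ev Y' w = ev y' w" by (simp_all add: Y_def Y'_def)
  have inv: "pact \<sigma> A (pact \<sigma> B v) = v"
    if "ev A w * ev B w = 1" "poly A 1 = \<epsilon>" "poly B 1 = \<epsilon>" for A B v
  proof -
    have "pact \<sigma> (A * B) v = pact \<sigma> 1 v"
      by (rule eig_eq_if_acts_as[OF pact_linear[OF s_clinear] pact_linear[OF s_clinear] _ acts_as_pact acts_as_pact])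
        (use that \<epsilon> in \<open>simp_all add: pact_on_fixed\<close>)
    thus ?thesis by (simp add: pact_mult[OF s_clinear] pact_1[OF s_clinear])
  qed
  have "pact \<sigma> Y \<in> torus_Aut L"
    by (rule torus_AutI[OF pact_End pact_End, of Y Y']; rule inv)
      (use unit Y1 in \<open>simp_all add: Yw mult.commute\<close>)
  moreover have "acts_as (pact \<sigma> Y) y" by (rule acts_as_pact_on[OF Yw(1)])
  moreover have "\<forall>v\<in>eig 0. pact \<sigma> Y v = of_int \<epsilon> *\<^sub>R v" by (simp add: pact_on_fixed Y1)
  ultimately show ?thesis by (intro bexI conjI)
qed

text \<open>A relation rather than a function: the unit is unique, but its existence is established
  only when End(A) is generated by \<sigma> up to multiples.\<close>

definition polarization_unit_rel :: "'g hform \<Rightarrow> complex \<Rightarrow> bool"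
  where "polarization_unit_rel H' u \<longleftrightarrow> (\<exists>f h. f \<in> torus_Aut L \<and> (\<forall>x y. H' x y = H (f x) y) \<and>
    (\<forall>v\<in>eig 0. f v = v) \<and> acts_as f (trace_lift h) \<and> u = ev h gam)"

lemma polarization_unit_rel_unique:
  assumes "polarization_unit_rel H' u" "polarization_unit_rel H' u'"
  shows "u = u'"
proof -
  obtain f h where f: "\<forall>x y. H' x y = H (f x) y" "acts_as f (trace_lift h)" "u = ev h gam"
    using assms(1) unfolding polarization_unit_rel_def by (elim exE conjE)
  obtain f' h' where f': "\<forall>x y. H' x y = H (f' x) y" "acts_as f' (trace_lift h')" "u' = ev h' gam"
    using assms(2) unfolding polarization_unit_rel_def by (elim exE conjE)
  have "f = f'"
  proof (rule ext, rule herm_eqI[OF herm])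
    fix x z show "H (f x) z = H (f' x) z" using f(1)[rule_format, of x z] f'(1)[rule_format, of x z] by simp
  qed
  hence "acts_as f' (trace_lift h)" using f(2) by (simp only:)
  hence "ev (trace_lift h) w = ev (trace_lift h') w" by (rule acts_as_unique[OF _ f'(2)])
  thus ?thesis unfolding ev_trace_lift_w f(3) f'(3) .
qed

text \<open>The residue 1 lets the unit act by an automorphism g that is the identity on the fixed
  space. Its scalars on the eigenspaces are real and positive, so g is selfadjoint and positive for
  H.\<close>

lemma polarization_of_unit:
  assumes unit: "ev h gam * ev h' gam = 1" and res: "int p dvd poly h 2 - 1"
    and pos: "\<forall>j\<in>{1..<p}. ev h (w ^ j + inverse (w ^ j)) \<in> \<real> \<and> 0 < Re (ev h (w ^ j + inverse (w ^ j)))"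
  shows "\<exists>H'. principal_polarization L H' \<and> polarization_unit_rel H' (ev h gam)"
proof -
  have "ev (trace_lift h) w * ev (trace_lift h') w = 1" using unit by (simp add: ev_trace_lift_w)
  moreover have "int p dvd poly (trace_lift h) 1 - 1" using res by (simp add: poly_trace_lift_1)
  moreover have "(1::int) * 1 = 1" by simp
  ultimately have "\<exists>g\<in>torus_Aut L. acts_as g (trace_lift h) \<and> (\<forall>v\<in>eig 0. g v = of_int 1 *\<^sub>R v)"
    by (rule Aut_of_unit)
  then obtain g where g: "g \<in> torus_Aut L" "acts_as g (trace_lift h)" "\<forall>v\<in>eig 0. g v = of_int 1 *\<^sub>R v"
    by (elim bexE conjE)
  have lin: "clinear g" by (rule torus_AutD(1)[OF g(1)])
  define r where "r j = (if j = 0 then 1 else Re (ev h (w ^ j + inverse (w ^ j))))" for j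
  have r: "0 < r j" "v \<in> eig j \<Longrightarrow> g v = of_real (r j) *s v" if j: "j < p" for j v
  proof -
    have jj: "j = 0 \<or> j \<in> {1..<p}" using j by auto
    show "0 < r j" using pos jj by (auto simp: r_def)
    assume v: "v \<in> eig j"
    show "g v = of_real (r j) *s v"
    proof (cases "j = 0")
      case True
      thus ?thesis using g(3) v by (simp add: r_def)
    next
      case False
      hence j1: "j \<in> {1..<p}" using j by simp
      have "ev (trace_lift h) (w ^ j) = ev h (w ^ j + inverse (w ^ j))"
        by (rule ev_trace_lift[OF w_power_power])
      also have "\<dots> = of_real (r j)" using pos[rule_format, OF j1] False by (simp add: r_def)
      finally show ?thesis using acts_asD[OF g(2) not_dvd_range[OF j1] v] by simp
    qed
  qed
  have Hg: "H (g (\<Sum>j<p. u j)) (\<Sum>j<p. v j) = (\<Sum>j<p. of_real (r j) * H (u j) (v j))"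
    if u: "\<forall>j<p. u j \<in> eig j" and v: "\<forall>j<p. v j \<in> eig j" for u v
  proof -
    have gu: "g (\<Sum>j<p. u j) = (\<Sum>j<p. of_real (r j) *s u j)"
      unfolding linear_sum[OF clinear_imp_linear[OF lin]] using r(2) u by (intro sum.cong) simp_all
    have "H (g (\<Sum>j<p. u j)) (\<Sum>j<p. v j) = (\<Sum>j<p. H (of_real (r j) *s u j) (v j))"
      unfolding gu by (rule herm_eig_sum) (use u v in \<open>simp_all add: eig_scale\<close>)
    thus ?thesis by (simp add: herm_scale_left[OF herm])
  qed
  define H' where "H' x y = H (g x) y" for x y
  have herm': "pos_def_hermitian H'"
  proof (rule pos_def_hermitianI)
    show "H' (x + y) z = H' x z + H' y z" for x y z
      by (simp add: H'_def clinear_add[OF lin] herm_add_left[OF herm])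
    show "H' (c *s x) z = c * H' x z" for c x z
      by (simp add: H'_def clinear_scale[OF lin] herm_scale_left[OF herm])
    fix x y
    obtain u where u: "\<forall>j<p. u j \<in> eig j" "x = (\<Sum>j<p. u j)" using eig_decomp[of x] by (elim exE conjE)
    obtain v where v: "\<forall>j<p. v j \<in> eig j" "y = (\<Sum>j<p. v j)" using eig_decomp[of y] by (elim exE conjE)
    show "H' y x = cnj (H' x y)"
      unfolding H'_def u(2) v(2) Hg[OF v(1) u(1)] Hg[OF u(1) v(1)] cnj_sum complex_cnj_mult
      by (intro sum.cong refl) (simp add: herm_cnj[OF herm, symmetric])
  next
    fix x :: "complex^'g" assume x: "x \<noteq> 0"
    obtain u where u: "\<forall>j<p. u j \<in> eig j" "x = (\<Sum>j<p. u j)" using eig_decomp[of x] by (elim exE conjE)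
    have "\<exists>j<p. u j \<noteq> 0"
    proof (rule ccontr)
      assume "\<not> ?thesis"
      hence "x = 0" unfolding u(2) by (intro sum.neutral) simp
      thus False using x by simp
    qed
    then obtain i where i: "i < p" "u i \<noteq> 0" by (elim exE conjE)
    have "Re (H' x x) = (\<Sum>j<p. r j * Re (H (u j) (u j)))"
      unfolding H'_def u(2) Hg[OF u(1) u(1)] by simp
    also have "\<dots> > 0"
    proof (rule sum_pos2[of _ i])
      show "0 < r i * Re (H (u i) (u i))" using r(1)[OF i(1)] herm_pos[OF herm i(2)] by simp
      fix j assume "j \<in> {..<p}"
      hence "0 < r j" using r(1) by simp
      thus "0 \<le> r j * Re (H (u j) (u j))"
        using herm_pos[OF herm, of "u j"] by (cases "u j = 0") (simp_all add: herm_0_left[OF herm])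
    qed (use i in simp_all)
    finally show "0 < Re (H' x x)" .
  qed
  have "{x. \<forall>l\<in>L. Im (H' x l) \<in> \<int>} = {x. g x \<in> {x. \<forall>l\<in>L. Im (H x l) \<in> \<int>}}"
    by (simp add: H'_def)
  also have "\<dots> = {x. g x \<in> L}" unfolding unimodular ..
  also have "\<dots> = L"
  proof (intro equalityI subsetI)
    fix x assume "x \<in> L" thus "x \<in> {x. g x \<in> L}" using torus_AutD(5)[OF g(1)] by simp
  next
    fix x assume "x \<in> {x. g x \<in> L}"
    hence "g x \<in> g ` L" using torus_AutD(3)[OF g(1)] by simp
    thus "x \<in> L" using bij_is_inj[OF torus_AutD(2)[OF g(1)]] by (simp add: inj_image_mem_iff)
  qed
  finally have "principal_polarization L H'" using herm' by (simp add: principal_polarization_def)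
  moreover have "polarization_unit_rel H' (ev h gam)"
    unfolding polarization_unit_rel_def
  proof (intro exI conjI)
    show "\<forall>x y. H' x y = H (g x) y" by (simp add: H'_def)
    show "\<forall>v\<in>eig 0. g v = v" using g(3) by simp
  qed (rule g(1), rule g(2), rule refl)
  ultimately show ?thesis by (intro exI conjI)
qed

end

context ppav_generic
begin

lemma End_eig:
  assumes "f \<in> torus_End L" "v \<in> eig j"
  shows "f v \<in> eig j"
proof -
  have "clinear f" using assms(1) by (simp add: torus_End_def)
  thus ?thesis using assms(2) End_commute[OF assms(1), of v] by (simp add: eig_def clinear_scale)
qed

lemma polarization_totpos:
  assumes p: "p > 2" and H': "principal_polarization L H'"
  shows "\<exists>h h'. polarization_unit_rel H' (ev h gam) \<and> ev h gam * ev h' gam = 1 \<and>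
    (\<forall>j\<in>{1..<p}. ev h (w ^ j + inverse (w ^ j)) \<in> \<real> \<and> 0 < Re (ev h (w ^ j + inverse (w ^ j))))"
proof -
  have odd: "odd p" using p prime_p prime_odd_nat by auto
  obtain f z z' where f: "f \<in> torus_Aut L" "\<forall>x y. H' x y = H (f x) y" "\<forall>v\<in>eig 0. f v = v"
    and z: "acts_as f z" "ev z w * ev z' w = 1"
    and pos: "\<forall>j. \<not> p dvd j \<longrightarrow> eig j \<noteq> {0} \<longrightarrow> ev z (w ^ j) \<in> \<real> \<and> 0 < Re (ev z (w ^ j))"
    using polarization_unit[OF H'] by (elim exE conjE)
  obtain j where j: "j \<in> {1..<p}" "eig j \<noteq> {0}" using ex_eig_ne_0 by (elim exE conjE)
  note j' = not_dvd_range[OF j(1)]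
  have "ev z (w ^ j) = ev (conj_poly z) (w ^ j)"
    using pos[rule_format, OF j' j(2)] unfolding ev_conj_poly by (simp add: Reals_cnj_iff)
  hence "ev z w = cnj (ev z w)" unfolding ev_conj_eq[OF j'] ev_conj_poly_w .
  hence real: "ev z w \<in> \<real>" by (simp add: Reals_cnj_iff)
  have "ev z' w = inverse (ev z w)" using z(2) by (simp add: inverse_unique)
  hence real': "ev z' w \<in> \<real>" using real by simp
  obtain h where "\<forall>y. y ^ p = 1 \<longrightarrow> ev z y = ev h (y + inverse y)"
    using ev_real_imp_trace[OF odd real] by (elim exE)
  note h = this[rule_format]
  obtain h' where "\<forall>y. y ^ p = 1 \<longrightarrow> ev z' y = ev h' (y + inverse y)"
    using ev_real_imp_trace[OF odd real'] by (elim exE)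
  note h' = this[rule_format]
  have "acts_as f (trace_lift h)"
    unfolding acts_as_def ev_trace_lift[OF w_power_power] h[OF w_power_power, symmetric]
    using z(1) unfolding acts_as_def .
  hence "polarization_unit_rel H' (ev h gam)"
    unfolding polarization_unit_rel_def using f by (intro exI[of _ f] exI[of _ h] conjI refl)
  moreover have "ev h gam * ev h' gam = 1"
    using z(2) unfolding h[OF w_pow] h'[OF w_pow] by (simp only: gam_def)
  moreover have "\<forall>i\<in>{1..<p}. ev h (w ^ i + inverse (w ^ i)) \<in> \<real> \<and> 0 < Re (ev h (w ^ i + inverse (w ^ i)))"
  proof
    fix i assume i: "i \<in> {1..<p}"
    have i': "p - i \<in> {1..<p}" using i by auto
    have eq: "ev z (w ^ i) = ev h (w ^ i + inverse (w ^ i))"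
      by (rule h[OF w_power_power])
    have inv: "w ^ (p - i) = inverse (w ^ i)" using i by (simp add: w_power_inverse power_inverse)
    have "ev z (w ^ (p - i)) = ev h (w ^ (p - i) + inverse (w ^ (p - i)))"
      by (rule h[OF w_power_power])
    hence eq': "ev z (w ^ (p - i)) = ev h (w ^ i + inverse (w ^ i))"
      unfolding inv by (simp only: inverse_inverse_eq add.commute)
    from eig_pair_ne_0[OF i] show "ev h (w ^ i + inverse (w ^ i)) \<in> \<real> \<and> 0 < Re (ev h (w ^ i + inverse (w ^ i)))"
    proof
      assume "eig i \<noteq> {0}"
      from pos[rule_format, OF not_dvd_range[OF i] this] show ?thesis unfolding eq .
    next
      assume "eig (p - i) \<noteq> {0}"
      from pos[rule_format, OF not_dvd_range[OF i'] this] show ?thesis unfolding eq' .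
    qed
  qed
  ultimately show ?thesis by (intro exI conjI)
qed

lemma pullback_imp_square:
  assumes p: "p > 2" and g: "g \<in> torus_Aut L" "H2 = pullback g H1"
    and u: "polarization_unit_rel H1 u1" "polarization_unit_rel H2 u2"
  shows "\<exists>k k'. ev k gam * ev k' gam = 1 \<and> u2 = u1 * (ev k gam)\<^sup>2"
proof -
  obtain f1 h1 where f1: "\<forall>x y. H1 x y = H (f1 x) y" "acts_as f1 (trace_lift h1)" "u1 = ev h1 gam"
    using u(1) unfolding polarization_unit_rel_def by (elim exE conjE)
  obtain f2 h2 where f2: "\<forall>x y. H2 x y = H (f2 x) y" "acts_as f2 (trace_lift h2)" "u2 = ev h2 gam"
    using u(2) unfolding polarization_unit_rel_def by (elim exE conjE)
  obtain z z' where z: "acts_as g z" and unit: "ev z w * ev z' w = 1"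
    using Aut_acts_as[OF g(1)] by (elim exE conjE)
  obtain j v where j: "\<not> p dvd j" "v \<in> eig j" "v \<noteq> 0" using ex_eig_vector by (elim exE conjE)
  have gv: "g v = ev z (w ^ j) *s v" by (rule acts_asD[OF z j(1,2)])
  have gv': "g v \<in> eig j" unfolding gv by (rule eig_scale[OF j(2)])
  have "H2 v v = H (f1 (g v)) (g v)" using f1(1) by (simp add: g(2) pullback_def)
  hence "ev (trace_lift h2) (w ^ j) * H v v =
      ev (trace_lift h1) (w ^ j) * (ev z (w ^ j) * (cnj (ev z (w ^ j)) * H v v))"
    unfolding f2(1)[rule_format] acts_asD[OF f2(2) j(1,2)] acts_asD[OF f1(2) j(1) gv']
    unfolding gv by (simp add: herm_scale_left[OF herm] herm_scale_right[OF herm] mult_ac)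
  hence "ev (trace_lift h2) (w ^ j) * H v v = ev (trace_lift h1 * z * conj_poly z) (w ^ j) * H v v"
    by (simp add: ev_conj_poly mult_ac)
  hence "ev (trace_lift h2) (w ^ j) = ev (trace_lift h1 * z * conj_poly z) (w ^ j)"
    using herm_self_eq_0[OF herm, of v] j(3) by simp
  hence "ev (trace_lift h2) w = ev (trace_lift h1 * z * conj_poly z) w" unfolding ev_conj_eq[OF j(1)] .
  hence u2: "u2 = u1 * (ev z w * cnj (ev z w))"
    by (simp add: ev_trace_lift_w f1(3) f2(3) ev_conj_poly_w mult.assoc)
  have mod1: "norm (ev (z * conj_poly z') (w ^ i)) = 1" if i: "\<not> p dvd i" for i
  proof -
    have "ev (z * z') w = ev 1 w" using unit by simp
    hence "ev (z * z') (w ^ i) = ev 1 (w ^ i)" unfolding ev_conj_eq[OF i] .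
    hence "norm (ev z (w ^ i) * ev z' (w ^ i)) = 1" by simp
    thus ?thesis by (simp add: norm_mult ev_conj_poly)
  qed
  have "\<exists>t>0. ev (z * conj_poly z') w ^ t = 1" by (rule unit_modulus_finite_order) (rule mod1)
  then obtain t where "t > 0" "ev (z * conj_poly z') w ^ t = 1" by (elim exE conjE)
  hence "(ev z w * cnj (ev z' w)) ^ t = 1" "t > 0" by (simp_all add: ev_conj_poly_w)
  from unit_norm_square[OF p unit this] obtain k k' where "ev k gam * ev k' gam = 1"
    "ev z w * cnj (ev z w) = (ev k gam)\<^sup>2" by (elim exE conjE)
  thus ?thesis unfolding u2 by (intro exI[of _ k] exI[of _ k']) simp
qed

text \<open>If \<open>L\<close> splits off the lattice of fixed points of \<open>\<sigma>\<close>, any unit gives an automorphism that is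
  trivial there; otherwise the squares that occur come from units \<open>\<equiv> \<plusminus>1\<close> modulo the prime above \<open>p\<close>.\<close>

lemma Aut_of_square:
  assumes unit: "ev y w * ev y' w = 1"
    and f1: "f1 \<in> torus_Aut L" "acts_as f1 z1" "\<forall>v\<in>eig 0. f1 v = v"
    and f2: "f2 \<in> torus_Aut L" "acts_as f2 z2" "\<forall>v\<in>eig 0. f2 v = v"
    and sq: "ev z2 w = ev z1 w * (ev y w)\<^sup>2"
  shows "\<exists>g \<epsilon>. g \<in> torus_Aut L \<and> acts_as g y \<and> \<epsilon> * \<epsilon> = 1 \<and> (\<forall>v\<in>eig 0. g v = of_int \<epsilon> *\<^sub>R v)"
proof (cases "\<forall>l\<in>L. (1 / real p) *\<^sub>R pact \<sigma> Phi l \<in> L")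
  case True
  \<comment> \<open>The projection to the fixed space; in this case it preserves L.\<close>
  define e where "e v = (1 / real p) *\<^sub>R pact \<sigma> Phi v" for v
  have e: "e \<in> torus_End L"
    using True clinear_scale[OF pact_clinear[OF s_clinear]] clinear_add[OF pact_clinear[OF s_clinear]]
    by (auto simp: torus_End_def clinear_iff e_def scaleR_eq_scale vec.scale_right_distrib mult.commute)
  have elin: "clinear e" using e by (simp add: torus_End_def)
  have e0: "e v = v" if "v \<in> eig 0" for v
    using pact_on_fixed[OF that, of Phi] p_gt_1 by (simp add: e_def poly_Phi_1)
  have ej: "e v = 0" if j: "\<not> p dvd j" and v: "v \<in> eig j" for v j
    using pact_eig[OF v, of Phi] ev_conj_iff[OF j, of Phi] by (simp add: e_def)
  define g where "g q v = pact \<sigma> q v + e (v - pact \<sigma> q v)" for q v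
  have glin: "clinear (g q)" for q
    unfolding clinear_iff g_def
    by (simp add: clinear_add[OF elin] clinear_scale[OF elin] clinear_add[OF pact_clinear[OF s_clinear]]
      clinear_scale[OF pact_clinear[OF s_clinear]] vec.scale_right_distrib
      linear_diff[OF clinear_imp_linear[OF elin]] vec.scale_right_diff_distrib)
  have gEnd: "g q \<in> torus_End L" for q
  proof -
    have "g q l \<in> L" if l: "l \<in> L" for l
    proof -
      have pl: "pact \<sigma> q l \<in> L" by (rule pact_lattice[OF s_clinear lat s_lattice l])
      hence "l - pact \<sigma> q l \<in> L" by (rule lattice_diff[OF lat l])
      hence "e (l - pact \<sigma> q l) \<in> L" using e by (auto simp: torus_End_def)
      thus ?thesis unfolding g_def by (rule lattice_add[OF lat pl])
    qed
    thus ?thesis using glin[of q] by (auto simp: torus_End_def)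
  qed
  have g0: "g q v = v" if v: "v \<in> eig 0" for q v
  proof -
    have "v - pact \<sigma> q v \<in> eig 0"
      using eig_scale[OF v, of "1 - ev q 1"] pact_eig[OF v, of q] by (simp add: vec.scale_left_diff_distrib)
    thus ?thesis unfolding g_def by (simp add: e0)
  qed
  have gj: "acts_as (g q) q" for q
    unfolding acts_as_def
  proof (intro allI impI)
    fix j v assume j: "\<not> p dvd j" and v: "v \<in> eig j"
    have "v - pact \<sigma> q v \<in> eig j"
      using eig_scale[OF v, of "1 - ev q (w ^ j)"] pact_eig[OF v, of q] by (simp add: vec.scale_left_diff_distrib)
    thus "g q v = ev q (w ^ j) *s v" unfolding g_def by (simp add: ej[OF j] pact_eig[OF v])
  qed
  have inv: "g A (g B v) = v" if AB: "ev A w * ev B w = 1" for A B v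
  proof (rule eig_eq_if_acts_as[where f = "\<lambda>v. g A (g B v)" and g = "\<lambda>v. v" and y = "A * B" and z = 1])
    show "linear (\<lambda>v. g A (g B v))" by (rule clinear_imp_linear[OF clinear_compose[OF glin glin]])
    show "linear (\<lambda>v. v :: complex^'g)" by (rule linear_id[unfolded id_def])
    show "g A (g B v) = v" if "v \<in> eig 0" for v using g0 that by simp
    show "acts_as (\<lambda>v. g A (g B v)) (A * B)"
      unfolding acts_as_def
    proof (intro allI impI)
      fix j v assume j: "\<not> p dvd j" and v: "v \<in> eig j"
      show "g A (g B v) = ev (A * B) (w ^ j) *s v"
        unfolding acts_asD[OF gj j v] acts_asD[OF gj j eig_scale[OF v]] by (simp add: mult.commute)
    qed
    show "acts_as (\<lambda>v. v) 1" by (simp add: acts_as_def)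
    show "ev (A * B) w = ev 1 w" using AB by simp
  qed
  have "g y \<in> torus_Aut L"
    by (rule torus_AutI[OF gEnd gEnd, of y y']; rule inv) (use unit in \<open>simp_all add: mult.commute\<close>)
  moreover have "\<forall>v\<in>eig 0. g y v = of_int 1 *\<^sub>R v" using g0 by simp
  ultimately show ?thesis using gj[of y] by (intro exI[of _ "g y"] exI[of _ 1]) simp
next
  case False
  hence "\<exists>l\<in>L. (1 / real p) *\<^sub>R pact \<sigma> Phi l \<notin> L" by (simp only: ball_simps bex_simps not_not)
  then obtain l where l: "l \<in> L" "(1 / real p) *\<^sub>R pact \<sigma> Phi l \<notin> L" by (elim bexE)
  \<comment> \<open>q = f2 - f1 y(\<sigma>)^2 is 0 on the moved eigenspaces and D on the fixed
    space, so p q = D Phi(\<sigma>). If p did not divide D, integrality of q would put Phi(\<sigma>)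
    l / p into L.\<close>
  define D where "D = 1 - (poly y 1)\<^sup>2"
  define q where "q v = f2 v - f1 (pact \<sigma> (y\<^sup>2) v)" for v
  note lin1 = clinear_imp_linear[OF torus_AutD(1)[OF f1(1)]]
  note lin2 = clinear_imp_linear[OF torus_AutD(1)[OF f2(1)]]
  have q0: "q v = of_int D *\<^sub>R v" if v: "v \<in> eig 0" for v
    using v f1(3) f2(3) by (simp add: q_def pact_on_fixed D_def linear_scale[OF lin1] scaleR_diff_left)
  have qj: "q v = 0" if j: "\<not> p dvd j" and v: "v \<in> eig j" for v j
  proof -
    have "ev z2 w = ev (z1 * y\<^sup>2) w" using sq by simp
    hence "ev z2 (w ^ j) = ev (z1 * y\<^sup>2) (w ^ j)" unfolding ev_conj_eq[OF j] .
    thus ?thesis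
      unfolding q_def pact_eig[OF v] acts_asD[OF f2(2) j v] acts_asD[OF f1(2) j eig_scale[OF v]]
      by (simp add: mult.commute)
  qed
  have qlin: "linear q"
    unfolding q_def
    using linear_compose_sub[OF lin2 linear_compose[OF pact_linear[OF s_clinear] lin1]] by (simp add: o_def)
  have qPhi: "real p *\<^sub>R q v = of_int D *\<^sub>R pact \<sigma> Phi v" for v
  proof (rule eig_eqI[where f = "\<lambda>v. real p *\<^sub>R q v" and g = "\<lambda>v. of_int D *\<^sub>R pact \<sigma> Phi v"])
    show "linear (\<lambda>v. real p *\<^sub>R q v)" by (rule linear_compose_scale_right[OF qlin])
    show "linear (\<lambda>v. of_int D *\<^sub>R pact \<sigma> Phi v)"
      by (rule linear_compose_scale_right[OF pact_linear[OF s_clinear]])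
    fix j v assume j: "j < p" and v: "v \<in> eig j"
    show "real p *\<^sub>R q v = of_int D *\<^sub>R pact \<sigma> Phi v"
    proof (cases "j = 0")
      case True
      thus ?thesis using v by (simp add: q0 pact_on_fixed poly_Phi_1)
    next
      case False
      hence j': "\<not> p dvd j" using j by (auto dest: dvd_imp_le)
      thus ?thesis using pact_eig[OF v, of Phi] ev_conj_iff[OF j', of Phi] by (simp add: qj[OF j' v])
    qed
  qed
  have "\<not> coprime D (int p)"
  proof
    assume "coprime D (int p)"
    hence "gcd D (int p) = 1" by (rule coprime_imp_gcd_eq_1)
    then obtain a b where ab: "a * D + b * int p = 1" using bezout_int[of D "int p"] by auto
    have "real_of_int (a * D + b * int p) = 1" unfolding ab by simp
    hence ab': "of_int a * of_int D + of_int b * real p = (1 :: real)" by simp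
    have qL: "q l \<in> L"
      unfolding q_def
      by (rule lattice_diff[OF lat torus_AutD(5)[OF f2(1) l(1)]
        torus_AutD(5)[OF f1(1) pact_lattice[OF s_clinear lat s_lattice l(1)]]])
    have "(1 / real p) *\<^sub>R pact \<sigma> Phi l = (1 / real p) *\<^sub>R ((of_int a * of_int D + of_int b * real p) *\<^sub>R pact \<sigma> Phi l)"
      unfolding ab' by simp
    also have "\<dots> = (1 / real p) *\<^sub>R (of_int a *\<^sub>R (of_int D *\<^sub>R pact \<sigma> Phi l) + real p *\<^sub>R (of_int b *\<^sub>R pact \<sigma> Phi l))"
      by (simp add: scaleR_add_left mult.commute)
    also have "\<dots> = of_int a *\<^sub>R q l + of_int b *\<^sub>R pact \<sigma> Phi l"
      unfolding qPhi[symmetric] using p_gt_1 by (simp add: scaleR_add_right)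
    also have "\<dots> \<in> L"
      by (intro lattice_add[OF lat] lattice_of_int[OF lat] qL pact_lattice[OF s_clinear lat s_lattice l(1)])
    finally show False using l(2) by simp
  qed
  moreover have "prime (int p)" using prime_p by simp
  ultimately have "int p dvd D" using prime_imp_coprime[of "int p" D] by (auto simp: coprime_commute)
  hence "int p dvd (1 - poly y 1) * (1 + poly y 1)" by (simp add: D_def power2_eq_square algebra_simps)
  hence "int p dvd 1 - poly y 1 \<or> int p dvd 1 + poly y 1"
    using \<open>prime (int p)\<close> by (simp add: prime_dvd_mult_iff)
  hence "int p dvd poly y 1 - 1 \<or> int p dvd poly y 1 - (- 1)"
    by (auto simp: dvd_diff_commute add.commute)
  then obtain \<epsilon> where \<epsilon>: "int p dvd poly y 1 - \<epsilon>" "\<epsilon> * \<epsilon> = 1"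
  proof
    assume "int p dvd poly y 1 - 1" thus ?thesis by (rule that) simp
  next
    assume "int p dvd poly y 1 - (- 1)" thus ?thesis by (rule that) simp
  qed
  from Aut_of_unit[OF unit this] \<epsilon>(2) show ?thesis by (elim bexE conjE) (intro exI conjI)
qed

text \<open>The two forms are compared on each eigenspace: k is real and enters as k^2, while the
  sign \<epsilon> on the fixed space cancels in H.\<close>

lemma square_imp_pullback:
  assumes unit: "ev k gam * ev k' gam = 1" and u2: "u2 = u1 * (ev k gam)\<^sup>2"
    and u: "polarization_unit_rel H1 u1" "polarization_unit_rel H2 u2"
  shows "\<exists>g\<in>torus_Aut L. H2 = pullback g H1"
proof -
  obtain f1 h1 where f1: "f1 \<in> torus_Aut L" "\<forall>x y. H1 x y = H (f1 x) y" "\<forall>v\<in>eig 0. f1 v = v"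
    "acts_as f1 (trace_lift h1)" "u1 = ev h1 gam"
    using u(1) unfolding polarization_unit_rel_def by (elim exE conjE)
  obtain f2 h2 where f2: "f2 \<in> torus_Aut L" "\<forall>x y. H2 x y = H (f2 x) y" "\<forall>v\<in>eig 0. f2 v = v"
    "acts_as f2 (trace_lift h2)" "u2 = ev h2 gam"
    using u(2) unfolding polarization_unit_rel_def by (elim exE conjE)
  have unit': "ev (trace_lift k) w * ev (trace_lift k') w = 1" using unit by (simp add: ev_trace_lift_w)
  have sq: "ev (trace_lift h2) w = ev (trace_lift h1) w * (ev (trace_lift k) w)\<^sup>2"
    using u2 by (simp add: ev_trace_lift_w f1(5) f2(5))
  obtain g \<epsilon> where g: "g \<in> torus_Aut L" "acts_as g (trace_lift k)"
    and \<epsilon>: "\<epsilon> * \<epsilon> = 1" "\<forall>v\<in>eig 0. g v = of_int \<epsilon> *\<^sub>R v"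
    using Aut_of_square[OF unit' f1(1,4,3) f2(1,4,3) sq] by (elim exE conjE)
  have "real_of_int (\<epsilon> * \<epsilon>) = 1" unfolding \<epsilon>(1) by simp
  hence \<epsilon>': "complex_of_int \<epsilon> * complex_of_int \<epsilon> = 1"
    by (metis \<epsilon>(1) of_int_1 of_int_mult)
  have eq: "H (f2 u) v = H (f1 (g u)) (g v)" if j: "j < p" and uv: "u \<in> eig j" "v \<in> eig j" for j u v
  proof (cases "j = 0")
    case True
    have "g u = of_int \<epsilon> *s u" "g v = of_int \<epsilon> *s v" using \<epsilon>(2) uv True by (simp_all add: scaleR_eq_scale)
    moreover have "f1 (of_int \<epsilon> *s u) = of_int \<epsilon> *s u" using f1(3) eig_scale[OF uv(1)] True by simp
    moreover have "f2 u = u" using f2(3) uv True by simp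
    ultimately show ?thesis
      using \<epsilon>' by (simp add: herm_scale_left[OF herm] herm_scale_right[OF herm] flip: mult.assoc)
  next
    case False
    hence j': "\<not> p dvd j" using j by (auto dest: dvd_imp_le)
    define a where "a = ev (trace_lift k) (w ^ j)"
    have "a = ev k (w ^ j + inverse (w ^ j))" unfolding a_def by (rule ev_trace_lift[OF w_power_power])
    moreover have "cnj (w ^ j) = inverse (w ^ j)" by (simp add: cnj_w power_inverse)
    ultimately have a: "cnj a = a" by (simp add: cnj_ev cnj_w power_inverse add.commute)
    have "ev (trace_lift h2) w = ev (trace_lift h1 * (trace_lift k)\<^sup>2) w" using sq by simp
    hence "ev (trace_lift h2) (w ^ j) = ev (trace_lift h1 * (trace_lift k)\<^sup>2) (w ^ j)" unfolding ev_conj_eq[OF j'] .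
    hence h2: "ev (trace_lift h2) (w ^ j) = ev (trace_lift h1) (w ^ j) * (a * a)"
      by (simp add: a_def power2_eq_square)
    show ?thesis
      unfolding acts_asD[OF g(2) j' uv(1)] acts_asD[OF g(2) j' uv(2)] acts_asD[OF f2(4) j' uv(1)]
        acts_asD[OF f1(4) j' eig_scale[OF uv(1)]] h2 a_def[symmetric]
      by (simp add: herm_scale_left[OF herm] herm_scale_right[OF herm] a mult_ac)
  qed
  have "H2 x y = pullback g H1 x y" for x y
  proof -
    obtain u where u: "\<forall>j<p. u j \<in> eig j" "x = (\<Sum>j<p. u j)" using eig_decomp[of x] by (elim exE conjE)
    obtain v where v: "\<forall>j<p. v j \<in> eig j" "y = (\<Sum>j<p. v j)" using eig_decomp[of y] by (elim exE conjE)
    note E = End_eig[OF torus_AutD(4)]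
    note lin = linear_sum[OF clinear_imp_linear[OF torus_AutD(1)]]
    have "H2 x y = H (\<Sum>j<p. f2 (u j)) (\<Sum>j<p. v j)"
      unfolding f2(2)[rule_format] u(2) v(2) lin[OF f2(1)] ..
    also have "\<dots> = (\<Sum>j<p. H (f2 (u j)) (v j))"
      by (rule herm_eig_sum) (use u(1) v(1) E[OF f2(1)] in simp_all)
    also have "\<dots> = (\<Sum>j<p. H (f1 (g (u j))) (g (v j)))"
      using eq u(1) v(1) by (intro sum.cong) simp_all
    also have "\<dots> = H (\<Sum>j<p. f1 (g (u j))) (\<Sum>j<p. g (v j))"
      by (rule herm_eig_sum[symmetric]) (use u(1) v(1) E[OF f1(1)] E[OF g(1)] in simp_all)
    also have "\<dots> = pullback g H1 x y"
      unfolding pullback_def f1(2)[rule_format] u(2) v(2) lin[OF g(1)] lin[OF f1(1)] ..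
    finally show ?thesis .
  qed
  hence "H2 = pullback g H1" by (intro ext)
  thus ?thesis using g(1) by (rule bexI)
qed

end

section \<open>Counting the classes of polarizations\<close>

lemma card_quotient_eq_card_image:
  assumes R: "\<And>x y. x \<in> A \<Longrightarrow> y \<in> A \<Longrightarrow> P x y \<longleftrightarrow> c x = c y"
  shows "card (A // {(x, y). x \<in> A \<and> y \<in> A \<and> P x y}) = card (c ` A)"
proof -
  let ?F = "\<lambda>t. {y \<in> A. c y = t}"
  have "{(x, y). x \<in> A \<and> y \<in> A \<and> P x y} `` {x} = ?F (c x)" if "x \<in> A" for x
    using R[OF that] that by auto
  hence "A // {(x, y). x \<in> A \<and> y \<in> A \<and> P x y} = ?F ` (c ` A)"
    unfolding quotient_def by (auto simp: image_image)
  moreover have "inj_on ?F (c ` A)"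
  proof (rule inj_onI)
    fix s t assume s: "s \<in> c ` A" and "?F s = ?F t"
    obtain x where x: "x \<in> A" "s = c x" using s by (rule imageE)
    hence "x \<in> ?F s" by simp
    hence "x \<in> ?F t" unfolding \<open>?F s = ?F t\<close> .
    thus "s = t" using x by simp
  qed
  ultimately show ?thesis by (simp only: card_image)
qed

lemma (in prime_root) square_coset_eq_iff:
  assumes w: "w = cis (2 * pi / p)"
  shows "square_units p #>\<^bsub>\<lparr>carrier = totpos_units p, monoid.mult = (*), one = 1\<rparr>\<^esub> u1 =
      square_units p #>\<^bsub>\<lparr>carrier = totpos_units p, monoid.mult = (*), one = 1\<rparr>\<^esub> u2 \<longleftrightarrow>
    (\<exists>k k'. ev k gam * ev k' gam = 1 \<and> u2 = u1 * (ev k gam)\<^sup>2)"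
proof -
  define C where "C u = {s\<^sup>2 * u | s. s \<in> cyc_units p}" for u :: complex
  have coset: "square_units p #>\<^bsub>\<lparr>carrier = totpos_units p, monoid.mult = (*), one = 1\<rparr>\<^esub> u = C u" for u
    by (auto simp: r_coset_def square_units_def C_def)
  have unitI: "ev k gam \<in> cyc_units p" if "ev k gam * ev k' gam = 1" for k k'
    unfolding cyc_units_iff[OF w] by (rule exI[of _ k], rule exI[of _ k'], intro conjI) (rule refl that)+
  have sub: "C (u * (ev k gam)\<^sup>2) \<subseteq> C u" if k: "ev k gam * ev k' gam = 1" for u k k'
  proof
    fix x assume "x \<in> C (u * (ev k gam)\<^sup>2)"
    then obtain s where s: "x = s\<^sup>2 * (u * (ev k gam)\<^sup>2)" "s \<in> cyc_units p" unfolding C_def mem_Collect_eq by (elim exE conjE)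
    obtain h h' where h: "s = ev h gam" "ev h gam * ev h' gam = 1"
      using s(2) unfolding cyc_units_iff[OF w] by (elim exE conjE)
    have "ev (h * k) gam * ev (h' * k') gam = (ev h gam * ev h' gam) * (ev k gam * ev k' gam)"
      by (simp add: mult_ac)
    hence "ev (h * k) gam \<in> cyc_units p" by (intro unitI[of _ "h' * k'"]) (simp add: h(2) k)
    moreover have "x = (ev (h * k) gam)\<^sup>2 * u" by (simp add: s(1) h(1) power_mult_distrib mult_ac)
    ultimately show "x \<in> C u" unfolding C_def mem_Collect_eq by (intro exI conjI)
  qed
  show ?thesis unfolding coset
  proof
    assume eq: "C u1 = C u2"
    have "1 \<in> cyc_units p" using unitI[of 1 1] by simp
    hence "u2 \<in> C u2" unfolding C_def mem_Collect_eq by (intro exI[of _ 1]) simp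
    hence "u2 \<in> C u1" unfolding eq .
    then obtain s where s: "u2 = s\<^sup>2 * u1" "s \<in> cyc_units p" unfolding C_def mem_Collect_eq by (elim exE conjE)
    obtain h h' where h: "s = ev h gam" "ev h gam * ev h' gam = 1"
      using s(2) unfolding cyc_units_iff[OF w] by (elim exE conjE)
    show "\<exists>k k'. ev k gam * ev k' gam = 1 \<and> u2 = u1 * (ev k gam)\<^sup>2"
      by (rule exI[of _ h], rule exI[of _ h']) (simp add: h s(1))
  next
    assume "\<exists>k k'. ev k gam * ev k' gam = 1 \<and> u2 = u1 * (ev k gam)\<^sup>2"
    then obtain k k' where k: "ev k gam * ev k' gam = 1" and u2: "u2 = u1 * (ev k gam)\<^sup>2" by (elim exE conjE)
    have "u2 * (ev k' gam)\<^sup>2 = u1 * (ev k gam * ev k' gam)\<^sup>2" by (simp add: u2 power_mult_distrib)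
    hence u1: "u1 = u2 * (ev k' gam)\<^sup>2" by (simp add: k)
    have k': "ev k' gam * ev k gam = 1" using k by (simp add: mult.commute)
    show "C u1 = C u2"
      using sub[OF k, of u1] sub[OF k', of u2] unfolding u2[symmetric] u1[symmetric] by (rule equalityI[rotated])
  qed
qed

lemma (in ppav_generic) num_polarizations_odd:
  assumes p: "p > 2" and w: "w = cis (2 * pi / p)"
  shows "num_polarizations L = \<uu> p"
proof -
  have odd: "odd p" using p prime_p prime_odd_nat by auto
  define A where "A = {H'. principal_polarization L H'}"
  define \<Psi> where "\<Psi> H' = (SOME u. polarization_unit_rel H' u)" for H'
  define c where "c u = square_units p #>\<^bsub>\<lparr>carrier = totpos_units p, monoid.mult = (*), one = 1\<rparr>\<^esub> u" for u
  have rel: "polarization_unit_rel H' (\<Psi> H')" if "H' \<in> A" for H'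
  proof -
    have "\<exists>u. polarization_unit_rel H' u"
      using polarization_totpos[OF p, of H'] that unfolding A_def mem_Collect_eq by blast
    thus ?thesis unfolding \<Psi>_def by (rule someI_ex)
  qed
  have Psi: "\<Psi> H' = u" if "H' \<in> A" "polarization_unit_rel H' u" for H' u
    by (rule polarization_unit_rel_unique[OF rel[OF that(1)] that(2)])
  have "(\<exists>f\<in>torus_Aut L. H2 = pullback f H1) \<longleftrightarrow> (c \<circ> \<Psi>) H1 = (c \<circ> \<Psi>) H2" if A: "H1 \<in> A" "H2 \<in> A" for H1 H2
  proof -
    note r = rel[OF A(1)] rel[OF A(2)]
    have "(\<exists>f\<in>torus_Aut L. H2 = pullback f H1) \<longleftrightarrow>
        (\<exists>k k'. ev k gam * ev k' gam = 1 \<and> \<Psi> H2 = \<Psi> H1 * (ev k gam)\<^sup>2)"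
    proof
      assume "\<exists>f\<in>torus_Aut L. H2 = pullback f H1"
      then obtain f where "f \<in> torus_Aut L" "H2 = pullback f H1" by (elim bexE)
      from pullback_imp_square[OF p this r]
      show "\<exists>k k'. ev k gam * ev k' gam = 1 \<and> \<Psi> H2 = \<Psi> H1 * (ev k gam)\<^sup>2" .
    next
      assume "\<exists>k k'. ev k gam * ev k' gam = 1 \<and> \<Psi> H2 = \<Psi> H1 * (ev k gam)\<^sup>2"
      then obtain k k' where "ev k gam * ev k' gam = 1" "\<Psi> H2 = \<Psi> H1 * (ev k gam)\<^sup>2" by (elim exE conjE)
      from square_imp_pullback[OF this r] show "\<exists>f\<in>torus_Aut L. H2 = pullback f H1" .
    qed
    thus ?thesis unfolding c_def o_apply square_coset_eq_iff[OF w] .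
  qed
  from card_quotient_eq_card_image[of A, OF this]
  have "num_polarizations L = card ((c \<circ> \<Psi>) ` A)"
    unfolding num_polarizations_def by (simp add: A_def)
  also have "(c \<circ> \<Psi>) ` A = c ` totpos_units p"
  proof (intro equalityI subsetI)
    fix x assume "x \<in> (c \<circ> \<Psi>) ` A"
    then obtain H' where H': "H' \<in> A" "x = c (\<Psi> H')" by auto
    hence "principal_polarization L H'" by (simp add: A_def)
    from polarization_totpos[OF p this]
    obtain h h' where h: "polarization_unit_rel H' (ev h gam)" "ev h gam * ev h' gam = 1"
      "\<forall>j\<in>{1..<p}. ev h (w ^ j + inverse (w ^ j)) \<in> \<real> \<and> 0 < Re (ev h (w ^ j + inverse (w ^ j)))"
      by (elim exE conjE)
    have "\<Psi> H' \<in> totpos_units p"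
      unfolding totpos_units_iff[OF w odd] Psi[OF H'(1) h(1)] by (rule exI[of _ h], rule exI[of _ h'], intro conjI) (rule refl h(2,3))+
    thus "x \<in> c ` totpos_units p" unfolding H'(2) by (rule imageI)
  next
    fix x assume "x \<in> c ` totpos_units p"
    then obtain u where u: "u \<in> totpos_units p" "x = c u" by (elim imageE)
    then obtain h h' where h: "u = ev h gam" "ev h gam * ev h' gam = 1"
      and pos: "\<forall>j\<in>{1..<p}. ev h (w ^ j + inverse (w ^ j)) \<in> \<real> \<and> 0 < Re (ev h (w ^ j + inverse (w ^ j)))"
      unfolding totpos_units_iff[OF w odd] by (elim exE conjE)
    \<comment> \<open>u is replaced by a unit of its coset with residue 1 at the prime above p, for
      which \<open>polarization_of_unit\<close> provides a polarization.\<close>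
    obtain k k' where k: "ev k gam * ev k' gam = 1" and res: "int p dvd poly (h * k * k) 2 - 1"
      using totally_positive_unit_adjust[OF p h(2)] pos by blast
    have unit: "ev (h * k * k) gam * ev (h' * k' * k') gam = 1"
    proof -
      have "ev (h * k * k) gam * ev (h' * k' * k') gam =
          (ev h gam * ev h' gam) * ((ev k gam * ev k' gam) * (ev k gam * ev k' gam))" by (simp add: mult_ac)
      thus ?thesis by (simp add: h(2) k)
    qed
    have pos': "\<forall>j\<in>{1..<p}. ev (h * k * k) (w ^ j + inverse (w ^ j)) \<in> \<real> \<and> 0 < Re (ev (h * k * k) (w ^ j + inverse (w ^ j)))"
    proof
      fix j assume j: "j \<in> {1..<p}"
      define t where "t = w ^ j + inverse (w ^ j)"
      have "cnj t = t" by (simp add: t_def cnj_w power_inverse add.commute)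
      hence "cnj (ev k t) = ev k t" by (simp add: cnj_ev)
      hence "ev k t \<in> \<real>" by (simp add: Reals_cnj_iff)
      then obtain b where b: "ev k t = of_real b" by (elim Reals_cases)
      have "ev (trace_lift k * trace_lift k' - 1) w = 0" by (simp add: ev_trace_lift_w k)
      hence "ev (trace_lift k * trace_lift k' - 1) (w ^ j) = 0"
        unfolding ev_conj_iff[OF not_dvd_range[OF j]] .
      hence "ev k t * ev k' t = 1" by (simp add: ev_trace_lift w_power_power t_def)
      hence "b \<noteq> 0" unfolding b by auto
      obtain a where a: "ev h t = of_real a" "a > 0"
        using pos[rule_format, OF j] unfolding t_def[symmetric] by (elim conjE Reals_cases) simp
      have "ev (h * k * k) t = of_real (a * (b * b))" by (simp add: a b mult.assoc)
      moreover have "a * (b * b) > 0" using a(2) \<open>b \<noteq> 0\<close> by (simp add: zero_less_mult_iff flip: power2_eq_square)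
      ultimately show "ev (h * k * k) t \<in> \<real> \<and> 0 < Re (ev (h * k * k) t)" by simp
    qed
    obtain H' where H': "principal_polarization L H'" "polarization_unit_rel H' (ev (h * k * k) gam)"
      using polarization_of_unit[OF unit res pos'] by (elim exE conjE)
    have "\<Psi> H' = u * (ev k gam)\<^sup>2"
      using Psi[of H', OF _ H'(2)] H'(1) by (simp add: A_def h(1) power2_eq_square mult.assoc)
    hence "c u = c (\<Psi> H')"
      unfolding c_def square_coset_eq_iff[OF w] using k by (intro exI conjI)
    thus "x \<in> (c \<circ> \<Psi>) ` A" unfolding u(2) using H'(1) by (intro image_eqI[of _ _ H']) (simp_all add: A_def)
  qed
  also have "card (c ` totpos_units p) = \<uu> p"
    unfolding \<uu>_def FactGroup_def RCOSETS_def c_def by (simp add: UNION_singleton_eq_range)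
  finally show ?thesis .
qed

section \<open>Very general members\<close>

lemma (in ppav_aut) ex_generic_rank_le:
  assumes type: "p = 2 \<or> (\<exists>i k. odd p \<and> i \<in> {1..<p} \<and> eig i \<noteq> {0} \<and> eig (p - i) \<noteq> {0} \<and> k \<in> {1..<p} \<and> \<not> one_dim k)"
    and tac: "torsion_action_conj n L \<sigma> \<rho>"
  shows "\<exists>L' H'. is_ppav (L', H') \<and> typed_automorphism p n \<rho> (L', H') \<sigma> \<and> End_rank L' \<le> pact_rank"
proof -
  obtain L' H' where ppav': "is_ppav (L', H')" and aut': "\<sigma> \<in> ppav_Aut (L', H')"
    and tac': "\<forall>n \<rho>. torsion_action_conj n L \<sigma> \<rho> \<longrightarrow> torsion_action_conj n L' \<sigma> \<rho>"
    and End': "torus_End L' \<subseteq> generic_End L H \<sigma>"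
    using generic_deformation by (elim exE conjE)
  have "\<exists>m q. m \<noteq> 0 \<and> (\<forall>v. of_int m *\<^sub>R f v = pact \<sigma> q v)" if "f \<in> torus_End L'" for f
    using type
  proof
    assume "p = 2"
    thus ?thesis by (rule generic_End_pact_2) (rule subsetD[OF End' that])
  next
    assume "\<exists>i k. odd p \<and> i \<in> {1..<p} \<and> eig i \<noteq> {0} \<and> eig (p - i) \<noteq> {0} \<and> k \<in> {1..<p} \<and> \<not> one_dim k"
    then obtain i k where ik: "odd p" "i \<in> {1..<p}" "eig i \<noteq> {0}" "eig (p - i) \<noteq> {0}" "k \<in> {1..<p}" "\<not> one_dim k"
      by (elim exE conjE)
    show ?thesis by (rule generic_End_pact_odd[OF ik(1) subsetD[OF End' that] ik(2-6)])
  qed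
  moreover have "is_lattice L'" using ppav' by (simp add: is_ppav_def)
  ultimately have "End_rank L' \<le> pact_rank" by (intro End_rank_le_pact_rank)
  moreover have "typed_automorphism p n \<rho> (L', H') \<sigma>"
    unfolding typed_automorphism_def using aut' ord tac'[rule_format, OF tac] by simp
  ultimately show ?thesis using ppav' by (intro exI conjI)
qed

lemma (in ppav_aut) one_dim_imp_dim:
  assumes "one_dim k"
  shows "vec.dim (eig k) = 1"
proof -
  obtain v where v: "v \<in> eig k" "v \<noteq> 0" "\<forall>u\<in>eig k. \<exists>c. u = c *s v"
    using assms unfolding one_dim_def by (elim bexE conjE)
  show ?thesis
  proof (rule vec.dim_unique[of "{v}"])
    show "{v} \<subseteq> eig k" using v(1) by simp
    show "eig k \<subseteq> vec.span {v}"
    proof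
      fix u assume "u \<in> eig k"
      from bspec[OF v(3) this] obtain c where "u = c *s v" by (elim exE)
      thus "u \<in> vec.span {v}" by (simp add: vec.span_scale vec.span_base)
    qed
    show "\<not> vec.dependent {v}" using v(2) by (simp add: vec.independent_insert vec.independent_empty)
  qed simp
qed

lemma typed_automorphism_ppav_aut:
  assumes "prime_root p w" "is_ppav (L, H)" "typed_automorphism p n \<rho> (L, H) \<sigma>"
  shows "ppav_aut p w L H \<sigma>"
  using assms by (auto simp: ppav_aut_def ppav_aut_axioms_def typed_automorphism_def)

lemma pact_rank_eq:
  assumes X: "ppav_aut p w L H \<sigma>" and X': "ppav_aut p w' L' H' \<sigma>'"
    and n: "n \<ge> 2" "coprime p n"
    and tac: "torsion_action_conj n L \<sigma> \<rho>" "torsion_action_conj n L' \<sigma>' \<rho>"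
  shows "ppav_aut.pact_rank p \<sigma> = ppav_aut.pact_rank p \<sigma>'"
proof -
  have "(\<forall>v. pact \<sigma> (prime_root.Phi p) v = 0) \<longleftrightarrow> (\<forall>v. pact \<sigma>' (prime_root.Phi p) v = 0)"
  proof (intro iffI allI)
    fix v assume "\<forall>v. pact \<sigma> (prime_root.Phi p) v = 0"
    hence "pact \<sigma> (prime_root.Phi p) v = 0" for v by (rule spec)
    from pact_Phi_eq_0_transfer[OF X X' n tac this] show "pact \<sigma>' (prime_root.Phi p) v = 0" .
  next
    fix v assume "\<forall>v. pact \<sigma>' (prime_root.Phi p) v = 0"
    hence "pact \<sigma>' (prime_root.Phi p) v = 0" for v by (rule spec)
    from pact_Phi_eq_0_transfer[OF X' X n tac(2,1) this] show "pact \<sigma> (prime_root.Phi p) v = 0" .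
  qed
  thus ?thesis unfolding ppav_aut.pact_rank_def[OF X] ppav_aut.pact_rank_def[OF X'] by (simp only:)
qed

text \<open>The automorphisms of (L, H) and of the reference member share only the type \<rho>.
  Minimality bounds the rank of End(A) by that of the reference member, hence by the rank of
  Z[\<sigma>'], which equals that of Z[\<sigma>] because \<rho> determines it.\<close>

lemma very_general_imp_generic:
  assumes p: "prime p" and n: "n \<ge> 3" "\<not> p dvd n"
    and vg: "very_general (typed_locus p n \<rho>) (L, H)"
    and Y: "is_ppav (L', H')" "typed_automorphism p n \<rho> (L', H') \<sigma>'" "End_rank L' \<le> ppav_aut.pact_rank p \<sigma>'"
  shows "\<exists>\<sigma>. typed_automorphism p n \<rho> (L, H) \<sigma> \<and> (\<forall>w. prime_root p w \<longrightarrow> ppav_generic p w L H \<sigma>)"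
proof -
  have X: "is_ppav (L, H)" "moduli_point (L, H) \<in> typed_locus p n \<rho>" using vg by (simp_all add: very_general_def)
  obtain M where M: "is_ppav M" "same_End (L, H) M"
    "\<forall>W. is_ppav W \<longrightarrow> moduli_point W \<in> typed_locus p n \<rho> \<longrightarrow> End_rank (fst M) \<le> End_rank (fst W)"
    using vg unfolding very_general_def by (elim exE conjE)
  have "moduli_point (L', H') \<in> typed_locus p n \<rho>"
    unfolding moduli_point_typed_locus_iff[OF Y(1)] using Y(2) by (rule exI[of _ \<sigma>'])
  hence "End_rank (fst M) \<le> End_rank L'" using M(3) Y(1) by fastforce
  moreover have "is_lattice (fst M)" using M(1) by (simp add: is_ppav_def)
  hence "End_rank L \<le> End_rank (fst M)" using same_End_rank_le[OF M(2)] by simp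
  ultimately have rank: "End_rank L \<le> ppav_aut.pact_rank p \<sigma>'" using Y(3) by linarith
  obtain \<sigma> where \<sigma>: "typed_automorphism p n \<rho> (L, H) \<sigma>"
    using X(2) unfolding moduli_point_typed_locus_iff[OF X(1)] by (rule exE)
  have "coprime p n" using p n(2) by (simp add: prime_imp_coprime)
  have "ppav_generic p w L H \<sigma>" if w: "prime_root p w" for w
  proof -
    have 1: "ppav_aut p w L H \<sigma>" by (rule typed_automorphism_ppav_aut[OF w X(1) \<sigma>])
    have 2: "ppav_aut p w L' H' \<sigma>'" by (rule typed_automorphism_ppav_aut[OF w Y(1,2)])
    have tac: "torsion_action_conj n L \<sigma> \<rho>" "torsion_action_conj n L' \<sigma>' \<rho>"
      using \<sigma> Y(2) by (simp_all add: typed_automorphism_def)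
    have "n \<ge> 2" using n(1) by simp
    from pact_rank_eq[OF 1 2 this \<open>coprime p n\<close> tac]
    have "End_rank L \<le> ppav_aut.pact_rank p \<sigma>" using rank by simp
    from ppav_aut.End_multiple_pact[OF 1 this] show ?thesis
      unfolding ppav_generic_def ppav_generic_axioms_def using 1 by blast
  qed
  thus ?thesis using \<sigma> by (intro exI[of _ \<sigma>] conjI allI impI)
qed

text \<open>The dimensions are known only outside the proper subset C, so the deformation starts
  from a point there. A nonzero term of the sum gives the pair, and a dimension \<noteq> 1 gives an
  eigenspace that is not a line.\<close>

lemma general_eigenspaces:
  assumes w: "prime_root p w" and "odd p" and "eigenspace_dims p n \<rho> w (typed_locus p n \<rho>) d"
    and "(\<Sum>i=1..(p - 1) div 2. d i * d (p - i)) > 0" and "\<exists>i\<in>{1..p - 1}. d i \<noteq> 1"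
  shows "\<exists>L' H' \<sigma>'. is_ppav (L', H') \<and> typed_automorphism p n \<rho> (L', H') \<sigma>' \<and> End_rank L' \<le> ppav_aut.pact_rank p \<sigma>'"
proof -
  obtain C where C: "C \<subset> typed_locus p n \<rho>"
    and gen: "\<forall>X. is_ppav X \<longrightarrow> moduli_point X \<in> typed_locus p n \<rho> - C \<longrightarrow>
      (\<exists>\<sigma>. typed_automorphism p n \<rho> X \<sigma> \<and> (\<forall>i<p. vec.dim {v. \<sigma> v = w ^ i *s v} = d i))"
    using assms(3) unfolding eigenspace_dims_def by (elim exE conjE)
  obtain x where x: "x \<in> typed_locus p n \<rho> - C" using C by blast
  hence "x \<in> typed_locus p n \<rho>" by (rule DiffD1)
  then obtain X where X': "x = moduli_point X" "is_ppav X"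
    unfolding typed_locus_def mem_Collect_eq by (elim exE conjE)
  have X: "is_ppav X" "moduli_point X \<in> typed_locus p n \<rho> - C" using X'(2) x unfolding X'(1) .
  obtain \<sigma> where \<sigma>: "typed_automorphism p n \<rho> X \<sigma>" "\<forall>i<p. vec.dim {v. \<sigma> v = w ^ i *s v} = d i"
    using gen[rule_format, OF X] by (elim exE conjE)
  obtain L H where LH: "X = (L, H)" by (rule prod.exhaust)
  interpret ppav_aut p w L H \<sigma>
    using typed_automorphism_ppav_aut[OF w, of L H n \<rho> \<sigma>] X(1) \<sigma>(1) unfolding LH by blast
  have dim: "vec.dim (eig i) = d i" if "i < p" for i
    using \<sigma>(2) that by (simp add: eig_def)
  have ne: "eig i \<noteq> {0}" if "i < p" "d i \<noteq> 0" for i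
  proof
    assume "eig i = {0}"
    hence "d i = vec.dim {0 :: complex^'a}" by (simp only: dim[OF that(1), symmetric])
    thus False using that(2) by (simp add: vec.dim_eq_0)
  qed
  have "\<exists>i\<in>{1..(p - 1) div 2}. d i * d (p - i) \<noteq> 0"
  proof (rule ccontr)
    assume "\<not> ?thesis"
    hence "\<forall>i\<in>{1..(p - 1) div 2}. d i * d (p - i) = 0" by (simp only: bex_simps not_not)
    hence "(\<Sum>i=1..(p - 1) div 2. d i * d (p - i)) = 0" by (rule sum.neutral)
    thus False using assms(4) by (simp only: less_irrefl)
  qed
  then obtain i where i: "i \<in> {1..(p - 1) div 2}" "d i * d (p - i) \<noteq> 0" by (elim bexE)
  have ip: "i \<in> {1..<p}" "i < p" "p - i < p" using i(1) by auto
  obtain k where k: "k \<in> {1..p - 1}" "d k \<noteq> 1" using assms(5) by (elim bexE)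
  have kp: "k \<in> {1..<p}" "k < p" using k(1) by auto
  have "\<not> one_dim k"
    using one_dim_imp_dim[of k] dim[OF kp(2)] k(2) by auto
  hence type: "\<exists>i k. odd p \<and> i \<in> {1..<p} \<and> eig i \<noteq> {0} \<and> eig (p - i) \<noteq> {0} \<and> k \<in> {1..<p} \<and> \<not> one_dim k"
    using \<open>odd p\<close> ip(1) ne[OF ip(2)] ne[OF ip(3)] i(2) kp(1) by (intro exI[of _ i] exI[of _ k]) simp
  have "torsion_action_conj n L \<sigma> \<rho>" using \<sigma>(1) by (simp add: typed_automorphism_def LH)
  from ex_generic_rank_le[OF disjI2[OF type] this] show ?thesis by (elim exE) (intro exI)
qed

lemma ex_typed_generic_2:
  assumes "typed_locus 2 n \<rho> \<noteq> {}"
  shows "\<exists>L' H' \<sigma>'. is_ppav (L', H') \<and> typed_automorphism 2 n \<rho> (L', H') \<sigma>' \<and> End_rank L' \<le> ppav_aut.pact_rank 2 \<sigma>'"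
proof -
  obtain x where "x \<in> typed_locus 2 n \<rho>" using assms by blast
  then obtain X \<sigma> where X: "is_ppav X" "typed_automorphism 2 n \<rho> X \<sigma>"
    unfolding typed_locus_def mem_Collect_eq by (elim exE conjE)
  obtain L H where LH: "X = (L, H)" by (rule prod.exhaust)
  have w: "prime_root 2 (cis (2 * pi / real 2))" by (rule prime_root_cis) simp
  interpret ppav_aut 2 "cis (2 * pi / real 2)" L H \<sigma>
    using typed_automorphism_ppav_aut[OF w, of L H n \<rho> \<sigma>] X unfolding LH by blast
  have "torsion_action_conj n L \<sigma> \<rho>" using X(2) by (simp add: typed_automorphism_def LH)
  from ex_generic_rank_le[OF disjI1[OF refl] this] show ?thesis by (elim exE) (intro exI)
qed

lemma very_general_polarizations:
  assumes p: "prime p" and n: "n \<ge> 3" "\<not> p dvd n"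
    and Y: "is_ppav (L', H')" "typed_automorphism p n \<rho> (L', H') \<sigma>'" "End_rank L' \<le> ppav_aut.pact_rank p \<sigma>'"
    and vg: "very_general (typed_locus p n \<rho>) (L, H)"
  shows "p = 2 \<Longrightarrow> num_polarizations L = 1" and "p > 2 \<Longrightarrow> num_polarizations L = \<uu> p"
    and "principal_polarization L H2 \<Longrightarrow> moduli_point (L, H2) \<in> typed_locus p n \<rho>"
proof -
  obtain \<sigma> where \<sigma>: "typed_automorphism p n \<rho> (L, H) \<sigma>" "\<forall>w. prime_root p w \<longrightarrow> ppav_generic p w L H \<sigma>"
    using very_general_imp_generic[OF p n vg Y] by (elim exE conjE)
  \<comment> \<open>Genericity holds for every primitive root; here it is taken at the root that
    defines the real cyclotomic ring, which may differ from the \<zeta> indexing the eigenspace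
    dimensions.\<close>
  interpret ppav_generic p "cis (2 * pi / real p)" L H \<sigma>
    using \<sigma>(2) prime_root_cis[OF p] by blast
  show "num_polarizations L = 1" if "p = 2" using that by (rule num_polarizations_2)
  show "num_polarizations L = \<uu> p" if "p > 2" by (rule num_polarizations_odd[OF that refl])
  assume H2: "principal_polarization L H2"
  have ppav2: "is_ppav (L, H2)" using H2 lat by (simp add: is_ppav_def)
  have "typed_automorphism p n \<rho> (L, H2) \<sigma>"
    using \<sigma>(1) polarization_Aut_mem[OF H2] by (simp add: typed_automorphism_def)
  thus "moduli_point (L, H2) \<in> typed_locus p n \<rho>"
    unfolding moduli_point_typed_locus_iff[OF ppav2] by (rule exI[of _ \<sigma>])
qed

theorem theorem1p4:
  fixes Z :: "('g::finite) pp set set"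
    and \<rho> :: "int^('g + 'g)^('g + 'g)"
    and p n :: nat
    and \<zeta> :: complex
    and d :: "nat \<Rightarrow> nat"
  assumes "CARD('g) \<ge> 3"
    and "prime p" and "n \<ge> 3" and "\<not> p dvd n" and "coprime (det \<rho>) (int n)"
    and "Z = typed_locus p n \<rho>"
    and "irreducible_component singular_locus Z"
    and "analytic_dim Z > 0"
    and "\<zeta> ^ p = 1" and "\<zeta> \<noteq> 1"
    and "eigenspace_dims p n \<rho> \<zeta> Z d"
  shows "(p = 2 \<longrightarrow> (\<forall>L H. very_general Z (L, H) \<longrightarrow> num_polarizations L = 1)) \<and>
    (p > 2 \<and> (\<Sum>i=1..(p - 1) div 2. d i * d (p - i)) > 0 \<and> (\<exists>i\<in>{1..p - 1}. d i \<noteq> 1) \<longrightarrow>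
      (\<forall>L H. very_general Z (L, H) \<longrightarrow> num_polarizations L = \<uu> p)) \<and>
    (p = 2 \<or> (p > 2 \<and> (\<Sum>i=1..(p - 1) div 2. d i * d (p - i)) > 0 \<and> (\<exists>i\<in>{1..p - 1}. d i \<noteq> 1)) \<longrightarrow>
      (\<forall>L H H'. very_general Z (L, H) \<longrightarrow> principal_polarization L H' \<longrightarrow>
        moduli_point (L, H') \<in> Z))"
proof -
  define case1 case2 where "case1 \<longleftrightarrow> p = 2"
    and "case2 \<longleftrightarrow> p > 2 \<and> (\<Sum>i=1..(p - 1) div 2. d i * d (p - i)) > 0 \<and> (\<exists>i\<in>{1..p - 1}. d i \<noteq> 1)"
  have w: "prime_root p \<zeta>" by unfold_locales (rule assms(2), rule assms(9), rule assms(10))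
  have ex: "\<exists>L' H' \<sigma>'. is_ppav (L', H' :: 'g hform) \<and> typed_automorphism p n \<rho> (L', H') \<sigma>' \<and> End_rank L' \<le> ppav_aut.pact_rank p \<sigma>'"
    if "case1 \<or> case2"
    using that
  proof
    assume "case1"
    hence p2: "p = 2" by (simp only: case1_def)
    have "Z \<noteq> {}" using assms(7) by (simp add: irreducible_component_def irreducible_subset_def)
    thus ?thesis unfolding assms(6) p2 by (rule ex_typed_generic_2)
  next
    assume c: "case2"
    hence "odd p" using assms(2) prime_odd_nat by (auto simp: case2_def)
    from general_eigenspaces[OF w this] show ?thesis using assms(11) c unfolding assms(6) case2_def by blast
  qed
  note vg = very_general_polarizations[where \<rho> = \<rho>, OF assms(2-4), folded assms(6)]
  have 1: "num_polarizations L = 1" if c: "case1" and g: "very_general Z (L, H)" for L :: "(complex^'g) set" and H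
  proof -
    obtain L' H' \<sigma>' where "is_ppav (L', H' :: 'g hform)" "typed_automorphism p n \<rho> (L', H') \<sigma>'" "End_rank L' \<le> ppav_aut.pact_rank p \<sigma>'"
      using ex[OF disjI1[OF c]] by (elim exE conjE)
    from vg(1)[OF this g c[unfolded case1_def]] show ?thesis .
  qed
  have 2: "num_polarizations L = \<uu> p" if c: "case2" and g: "very_general Z (L, H)" for L :: "(complex^'g) set" and H
  proof -
    obtain L' H' \<sigma>' where "is_ppav (L', H' :: 'g hform)" "typed_automorphism p n \<rho> (L', H') \<sigma>'" "End_rank L' \<le> ppav_aut.pact_rank p \<sigma>'"
      using ex[OF disjI2[OF c]] by (elim exE conjE)
    from vg(2)[OF this g conjunct1[OF c[unfolded case2_def]]] show ?thesis .
  qed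
  have 3: "moduli_point (L, H2) \<in> Z" if c: "case1 \<or> case2" and g: "very_general Z (L, H)" and H2: "principal_polarization L H2"
    for L :: "(complex^'g) set" and H H2
  proof -
    obtain L' H' \<sigma>' where "is_ppav (L', H' :: 'g hform)" "typed_automorphism p n \<rho> (L', H') \<sigma>'" "End_rank L' \<le> ppav_aut.pact_rank p \<sigma>'"
      using ex[OF c] by (elim exE conjE)
    from vg(3)[OF this g H2] show ?thesis .
  qed
  show ?thesis
    unfolding case1_def[symmetric] case2_def[symmetric] using 1 2 3 by blast
qed

end
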